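(* (i) Every irreducible quasifinite module over $\mathcal{W}(\mathbb{Z},1)^{(1)}$ or over $\mathcal{W}_\infty=\widehat{\mathcal{W}}(\mathbb{Z},1)^{(1)}$ is a highest weight module, a lowest weight module, or a module of the intermediate series. (ii) Let $\Gamma$ be a nondegenerate additive subgroup of $\mathbb{F}^n$ that is not isomorphic to $\mathbb{Z}$. Every irreducible quasifinite $\mathcal{W}(\Gamma,n)^{(1)}$-module is a module of the intermediate series. Likewise, for $n=1$, every irreducible quasifinite $\widehat{\mathcal{W}}(\Gamma,1)^{(1)}$-module is a module of the intermediate series.
   Context: Let $\mathbb{F}$ be an algebraically closed field of characteristic zero, and let $\Gamma$ be a nondegenerate additive subgroup of $\mathbb{F}^n$, meaning that $\Gamma$ contains an $\mathbb{F}$-basis of $\mathbb{F}^n$. Elements of $\mathbb{F}^n$ are written $\alpha=(\alpha_1,\dots,\alpha_n)$. Let $\mathbb{F}[\Gamma]=\mathrm{span}\{t^\alpha\mid\alpha\in\Gamma\}$ be the group algebra, with $t^\alpha t^\beta=t^{\alpha+\beta}$. The degree derivations $D_i$ of $\mathbb{F}[\Gamma]$ are given by $D_i(t^\alpha)=\alpha_i t^\alpha$. Set $\mathcal{W}(\Gamma,n)=\mathbb{F}[\Gamma]\otimes\mathbb{F}[D_1,\dots,D_n]$, which has basis $t^\alpha D^\mu$ with $\alpha\in\Gamma$, $\mu\in\mathbb{Z}_+^n$ and $D^\mu=\prod_i D_i^{\mu_i}$. Its associative product is $$(t^\alpha D^\mu)(t^\beta D^\nu)=\sum_{\lambda\in\mathbb{Z}_+^n}\binom{\mu}{\lambda}\beta^\lambda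 t^{\alpha+\beta}D^{\mu+\nu-\lambda},$$ where $\beta^\lambda=\prod_i\beta_i^{\lambda_i}$ and $\binom{\mu}{\lambda}=\prod_i\binom{\mu_i}{\lambda_i}$. The Lie bracket is the commutator. The subalgebra $\mathcal{W}(\Gamma,n)^{(1)}$ is spanned by all $t^\alpha D^\mu$ with $|\mu|=\sum_i\mu_i\ge1$. It is $\Gamma$-graded, with degree-$\alpha$ component spanned by $t^\alpha D^\mu$, $\mu\neq0$. For $n=1$, write $D=D_1$ and $[D]_\mu=D(D-1)\cdots(D-\mu+1)$. The central extension $\widehat{\mathcal{W}}(\Gamma,1)=\mathcal{W}(\Gamma,1)\oplus\mathbb{F}C$ has bracket $$[t^\alpha[D]_\mu,t^\beta[D]_\nu]=(t^\alpha[D]_\mu)(t^\beta[D]_\nu)-(t^\beta[D]_\nu)(t^\alpha[D]_\mu)+\delta_{\alpha,-\beta}(-1)^\mu\mu!\nu!\binom{\alpha+\mu}{\mu+\nu+1}C,$$ with $C$ central. The subalgebra $\widehat{\mathcal{W}}(\Gamma,1)^{(1)}$ is spanned by $C$ and the $t^\alpha[D]_\mu$ with $\mu\ge1$; $C$ has degree $0$. Then $\mathcal{W}_\infty=\widehat{\mathcal{W}}(\mathbb{Z},1)^{(1)}$. A module $V$ over one of these $\Gamma$-graded algebras $L$ is quasifinite if $V=\bigoplus_{\beta\in\Gamma}V_\beta$, $L_\alpha V_\beta\subset V_{\alpha+\beta}$, and $\dim V_\beta<\infty$ for all $\alpha,\beta\in\Gamma$. For $\alpha\in\mathbb{F}^n$,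 the modules $A_\alpha$ and $B_\alpha$ have basis $\{y_\gamma\mid\gamma\in\Gamma\}$, $C$ acts as $0$, and for $\mu\neq0$: - in $A_\alpha$, $t^\beta D^\mu y_\gamma=(\alpha+\gamma)^\mu y_{\beta+\gamma}$; - in $B_\alpha$, $t^\beta D^\mu y_\gamma=(-1)^{|\mu|+1}(\alpha+\beta+\gamma)^\mu y_{\beta+\gamma}$. A module of the intermediate series is a module isomorphic to a subquotient of some $A_\alpha$ or $B_\alpha$. For a $\mathbb{Z}$-graded algebra $L$, let $L_+$ (resp. $L_-$, $L_0$) be the span of the components of positive (resp. negative, zero) degree. A highest (resp. lowest) weight module is a module generated by a nonzero homogeneous vector $v$ that is a common eigenvector of $L_0$ and satisfies $L_+v=0$ (resp. $L_-v=0$). *)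

theory Defs
  imports "HOL-Analysis.Analysis" "HOL-Computational_Algebra.Polynomial" "HOL-Library.Function_Algebras"
begin

definition mpow :: "'a::comm_semiring_1 ^ 'n::finite \<Rightarrow> ('n \<Rightarrow> nat) \<Rightarrow> 'a" where
  "mpow \<beta> l = (\<Prod>i\<in>UNIV. (\<beta> $ i) ^ (l i))"

definition mbinom :: "('n::finite \<Rightarrow> nat) \<Rightarrow> ('n \<Rightarrow> nat) \<Rightarrow> nat" where
  "mbinom \<mu> l = (\<Prod>i\<in>UNIV. \<mu> i choose l i)"

definition mabs :: "('n::finite \<Rightarrow> nat) \<Rightarrow> nat" where
  "mabs \<mu> = (\<Sum>i\<in>UNIV. \<mu> i)"

definition add_subgroup :: "'b::ab_group_add set \<Rightarrow> bool" where
  "add_subgroup G \<longleftrightarrow> 0 \<in> G \<and> (\<forall>x\<in>G. \<forall>y\<in>G. x + y \<in> G) \<and> (\<forall>x\<in>G. - x \<in> G)"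

definition nondegenerate :: "('a::field ^ 'n::finite) set \<Rightarrow> bool" where
  "nondegenerate G \<longleftrightarrow> (\<exists>B\<subseteq>G. vec.independent B \<and> vec.span B = UNIV)"

definition iso_to_Z :: "'b::ab_group_add set \<Rightarrow> bool" where
  "iso_to_Z G \<longleftrightarrow> (\<exists>\<phi>::'b \<Rightarrow> int. bij_betw \<phi> G UNIV \<and>
      (\<forall>x\<in>G. \<forall>y\<in>G. \<phi> (x + y) = \<phi> x + \<phi> y))"

definition ZZ :: "('a::ring_1 ^ 1) set" where
  "ZZ = range (\<lambda>k::int. (\<chi> i. of_int k))"

text \<open>A module is a vector space (sc) over F, together with the action
  rho alpha mu of the basis element t^alpha D^mu (alpha in Gamma, mu nonzero);
  the action of a general element is the linear extension.  The Lie bracket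
  is the commutator of the associative product
  (t^a D^m)(t^b D^n) = sum_l binom(m,l) b^l t^(a+b) D^(m+n-l).\<close>

definition W_comm :: "('c::field \<Rightarrow> 'v \<Rightarrow> 'v) \<Rightarrow> ('c ^ 'n::finite \<Rightarrow> ('n \<Rightarrow> nat) \<Rightarrow> 'v \<Rightarrow> 'v)
    \<Rightarrow> 'c ^ 'n \<Rightarrow> ('n \<Rightarrow> nat) \<Rightarrow> 'c ^ 'n \<Rightarrow> ('n \<Rightarrow> nat) \<Rightarrow> 'v::ab_group_add \<Rightarrow> 'v" where
  "W_comm sc \<rho> \<alpha> \<mu> \<beta> \<nu> v =
     (\<Sum>l\<in>{l. l \<le> \<mu>}. sc (of_nat (mbinom \<mu> l) * mpow \<beta> l) (\<rho> (\<alpha> + \<beta>) (\<mu> + \<nu> - l) v))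
   - (\<Sum>l\<in>{l. l \<le> \<nu>}. sc (of_nat (mbinom \<nu> l) * mpow \<alpha> l) (\<rho> (\<alpha> + \<beta>) (\<mu> + \<nu> - l) v))"

definition W_module :: "('c::field \<Rightarrow> 'v::ab_group_add \<Rightarrow> 'v) \<Rightarrow> ('c ^ 'n::finite) set
    \<Rightarrow> ('c ^ 'n \<Rightarrow> ('n \<Rightarrow> nat) \<Rightarrow> 'v \<Rightarrow> 'v) \<Rightarrow> bool" where
  "W_module sc G \<rho> \<longleftrightarrow> vector_space sc \<and>
     (\<forall>\<alpha>\<in>G. \<forall>\<mu>. \<mu> \<noteq> 0 \<longrightarrow> Vector_Spaces.linear sc sc (\<rho> \<alpha> \<mu>)) \<and>
     (\<forall>\<alpha>\<in>G. \<forall>\<beta>\<in>G. \<forall>\<mu> \<nu>. \<mu> \<noteq> 0 \<longrightarrow> \<nu> \<noteq> 0 \<longrightarrow> (\<forall>v.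
        \<rho> \<alpha> \<mu> (\<rho> \<beta> \<nu> v) - \<rho> \<beta> \<nu> (\<rho> \<alpha> \<mu> v) = W_comm sc \<rho> \<alpha> \<mu> \<beta> \<nu> v))"

definition W_submodule :: "('c::field \<Rightarrow> 'v::ab_group_add \<Rightarrow> 'v) \<Rightarrow> ('c ^ 'n::finite) set \<Rightarrow> ('c ^ 'n \<Rightarrow> ('n \<Rightarrow> nat) \<Rightarrow> 'v \<Rightarrow> 'v) \<Rightarrow> 'v set \<Rightarrow> bool" where
  "W_submodule sc G \<rho> S \<longleftrightarrow> module.subspace sc S \<and>
     (\<forall>\<alpha>\<in>G. \<forall>\<mu>. \<mu> \<noteq> 0 \<longrightarrow> \<rho> \<alpha> \<mu> ` S \<subseteq> S)"

definition W_irreducible :: "('c::field \<Rightarrow> 'v::ab_group_add \<Rightarrow> 'v) \<Rightarrow> ('c ^ 'n::finite) set \<Rightarrow> ('c ^ 'n \<Rightarrow> ('n \<Rightarrow> nat) \<Rightarrow> 'v \<Rightarrow> 'v) \<Rightarrow> bool" where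
  "W_irreducible sc G \<rho> \<longleftrightarrow> (\<exists>v::'v. v \<noteq> 0) \<and>
     (\<forall>S. W_submodule sc G \<rho> S \<longrightarrow> S = {0} \<or> S = UNIV)"

definition fin_dim :: "('c::field \<Rightarrow> 'v \<Rightarrow> 'v) \<Rightarrow> 'v::ab_group_add set \<Rightarrow> bool" where
  "fin_dim sc S \<longleftrightarrow> (\<exists>B. finite B \<and> S \<subseteq> module.span sc B)"

definition qf_grading :: "('c::field \<Rightarrow> 'v::ab_group_add \<Rightarrow> 'v) \<Rightarrow> 'g set \<Rightarrow> ('g \<Rightarrow> 'v set) \<Rightarrow> bool" where
  "qf_grading sc G Vg \<longleftrightarrow>
     (\<forall>\<beta>\<in>G. module.subspace sc (Vg \<beta>) \<and> fin_dim sc (Vg \<beta>)) \<and>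
     (\<forall>v. \<exists>!f. (\<forall>\<beta>. \<beta> \<notin> G \<longrightarrow> f \<beta> = 0) \<and> finite {\<beta>. f \<beta> \<noteq> 0} \<and>
               (\<forall>\<beta>\<in>G. f \<beta> \<in> Vg \<beta>) \<and> v = (\<Sum>\<beta>\<in>{\<beta>. f \<beta> \<noteq> 0}. f \<beta>))"

definition W_quasifinite :: "('c::field \<Rightarrow> 'v::ab_group_add \<Rightarrow> 'v) \<Rightarrow> ('c ^ 'n::finite) set \<Rightarrow> ('c ^ 'n \<Rightarrow> ('n \<Rightarrow> nat) \<Rightarrow> 'v \<Rightarrow> 'v) \<Rightarrow> ('c ^ 'n \<Rightarrow> 'v set) \<Rightarrow> bool" where
  "W_quasifinite sc G \<rho> Vg \<longleftrightarrow> qf_grading sc G Vg \<and>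
     (\<forall>\<alpha>\<in>G. \<forall>\<beta>\<in>G. \<forall>\<mu>. \<mu> \<noteq> 0 \<longrightarrow> \<rho> \<alpha> \<mu> ` Vg \<beta> \<subseteq> Vg (\<alpha> + \<beta>))"

definition cD :: "nat \<Rightarrow> (1 \<Rightarrow> nat)" where "cD k = (\<lambda>_. k)"

definition ffp :: "nat \<Rightarrow> 'c::comm_ring_1 poly" where
  "ffp m = (\<Prod>k<m. [:- of_nat k, 1:])"

text \<open>action of t^alpha [D]_m, expanded in the basis t^alpha D^k\<close>
definition rho_ff :: "('c::comm_ring_1 \<Rightarrow> 'v::ab_group_add \<Rightarrow> 'v) \<Rightarrow> ('c ^ 1 \<Rightarrow> (1 \<Rightarrow> nat) \<Rightarrow> 'v \<Rightarrow> 'v) \<Rightarrow> 'c ^ 1 \<Rightarrow> nat \<Rightarrow> 'v \<Rightarrow> 'v" where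
  "rho_ff sc \<rho> \<alpha> m v = (\<Sum>k\<le>m. sc (coeff (ffp m) k) (\<rho> \<alpha> (cD k) v))"

text \<open>the cocycle of the central extension on the basis t^alpha [D]_m\<close>
definition cocycle :: "'c::field_char_0 ^ 1 \<Rightarrow> nat \<Rightarrow> 'c ^ 1 \<Rightarrow> nat \<Rightarrow> 'c" where
  "cocycle \<alpha> m \<beta> n = (if \<alpha> = - \<beta> then
     (-1) ^ m * fact m * fact n * ((\<alpha> $ 1 + of_nat m) gchoose (m + n + 1)) else 0)"

text \<open>rho: action of t^alpha D^mu; c: action of C.  The bracket relations are imposed
  on the spanning set t^alpha [D]_m (m >= 1), C.\<close>
definition Wh_module :: "('c::field_char_0 \<Rightarrow> 'v::ab_group_add \<Rightarrow> 'v) \<Rightarrow> ('c ^ 1) set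
    \<Rightarrow> ('c ^ 1 \<Rightarrow> (1 \<Rightarrow> nat) \<Rightarrow> 'v \<Rightarrow> 'v) \<Rightarrow> ('v \<Rightarrow> 'v) \<Rightarrow> bool" where
  "Wh_module sc G \<rho> c \<longleftrightarrow> vector_space sc \<and>
     (\<forall>\<alpha>\<in>G. \<forall>\<mu>. \<mu> \<noteq> 0 \<longrightarrow> Vector_Spaces.linear sc sc (\<rho> \<alpha> \<mu>)) \<and>
     Vector_Spaces.linear sc sc c \<and>
     (\<forall>\<alpha>\<in>G. \<forall>\<mu>. \<mu> \<noteq> 0 \<longrightarrow> (\<forall>v. c (\<rho> \<alpha> \<mu> v) = \<rho> \<alpha> \<mu> (c v))) \<and>
     (\<forall>\<alpha>\<in>G. \<forall>\<beta>\<in>G. \<forall>m n. m \<ge> 1 \<longrightarrow> n \<ge> 1 \<longrightarrow> (\<forall>v.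
        rho_ff sc \<rho> \<alpha> m (rho_ff sc \<rho> \<beta> n v) - rho_ff sc \<rho> \<beta> n (rho_ff sc \<rho> \<alpha> m v)
        = (\<Sum>j\<le>m. \<Sum>k\<le>n. sc (coeff (ffp m) j * coeff (ffp n) k)
                              (W_comm sc \<rho> \<alpha> (cD j) \<beta> (cD k) v))
          + sc (cocycle \<alpha> m \<beta> n) (c v)))"

definition Wh_submodule :: "('c::field \<Rightarrow> 'v::ab_group_add \<Rightarrow> 'v) \<Rightarrow> ('c ^ 1) set \<Rightarrow> ('c ^ 1 \<Rightarrow> (1 \<Rightarrow> nat) \<Rightarrow> 'v \<Rightarrow> 'v) \<Rightarrow> ('v \<Rightarrow> 'v) \<Rightarrow> 'v set \<Rightarrow> bool" where
  "Wh_submodule sc G \<rho> c S \<longleftrightarrow> W_submodule sc G \<rho> S \<and> c ` S \<subseteq> S"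

definition Wh_irreducible :: "('c::field \<Rightarrow> 'v::ab_group_add \<Rightarrow> 'v) \<Rightarrow> ('c ^ 1) set \<Rightarrow> ('c ^ 1 \<Rightarrow> (1 \<Rightarrow> nat) \<Rightarrow> 'v \<Rightarrow> 'v) \<Rightarrow> ('v \<Rightarrow> 'v) \<Rightarrow> bool" where
  "Wh_irreducible sc G \<rho> c \<longleftrightarrow> (\<exists>v::'v. v \<noteq> 0) \<and>
     (\<forall>S. Wh_submodule sc G \<rho> c S \<longrightarrow> S = {0} \<or> S = UNIV)"

definition Wh_quasifinite :: "('c::field \<Rightarrow> 'v::ab_group_add \<Rightarrow> 'v) \<Rightarrow> ('c ^ 1) set \<Rightarrow> ('c ^ 1 \<Rightarrow> (1 \<Rightarrow> nat) \<Rightarrow> 'v \<Rightarrow> 'v) \<Rightarrow> ('v \<Rightarrow> 'v) \<Rightarrow> ('c ^ 1 \<Rightarrow> 'v set) \<Rightarrow> bool" where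
  "Wh_quasifinite sc G \<rho> c Vg \<longleftrightarrow> W_quasifinite sc G \<rho> Vg \<and>
     (\<forall>\<beta>\<in>G. c ` Vg \<beta> \<subseteq> Vg \<beta>)"

text \<open>sg = 1: highest weight (L_+ v = 0); sg = -1: lowest weight (L_- v = 0).\<close>
definition W_hw :: "('c::field \<Rightarrow> 'v::ab_group_add \<Rightarrow> 'v) \<Rightarrow> ('c ^ 1 \<Rightarrow> (1 \<Rightarrow> nat) \<Rightarrow> 'v \<Rightarrow> 'v)
    \<Rightarrow> ('c ^ 1 \<Rightarrow> 'v set) \<Rightarrow> int \<Rightarrow> bool" where
  "W_hw sc \<rho> Vg sg \<longleftrightarrow> (\<exists>v. v \<noteq> 0 \<and> (\<exists>k::int. v \<in> Vg (\<chi> i. of_int k)) \<and>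
     (\<forall>\<mu>. \<mu> \<noteq> 0 \<longrightarrow> (\<exists>a. \<rho> 0 \<mu> v = sc a v)) \<and>
     (\<forall>k::int. k > 0 \<longrightarrow> (\<forall>\<mu>. \<mu> \<noteq> 0 \<longrightarrow> \<rho> (\<chi> i. of_int (sg * k)) \<mu> v = 0)) \<and>
     \<Inter>{S. W_submodule sc ZZ \<rho> S \<and> v \<in> S} = UNIV)"

definition Wh_hw :: "('c::field \<Rightarrow> 'v::ab_group_add \<Rightarrow> 'v) \<Rightarrow> ('c ^ 1 \<Rightarrow> (1 \<Rightarrow> nat) \<Rightarrow> 'v \<Rightarrow> 'v)
    \<Rightarrow> ('v \<Rightarrow> 'v) \<Rightarrow> ('c ^ 1 \<Rightarrow> 'v set) \<Rightarrow> int \<Rightarrow> bool" where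
  "Wh_hw sc \<rho> c Vg sg \<longleftrightarrow> (\<exists>v. v \<noteq> 0 \<and> (\<exists>k::int. v \<in> Vg (\<chi> i. of_int k)) \<and>
     (\<forall>\<mu>. \<mu> \<noteq> 0 \<longrightarrow> (\<exists>a. \<rho> 0 \<mu> v = sc a v)) \<and> (\<exists>a. c v = sc a v) \<and>
     (\<forall>k::int. k > 0 \<longrightarrow> (\<forall>\<mu>. \<mu> \<noteq> 0 \<longrightarrow> \<rho> (\<chi> i. of_int (sg * k)) \<mu> v = 0)) \<and>
     \<Inter>{S. Wh_submodule sc ZZ \<rho> c S \<and> v \<in> S} = UNIV)"

text \<open>Elements of A_alpha, B_alpha: finitely supported coefficient functions
  gamma |-> coefficient of y_gamma, supported in Gamma.\<close>
definition fsupp :: "('c::zero ^ 'n) set \<Rightarrow> ('c ^ 'n \<Rightarrow> 'c) set" where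
  "fsupp G = {f. finite {\<gamma>. f \<gamma> \<noteq> 0} \<and> (\<forall>\<gamma>. f \<gamma> \<noteq> 0 \<longrightarrow> \<gamma> \<in> G)}"

text \<open>t^beta D^mu y_gamma = (alpha+gamma)^mu y_(beta+gamma)\<close>
definition A_act :: "'c::comm_ring_1 ^ 'n::finite \<Rightarrow> 'c ^ 'n \<Rightarrow> ('n \<Rightarrow> nat) \<Rightarrow> ('c ^ 'n \<Rightarrow> 'c) \<Rightarrow> ('c ^ 'n \<Rightarrow> 'c)" where
  "A_act \<alpha> \<beta> \<mu> f = (\<lambda>\<delta>. mpow (\<alpha> + (\<delta> - \<beta>)) \<mu> * f (\<delta> - \<beta>))"

text \<open>t^beta D^mu y_gamma = (-1)^(|mu|+1) (alpha+beta+gamma)^mu y_(beta+gamma)\<close>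
definition B_act :: "'c::comm_ring_1 ^ 'n::finite \<Rightarrow> 'c ^ 'n \<Rightarrow> ('n \<Rightarrow> nat) \<Rightarrow> ('c ^ 'n \<Rightarrow> 'c) \<Rightarrow> ('c ^ 'n \<Rightarrow> 'c)" where
  "B_act \<alpha> \<beta> \<mu> f = (\<lambda>\<delta>. (-1) ^ (mabs \<mu> + 1) * mpow (\<alpha> + \<delta>) \<mu> * f (\<delta> - \<beta>))"

definition ser_submodule :: "('c::field ^ 'n::finite) set \<Rightarrow> ('c ^ 'n \<Rightarrow> ('n \<Rightarrow> nat) \<Rightarrow> ('c ^ 'n \<Rightarrow> 'c) \<Rightarrow> ('c ^ 'n \<Rightarrow> 'c))
    \<Rightarrow> ('c ^ 'n \<Rightarrow> 'c) set \<Rightarrow> bool" where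
  "ser_submodule G act S \<longleftrightarrow> S \<subseteq> fsupp G \<and> (\<lambda>_. 0) \<in> S \<and>
     (\<forall>x\<in>S. \<forall>y\<in>S. (\<lambda>\<delta>. x \<delta> + y \<delta>) \<in> S) \<and> (\<forall>a. \<forall>x\<in>S. (\<lambda>\<delta>. a * x \<delta>) \<in> S) \<and>
     (\<forall>\<beta>\<in>G. \<forall>\<mu>. \<mu> \<noteq> 0 \<longrightarrow> (\<forall>x\<in>S. act \<beta> \<mu> x \<in> S))"

definition iso_subquotient :: "('c::field \<Rightarrow> 'v::ab_group_add \<Rightarrow> 'v) \<Rightarrow> ('c ^ 'n::finite) set
    \<Rightarrow> ('c ^ 'n \<Rightarrow> ('n \<Rightarrow> nat) \<Rightarrow> 'v \<Rightarrow> 'v)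
    \<Rightarrow> ('c ^ 'n \<Rightarrow> ('n \<Rightarrow> nat) \<Rightarrow> ('c ^ 'n \<Rightarrow> 'c) \<Rightarrow> ('c ^ 'n \<Rightarrow> 'c)) \<Rightarrow> bool" where
  "iso_subquotient sc G \<rho> act \<longleftrightarrow> (\<exists>S S' (\<phi>::('c ^ 'n \<Rightarrow> 'c) \<Rightarrow> 'v).
     ser_submodule G act S \<and> ser_submodule G act S' \<and> S' \<subseteq> S \<and>
     (\<forall>x\<in>S. \<forall>y\<in>S. \<phi> (\<lambda>\<delta>. x \<delta> + y \<delta>) = \<phi> x + \<phi> y) \<and>
     (\<forall>a. \<forall>x\<in>S. \<phi> (\<lambda>\<delta>. a * x \<delta>) = sc a (\<phi> x)) \<and>
     \<phi> ` S = UNIV \<and> {x\<in>S. \<phi> x = 0} = S' \<and>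
     (\<forall>\<beta>\<in>G. \<forall>\<mu>. \<mu> \<noteq> 0 \<longrightarrow> (\<forall>x\<in>S. \<phi> (act \<beta> \<mu> x) = \<rho> \<beta> \<mu> (\<phi> x))))"

definition W_intermediate :: "('c::field \<Rightarrow> 'v::ab_group_add \<Rightarrow> 'v) \<Rightarrow> ('c ^ 'n::finite) set \<Rightarrow> ('c ^ 'n \<Rightarrow> ('n \<Rightarrow> nat) \<Rightarrow> 'v \<Rightarrow> 'v) \<Rightarrow> bool" where
  "W_intermediate sc G \<rho> \<longleftrightarrow>
     (\<exists>\<alpha>. iso_subquotient sc G \<rho> (A_act \<alpha>) \<or> iso_subquotient sc G \<rho> (B_act \<alpha>))"

text \<open>C acts as 0 on A_alpha and B_alpha.\<close>
definition Wh_intermediate :: "('c::field \<Rightarrow> 'v::ab_group_add \<Rightarrow> 'v) \<Rightarrow> ('c ^ 1) set \<Rightarrow> ('c ^ 1 \<Rightarrow> (1 \<Rightarrow> nat) \<Rightarrow> 'v \<Rightarrow> 'v) \<Rightarrow> ('v \<Rightarrow> 'v) \<Rightarrow> bool" where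
  "Wh_intermediate sc G \<rho> c \<longleftrightarrow> W_intermediate sc G \<rho> \<and> (\<forall>v. c v = 0)"

end

theory Submission
  imports Defs
begin

text \<open>For f in \<open>F[D]\<close> with \<open>f(0) = 0\<close> write \<open>T k f\<close> for the action of \<open>t^k f(D)\<close>. The f for which \<open>T k f\<close>
  kills a given weight space contain an ideal of finite codimension (quasifiniteness), so the action of each
  degree splits into local parts \<open>E y x f\<close>, with \<open>y - x = k\<close>, supported at the finitely many points x of that
  ideal. The bracket turns them into matrix units over truncated polynomials: \<open>E y x\<close> moves a particle from
  the site x of \<open>F^n\<close> to the site y, and does nothing at all but finitely many sites of a given vector.

  Such idle sites form a vacuum. If an eigenvector of degree 0 has a single vacuum, finite dimension of the
  weight spaces allows at most one particle (or, dually, one hole), and the module is spanned by its positions: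
  this is A, respectively B by duality. If the multiples of k have infinite index in the grading group, there
  is always a single vacuum. Otherwise the group is cyclic, and there may be two different vacua, one towards
  each end. Then some vector is killed by all raising operators of large degree, the remaining ones are
  nilpotent, and this leads to a highest or lowest weight vector.

  The bracket identifies the action only up to a character of the degree 0 part and up to the centre. The
  former vanishes as difference operators on polynomials are surjective, the latter by comparing
  the cocycle in degrees k and \<open>2 k\<close>.\<close>

section \<open>Polynomial functions and their ideals\<close>

text \<open>A Lie action gives no relation for the product of two operators. The local operators
  therefore satisfy the relations of an infinite general linear Lie algebra, which also acts on
  tensor powers and Fock spaces; finite dimension of the weight spaces has to exclude these.
  Annihilators are ideals because \<open>[T 0 h, T k f] = T k ((sh k h - h) * f)\<close>, and for
  \<open>k \<noteq> 0\<close> the differences \<open>sh k h - h\<close> generate all polynomials. In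
  degree 0 they vanish, so \<open>T 0\<close> is never localised, and brackets of opposite degree
  are evaluated on common eigenvectors of \<open>T 0\<close>. Since \<open>\<mu> = 0\<close> is
  absent, f has to vanish at 0, which makes the site 0 exceptional: there A and B become reducible,
  and most case distinctions come from it. The duality is
  \<open>t^k f(D) -> - t^k f(- D - k)\<close>, a Lie automorphism of the algebra that includes
  \<open>\<mu> = 0\<close>. It does not preserve the condition \<open>f 0 = 0\<close> but turns a
  condition on the source of a move into one on its target. So the relations are stated for both
  conditions at once, with the flag \<open>b\<close>.\<close>

named_theorems pointwise

text \<open>As rewrite rules these would expand ring operations on functions even where the functions are not applied.\<close>

declare plus_fun_apply [simp del, pointwise] times_fun_apply [simp del, pointwise]
  zero_fun_apply [simp del, pointwise] one_fun_apply [simp del, pointwise]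
  minus_apply [simp del, pointwise] uminus_apply [simp del, pointwise]

text \<open>Polynomials in D are kept as functions on \<open>F^n\<close>. Over an infinite field
  they are determined by their values, and shifts and reflections become substitutions.\<close>

inductive polyfun :: "('a::comm_ring_1 ^ 'n::finite \<Rightarrow> 'a) \<Rightarrow> bool" where
  const: "polyfun (\<lambda>_. c)"
| coord: "polyfun (\<lambda>x. x $ i)"
| add: "polyfun f \<Longrightarrow> polyfun g \<Longrightarrow> polyfun (f + g)"
| mult: "polyfun f \<Longrightarrow> polyfun g \<Longrightarrow> polyfun (f * g)"

text \<open>The shift records how a polynomial in D passes a group element:
  \<open>f(D) t^l = t^l (sh l f)(D)\<close>.\<close>

definition sh :: "'b::plus \<Rightarrow> ('b \<Rightarrow> 'c) \<Rightarrow> 'b \<Rightarrow> 'c" where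
  "sh l f = (\<lambda>x. f (x + l))"

definition lin :: "'n::finite \<Rightarrow> 'a \<Rightarrow> 'a::comm_ring_1 ^ 'n \<Rightarrow> 'a" where
  "lin i c = (\<lambda>x. x $ i - c)"

definition cst :: "'a \<Rightarrow> 'b \<Rightarrow> 'a" where
  "cst c = (\<lambda>_. c)"

lemma lin_apply [pointwise]: "lin i c x = x $ i - c"
  by (simp add: lin_def)

lemma cst_apply [pointwise]: "cst c x = c"
  by (simp add: cst_def)

lemma power_fun_apply [pointwise]: "(f ^ n) x = f x ^ n" for f :: "'b \<Rightarrow> 'c::comm_semiring_1"
  by (induction n) (auto simp: pointwise)

lemma sum_fun_apply: "sum f A x = (\<Sum>i\<in>A. f i x)" for f :: "'i \<Rightarrow> 'b \<Rightarrow> 'c::comm_monoid_add"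
  by (induction A rule: infinite_finite_induct) (auto simp: zero_fun_def pointwise)

lemma prod_fun_apply: "(\<Prod>i\<in>A. f i) x = (\<Prod>i\<in>A. f i x)" for f :: "'i \<Rightarrow> 'b \<Rightarrow> 'c::comm_monoid_mult"
  by (induction A rule: infinite_finite_induct) (auto simp: one_fun_def pointwise)

lemma sh_apply [pointwise]: "sh l f x = f (x + l)"
  by (simp add: sh_def)

lemma sh_add: "sh l (f + g) = sh l f + sh l g"
  and sh_minus: "sh l (f - g) = sh l f - sh l g"
  and sh_mult: "sh l (f * g) = sh l f * sh l g"
  and sh_cst: "sh l (cst c) = cst c"
  and sh_one: "sh l 1 = 1"
  and sh_power: "sh l (f' ^ n) = sh l f' ^ n"
  for f g :: "'b::plus \<Rightarrow> 'a::comm_ring_1" and f' :: "'b::plus \<Rightarrow> 'a::comm_ring_1"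
  by (auto simp: fun_eq_iff pointwise algebra_simps)

lemma sh_lin: "sh l (lin i c) = lin i (c - l $ i)"
  by (auto simp: fun_eq_iff pointwise)

lemma sh_sh: "sh k (sh l f) = sh (k + l) f" for k :: "'b::semigroup_add"
  by (auto simp: fun_eq_iff pointwise add.assoc)

lemma sh_zero [simp]: "sh 0 f = f" for f :: "'b::monoid_add \<Rightarrow> 'c"
  by (auto simp: fun_eq_iff pointwise)

lemma polyfun_cst [simp, intro]: "polyfun (cst c)"
  unfolding cst_def by (rule polyfun.const)

lemma polyfun_one [simp, intro]: "polyfun 1" and polyfun_zero [simp, intro]: "polyfun 0"
  using polyfun_cst[of 1] polyfun_cst[of 0] by (simp_all add: cst_def one_fun_def zero_fun_def)

lemma polyfun_uminus [simp, intro]: "polyfun f \<Longrightarrow> polyfun (- f)"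
proof -
  assume "polyfun f"
  then have "polyfun (cst (-1) * f)" by (intro polyfun.mult polyfun_cst)
  moreover have "cst (-1) * f = - f" by (auto simp: fun_eq_iff pointwise)
  ultimately show ?thesis by simp
qed

lemma polyfun_minus [simp, intro]: "polyfun f \<Longrightarrow> polyfun g \<Longrightarrow> polyfun (f - g)"
  using polyfun.add[of f "- g"] by simp

lemma polyfun_add [simp, intro]: "polyfun f \<Longrightarrow> polyfun g \<Longrightarrow> polyfun (f + g)"
  and polyfun_mult [simp, intro]: "polyfun f \<Longrightarrow> polyfun g \<Longrightarrow> polyfun (f * g)"
  by (rule polyfun.add polyfun.mult; assumption)+

lemma polyfun_lin [simp, intro]: "polyfun (lin i c)"
proof -
  have "lin i c = (\<lambda>x. x $ i) - cst c" by (auto simp: fun_eq_iff pointwise)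
  then show ?thesis by (auto intro: polyfun.coord)
qed

lemma polyfun_power [simp, intro]: "polyfun f \<Longrightarrow> polyfun (f ^ n)"
  by (induction n) auto

lemma polyfun_sum [intro]: "(\<And>i. i \<in> A \<Longrightarrow> polyfun (f i)) \<Longrightarrow> polyfun (\<Sum>i\<in>A. f i)"
  by (induction A rule: infinite_finite_induct) auto

lemma polyfun_prod [intro]: "(\<And>i. i \<in> A \<Longrightarrow> polyfun (f i)) \<Longrightarrow> polyfun (\<Prod>i\<in>A. f i)"
  by (induction A rule: infinite_finite_induct) auto

lemma polyfun_sh [simp, intro]: "polyfun f \<Longrightarrow> polyfun (sh l f)"
proof (induction rule: polyfun.induct)
  case (const c)
  have "sh l (\<lambda>_. c) = cst c" by (auto simp: fun_eq_iff pointwise)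
  then show ?case by (metis polyfun_cst)
next
  case (coord i)
  have "sh l (\<lambda>x. x $ i) = lin i (- l $ i)" by (auto simp: fun_eq_iff pointwise)
  then show ?case by simp
qed (simp_all only: sh_add sh_mult polyfun_add polyfun_mult)

definition refl :: "('b::uminus \<Rightarrow> 'c) \<Rightarrow> 'b \<Rightarrow> 'c" where
  "refl f = (\<lambda>x. f (- x))"

lemma refl_apply [pointwise]: "refl f x = f (- x)"
  by (simp add: refl_def)

lemma polyfun_refl [simp, intro]: "polyfun f \<Longrightarrow> polyfun (refl f)"
proof (induction rule: polyfun.induct)
  case (const c)
  have "refl (\<lambda>_::'a^'b. c) = cst c" by (auto simp: fun_eq_iff pointwise)
  then show ?case by (metis polyfun_cst)
next
  case (coord i)
  have "refl (\<lambda>x::'a^'b. x $ i) = - lin i 0" by (auto simp: fun_eq_iff pointwise)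
  then show ?case by simp
next
  case (add f g)
  have "refl (f + g) = refl f + refl g" by (auto simp: fun_eq_iff pointwise)
  then show ?case using add by simp
next
  case (mult f g)
  have "refl (f * g) = refl f * refl g" by (auto simp: fun_eq_iff pointwise)
  then show ?case using mult by simp
qed

definition upoly :: "'a::comm_ring_1 poly \<Rightarrow> 'n::finite \<Rightarrow> 'a ^ 'n \<Rightarrow> 'a" where
  "upoly p i = (\<lambda>x. poly p (x $ i))"

lemma upoly_apply [pointwise]: "upoly p i x = poly p (x $ i)"
  by (simp add: upoly_def)

lemma upoly_mult: "upoly (p * q) i = upoly p i * upoly q i"
  by (auto simp: fun_eq_iff pointwise)

lemma polyfun_upoly [simp, intro]: "polyfun (upoly p i)"
proof (induction p)
  case 0
  have "upoly 0 i = 0" by (auto simp: fun_eq_iff pointwise)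
  then show ?case by (metis polyfun_zero)
next
  case (pCons a p)
  have "upoly (pCons a p) i = cst a + lin i 0 * upoly p i" by (auto simp: fun_eq_iff pointwise)
  then show ?case using pCons by simp
qed

section \<open>Ideals of polynomial functions\<close>

definition pideal :: "('a::comm_ring_1 ^ 'n::finite \<Rightarrow> 'a) set \<Rightarrow> bool" where
  "pideal J \<longleftrightarrow> (\<forall>f\<in>J. polyfun f) \<and> 0 \<in> J \<and> (\<forall>f\<in>J. \<forall>g\<in>J. f + g \<in> J) \<and>
     (\<forall>f\<in>J. \<forall>h. polyfun h \<longrightarrow> h * f \<in> J)"

lemma pidealI:
  assumes "\<And>f. f \<in> J \<Longrightarrow> polyfun f" "0 \<in> J" "\<And>f g. f \<in> J \<Longrightarrow> g \<in> J \<Longrightarrow> f + g \<in> J"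
    "\<And>f h. f \<in> J \<Longrightarrow> polyfun h \<Longrightarrow> h * f \<in> J"
  shows "pideal J"
  using assms unfolding pideal_def by blast

lemma pideal_polyfun: "pideal J \<Longrightarrow> f \<in> J \<Longrightarrow> polyfun f"
  and pideal_zero: "pideal J \<Longrightarrow> 0 \<in> J"
  and pideal_add: "pideal J \<Longrightarrow> f \<in> J \<Longrightarrow> g \<in> J \<Longrightarrow> f + g \<in> J"
  and pideal_mult: "pideal J \<Longrightarrow> f \<in> J \<Longrightarrow> polyfun h \<Longrightarrow> h * f \<in> J"
  unfolding pideal_def by blast+

lemma pideal_mult2: "pideal J \<Longrightarrow> f \<in> J \<Longrightarrow> polyfun h \<Longrightarrow> f * h \<in> J"
  using pideal_mult[of J f h] by (simp add: mult.commute)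

lemma pideal_minus: assumes "pideal J" "f \<in> J" "g \<in> J" shows "f - g \<in> J"
proof -
  have "f - g = f + cst (-1) * g" by (auto simp: fun_eq_iff pointwise)
  then show ?thesis using assms by (metis pideal_add pideal_mult polyfun_cst)
qed

lemma pideal_sum: "pideal J \<Longrightarrow> (\<And>i. i \<in> A \<Longrightarrow> f i \<in> J) \<Longrightarrow> (\<Sum>i\<in>A. f i) \<in> J"
  by (induction A rule: infinite_finite_induct) (auto intro: pideal_zero pideal_add)

lemma pideal_colon: "pideal J \<Longrightarrow> polyfun g \<Longrightarrow> pideal {h. polyfun h \<and> h * g \<in> J}"
  by (rule pidealI) (auto intro: pideal_zero pideal_add pideal_mult simp: distrib_right mult.assoc)

lemma pideal_shift: assumes "pideal J" shows "pideal {h. polyfun h \<and> sh l h \<in> J}"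
proof (rule pidealI)
  have "sh l 0 = (0 :: 'a^'b \<Rightarrow> 'a)" by (auto simp: fun_eq_iff pointwise)
  then show "0 \<in> {h. polyfun h \<and> sh l h \<in> J}" using assms pideal_zero by auto
qed (use assms in \<open>auto simp: sh_add sh_mult intro: pideal_add pideal_mult\<close>)

lemma pideal_Int: "pideal J \<Longrightarrow> pideal K \<Longrightarrow> pideal (J \<inter> K)"
  by (rule pidealI) (auto intro: pideal_zero pideal_add pideal_mult dest: pideal_polyfun)

lemma pideal_maximal:
  assumes J: "pideal J" and l: "\<And>i. lin i (a $ i) \<in> J" and f: "polyfun f"
  shows "f - cst (f a) \<in> J"
  using f
proof (induction rule: polyfun.induct)
  case (const c)
  have "(\<lambda>_. c) - cst c = (0 :: 'a^'b \<Rightarrow> 'a)" by (auto simp: fun_eq_iff pointwise)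
  then show ?case using pideal_zero[OF J] by (metis (full_types))
next
  case (coord i)
  have "(\<lambda>x. x $ i) - cst (a $ i) = lin i (a $ i)" by (auto simp: fun_eq_iff pointwise)
  then show ?case using l by simp
next
  case (add f g)
  have "(f + g) - cst ((f + g) a) = (f - cst (f a)) + (g - cst (g a))" by (auto simp: fun_eq_iff pointwise)
  then show ?case using add pideal_add[OF J] by metis
next
  case (mult f g)
  have "(f * g) - cst ((f * g) a) = g * (f - cst (f a)) + cst (f a) * (g - cst (g a))"
    by (auto simp: fun_eq_iff pointwise algebra_simps)
  then show ?case using mult pideal_add[OF J] pideal_mult[OF J] by simp
qed

text \<open>Finite codimension, in the form in which it is obtained and used: a nonzero univariate
  member for each coordinate bounds all exponents.\<close>

definition cofinite_ideal :: "('a::comm_ring_1 ^ 'n::finite \<Rightarrow> 'a) set \<Rightarrow> bool" where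
  "cofinite_ideal J \<longleftrightarrow> pideal J \<and> (\<forall>i. \<exists>p. p \<noteq> 0 \<and> upoly p i \<in> J)"

lemma cofinite_Int:
  fixes J K :: "('a::idom ^ 'n::finite \<Rightarrow> 'a) set"
  assumes "cofinite_ideal J" "cofinite_ideal K" shows "cofinite_ideal (J \<inter> K)"
proof -
  have "\<exists>p. p \<noteq> 0 \<and> upoly p i \<in> J \<inter> K" for i
  proof -
    obtain p q where "p \<noteq> 0" "upoly p i \<in> J" "q \<noteq> 0" "upoly q i \<in> K"
      using assms unfolding cofinite_ideal_def by blast
    moreover have "pideal J" "pideal K" using assms by (auto simp: cofinite_ideal_def)
    ultimately have "p * q \<noteq> 0" "upoly (p * q) i \<in> J \<inter> K"
      by (auto simp: upoly_mult intro: pideal_mult pideal_mult2)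
    then show ?thesis by blast
  qed
  then show ?thesis using assms by (auto simp: cofinite_ideal_def intro: pideal_Int)
qed

lemma cofinite_shift:
  fixes J :: "('a::idom ^ 'n::finite \<Rightarrow> 'a) set"
  assumes "cofinite_ideal J" shows "cofinite_ideal {h. polyfun h \<and> sh l h \<in> J}"
proof -
  have "\<exists>p. p \<noteq> 0 \<and> upoly p i \<in> {h. polyfun h \<and> sh l h \<in> J}" for i
  proof -
    obtain p where p: "p \<noteq> 0" "upoly p i \<in> J" using assms unfolding cofinite_ideal_def by blast
    define q where "q = pcompose p [:- (l $ i), 1:]"
    have "q \<noteq> 0" using p(1) by (simp add: q_def pcompose_eq_0_iff)
    moreover have "sh l (upoly q i) = upoly p i" by (auto simp: fun_eq_iff pointwise q_def poly_pcompose)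
    ultimately show ?thesis using p by (intro exI[of _ q]) auto
  qed
  then show ?thesis using assms pideal_shift by (auto simp: cofinite_ideal_def)
qed

text \<open>A weak Nullstellensatz for ideals of finite codimension. Dividing a linear factor out of one of the
  univariate members, either the colon ideal or the ideal itself has smaller univariate members.\<close>

lemma weak_nullstellensatz:
  fixes J :: "('a::alg_closed_field ^ 'n::finite \<Rightarrow> 'a) set"
  assumes "cofinite_ideal J" and nz: "\<And>x. \<exists>h\<in>J. h x \<noteq> 0"
  shows "1 \<in> J"
proof -
  have main: "1 \<in> J" if "pideal J" "\<And>i. ps i \<noteq> 0 \<and> upoly (ps i) i \<in> J" "\<And>x. \<exists>h\<in>J. h x \<noteq> 0"
      "(\<Sum>i\<in>UNIV. degree (ps i)) = m" for J :: "('a ^ 'n \<Rightarrow> 'a) set" and ps m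
    using that
  proof (induction m arbitrary: J ps rule: less_induct)
    case (less m)
    note J = less.prems(1)
    show ?case
    proof (cases "\<exists>i. degree (ps i) \<noteq> 1")
      case False
      then have "\<exists>a. lin i a \<in> J" for i
      proof -
        obtain a b where ab: "ps i = [:b, a:]" "a \<noteq> 0"
          using False by (metis degree1_coeffs)
        have "cst (inverse a) * upoly (ps i) i \<in> J" using less.prems J pideal_mult by blast
        moreover have "cst (inverse a) * upoly (ps i) i = lin i (- b / a)"
          using ab by (auto simp: fun_eq_iff pointwise field_simps)
        ultimately show ?thesis by metis
      qed
      then obtain a where a: "\<And>i. lin i (a i) \<in> J" by metis
      \<comment> \<open>The linear members single out one point a. Some h in J does not vanish
        there, and modulo J it equals the constant \<open>h a\<close>.\<close>
      obtain h where h: "h \<in> J" "h (\<chi> i. a i) \<noteq> 0" using less.prems by blast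
      have "h - cst (h (\<chi> i. a i)) \<in> J"
        by (rule pideal_maximal[OF J]) (use a h J pideal_polyfun in auto)
      then have "h - (h - cst (h (\<chi> i. a i))) \<in> J" using J h pideal_minus by blast
      then have "cst (inverse (h (\<chi> i. a i))) * (h - (h - cst (h (\<chi> i. a i)))) \<in> J"
        using J pideal_mult by blast
      moreover have "cst (inverse (h (\<chi> i. a i))) * (h - (h - cst (h (\<chi> i. a i)))) = 1"
        using h by (auto simp: fun_eq_iff pointwise)
      ultimately show ?thesis by simp
    next
      case True
      then obtain i where i: "degree (ps i) \<noteq> 1" by blast
      \<comment> \<open>Any ideal above J with a univariate member of smaller degree in coordinate i
        falls under the induction hypothesis; it has no common zero because J has none.\<close>
      have shrink: "1 \<in> J'" if "pideal J'" "J \<subseteq> J'" "q \<noteq> 0" "upoly q i \<in> J'" "degree q < degree (ps i)"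
        for J' q
      proof (rule less.IH[OF _ _ _ _ refl])
        show "(\<Sum>j\<in>UNIV. degree ((ps(i := q)) j)) < m"
          unfolding less.prems(4)[symmetric]
          by (rule sum_strict_mono_ex1) (use that in auto)
        show "\<And>x. \<exists>h\<in>J'. h x \<noteq> 0" using that(2) less.prems(3) by blast
      qed (use that less.prems in \<open>auto split: if_splits\<close>)
      show ?thesis
      proof (cases "degree (ps i) = 0")
        case True
        then obtain c where "ps i = [:c:]" using degree_eq_zeroE by blast
        then have "c \<noteq> 0" "cst (inverse c) * upoly (ps i) i = 1" using less.prems(2)[of i] by (auto simp: fun_eq_iff pointwise)
        then show ?thesis using less.prems J pideal_mult by (metis polyfun_cst)
      next
        case False
        then obtain a where "poly (ps i) a = 0" using alg_closed_imp_poly_has_root[of "ps i"] by auto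
        then obtain q where q: "ps i = [:-a, 1:] * q" by (auto simp: poly_eq_0_iff_dvd)
        have q0: "q \<noteq> 0" using q less.prems(2)[of i] by auto
        have dq: "degree (ps i) = Suc (degree q)" using q0 unfolding q by (subst degree_mult_eq) auto
        \<comment> \<open>The colon ideal by the cofactor q contains J and the linear factor, whose
          degree 1 is smaller than that of \<open>ps i\<close>. That it contains 1 puts q into J
          itself.\<close>
        have "1 \<in> {h. polyfun h \<and> h * upoly q i \<in> J}"
        proof (rule shrink)
          show "upoly [:-a, 1:] i \<in> {h. polyfun h \<and> h * upoly q i \<in> J}"
            using less.prems(2)[of i] by (simp add: q upoly_mult del: mult_pCons_left)
          show "J \<subseteq> {h. polyfun h \<and> h * upoly q i \<in> J}"
            using J by (auto intro: pideal_polyfun pideal_mult2)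
        qed (use J dq i False in \<open>auto intro: pideal_colon\<close>)
        then have "upoly q i \<in> J" by simp
        then show ?thesis using shrink[of J q] J q0 dq by simp
      qed
    qed
  qed
  obtain ps where "\<And>i. ps i \<noteq> 0 \<and> upoly (ps i) i \<in> J"
    using assms(1) unfolding cofinite_ideal_def by metis
  then show ?thesis using main[of J ps] assms unfolding cofinite_ideal_def by auto
qed

text \<open>The powers leave x as the only possible common zero, and e excludes it. Applied to colon
  ideals, this reduces a membership in J to a test at a single point.\<close>

lemma local_nullstellensatz:
  fixes J :: "('a::alg_closed_field ^ 'n::finite \<Rightarrow> 'a) set"
  assumes J: "pideal J" and N: "\<And>i. \<exists>N. lin i (x $ i) ^ N \<in> J" and e: "e \<in> J" "e x \<noteq> 0"
  shows "1 \<in> J"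
proof (rule weak_nullstellensatz)
  have u: "upoly ([:- (x $ i), 1:] ^ N) i = lin i (x $ i) ^ N" for i N
    by (auto simp: fun_eq_iff pointwise)
  then have "\<exists>p. p \<noteq> 0 \<and> upoly p i \<in> J" for i
    using N[of i] by (metis pCons_eq_0_iff power_not_zero zero_neq_one)
  then show "cofinite_ideal J" using J by (simp add: cofinite_ideal_def)
  fix y
  show "\<exists>h\<in>J. h y \<noteq> 0"
  proof (cases "y = x")
    case False
    then obtain i where "y $ i \<noteq> x $ i" by (auto simp: vec_eq_iff)
    moreover obtain N where "lin i (x $ i) ^ N \<in> J" using N by blast
    ultimately show ?thesis by (intro bexI[of _ "lin i (x $ i) ^ N"]) (auto simp: pointwise)
  qed (use e in auto)
qed

subsection \<open>Idempotents at the points of a zero-dimensional ideal\<close>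

text \<open>Modulo J, d is the idempotent of the local factor at x: it is supported at x, and there
  it is 1 because e is invertible at x. At a point that is not a zero of J it is 0 modulo J. Stating
  this by memberships in J avoids the quotient ring and lets it pass to larger ideals and along
  shifts.\<close>

definition isdelta :: "('a::comm_ring_1 ^ 'n::finite \<Rightarrow> 'a) set \<Rightarrow> 'a ^ 'n \<Rightarrow> ('a ^ 'n \<Rightarrow> 'a) \<Rightarrow> bool" where
  "isdelta J x d \<longleftrightarrow> polyfun d \<and> (\<forall>i. \<exists>N. lin i (x $ i) ^ N * d \<in> J) \<and>
     (\<exists>e. polyfun e \<and> e x = 1 \<and> e * (1 - d) \<in> J)"

lemma isdelta_polyfun: "isdelta J x d \<Longrightarrow> polyfun d"
  by (simp add: isdelta_def)

lemma isdelta_mono: "isdelta J x d \<Longrightarrow> J \<subseteq> K \<Longrightarrow> isdelta K x d"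
  unfolding isdelta_def by blast

lemma isdelta_shift:
  assumes "isdelta {h. polyfun h \<and> sh l h \<in> J} x d" shows "isdelta J (x - l) (sh l d)"
proof -
  have "\<exists>N. lin i ((x - l) $ i) ^ N * sh l d \<in> J" for i
    using assms by (auto simp: isdelta_def sh_mult sh_lin sh_power)
  moreover obtain e where e: "polyfun e" "e x = 1" "sh l (e * (1 - d)) \<in> J"
    using assms by (auto simp: isdelta_def)
  then have "polyfun (sh l e)" "sh l e (x - l) = 1" "sh l e * (1 - sh l d) \<in> J"
    by (auto simp: sh_mult sh_minus sh_one sh_apply)
  ultimately show ?thesis using assms by (auto simp: isdelta_def)
qed

text \<open>The colon ideal of \<open>d * (1 - d')\<close> contains powers of the coordinates at x,
  because of d, and a function with value 1 at x, because of d'. For \<open>d = d'\<close> this is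
  idempotence; in general it gives uniqueness modulo J.\<close>

lemma isdelta_absorb:
  fixes J :: "('a::alg_closed_field ^ 'n::finite \<Rightarrow> 'a) set"
  assumes J: "pideal J" and d: "isdelta J x d" "isdelta J x d'"
  shows "d * (1 - d') \<in> J"
proof -
  let ?K = "{h. polyfun h \<and> h * (d * (1 - d')) \<in> J}"
  have pf: "polyfun d" "polyfun d'" using d by (auto simp: isdelta_def)
  have "1 \<in> ?K"
  proof (rule local_nullstellensatz[of _ x])
    show "pideal ?K" using J pf by (intro pideal_colon) auto
    fix i
    obtain N where "lin i (x $ i) ^ N * d \<in> J" using d by (auto simp: isdelta_def)
    then have "(1 - d') * (lin i (x $ i) ^ N * d) \<in> J" using J pf pideal_mult by blast
    then show "\<exists>N. lin i (x $ i) ^ N \<in> ?K" by (intro exI[of _ N]) (auto simp: mult_ac)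
  next
    obtain e where e: "polyfun e" "e x = 1" "e * (1 - d') \<in> J" using d by (auto simp: isdelta_def)
    then have "d * (e * (1 - d')) \<in> J" using J pf pideal_mult by blast
    then show "(SOME e. polyfun e \<and> e x = 1 \<and> e * (d * (1 - d')) \<in> J) \<in> ?K"
      "(SOME e. polyfun e \<and> e x = 1 \<and> e * (d * (1 - d')) \<in> J) x \<noteq> 0"
      using someI[of "\<lambda>e. polyfun e \<and> e x = 1 \<and> e * (d * (1 - d')) \<in> J" e] e
      by (simp_all add: mult_ac)
  qed
  then show ?thesis by simp
qed

text \<open>A coordinate in which x and x' differ supplies, through d', a member of the colon ideal
  that does not vanish at x.\<close>

lemma isdelta_orthogonal:
  fixes J :: "('a::alg_closed_field ^ 'n::finite \<Rightarrow> 'a) set"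
  assumes J: "pideal J" and d: "isdelta J x d" "isdelta J x' d'" and ne: "x \<noteq> x'"
  shows "d * d' \<in> J"
proof -
  let ?K = "{h. polyfun h \<and> h * (d * d') \<in> J}"
  have pf: "polyfun d" "polyfun d'" using d by (auto simp: isdelta_def)
  obtain i where i: "x $ i \<noteq> x' $ i" using ne by (auto simp: vec_eq_iff)
  obtain N where N: "lin i (x' $ i) ^ N * d' \<in> J" using d by (auto simp: isdelta_def)
  have "1 \<in> ?K"
  proof (rule local_nullstellensatz[of _ x])
    show "pideal ?K" using J pf by (intro pideal_colon) auto
    fix i
    obtain N where "lin i (x $ i) ^ N * d \<in> J" using d by (auto simp: isdelta_def)
    then have "d' * (lin i (x $ i) ^ N * d) \<in> J" using J pf pideal_mult by blast
    then show "\<exists>N. lin i (x $ i) ^ N \<in> ?K" by (intro exI[of _ N]) (auto simp: mult_ac)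
  next
    have "d * (lin i (x' $ i) ^ N * d') \<in> J" using N J pf pideal_mult by blast
    then show "lin i (x' $ i) ^ N \<in> ?K" by (auto simp: mult_ac)
    show "(lin i (x' $ i) ^ N) x \<noteq> 0" using i by (auto simp: pointwise)
  qed
  then show ?thesis by simp
qed

lemma one_minus_prod_in_ideal:
  assumes "pideal J" "finite A" "\<And>i. i \<in> A \<Longrightarrow> polyfun (q i) \<and> polyfun (d i) \<and> q i * (1 - d i) \<in> J"
  shows "(\<Prod>i\<in>A. q i) * (1 - (\<Prod>i\<in>A. d i)) \<in> J"
  using assms(2,3)
proof (induction A rule: finite_induct)
  case empty
  then show ?case using assms(1) pideal_zero by (simp only: prod.empty diff_self mult_zero_right)
next
  case (insert a A)
  have "(\<Prod>i\<in>insert a A. q i) * (1 - (\<Prod>i\<in>insert a A. d i))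
      = (\<Prod>i\<in>A. q i) * (q a * (1 - d a)) + (q a * d a) * ((\<Prod>i\<in>A. q i) * (1 - (\<Prod>i\<in>A. d i)))"
    using insert by (simp add: algebra_simps)
  also have "\<dots> \<in> J"
    using insert assms(1)
    by (intro pideal_add[OF assms(1)] pideal_mult[OF assms(1), of "_ * (1 - _)"]
        pideal_mult[OF assms(1), of "q a * (1 - d a)"] polyfun_prod polyfun_mult) auto
  finally show ?case .
qed

text \<open>In one variable, the univariate member is a power of \<open>X - x_i\<close> times a
  cofactor, normalised to Q with value 1 at \<open>x_i\<close>. Then \<open>1 - (1 - Q)^N\<close> is
  a multiple of Q, while its complement \<open>(1 - Q)^N\<close> is a multiple of
  \<open>(X - x_i)^N\<close>. The product over all coordinates is the idempotent at x.\<close>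

lemma isdelta_exists:
  fixes J :: "('a::field ^ 'n::finite \<Rightarrow> 'a) set"
  assumes "cofinite_ideal J" shows "\<exists>d. isdelta J x d"
proof -
  have J: "pideal J" using assms by (simp add: cofinite_ideal_def)
  have "\<exists>d N q. polyfun d \<and> polyfun q \<and> q x = 1 \<and> lin i (x $ i) ^ N * d \<in> J \<and> q * (1 - d) \<in> J" for i
  proof -
    obtain p where p: "p \<noteq> 0" "upoly p i \<in> J" using assms unfolding cofinite_ideal_def by blast
    obtain r where r: "p = [:- (x $ i), 1:] ^ order (x $ i) p * r" "\<not> [:- (x $ i), 1:] dvd r"
      using order_decomp[OF p(1)] by blast
    define N where "N = Suc (order (x $ i) p)"
    have rx: "poly r (x $ i) \<noteq> 0" using r(2) by (simp add: poly_eq_0_iff_dvd)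
    define Q where "Q = smult (inverse (poly r (x $ i))) r"
    have "poly (1 - Q) (x $ i) = 0" using rx by (simp add: Q_def)
    then have "[:- (x $ i), 1:] dvd 1 - Q" by (simp only: poly_eq_0_iff_dvd)
    then obtain s where s: "1 - Q = [:- (x $ i), 1:] * s" by (elim dvdE)
    have "Q dvd 1 - (1 - Q) ^ N"
    proof -
      have "1 - (1 - Q) dvd 1 ^ N - (1 - Q) ^ N" by (metis dvd_triv_left power_diff_sumr2)
      then show ?thesis by simp
    qed
    then obtain s' where s': "1 - (1 - Q) ^ N = Q * s'" by auto
    define d where "d = upoly (1 - (1 - Q) ^ N) i"
    have Qp: "[:- (x $ i), 1:] ^ N * Q = smult (inverse (poly r (x $ i))) [:- (x $ i), 1:] * p"
    proof -
      have "[:- (x $ i), 1:] ^ N * Q = smult (inverse (poly r (x $ i)))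
          ([:- (x $ i), 1:] * ([:- (x $ i), 1:] ^ order (x $ i) p * r))"
        unfolding N_def Q_def by (simp only: power_Suc mult_smult_right mult_smult_left mult_ac)
      then show ?thesis unfolding r(1)[symmetric] by (simp only: mult_smult_left)
    qed
    have "upoly ([:- (x $ i), 1:] ^ N * (1 - (1 - Q) ^ N)) i \<in> J"
      unfolding s' mult.assoc[symmetric] Qp upoly_mult
      using p J by (intro pideal_mult2[OF J] pideal_mult[OF J]) auto
    moreover have "upoly ([:- (x $ i), 1:] ^ N * (1 - (1 - Q) ^ N)) i = lin i (x $ i) ^ N * d"
      by (auto simp: fun_eq_iff pointwise d_def)
    ultimately have 1: "lin i (x $ i) ^ N * d \<in> J" by simp
    have "upoly Q i * (1 - d) = upoly (Q * (1 - Q) ^ N) i" by (auto simp: fun_eq_iff pointwise d_def)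
    also have "Q * (1 - Q) ^ N = [:- (x $ i), 1:] ^ N * Q * s ^ N"
      unfolding s power_mult_distrib by (simp only: mult_ac)
    also have "upoly \<dots> i \<in> J"
      unfolding Qp upoly_mult using p J by (intro pideal_mult2[OF J] pideal_mult[OF J]) auto
    finally have 2: "upoly Q i * (1 - d) \<in> J" .
    have "upoly Q i x = 1" using rx by (simp add: Q_def pointwise)
    then show ?thesis using 1 2 by (intro exI[of _ d] exI[of _ N] exI[of _ "upoly Q i"]) (auto simp: d_def)
  qed
  then obtain d N q where *: "\<And>i. polyfun (d i) \<and> polyfun (q i) \<and> q i x = 1 \<and>
      lin i (x $ i) ^ N i * d i \<in> J \<and> q i * (1 - d i) \<in> J" by metis
  have "lin i (x $ i) ^ N i * (\<Prod>i\<in>UNIV. d i) \<in> J" for i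
  proof -
    have "lin i (x $ i) ^ N i * (\<Prod>i\<in>UNIV. d i) = (\<Prod>j\<in>UNIV - {i}. d j) * (lin i (x $ i) ^ N i * d i)"
      by (subst prod.remove[of _ i]) (auto simp: mult_ac)
    then show ?thesis using * pideal_mult[OF J, of "lin i (x $ i) ^ N i * d i"] by (auto intro!: polyfun_prod)
  qed
  moreover have "(\<Prod>i\<in>UNIV. q i) * (1 - (\<Prod>i\<in>UNIV. d i)) \<in> J"
    using * J by (intro one_minus_prod_in_ideal) auto
  moreover have "(\<Prod>i\<in>UNIV. q i) x = 1" using * by (simp add: prod_fun_apply)
  ultimately show ?thesis using * unfolding isdelta_def
    by (intro exI[of _ "\<Prod>i\<in>UNIV. d i"]) (auto intro!: polyfun_prod exI[of _ "\<Prod>i\<in>UNIV. q i"])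
qed

text \<open>A member h that is nonzero at x is invertible in the local factor. This is why only the
  zeros of an annihilator contribute local parts.\<close>

lemma isdelta_vanishes:
  fixes J :: "('a::alg_closed_field ^ 'n::finite \<Rightarrow> 'a) set"
  assumes J: "pideal J" and d: "isdelta J x d" and h: "h \<in> J" "h x \<noteq> 0"
  shows "d \<in> J"
proof -
  have pf: "polyfun d" using d by (auto simp: isdelta_def)
  have "1 \<in> {h. polyfun h \<and> h * d \<in> J}"
    by (rule local_nullstellensatz[of _ x h])
      (use assms pf in \<open>auto simp: isdelta_def intro: pideal_colon pideal_mult2 pideal_polyfun\<close>)
  then show ?thesis by simp
qed

lemma finite_vec_set:
  fixes A :: "'n::finite \<Rightarrow> 'a set"
  assumes "\<And>i. finite (A i)" shows "finite {x :: 'a ^ 'n. \<forall>i. x $ i \<in> A i}"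
proof -
  have "finite (PiE UNIV A)" using assms by (intro finite_PiE) auto
  moreover have "{x :: 'a ^ 'n. \<forall>i. x $ i \<in> A i} \<subseteq> vec_lambda ` PiE UNIV A"
  proof
    fix x :: "'a ^ 'n" assume "x \<in> {x. \<forall>i. x $ i \<in> A i}"
    then have "x = vec_lambda (vec_nth x)" "vec_nth x \<in> PiE UNIV A" by auto
    then show "x \<in> vec_lambda ` PiE UNIV A" by blast
  qed
  ultimately show ?thesis using finite_surj by blast
qed

lemma cofinite_zeros:
  fixes J :: "('a::field ^ 'n::finite \<Rightarrow> 'a) set"
  assumes "cofinite_ideal J" shows "finite {x. \<forall>h\<in>J. h x = 0}"
proof -
  obtain p where p: "\<And>i. p i \<noteq> 0 \<and> upoly (p i) i \<in> J" using assms unfolding cofinite_ideal_def by metis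
  have "finite {x :: 'a ^ 'n. \<forall>i. x $ i \<in> {a. poly (p i) a = 0}}"
    using p by (intro finite_vec_set) (auto intro: poly_roots_finite)
  then show ?thesis by (rule rev_finite_subset) (use p in \<open>force simp: pointwise\<close>)
qed

text \<open>The colon ideal of one minus the sum contains J, and for each zero x of J also
  \<open>d x\<close>, by orthogonality. The latter has value 1 at x, since
  \<open>e * (1 - d x)\<close> vanishes there. Hence there is no common zero.\<close>

lemma isdelta_partition:
  fixes J :: "('a::alg_closed_field ^ 'n::finite \<Rightarrow> 'a) set"
  assumes co: "cofinite_ideal J" and d: "\<And>x. isdelta J x (d x)"
    and X: "finite X" "{x. \<forall>h\<in>J. h x = 0} \<subseteq> X"
  shows "1 - (\<Sum>x\<in>X. d x) \<in> J"
proof -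
  have J: "pideal J" using co by (simp add: cofinite_ideal_def)
  let ?s = "\<Sum>x\<in>X. d x"
  let ?K = "{h. polyfun h \<and> h * (1 - ?s) \<in> J}"
  have pf: "polyfun (d x)" for x using d by (auto simp: isdelta_def)
  then have pfs: "polyfun (1 - ?s)" by (auto intro!: polyfun_sum)
  have JK: "J \<subseteq> ?K" using J pfs by (auto intro: pideal_mult2 pideal_polyfun)
  have "1 \<in> ?K"
  proof (rule weak_nullstellensatz)
    show "cofinite_ideal ?K" using co JK J pfs unfolding cofinite_ideal_def by (blast intro: pideal_colon)
    fix x
    show "\<exists>h\<in>?K. h x \<noteq> 0"
    proof (cases "\<exists>h\<in>J. h x \<noteq> 0")
      case False
      then have x: "x \<in> X" using X by blast
      have 1: "d x * (1 - ?s) = d x * (1 - d x) - (\<Sum>y\<in>X - {x}. d x * d y)"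
        using X x by (simp add: sum.remove[of X x] algebra_simps sum_distrib_left)
      have "d x * (1 - d x) \<in> J" by (rule isdelta_absorb[OF J d d])
      moreover have "(\<Sum>y\<in>X - {x}. d x * d y) \<in> J"
        by (intro pideal_sum[OF J] isdelta_orthogonal[OF J d d]) auto
      ultimately have "d x * (1 - ?s) \<in> J" unfolding 1 by (rule pideal_minus[OF J])
      then have "d x \<in> ?K" using pf by simp
      moreover obtain e where "e x = 1" "e * (1 - d x) \<in> J" using d[of x] by (auto simp: isdelta_def)
      then have "d x x = 1" using False by (force simp: pointwise)
      ultimately show ?thesis by force
    qed (use JK in blast)
  qed
  then show ?thesis by simp
qed

section \<open>Systems of local operators\<close>

text \<open>Otherwise \<open>B n\<close> would kill the span of the earlier vectors but not
  \<open>w n\<close>, and all \<open>w n\<close> would be independent. The exclusion of vectors with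
  many particles rests on this criterion.\<close>

lemma (in vector_space) triangular_family_degenerate:
  assumes "finite S" and w: "\<And>i::nat. w i \<in> span S"
    and B: "\<And>i. Vector_Spaces.linear scale scale (B i)"
    and tri: "\<And>i j. j < i \<Longrightarrow> B i (w j) = 0"
  shows "\<exists>i. B i (w i) = 0"
proof (rule ccontr)
  assume "\<not> ?thesis"
  then have nz: "B i (w i) \<noteq> 0" for i by simp
  have ind: "independent (w ` {..<n}) \<and> card (w ` {..<n}) = n" for n
  proof (induction n)
    case 0
    then show ?case by (simp add: independent_empty)
  next
    case (Suc n)
    have "B n x = 0" if "x \<in> span (w ` {..<n})" for x
    proof (rule span_induct[OF that])
      have "B n (x + y) = B n x + B n y" "B n (scale c x) = scale c (B n x)" for x y c
        using B[of n] unfolding Vector_Spaces.linear_iff by blast+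
      moreover from this(2)[of 0 0] have "B n 0 = 0" by (simp only: scale_zero_left)
      ultimately show "subspace {x. B n x = 0}" unfolding subspace_def by simp
    qed (use tri in auto)
    then have n: "w n \<notin> span (w ` {..<n})" using nz by blast
    then have "w n \<notin> w ` {..<n}" using span_base[of "w n" "w ` {..<n}"] by blast
    then show ?case using Suc n by (simp add: lessThan_Suc independent_insert)
  qed
  have "w ` {..<Suc (card S)} \<subseteq> span S" using w by auto
  then have "card (w ` {..<Suc (card S)}) \<le> card S"
    using independent_span_bound[OF assms(1)] ind by blast
  then show False using ind[of "Suc (card S)"] by simp
qed

lemma inj_multiples:
  fixes k :: "'a::field_char_0 ^ 'n::finite"
  assumes "k \<noteq> 0" shows "inj (\<lambda>i::nat. p + of_nat i *s k)"
proof (rule injI)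
  fix i j :: nat
  assume eq: "p + of_nat i *s k = p + of_nat j *s k"
  obtain t where t: "k $ t \<noteq> 0" using assms by (auto simp: vec_eq_iff)
  have "of_nat i * k $ t = of_nat j * k $ t"
    using arg_cong[OF eq, of "\<lambda>v. v $ t"] by simp
  then show "i = j" using t by simp
qed

lemma multiples_avoid_finite:
  fixes k :: "'a::field_char_0 ^ 'n::finite"
  assumes "k \<noteq> 0" "finite A" shows "\<exists>M. \<forall>i\<ge>M. p + of_nat i *s k \<notin> A"
proof -
  have "finite {i::nat. p + of_nat i *s k \<in> A}"
    using finite_vimageI[OF assms(2) inj_multiples[OF assms(1)], of p] by (simp add: vimage_def)
  then obtain M where "\<forall>i\<in>{i::nat. p + of_nat i *s k \<in> A}. i < M"
    using finite_nat_bounded by blast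
  then show ?thesis by (intro exI[of _ M]) force
qed

lemma add_subgroup_multiples:
  fixes k :: "'a::comm_ring_1 ^ 'n::finite"
  assumes "add_subgroup G" "k \<in> G" shows "of_nat i *s k \<in> G"
  using assms by (induction i) (auto simp: add_subgroup_def vector_sadd_rdistrib)

section \<open>The axioms of the local operators\<close>

definition ad :: "bool \<Rightarrow> 'a::comm_ring_1 ^ 'n::finite \<Rightarrow> 'a ^ 'n \<Rightarrow> ('a ^ 'n \<Rightarrow> 'a) \<Rightarrow> bool" where
  "ad b y x f \<longleftrightarrow> polyfun f \<and> ((if b then x else y) = 0 \<longrightarrow> f 0 = 0)"

text \<open>\<open>E y x f\<close> moves a particle from site x to site y, the polynomial f being written in the local
  coordinate at x. It models the part of \<open>t^(y-x) f(D)\<close> supported at x. The flag b tells whether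
  movements out of the site 0 (as in the modules A) or into the site 0 (as in B) are the ones for which
  f has to vanish at 0.\<close>

locale glsys = vector_space sc
  for sc :: "'a::{alg_closed_field, field_char_0} \<Rightarrow> 'v::ab_group_add \<Rightarrow> 'v" +
  fixes G :: "('a ^ 'n::finite) set" and Vg :: "'a ^ 'n \<Rightarrow> 'v set"
    and E :: "'a ^ 'n \<Rightarrow> 'a ^ 'n \<Rightarrow> ('a ^ 'n \<Rightarrow> 'a) \<Rightarrow> 'v \<Rightarrow> 'v"
    and H :: "('a ^ 'n \<Rightarrow> 'a) \<Rightarrow> 'v \<Rightarrow> 'v" and b :: bool
  assumes G: "add_subgroup G"
    and Vg_fin_dim: "a \<in> G \<Longrightarrow> fin_dim sc (Vg a)"
    and Vg_subspace: "a \<in> G \<Longrightarrow> subspace (Vg a)"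
    and E_off: "y - x \<notin> G \<Longrightarrow> E y x f u = 0"
    and E_linear: "y \<noteq> x \<Longrightarrow> ad b y x f \<Longrightarrow> Vector_Spaces.linear sc sc (E y x f)"
    and E_add: "y \<noteq> x \<Longrightarrow> ad b y x f \<Longrightarrow> ad b y x g \<Longrightarrow> E y x (f + g) u = E y x f u + E y x g u"
    and E_scale: "y \<noteq> x \<Longrightarrow> ad b y x f \<Longrightarrow> E y x (cst c * f) u = sc c (E y x f u)"
    and E_comp: "x \<noteq> y \<Longrightarrow> y \<noteq> z \<Longrightarrow> x \<noteq> z \<Longrightarrow> y - x \<in> G \<Longrightarrow> z - y \<in> G \<Longrightarrow> ad b y x f \<Longrightarrow> ad b z y g \<Longrightarrow>
        E z y g (E y x f u) = E y x f (E z y g u) + E z x (f * g) u"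
    and E_commute: "y \<noteq> x \<Longrightarrow> w \<noteq> z \<Longrightarrow> y \<noteq> z \<Longrightarrow> x \<noteq> w \<Longrightarrow> ad b y x f \<Longrightarrow> ad b w z g \<Longrightarrow>
        E y x f (E w z g u) = E w z g (E y x f u)"
    and E_grade: "y \<noteq> x \<Longrightarrow> ad b y x f \<Longrightarrow> y - x \<in> G \<Longrightarrow> a \<in> G \<Longrightarrow> u \<in> Vg a \<Longrightarrow> E y x f u \<in> Vg (a + (y - x))"
    and E_nil: "y \<noteq> x \<Longrightarrow> \<exists>N. \<forall>f. ad b y x f \<longrightarrow> E y x (lin i 0 ^ N * f) u = 0"
    and E_fin: "k \<noteq> 0 \<Longrightarrow> finite {x. \<exists>f. ad b (x + k) x f \<and> E (x + k) x f u \<noteq> 0}"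
    and H_linear: "polyfun h \<Longrightarrow> h 0 = 0 \<Longrightarrow> Vector_Spaces.linear sc sc (H h)"
    and H_uminus: "polyfun h \<Longrightarrow> h 0 = 0 \<Longrightarrow> H (- h) u = - H h u"
    and H_grade: "polyfun h \<Longrightarrow> h 0 = 0 \<Longrightarrow> a \<in> G \<Longrightarrow> u \<in> Vg a \<Longrightarrow> H h u \<in> Vg a"
    and H_commute: "polyfun h \<Longrightarrow> h 0 = 0 \<Longrightarrow> polyfun h' \<Longrightarrow> h' 0 = 0 \<Longrightarrow> H h (H h' u) = H h' (H h u)"
    and H_E: "y \<noteq> x \<Longrightarrow> polyfun h \<Longrightarrow> h 0 = 0 \<Longrightarrow> \<exists>p. polyfun p \<and> p 0 = h y - h x \<and>
        (\<forall>f u. ad b y x f \<longrightarrow> H h (E y x f u) = E y x f (H h u) + E y x (p * f) u)"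
    and E_E_opposite: "y \<noteq> x \<Longrightarrow> y - x \<in> G \<Longrightarrow> a \<in> G \<Longrightarrow> ad b y x f \<Longrightarrow> ad b x y g \<Longrightarrow>
        \<exists>h s. polyfun h \<and> h 0 = 0 \<and>
          (\<forall>u\<in>Vg a. E y x f (E x y g u) - E x y g (E y x f u) = H h u + sc s u)"
begin

lemma
  assumes "y \<noteq> x" "ad b y x f"
  shows E_zero [simp]: "E y x f 0 = 0"
    and E_vadd: "E y x f (u + v) = E y x f u + E y x f v"
    and E_vminus: "E y x f (u - v) = E y x f u - E y x f v"
    and E_neg: "E y x f (- u) = - E y x f u"
    and E_vscale: "E y x f (sc c u) = sc c (E y x f u)"
proof -
  interpret l: Vector_Spaces.linear sc sc "E y x f" by (rule E_linear[OF assms])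
  show "E y x f 0 = 0" "E y x f (u + v) = E y x f u + E y x f v"
    "E y x f (u - v) = E y x f u - E y x f v" "E y x f (- u) = - E y x f u"
    "E y x f (sc c u) = sc c (E y x f u)"
    by (rule l.zero l.add l.diff l.neg l.scale)+
qed

lemma
  assumes "polyfun h" "h 0 = 0"
  shows H_vadd: "H h (u + v) = H h u + H h v"
    and H_neg: "H h (- u) = - H h u"
    and H_vscale: "H h (sc c u) = sc c (H h u)"
proof -
  interpret l: Vector_Spaces.linear sc sc "H h" by (rule H_linear[OF assms])
  show "H h (u + v) = H h u + H h v" "H h (- u) = - H h u" "H h (sc c u) = sc c (H h u)"
    by (rule l.add l.neg l.scale)+
qed

lemma G_closed:
  shows G_zero: "0 \<in> G" and G_add: "x \<in> G \<Longrightarrow> y \<in> G \<Longrightarrow> x + y \<in> G"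
    and G_neg: "x \<in> G \<Longrightarrow> - x \<in> G" and G_diff: "x \<in> G \<Longrightarrow> y \<in> G \<Longrightarrow> x - y \<in> G"
  using G unfolding add_subgroup_def by (blast, blast, blast, metis add_uminus_conv_diff)

lemma G_diff_commute: "x - y \<in> G \<longleftrightarrow> y - x \<in> G"
  using G_neg[of "x - y"] G_neg[of "y - x"] by auto

lemma G_diff_trans: "x - y \<in> G \<Longrightarrow> y - z \<in> G \<Longrightarrow> x - z \<in> G"
  using G_add[of "x - y" "y - z"] by simp

lemma E_compose:
  assumes "x \<noteq> y" "y \<noteq> z" "x \<noteq> z" "y - x \<in> G \<or> z - y \<in> G" "ad b y x f" "ad b z y g"
  shows "E z y g (E y x f u) = E y x f (E z y g u) + E z x (f * g) u"
proof -
  have "z - x \<notin> G" if "y - x \<notin> G \<or> z - y \<notin> G"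
    using that assms(4) G_diff_trans[of z y x] G_diff_trans[of y z x] G_diff_trans[of z x y] G_diff_commute by blast
  then show ?thesis using assms by (cases "y - x \<in> G \<and> z - y \<in> G") (auto simp: E_comp E_off)
qed

lemma E_bracket:
  assumes "x \<noteq> y" "y \<noteq> z" "x \<noteq> z" "y - x \<in> G \<or> z - y \<in> G" "ad b y x f" "ad b z y g"
  shows "E z x (f * g) u = E z y g (E y x f u) - E y x f (E z y g u)"
  using E_compose[OF assms] by simp

text \<open>Sites without exchange in either direction are equally occupied, for instance all empty
  or all full. Leaving out the site 0 makes every polynomial admissible between two sites of
  S.\<close>

definition vac :: "'v \<Rightarrow> ('a ^ 'n) set \<Rightarrow> bool" where
  "vac v S \<longleftrightarrow> 0 \<notin> S \<and> (\<forall>x\<in>S. \<forall>y\<in>S. \<forall>f. x \<noteq> y \<longrightarrow> polyfun f \<longrightarrow> E y x f v = 0)"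

definition eig :: "'v \<Rightarrow> bool" where
  "eig v \<longleftrightarrow> (\<forall>h. polyfun h \<longrightarrow> h 0 = 0 \<longrightarrow> (\<exists>c. H h v = sc c v))"

lemma eigD: "eig v \<Longrightarrow> polyfun h \<Longrightarrow> h 0 = 0 \<Longrightarrow> \<exists>c. H h v = sc c v"
  by (simp add: eig_def)

text \<open>On an eigenvector both the degree 0 part and the central term of the opposite bracket
  act by scalars.\<close>

lemma E_E_eig:
  assumes "eig v" "v \<in> Vg a" "a \<in> G" "y \<noteq> x" "y - x \<in> G" "ad b y x f" "ad b x y g"
  shows "\<exists>c. E y x f (E x y g v) - E x y g (E y x f v) = sc c v"
proof -
  obtain h s where h: "polyfun h" "h 0 = 0"
    "E y x f (E x y g v) - E x y g (E y x f v) = H h v + sc s v"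
    using E_E_opposite[OF assms(4,5,3,6,7)] assms(2) by blast
  obtain c where "H h v = sc c v" using eigD assms(1) h by blast
  then show ?thesis using h by (metis scale_left_distrib)
qed

text \<open>Only finitely many sites can be involved in a vector of given degree: if two moves to or from sites of
  a vacuum gave a nonzero vector, then sliding both vacuum sites along multiples of k would give infinitely
  many linearly independent vectors of the same degree.\<close>

lemma vacuum_out_in:
  assumes S: "vac v S" "vac v S'" and v: "v \<in> Vg a" "a \<in> G" and k: "k \<in> G" "k \<noteq> 0"
    and z: "z \<in> S" "z' \<in> S'" and ray: "\<And>i. i \<ge> M \<Longrightarrow> z + of_nat i *s k \<in> S \<and> z' + of_nat i *s k \<in> S'"
    and ne: "z \<noteq> z'" "z \<noteq> x1" "x2 \<noteq> z'" and f: "ad b z x1 f" and g: "ad b x2 z' g"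
  shows "E z x1 f (E x2 z' g v) = 0"
proof (cases "z - x1 \<in> G \<and> x2 - z' \<in> G")
  case False
  then show ?thesis using f ne E_off[of z x1] E_off[of x2 z'] by auto
next
  case True
  obtain M1 M2 where M1: "\<And>i. i \<ge> M1 \<Longrightarrow> z + of_nat i *s k \<notin> {z, x1, x2, z'}"
    and M2: "\<And>i. i \<ge> M2 \<Longrightarrow> z' + of_nat i *s k \<notin> {z, x1, x2, z'}"
    using multiples_avoid_finite[OF k(2)] by (metis finite.emptyI finite.insertI)
  define m where "m i = M + M1 + M2 + i" for i
  \<comment> \<open>One site is a target and the other a source, and both are shifted by the same
    multiple of k, so the degree of the composite does not depend on i.\<close>
  define Z where "Z i = z + of_nat (m i) *s k" for i
  define Z' where "Z' i = z' + of_nat (m i) *s k" for i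
  have ZS: "Z i \<in> S" "Z' i \<in> S'" for i using ray[of "m i"] unfolding Z_def Z'_def m_def by auto
  have Zn: "Z i \<notin> {z, x1, x2, z'}" "Z' i \<notin> {z, x1, x2, z'}" for i
    using M1[of "m i"] M2[of "m i"] by (auto simp: Z_def Z'_def m_def)
  have Zinj: "Z i = Z j \<Longrightarrow> i = j" for i j
    using injD[OF inj_multiples[OF k(2), of z]] by (auto simp: Z_def m_def)
  have S0: "0 \<notin> S" "0 \<notin> S'" using S by (auto simp: vac_def)
  have mk: "of_nat i *s k \<in> G" for i using add_subgroup_multiples[OF G k(1)] .
  have ZG: "Z i - x1 \<in> G" "x2 - Z' i \<in> G" for i
    using True G_add[OF mk, of "z - x1" "m i"] G_diff[OF _ mk, of "x2 - z'" "m i"]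
    by (simp_all add: Z_def Z'_def algebra_simps)
  have fi: "ad b (Z i) x1 f" and gi: "ad b x2 (Z' i) g" for i
    using f g ZS[of i] S0 z by (auto simp: ad_def split: if_splits)
  have one: "ad b y x 1" if "x \<in> S \<union> S'" "y \<in> S \<union> S'" for x y
    using that S0 by (auto simp: ad_def)
  define d where "d = a + (x2 - z') + (z - x1)"
  have dG: "d \<in> G" unfolding d_def using v True G_add by blast
  define w where "w i = E (Z i) x1 f (E x2 (Z' i) g v)" for i
  have "w i \<in> Vg d" for i
  proof -
    have "E x2 (Z' i) g v \<in> Vg (a + (x2 - Z' i))" using E_grade gi ZG v Zn[of i] by auto
    then have "w i \<in> Vg (a + (x2 - Z' i) + (Z i - x1))"
      unfolding w_def using E_grade fi ZG v Zn[of i] G_add by auto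
    then show ?thesis by (simp add: d_def Z_def Z'_def algebra_simps)
  qed
  moreover obtain B where B: "finite B" "Vg d \<subseteq> span B" using Vg_fin_dim[OF dG] by (auto simp: fin_dim_def)
  \<comment> \<open>The move back from \<open>Z i\<close> meets a particle only in
    \<open>w i\<close>. In the earlier \<open>w j\<close> it commutes past both factors and
    annihilates v.\<close>
  moreover have "E z (Z i) 1 (w j) = 0" if "j < i" for i j
  proof -
    have "Z i \<noteq> Z j" using Zinj that by blast
    then have "E z (Z i) 1 (w j) = E (Z j) x1 f (E z (Z i) 1 (E x2 (Z' j) g v))"
      unfolding w_def using Zn[of i] Zn[of j] ne fi one[OF UnI1[OF ZS(1)] UnI1[OF z(1)]]
      by (intro E_commute) auto
    also have "E z (Z i) 1 (E x2 (Z' j) g v) = E x2 (Z' j) g (E z (Z i) 1 v)"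
      using Zn[of i] Zn[of j] ne gi one[OF UnI1[OF ZS(1)] UnI1[OF z(1)]] by (intro E_commute) auto
    also have "E z (Z i) 1 v = 0" using S z ZS Zn[of i] by (auto simp: vac_def)
    finally show ?thesis using gi fi Zn[of j] by auto
  qed
  moreover have "Vector_Spaces.linear sc sc (E z (Z i) 1)" for i
    using Zn[of i] one ZS(1)[of i] z by (intro E_linear) auto
  ultimately obtain i where i: "E z (Z i) 1 (w i) = 0"
    using triangular_family_degenerate[of B w "\<lambda>i. E z (Z i) 1"] by blast
  note n = Zn[of i]
  have o: "ad b z (Z i) 1" "ad b (Z' i) z' 1" using one ZS[of i] z by auto
  have vz: "E z (Z i) 1 v = 0" "E (Z' i) z' 1 v = 0" using S z ZS[of i] n by (auto simp: vac_def)
  have c1: "E z (Z i) 1 (E x2 (Z' i) g v) = 0"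
    using E_commute[of z "Z i" x2 "Z' i" 1 g v] n ne o gi vz by auto
  have "E z (Z i) 1 (w i) = E z x1 f (E x2 (Z' i) g v)"
    unfolding w_def using E_compose[of x1 "Z i" z f 1] n ne o fi[of i] ZG(1)[of i] c1 by auto
  then have c2: "E z x1 f (E x2 (Z' i) g v) = 0" using i by simp
  \<comment> \<open>It remains to return the source from \<open>Z' i\<close> to z'. The additional
    move lies inside the vacuum and commutes with the other factor.\<close>
  have "E x2 z' g v = - E (Z' i) z' 1 (E x2 (Z' i) g v)"
    using E_bracket[of z' "Z' i" x2 1 g v] n ne o gi[of i] ZG(2)[of i] vz by auto
  then have "E z x1 f (E x2 z' g v) = - E z x1 f (E (Z' i) z' 1 (E x2 (Z' i) g v))"
    using f ne by (simp add: E_neg)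
  also have "E z x1 f (E (Z' i) z' 1 (E x2 (Z' i) g v)) = E (Z' i) z' 1 (E z x1 f (E x2 (Z' i) g v))"
    using n ne f o by (intro E_commute) auto
  finally show ?thesis using c2 n o by (metis E_zero add.inverse_neutral)
qed

text \<open>Two targets have to be shifted in opposite directions to keep the degree fixed. This
  needs the same vacuum at both ends of a line, hence a cofinite S.\<close>

lemma vacuum_out_out:
  assumes S: "vac v S" and v: "v \<in> Vg a" "a \<in> G" and k: "k \<in> G" "k \<noteq> 0" and fin: "finite (- S)"
    and z: "z \<in> S" "z' \<in> S"
    and ne: "z \<noteq> z'" "z \<noteq> x1" "z \<noteq> x2" "z' \<noteq> x1" "z' \<noteq> x2" and f: "ad b z x1 f" and g: "ad b z' x2 g"
  shows "E z x1 f (E z' x2 g v) = 0"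
proof (cases "z - x1 \<in> G \<and> z' - x2 \<in> G")
  case False
  then show ?thesis using f ne E_off[of z x1] E_off[of z' x2] by auto
next
  case True
  have k': "- k \<noteq> 0" using k by simp
  have fin': "finite (- S \<union> {z, x1, x2, z'})" using fin by simp
  \<comment> \<open>M3 keeps the two rays disjoint: a common point of them would exhibit z' as z
    plus a large multiple of k.\<close>
  obtain M1 M2 M3 where M1: "\<And>i. i \<ge> M1 \<Longrightarrow> z + of_nat i *s k \<notin> - S \<union> {z, x1, x2, z'}"
    and M2: "\<And>i. i \<ge> M2 \<Longrightarrow> z' + of_nat i *s (- k) \<notin> - S \<union> {z, x1, x2, z'}"
    and M3: "\<And>i. i \<ge> M3 \<Longrightarrow> z + of_nat i *s k \<notin> {z'}"
    using multiples_avoid_finite[OF k(2) fin'] multiples_avoid_finite[OF k' fin'] multiples_avoid_finite[OF k(2), of "{z'}"]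
    by (metis finite.emptyI finite.insertI)
  define m where "m i = M3 + M1 + M2 + i" for i
  define Z where "Z i = z + of_nat (m i) *s k" for i
  define Z' where "Z' i = z' + of_nat (m i) *s (- k)" for i
  have ZS: "Z i \<in> S" "Z' i \<in> S" for i
    using M1[of "m i"] M2[of "m i"] by (auto simp: Z_def Z'_def m_def)
  have Zn: "Z i \<notin> {z, x1, x2, z'}" "Z' i \<notin> {z, x1, x2, z'}" for i
    using M1[of "m i"] M2[of "m i"] by (auto simp: Z_def Z'_def m_def)
  have Zinj: "Z i = Z j \<Longrightarrow> i = j" for i j
    using injD[OF inj_multiples[OF k(2), of z]] by (auto simp: Z_def m_def)
  have ZZ: "Z i \<noteq> Z' j" for i j
  proof
    assume "Z i = Z' j"
    then have "z + of_nat (m i + m j) *s k = z'"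
      by (simp add: Z_def Z'_def vector_sadd_rdistrib algebra_simps)
    then show False using M3[of "m i + m j"] by (simp add: m_def)
  qed
  have S0: "0 \<notin> S" using S by (auto simp: vac_def)
  have mk: "of_nat i *s k \<in> G" for i using add_subgroup_multiples[OF G k(1)] .
  have ZG: "Z i - x1 \<in> G" "Z' i - x2 \<in> G" for i
    using True G_add[OF mk, of "z - x1" "m i"] G_diff[OF _ mk, of "z' - x2" "m i"]
    by (simp_all add: Z_def Z'_def algebra_simps)
  have fi: "ad b (Z i) x1 f" and gi: "ad b (Z' i) x2 g" for i
    using f g ZS[of i] S0 z by (auto simp: ad_def split: if_splits)
  have one: "ad b y x 1" if "x \<in> S" "y \<in> S" for x y
    using that S0 by (auto simp: ad_def)
  define d where "d = a + (z' - x2) + (z - x1)"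
  have dG: "d \<in> G" unfolding d_def using v True G_add by blast
  define w where "w i = E (Z i) x1 f (E (Z' i) x2 g v)" for i
  have "w i \<in> Vg d" for i
  proof -
    have "E (Z' i) x2 g v \<in> Vg (a + (Z' i - x2))" using E_grade gi ZG v Zn[of i] by auto
    then have "w i \<in> Vg (a + (Z' i - x2) + (Z i - x1))"
      unfolding w_def using E_grade fi ZG v Zn[of i] G_add by auto
    then show ?thesis by (simp add: d_def Z_def Z'_def algebra_simps)
  qed
  moreover obtain B where B: "finite B" "Vg d \<subseteq> span B" using Vg_fin_dim[OF dG] by (auto simp: fin_dim_def)
  moreover have "E z (Z i) 1 (w j) = 0" if "j < i" for i j
  proof -
    have "Z i \<noteq> Z j" using Zinj that by blast
    then have "E z (Z i) 1 (w j) = E (Z j) x1 f (E z (Z i) 1 (E (Z' j) x2 g v))"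
      unfolding w_def using Zn[of i] Zn[of j] ne fi one[OF ZS(1) z(1)]
      by (intro E_commute) auto
    also have "E z (Z i) 1 (E (Z' j) x2 g v) = E (Z' j) x2 g (E z (Z i) 1 v)"
      using Zn[of i] Zn[of j] ne gi one[OF ZS(1) z(1)] ZZ by (intro E_commute) auto
    also have "E z (Z i) 1 v = 0" using S z ZS Zn[of i] by (auto simp: vac_def)
    finally show ?thesis using gi fi Zn[of j] by auto
  qed
  moreover have "Vector_Spaces.linear sc sc (E z (Z i) 1)" for i
    using Zn[of i] one ZS(1)[of i] z by (intro E_linear) auto
  ultimately obtain i where i: "E z (Z i) 1 (w i) = 0"
    using triangular_family_degenerate[of B w "\<lambda>i. E z (Z i) 1"] by blast
  note n = Zn[of i]
  have o: "ad b z (Z i) 1" "ad b z' (Z' i) 1" using one ZS[of i] z by auto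
  have vz: "E z (Z i) 1 v = 0" "E z' (Z' i) 1 v = 0" using S z ZS[of i] n by (auto simp: vac_def)
  have c1: "E z (Z i) 1 (E (Z' i) x2 g v) = 0"
    using E_commute[of z "Z i" "Z' i" x2 1 g v] n ne o gi[of i] vz ZZ[of i i] by auto
  have "E z (Z i) 1 (w i) = E z x1 f (E (Z' i) x2 g v)"
    unfolding w_def using E_compose[of x1 "Z i" z f 1] n ne o fi[of i] ZG(1)[of i] c1 by auto
  then have c2: "E z x1 f (E (Z' i) x2 g v) = 0" using i by simp
  have "E z' x2 g v = E z' (Z' i) 1 (E (Z' i) x2 g v)"
    using E_bracket[of x2 "Z' i" z' g 1 v] n ne o gi[of i] ZG(2)[of i] vz by auto
  then have "E z x1 f (E z' x2 g v) = E z x1 f (E z' (Z' i) 1 (E (Z' i) x2 g v))" by simp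
  also have "\<dots> = E z' (Z' i) 1 (E z x1 f (E (Z' i) x2 g v))"
    using n ne f o by (intro E_commute) auto
  finally show ?thesis using c2 n o by (metis E_zero add.inverse_neutral)
qed

end

section \<open>Particle-hole duality\<close>

lemma linear_uminus_comp:
  assumes "Vector_Spaces.linear sc sc f" shows "Vector_Spaces.linear sc sc (\<lambda>u. - f u)"
proof -
  interpret vector_space sc using assms by (simp add: Vector_Spaces.linear_iff)
  show ?thesis using assms unfolding Vector_Spaces.linear_iff by (auto simp: scale_minus_right)
qed

lemma refl_refl [simp]: "refl (refl f) = f" for f :: "'b::group_add \<Rightarrow> 'c"
  by (auto simp: fun_eq_iff pointwise)

lemma refl_mult: "refl (f * g) = refl f * refl g" and refl_add: "refl (f + g) = refl f + refl g"
  and refl_cst: "refl (cst c) = cst c" and refl_one: "refl 1 = 1"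
  for f g :: "'b::uminus \<Rightarrow> 'c::comm_ring_1"
  by (auto simp: fun_eq_iff pointwise)

lemma refl_lin_power: "refl (lin i 0 ^ N * f) = cst ((-1) ^ N) * (lin i 0 ^ N * refl f)"
  by (auto simp: fun_eq_iff pointwise power_minus[of "_ $ _"])

lemma refl_at_0 [simp]: "refl f (0 :: 'b::group_add) = f 0"
  by (simp add: refl_apply)

lemma ad_dual: "ad (\<not> b) y x f \<longleftrightarrow> ad b (- x) (- y) (refl f)"
  using polyfun_refl[of f] polyfun_refl[of "refl f"] by (auto simp: ad_def)

text \<open>Reversing all moves and reflecting the sites, with a sign, preserves the relations; a
  particle at x becomes a hole at \<open>- x\<close>. The condition at the site 0 passes from source
  to target or back, so b is negated. Every statement about moves into a vacuum thereby yields one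
  about moves out of it.\<close>

lemma (in glsys) dual:
  "glsys sc G Vg (\<lambda>y x f u. - E (- x) (- y) (refl f) u) (\<lambda>h u. - H (refl h) u) (\<not> b)"
proof (intro glsys.intro glsys_axioms.intro)
  show "vector_space sc" by (rule vector_space_axioms)
  show "add_subgroup G" by (rule G)
next
  fix a assume "a \<in> G"
  then show "fin_dim sc (Vg a)" "subspace (Vg a)" by (rule Vg_fin_dim Vg_subspace)+
next
  fix y x :: "'a^'n" and f u assume "y - x \<notin> G"
  then show "- E (- x) (- y) (refl f) u = 0" using E_off[of "-x" "-y"] by simp
next
  fix y x :: "'a^'n" and f assume "y \<noteq> x" "ad (\<not> b) y x f"
  then show "Vector_Spaces.linear sc sc (\<lambda>u. - E (- x) (- y) (refl f) u)"
    by - (rule linear_uminus_comp, rule E_linear, auto simp: ad_dual)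
next
  fix y x :: "'a^'n" and f g u assume "y \<noteq> x" "ad (\<not> b) y x f" "ad (\<not> b) y x g"
  then show "- E (- x) (- y) (refl (f + g)) u = - E (- x) (- y) (refl f) u + - E (- x) (- y) (refl g) u"
    using E_add[of "-x" "-y"] by (auto simp: ad_dual refl_add)
next
  fix y x :: "'a^'n" and f c u assume "y \<noteq> x" "ad (\<not> b) y x f"
  then show "- E (- x) (- y) (refl (cst c * f)) u = sc c (- E (- x) (- y) (refl f) u)"
    using E_scale[of "-x" "-y"] by (auto simp: ad_dual refl_mult refl_cst)
next
  fix x y z :: "'a^'n" and f g u
  assume *: "x \<noteq> y" "y \<noteq> z" "x \<noteq> z" "y - x \<in> G" "z - y \<in> G" "ad (\<not> b) y x f" "ad (\<not> b) z y g"
  then have "E (- x) (- y) (refl f) (E (- y) (- z) (refl g) u) =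
     E (- y) (- z) (refl g) (E (- x) (- y) (refl f) u) + E (- x) (- z) (refl g * refl f) u"
    by (intro E_comp) (auto simp: ad_dual)
  then show "- E (- y) (- z) (refl g) (- E (- x) (- y) (refl f) u) =
     - E (- x) (- y) (refl f) (- E (- y) (- z) (refl g) u) + - E (- x) (- z) (refl (f * g)) u"
    using * by (auto simp: ad_dual E_neg refl_mult mult.commute)
next
  fix y x w z :: "'a^'n" and f g u
  assume *: "y \<noteq> x" "w \<noteq> z" "y \<noteq> z" "x \<noteq> w" "ad (\<not> b) y x f" "ad (\<not> b) w z g"
  then have "E (- x) (- y) (refl f) (E (- z) (- w) (refl g) u) =
     E (- z) (- w) (refl g) (E (- x) (- y) (refl f) u)"
    by (intro E_commute) (auto simp: ad_dual)
  then show "- E (- x) (- y) (refl f) (- E (- z) (- w) (refl g) u) =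
     - E (- z) (- w) (refl g) (- E (- x) (- y) (refl f) u)"
    using * by (auto simp: ad_dual E_neg)
next
  fix y x a :: "'a^'n" and f u
  assume *: "y \<noteq> x" "ad (\<not> b) y x f" "y - x \<in> G" "a \<in> G" "u \<in> Vg a"
  then have "E (- x) (- y) (refl f) u \<in> Vg (a + (- x - (- y)))"
    by (intro E_grade) (auto simp: ad_dual)
  moreover have "a + (y - x) \<in> G" using * G_add by blast
  ultimately show "- E (- x) (- y) (refl f) u \<in> Vg (a + (y - x))"
    using subspace_neg[OF Vg_subspace] by simp
next
  fix y x :: "'a^'n" and i u assume "y \<noteq> x"
  then obtain N where N: "\<And>f. ad b (- x) (- y) f \<Longrightarrow> E (- x) (- y) (lin i 0 ^ N * f) u = 0"
    using E_nil[of "-x" "-y" i u] by auto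
  have "- E (- x) (- y) (refl (lin i 0 ^ N * f)) u = 0" if f: "ad (\<not> b) y x f" for f
  proof -
    have f': "ad b (- x) (- y) (refl f)" using f by (simp add: ad_dual)
    then have "ad b (- x) (- y) (lin i 0 ^ N * refl f)" by (auto simp: ad_def pointwise)
    then show ?thesis using \<open>y \<noteq> x\<close> f' N by (auto simp: refl_lin_power E_scale)
  qed
  then show "\<exists>N. \<forall>f. ad (\<not> b) y x f \<longrightarrow> - E (- x) (- y) (refl (lin i 0 ^ N * f)) u = 0" by blast
next
  fix k :: "'a^'n" and u assume k: "k \<noteq> 0"
  have "{x. \<exists>f. ad (\<not> b) (x + k) x f \<and> - E (- x) (- (x + k)) (refl f) u \<noteq> 0}
      \<subseteq> (\<lambda>x. - x - k) ` {x. \<exists>f. ad b (x + k) x f \<and> E (x + k) x f u \<noteq> 0}"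
  proof
    fix x assume "x \<in> {x. \<exists>f. ad (\<not> b) (x + k) x f \<and> - E (- x) (- (x + k)) (refl f) u \<noteq> 0}"
    then obtain f where "ad b (- x) (- (x + k)) (refl f)" "E (- x) (- (x + k)) (refl f) u \<noteq> 0"
      by (auto simp: ad_dual)
    moreover have "- x = - (x + k) + k" by simp
    ultimately have "ad b (- (x + k) + k) (- (x + k)) (refl f) \<and> E (- (x + k) + k) (- (x + k)) (refl f) u \<noteq> 0"
      by metis
    then have "- (x + k) \<in> {x. \<exists>f. ad b (x + k) x f \<and> E (x + k) x f u \<noteq> 0}" by blast
    then show "x \<in> (\<lambda>x. - x - k) ` {x. \<exists>f. ad b (x + k) x f \<and> E (x + k) x f u \<noteq> 0}"
      by (rule rev_image_eqI) simp
  qed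
  then show "finite {x. \<exists>f. ad (\<not> b) (x + k) x f \<and> - E (- x) (- (x + k)) (refl f) u \<noteq> 0}"
    by (rule finite_surj[OF E_fin[OF k]])
next
  fix h :: "'a^'n \<Rightarrow> 'a" assume "polyfun h" "h 0 = 0"
  then show "Vector_Spaces.linear sc sc (\<lambda>u. - H (refl h) u)"
    by - (rule linear_uminus_comp, rule H_linear, auto)
next
  fix h :: "'a^'n \<Rightarrow> 'a" and u assume "polyfun h" "h 0 = 0"
  moreover have "refl (- h) = - refl h" by (auto simp: fun_eq_iff pointwise)
  ultimately show "- H (refl (- h)) u = - (- H (refl h) u)"
    by (simp add: H_uminus)
next
  fix h :: "'a^'n \<Rightarrow> 'a" and a u assume "polyfun h" "h 0 = 0" "a \<in> G" "u \<in> Vg a"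
  then show "- H (refl h) u \<in> Vg a"
    using subspace_neg[OF Vg_subspace] H_grade[of "refl h"] by auto
next
  fix h h' :: "'a^'n \<Rightarrow> 'a" and u assume *: "polyfun h" "h 0 = 0" "polyfun h'" "h' 0 = 0"
  then have "H (refl h) (- v) = - H (refl h) v" "H (refl h') (- v) = - H (refl h') v" for v
    by (auto simp: H_neg)
  then show "- H (refl h) (- H (refl h') u) = - H (refl h') (- H (refl h) u)"
    using H_commute[of "refl h" "refl h'"] * by auto
next
  fix y x h assume *: "(y :: 'a^'n) \<noteq> x" "polyfun h" "h (0 :: 'a^'n) = (0::'a)"
  then obtain p where p: "polyfun p" "p 0 = refl h (- x) - refl h (- y)"
    "\<And>f u. ad b (- x) (- y) f \<Longrightarrow> H (refl h) (E (- x) (- y) f u) = E (- x) (- y) f (H (refl h) u) + E (- x) (- y) (p * f) u"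
    using H_E[of "-x" "-y" "refl h"] by auto
  have "H (refl h) (- v) = - H (refl h) v" for v
    using * by (auto simp: H_neg)
  then have "- H (refl h) (- E (- x) (- y) (refl f) u) =
      - E (- x) (- y) (refl f) (- H (refl h) u) + - E (- x) (- y) (refl (- refl p * f)) u"
    if "ad (\<not> b) y x f" for f u
  proof -
    have a: "ad b (- x) (- y) (refl f)" using that by (simp add: ad_dual)
    have "refl (- refl p * f) = cst (- 1) * (p * refl f)" by (auto simp: fun_eq_iff pointwise)
    moreover have "ad b (- x) (- y) (p * refl f)" using a p by (auto simp: ad_def pointwise)
    ultimately show ?thesis using a p(3)[OF a] * \<open>\<And>v. H (refl h) (- v) = - H (refl h) v\<close>
      by (simp add: E_neg E_scale scale_minus_left)
  qed
  moreover have "(- refl p) 0 = h y - h x" using p by (simp add: pointwise)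
  ultimately show "\<exists>p. polyfun p \<and> p 0 = h y - h x \<and> (\<forall>f u. ad (\<not> b) y x f \<longrightarrow>
      - H (refl h) (- E (- x) (- y) (refl f) u) = - E (- x) (- y) (refl f) (- H (refl h) u) + - E (- x) (- y) (refl (p * f)) u)"
    using p by (intro exI[of _ "- refl p"]) auto
next
  fix y x a :: "'a^'n" and f g
  assume *: "y \<noteq> x" "y - x \<in> G" "a \<in> G" "ad (\<not> b) y x f" "ad (\<not> b) x y g"
  then have "- x - - y \<in> G" "- x \<noteq> - y" "ad b (- x) (- y) (refl f)" "ad b (- y) (- x) (refl g)"
    by (auto simp: ad_dual)
  from E_E_opposite[OF this(2,1) *(3) this(3,4)] obtain h s where h: "polyfun h" "h 0 = 0"
    "\<And>u. u \<in> Vg a \<Longrightarrow> E (- x) (- y) (refl f) (E (- y) (- x) (refl g) u) - E (- y) (- x) (refl g) (E (- x) (- y) (refl f) u) = H h u + sc s u"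
    by blast
  show "\<exists>h s. polyfun h \<and> h 0 = 0 \<and> (\<forall>u\<in>Vg a. - E (- x) (- y) (refl f) (- E (- y) (- x) (refl g) u) -
     - E (- y) (- x) (refl g) (- E (- x) (- y) (refl f) u) = - H (refl h) u + sc s u)"
  proof (intro exI conjI ballI)
    show "polyfun (refl (- h))" "refl (- h) 0 = 0" using h by (auto simp: pointwise)
    fix u assume "u \<in> Vg a"
    then show "- E (- x) (- y) (refl f) (- E (- y) (- x) (refl g) u) -
     - E (- y) (- x) (refl g) (- E (- x) (- y) (refl f) u) = - H (refl (refl (- h))) u + sc s u"
      using h * by (simp add: H_uminus E_neg ad_dual)
  qed
qed

lemma uminus_mem_image [simp]: "- x \<in> uminus ` A \<longleftrightarrow> x \<in> A" for x :: "'b::group_add"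
  by force

context glsys
begin

lemma vac_dual:
  assumes "vac v S"
  shows "glsys.vac (\<lambda>y x f u. - E (- x) (- y) (refl f) u) v (uminus ` S)"
proof -
  interpret D: glsys sc G Vg "\<lambda>y x f u. - E (- x) (- y) (refl f) u" "\<lambda>h u. - H (refl h) u" "\<not> b"
    by (rule dual)
  show ?thesis using assms unfolding vac_def D.vac_def by auto
qed

text \<open>\<open>vacuum_out_in\<close> for the dual system, in which the factors come in the other
  order, z and z' are exchanged, and k becomes \<open>- k\<close>.\<close>

lemma vacuum_in_out:
  assumes S: "vac v S" "vac v S'" and v: "v \<in> Vg a" "a \<in> G" and k: "k \<in> G" "k \<noteq> 0"
    and z: "z \<in> S" "z' \<in> S'" and ray: "\<And>i. i \<ge> M \<Longrightarrow> z + of_nat i *s k \<in> S \<and> z' + of_nat i *s k \<in> S'"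
    and ne: "z \<noteq> z'" "z \<noteq> x1" "x2 \<noteq> z'" and f: "ad b z x1 f" and g: "ad b x2 z' g"
  shows "E x2 z' g (E z x1 f v) = 0"
proof -
  interpret D: glsys sc G Vg "\<lambda>y x f u. - E (- x) (- y) (refl f) u" "\<lambda>h u. - H (refl h) u" "\<not> b"
    by (rule dual)
  have "- z' + of_nat i *s (- k) \<in> uminus ` S'" "- z + of_nat i *s (- k) \<in> uminus ` S" if "i \<ge> M" for i
  proof -
    have "- p + of_nat i *s (- k) = - (p + of_nat i *s k)" for p :: "'a ^ 'n" by (simp add: vector_smult_rneg)
    then show "- z' + of_nat i *s (- k) \<in> uminus ` S'" "- z + of_nat i *s (- k) \<in> uminus ` S"
      using ray[OF that] by (simp_all only: uminus_mem_image)
  qed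
  then have "- E x2 z' g (- E z x1 f v) = 0"
    using D.vacuum_out_in[OF vac_dual[OF S(2)] vac_dual[OF S(1)] v, of "- k" "- z'" "- z" M "- x2" "- x1" "refl g" "refl f"]
      k z ne f g G_neg by (auto simp: ad_dual)
  then show ?thesis using g ne by (simp add: E_neg)
qed

text \<open>A move is a bracket of two moves through a third site. The polynomial goes to the leg
  that ends at the site on which \<open>ad b\<close> puts its condition; the other leg carries
  1.\<close>

lemma E_via:
  assumes "y \<noteq> x" "z \<noteq> x" "z \<noteq> y" "z \<noteq> 0" "z - x \<in> G \<or> y - z \<in> G" "ad b y x f"
  shows "\<exists>p q. ad b z x p \<and> ad b y z q \<and> p * q = f \<and>
    (\<forall>u. E y x f u = E y z q (E z x p u) - E z x p (E y z q u))"
proof (cases b)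
  case True
  then have "ad b z x f" "ad b y z 1" using assms by (auto simp: ad_def pointwise)
  then show ?thesis using assms E_bracket[of x z y f 1] by (intro exI[of _ f] exI[of _ 1]) auto
next
  case False
  then have "ad b z x 1" "ad b y z f" using assms by (auto simp: ad_def pointwise)
  then show ?thesis using assms E_bracket[of x z y 1 f] by (intro exI[of _ 1] exI[of _ f]) auto
qed

end

subsection \<open>Vectors with a single vacuum\<close>

text \<open>\<open>w z\<close> is the state with the particle at z. The site 0 carries no state: in
  A the corresponding vector is annihilated by the whole algebra, in B it is never reached. The
  functional lam is the degree 0 character that the bracket leaves undetermined.\<close>

definition particle :: "('a::field \<Rightarrow> 'v \<Rightarrow> 'v) \<Rightarrow> ('a ^ 'n::finite) set
    \<Rightarrow> ('a ^ 'n \<Rightarrow> 'a ^ 'n \<Rightarrow> ('a ^ 'n \<Rightarrow> 'a) \<Rightarrow> 'v \<Rightarrow> 'v) \<Rightarrow> (('a ^ 'n \<Rightarrow> 'a) \<Rightarrow> 'v \<Rightarrow> 'v) \<Rightarrow> bool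
    \<Rightarrow> 'a ^ 'n \<Rightarrow> ('a ^ 'n \<Rightarrow> 'v::ab_group_add) \<Rightarrow> (('a ^ 'n \<Rightarrow> 'a) \<Rightarrow> 'a) \<Rightarrow> bool" where
  "particle sc G E H b x w lam \<longleftrightarrow>
     (\<forall>z. w z \<noteq> 0 \<longleftrightarrow> z - x \<in> G \<and> z \<noteq> 0) \<and> x \<noteq> 0 \<and>
     (\<forall>y z f. y \<noteq> z \<longrightarrow> y - z \<in> G \<longrightarrow> ad b y z f \<longrightarrow> w z \<noteq> 0 \<longrightarrow> E y z f (w z) = sc (f 0) (w y)) \<and>
     (\<forall>y z' z f. y \<noteq> z' \<longrightarrow> z' \<noteq> z \<longrightarrow> ad b y z' f \<longrightarrow> E y z' f (w z) = 0) \<and>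
     (\<forall>h z. polyfun h \<longrightarrow> h 0 = 0 \<longrightarrow> H h (w z) = sc (h z + lam h) (w z))"

text \<open>F is a finite core outside of which v shows a single vacuum. The condition
  \<open>faithful\<close> sets aside the one-dimensional module, which is treated
  separately.\<close>

locale onevac = glsys sc G Vg E H b
  for sc :: "'a::{alg_closed_field, field_char_0} \<Rightarrow> 'v::ab_group_add \<Rightarrow> 'v"
    and G :: "('a ^ 'n::finite) set" and Vg E H b +
  fixes F :: "('a ^ 'n) set" and v :: 'v and a k :: "'a ^ 'n"
  assumes finF: "finite F" and vacF: "vac v (- F)"
    and v: "v \<in> Vg a" "a \<in> G" "v \<noteq> 0" "eig v" and k: "k \<in> G" "k \<noteq> 0"
    and faithful: "\<And>u. (\<And>y x f. y \<noteq> x \<Longrightarrow> ad b y x f \<Longrightarrow> E y x f u = 0) \<Longrightarrow> u = 0"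
begin

lemma F0: "0 \<in> F"
  using vacF by (auto simp: vac_def)

lemma nonzero: "z \<notin> F \<Longrightarrow> z \<noteq> 0"
  using F0 by auto

lemma vacuum: "x \<notin> F \<Longrightarrow> y \<notin> F \<Longrightarrow> x \<noteq> y \<Longrightarrow> polyfun f \<Longrightarrow> E y x f v = 0"
  using vacF by (auto simp: vac_def)

lemma fresh: "finite A \<Longrightarrow> \<exists>z. z \<notin> F \<and> z \<notin> A \<and> z - x \<in> G"
proof -
  assume "finite A"
  then obtain M where "\<And>i. i \<ge> M \<Longrightarrow> x + of_nat i *s k \<notin> F \<union> A"
    using multiples_avoid_finite[OF k(2), of "F \<union> A" x] finF by auto
  then show ?thesis using add_subgroup_multiples[OF G k(1), of M]
    by (intro exI[of _ "x + of_nat M *s k"]) auto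
qed

lemma ray: "\<exists>M. \<forall>i\<ge>M. z + of_nat i *s k \<in> - F \<and> z' + of_nat i *s k \<in> - F"
proof -
  obtain M M' where "\<And>i. i \<ge> M \<Longrightarrow> z + of_nat i *s k \<notin> F" "\<And>i. i \<ge> M' \<Longrightarrow> z' + of_nat i *s k \<notin> F"
    using multiples_avoid_finite[OF k(2) finF] by metis
  then show ?thesis by (intro exI[of _ "M + M'"]) auto
qed

text \<open>The names refer to the core: the factor "out" moves a particle from x1 to the vacuum
  site z, the factor "in" moves one from the vacuum site z' to x2.\<close>

lemma out_in: "z \<notin> F \<Longrightarrow> z' \<notin> F \<Longrightarrow> z \<noteq> z' \<Longrightarrow> z \<noteq> x1 \<Longrightarrow> x2 \<noteq> z' \<Longrightarrow> ad b z x1 f \<Longrightarrow> ad b x2 z' g \<Longrightarrow>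
    E z x1 f (E x2 z' g v) = 0"
  using ray[of z z'] vacuum_out_in[OF vacF vacF v(1,2) k, of z z'] by blast

lemma in_out: "z \<notin> F \<Longrightarrow> z' \<notin> F \<Longrightarrow> z \<noteq> z' \<Longrightarrow> z \<noteq> x1 \<Longrightarrow> x2 \<noteq> z' \<Longrightarrow> ad b z x1 f \<Longrightarrow> ad b x2 z' g \<Longrightarrow>
    E x2 z' g (E z x1 f v) = 0"
  using ray[of z z'] vacuum_in_out[OF vacF vacF v(1,2) k, of z z'] by blast

lemma out_out: "z \<notin> F \<Longrightarrow> z' \<notin> F \<Longrightarrow> z \<noteq> z' \<Longrightarrow> x1 \<notin> {z, z'} \<Longrightarrow> x2 \<notin> {z, z'} \<Longrightarrow> ad b z x1 f \<Longrightarrow> ad b z' x2 g \<Longrightarrow>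
    E z x1 f (E z' x2 g v) = 0"
  using vacuum_out_out[OF vacF v(1,2) k, of z z' x1 x2] finF by auto

lemma dual_onevac:
  "onevac sc G Vg (\<lambda>y x f u. - E (- x) (- y) (refl f) u) (\<lambda>h u. - H (refl h) u) (\<not> b) (uminus ` F) v a k"
proof -
  interpret D: glsys sc G Vg "\<lambda>y x f u. - E (- x) (- y) (refl f) u" "\<lambda>h u. - H (refl h) u" "\<not> b"
    by (rule dual)
  have "- uminus ` F = uminus ` (- F)"
  proof (rule set_eqI)
    fix x show "x \<in> - uminus ` F \<longleftrightarrow> x \<in> uminus ` (- F)"
      by (force simp: image_iff intro: bexI[of _ "- x"])
  qed
  then have vd: "D.vac v (- uminus ` F)" using vac_dual[OF vacF] by simp
  show ?thesis
  proof (intro onevac.intro onevac_axioms.intro dual)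
    show "finite (uminus ` F)" using finF by simp
    show "glsys.vac (\<lambda>y x f u. - E (- x) (- y) (refl f) u) v (- uminus ` F)" by (rule vd)
    have "\<exists>c. - H (refl h) v = sc c v" if "polyfun h" "h 0 = 0" for h
      using eigD[OF v(4), of "refl h"] that by (auto simp flip: scale_minus_left)
    then show "glsys.eig sc (\<lambda>h u. - H (refl h) u) v" unfolding D.eig_def by blast
    fix u
    assume *: "\<And>y x f. y \<noteq> x \<Longrightarrow> ad (\<not> b) y x f \<Longrightarrow> - E (- x) (- y) (refl f) u = 0"
    show "u = 0"
    proof (rule faithful)
      fix y x f assume "(y :: 'a^'n) \<noteq> x" "ad b y x f"
      then show "E y x f u = 0" using *[of "- x" "- y" "refl f"] by (auto simp: ad_dual)
    qed
  qed (use v k in auto)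
qed

lemma in_in:
  assumes "z \<notin> F" "z' \<notin> F" "z \<noteq> z'" "x1 \<notin> {z, z'}" "x2 \<notin> {z, z'}" "ad b x1 z f" "ad b x2 z' g"
  shows "E x1 z f (E x2 z' g v) = 0"
proof -
  interpret D: onevac sc G Vg "\<lambda>y x f u. - E (- x) (- y) (refl f) u" "\<lambda>h u. - H (refl h) u" "\<not> b" "uminus ` F" v a k
    by (rule dual_onevac)
  have "- E x1 z f (- E x2 z' g v) = 0"
    using D.out_out[of "- z" "- z'" "- x1" "- x2" "refl f" "refl g"] assms by (auto simp: ad_dual)
  then show ?thesis using assms by (simp add: E_neg)
qed

text \<open>Computing the weight of the bracket on \<open>E z0 x g v\<close> shows that \<open>f * h - c\<close> acts by zero, so the local
  Nullstellensatz identifies c.\<close>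

lemma alive_bracket:
  assumes alive: "z0 \<notin> F" "x \<noteq> z0" "ad b z0 x g0" "E z0 x g0 v \<noteq> 0"
    and z: "z \<notin> F" "z \<noteq> z0" "z \<noteq> x" "z - x \<in> G" and f: "ad b z x f" and h: "ad b x z h"
  shows "E x z h (E z x f v) - E z x f (E x z h v) = sc (f 0 * h 0) v"
    and "ad b z0 x g \<Longrightarrow> E z0 x (f * h * g) v = sc (f 0 * h 0) (E z0 x g v)"
proof -
  have nz: "z \<noteq> 0" "z0 \<noteq> 0" using nonzero z alive by auto
  have xz: "x - z \<in> G" using z G_diff_commute by blast
  obtain c where c: "E x z h (E z x f v) - E z x f (E x z h v) = sc c v"
    using E_E_eig[OF v(4,1,2), of x z h f] z f h xz by blast
  have pf: "polyfun f" "polyfun h" using f h by (auto simp: ad_def)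
  have key: "E z0 x (f * h * g) v = sc c (E z0 x g v)" if g: "ad b z0 x g" for g
  proof -
    have pg: "polyfun g" using g by (auto simp: ad_def)
    have 1: "E x z h (E z0 x g u) = E z0 x g (E x z h u) - E z0 z (h * g) u" for u
      using E_compose[of z x z0 h g u] z alive g h xz by simp
    have Bu: "E z x f (E z0 x g u) = E z0 x g (E z x f u)" for u
      using z alive f g by (intro E_commute) auto
    have 2: "E z0 z (h * g) (E z x f u) = E z x f (E z0 z (h * g) u) + E z0 x (f * (h * g)) u" for u
    proof (rule E_compose)
      show "ad b z0 z (h * g)" using nz pf pg by (auto simp: ad_def pointwise)
    qed (use z alive f in auto)
    have 3: "E z0 z (h * g) v = 0" using vacuum z alive pf pg by auto
    have 4: "E z0 x g (E x z h v) = 0" using z alive g h by (intro out_in) auto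
    have 5: "E x z h (E z0 x g v) = 0" unfolding 1 3 4 by simp
    have 6: "E z x f (E z0 x g v) = 0" using z alive f g by (intro out_out) auto
    \<comment> \<open>Two particles cannot both go from x to the vacuum. Expanding this zero
      expresses the scalar c through the action of \<open>f * h * g\<close>.\<close>
    have "0 = E x z h (E z x f (E z0 x g v))" using 6 h z by auto
    also have "\<dots> = E z0 x g (E x z h (E z x f v)) - E z0 z (h * g) (E z x f v)" unfolding Bu 1 ..
    also have "E z0 z (h * g) (E z x f v) = E z0 x (f * h * g) v" unfolding 2 3 using f z by (simp add: mult_ac)
    also have "E x z h (E z x f v) = sc c v + E z x f (E x z h v)" using c by (simp add: algebra_simps)
    also have "E z0 x g (sc c v + E z x f (E x z h v)) = sc c (E z0 x g v) + E z x f (E z0 x g (E x z h v))"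
      using g alive by (simp add: E_vadd E_vscale Bu)
    finally show ?thesis unfolding 4 using f z by simp
  qed
  \<comment> \<open>The polynomials that act by zero on the live move. By \<open>E_nil\<close> all
    coordinates are nilpotent modulo J, so a member with nonzero value at 0 would put 1 into J,
    against the choice of g0.\<close>
  define J where "J = {q. polyfun q \<and> (\<forall>g. ad b z0 x g \<longrightarrow> E z0 x (q * g) v = 0)}"
  have adm: "ad b z0 x (q * g)" if "polyfun q" "ad b z0 x g" for q g
    using that by (auto simp: ad_def pointwise)
  have zz: "E z0 x 0 v = 0" using E_scale[of z0 x g0 0 v] alive
    by (auto simp: cst_def zero_fun_def times_fun_def)
  have J: "pideal J"
  proof (rule pidealI)
    show "0 \<in> J" unfolding J_def using zz by simp
    show "p + q \<in> J" if "p \<in> J" "q \<in> J" for p q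
      using that alive unfolding J_def by (auto simp: distrib_right E_add adm)
    show "h * q \<in> J" if "q \<in> J" "polyfun h" for q h
    proof -
      have "E z0 x (h * q * g) v = 0" if "ad b z0 x g" for g
      proof -
        have "E z0 x (q * (h * g)) v = 0" using that \<open>q \<in> J\<close> \<open>polyfun h\<close> adm unfolding J_def by blast
        then show ?thesis by (simp add: mult_ac)
      qed
      then show ?thesis using that by (auto simp: J_def)
    qed
  qed (auto simp: J_def)
  have nilJ: "\<exists>N. lin i (0 $ i) ^ N \<in> J" for i
    using E_nil[of z0 x i v] alive unfolding J_def by auto
  have "f * h - cst c \<in> J"
  proof -
    have "E z0 x ((f * h - cst c) * g) v = 0" if g: "ad b z0 x g" for g
    proof -
      have "(f * h - cst c) * g = f * h * g + cst (- c) * g" by (auto simp: fun_eq_iff pointwise algebra_simps)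
      then show ?thesis using key[OF g] g pf alive
        by (simp add: E_add E_scale adm scale_minus_left)
    qed
    then show ?thesis using pf by (auto simp: J_def)
  qed
  moreover have "1 \<notin> J" using alive by (auto simp: J_def)
  ultimately have "(f * h - cst c) 0 = 0" using local_nullstellensatz[OF J nilJ] by blast
  then have cc: "c = f 0 * h 0" by (simp add: pointwise)
  show "E x z h (E z x f v) - E z x f (E x z h v) = sc (f 0 * h 0) v" using c cc by simp
  show "ad b z0 x g \<Longrightarrow> E z0 x (f * h * g) v = sc (f 0 * h 0) (E z0 x g v)" using key cc by simp
qed

end

text \<open>x is an occupied site other than 0: some polynomial moves its particle to the vacuum
  site z0.\<close>

locale onevac_alive = onevac sc G Vg E H b F v a k
  for sc :: "'a::{alg_closed_field, field_char_0} \<Rightarrow> 'v::ab_group_add \<Rightarrow> 'v"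
    and G :: "('a ^ 'n::finite) set" and Vg E H b F v a k +
  fixes x z0 g0
  assumes x: "x \<noteq> 0" and z0: "z0 \<notin> F" "z0 \<noteq> x" and g0: "ad b z0 x g0" and alive: "E z0 x g0 v \<noteq> 0"
begin

lemma xF: "x \<in> F"
proof (rule ccontr)
  assume "x \<notin> F"
  moreover have "polyfun g0" using g0 by (simp add: ad_def)
  ultimately show False using vacuum[of x z0 g0] z0 alive by auto
qed

lemma z0G: "z0 - x \<in> G"
  using E_off alive by blast

lemma ad_x: "polyfun f \<Longrightarrow> z \<notin> F \<Longrightarrow> ad b z x f" "polyfun f \<Longrightarrow> z \<notin> F \<Longrightarrow> ad b x z f"
  using x nonzero by (auto simp: ad_def)

lemma ad_vac: "polyfun f \<Longrightarrow> z \<notin> F \<Longrightarrow> z' \<notin> F \<Longrightarrow> ad b z z' f"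
  using nonzero by (auto simp: ad_def)

lemma E_z0_x: "polyfun f \<Longrightarrow> E z0 x f v = sc (f 0) (E z0 x 1 v)"
proof -
  assume f: "polyfun f"
  obtain z where z: "z \<notin> F" "z \<notin> {z0, x}" "z - x \<in> G" using fresh[of "{z0, x}" x] by auto
  show ?thesis using alive_bracket(2)[OF z0(1) _ g0 alive, of z f 1 1] z z0 f xF
    by (auto simp: ad_x pointwise)
qed

lemma E_z0_x_nonzero: "E z0 x 1 v \<noteq> 0"
  using E_z0_x[of g0] g0 alive by (auto simp: ad_def)

lemma E_z0_z_x:
  assumes z: "z \<notin> F" "z \<noteq> z0"
  shows "polyfun f \<Longrightarrow> E z z0 1 (E z0 x f v) = E z x f v"
  using E_compose[of x z0 z f 1 v] z z0 z0G xF vacuum[of z0 z 1] ad_x ad_vac by auto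

lemma E_z_x:
  assumes z: "z \<notin> F" and f: "polyfun f" shows "E z x f v = sc (f 0) (E z x 1 v)"
proof (cases "z = z0")
  case False
  have "E z x f v = E z z0 1 (E z0 x f v)" using E_z0_z_x z f False by simp
  also have "\<dots> = sc (f 0) (E z z0 1 (E z0 x 1 v))"
    using z z0 False ad_vac by (subst E_z0_x[OF f]) (auto simp: E_vscale)
  finally show ?thesis using E_z0_z_x z False by simp
qed (use E_z0_x[OF f] in blast)

lemma E_z_x_nonzero:
  assumes z: "z \<notin> F" "z - x \<in> G" shows "E z x 1 v \<noteq> 0"
proof (cases "z = z0")
  case False
  have "E z0 z 1 (E z x 1 v) = E z x 1 (E z0 z 1 v) + E z0 x (1 * 1) v"
    using E_compose[of x z z0 1 1 v] z z0 xF ad_x ad_vac False by auto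
  then have "E z0 z 1 (E z x 1 v) = E z0 x 1 v"
    using vacuum[of z z0 1] z z0 False ad_x[of 1 z] xF E_zero[of z x 1] by (cases "z = x") auto
  then show ?thesis using E_z0_x_nonzero z z0 ad_vac[of 1 z0 z] False by auto
qed (use E_z0_x_nonzero in simp)

text \<open>The bracket measures the occupation of x relative to the vacuum site z, and this is
  exactly one.\<close>

lemma bracket_v:
  assumes z: "z \<notin> F" "z - x \<in> G" and f: "polyfun f" and h: "polyfun h"
  shows "E x z h (E z x f v) - E z x f (E x z h v) = sc (f 0 * h 0) v"
proof -
  obtain y where y: "y \<notin> F" "y \<notin> {z, x}" "y - x \<in> G" using fresh[of "{z, x}" x] by auto
  show ?thesis
    using alive_bracket(1)[of y x 1 z f h] E_z_x_nonzero[of y] y z xF f h ad_x by auto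
qed

text \<open>The bracket of \<open>E x z 1\<close> and \<open>E z x 1\<close> is the identity on v.
  The move considered commutes with both, so the bracket is also the identity on the moved vector;
  but \<open>in_out\<close> and \<open>out_out\<close> make both of its terms zero there.\<close>

lemma no_other_out:
  assumes z: "z' \<notin> F" and w: "w \<noteq> x" "w \<noteq> z'" and g: "ad b z' w g"
  shows "E z' w g v = 0"
proof -
  obtain z where z: "z \<notin> F" "z \<notin> {z', w, x}" "z - x \<in> G" using fresh[of "{z', w, x}" x] by auto
  let ?u = "E z' w g v"
  have zx: "z \<noteq> x" "z' \<noteq> x" using z xF assms by auto
  have o: "ad b x z 1" "ad b z x 1" using ad_x z by auto
  have 1: "E z x 1 ?u = 0" using z zx assms o by (intro out_out) auto
  have 2: "E x z 1 ?u = 0" using z zx assms o by (intro in_out) auto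
  have c1: "E z x 1 (E z' w g u) = E z' w g (E z x 1 u)" for u using z zx assms o by (intro E_commute) auto
  have c2: "E x z 1 (E z' w g u) = E z' w g (E x z 1 u)" for u using z zx assms o by (intro E_commute) auto
  have "0 = E x z 1 (E z x 1 ?u) - E z x 1 (E x z 1 ?u)" unfolding 1 2 using o zx by simp
  also have "\<dots> = E z' w g (E x z 1 (E z x 1 v) - E z x 1 (E x z 1 v))"
    unfolding c1 c2 using g w by (simp add: E_vminus)
  also have "\<dots> = ?u" using bracket_v[OF z(1,3), of 1 1] by (simp add: pointwise)
  finally show ?thesis by simp
qed

text \<open>The counting argument again. For \<open>w = x\<close> the move would add a second
  particle at x, and the count ends with twice the vector being 0.\<close>

lemma no_in:
  assumes z: "z' \<notin> F" and w: "w \<noteq> z'" and g: "ad b w z' g"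
  shows "E w z' g v = 0"
proof -
  obtain z where z: "z \<notin> F" "z \<notin> {z', w, x}" "z - x \<in> G" using fresh[of "{z', w, x}" x] by auto
  let ?u = "E w z' g v"
  have zx: "z \<noteq> x" "z' \<noteq> x" using z xF assms by auto
  have o: "ad b x z 1" "ad b z x 1" using ad_x z by auto
  have 1: "E z x 1 ?u = 0" using z zx assms o by (intro out_in) auto
  have 2: "E x z 1 ?u = 0" using z zx assms o by (intro in_in) auto
  show ?thesis
  proof (cases "w = x")
    case False
    have c1: "E z x 1 (E w z' g u) = E w z' g (E z x 1 u)" for u using z zx assms o False by (intro E_commute) auto
    have c2: "E x z 1 (E w z' g u) = E w z' g (E x z 1 u)" for u using z zx assms o False by (intro E_commute) auto
    have "0 = E x z 1 (E z x 1 ?u) - E z x 1 (E x z 1 ?u)" unfolding 1 2 using o zx by simp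
    also have "\<dots> = E w z' g (E x z 1 (E z x 1 v) - E z x 1 (E x z 1 v))"
      unfolding c1 c2 using g w by (simp add: E_vminus)
    also have "\<dots> = ?u" using bracket_v[OF z(1,3), of 1 1] by (simp add: pointwise)
    finally show ?thesis by simp
  next
    case True
    have pg: "polyfun g" using g by (simp add: ad_def)
    have azz: "ad b z z' g" using ad_vac pg z assms by auto
    have gx: "ad b x z' g" using g True by simp
    have b1: "E z x 1 (E x z' g u) = E x z' g (E z x 1 u) + E z z' g u" for u
      using E_compose[of z' x z g 1 u] z zx gx o by auto
    have b2: "E x z 1 (E z z' g u) = E z z' g (E x z 1 u) + E x z' g u" for u
      using E_compose[of z' z x g 1 u] z zx azz o G_diff_commute by auto
    have vz: "E z z' g v = 0" using vacuum z assms pg by auto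
    have c: "E x z 1 (E x z' g u) = E x z' g (E x z 1 u)" for u using z zx gx o by (intro E_commute) auto
    have 3: "E x z' g (E x z 1 v) = 0" using z assms zx gx o by (intro in_in) auto
    have "E z z' g (E x z 1 v) = - E x z' g v" using b2[of v] vz o zx by (simp add: eq_neg_iff_add_eq_0)
    moreover have "E x z' g (E z x 1 (E x z 1 v)) + E z z' g (E x z 1 v) = 0"
      using b1[of "E x z 1 v"] 3 o zx by simp
    ultimately have 4: "E x z' g (E z x 1 (E x z 1 v)) = E x z' g v" by simp
    have 5: "E x z' g (E z x 1 v) = 0" using b1[of v] vz 1 True by simp
    have "0 = E x z 1 (E x z' g (E z x 1 v))" unfolding 5 using o zx by simp
    also have "\<dots> = E x z' g (E x z 1 (E z x 1 v))" by (rule c)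
    also have "E x z 1 (E z x 1 v) = v + E z x 1 (E x z 1 v)"
      using bracket_v[OF z(1,3), of 1 1] by (simp add: pointwise algebra_simps)
    also have "E x z' g \<dots> = E x z' g v + E x z' g v" using gx zx 4 by (simp add: E_vadd)
    finally have "sc 2 ?u = 0" unfolding True by (metis one_add_one scale_left_distrib scale_one)
    then show ?thesis by simp
  qed
qed

text \<open>Moves that touch the vacuum are already excluded, and a move inside the core factors
  through a vacuum site.\<close>

lemma dead:
  assumes w: "w \<noteq> x" "y \<noteq> w" and f: "ad b y w f"
  shows "E y w f v = 0"
proof -
  consider "y \<notin> F" | "w \<notin> F" | "y \<in> F" "w \<in> F" by blast
  then show ?thesis
  proof cases
    case 3
    obtain z where z: "z \<notin> F" "z \<notin> {y, w}" "z - w \<in> G" using fresh[of "{y, w}" w] by auto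
    obtain p q where pq: "ad b z w p" "ad b y z q" "\<And>u. E y w f u = E y z q (E z w p u) - E z w p (E y z q u)"
      using E_via[of y w z f] z w f nonzero[of z] by auto
    then show ?thesis using no_other_out[of z w p] no_in[of z y q] z w by auto
  qed (use no_other_out no_in assms in auto)
qed

text \<open>There is just one particle at x. Both targets are replaced by vacuum sites with the help
  of \<open>E_via\<close>, where \<open>out_out\<close> applies.\<close>

lemma double_out:
  assumes y: "y \<noteq> x" "z \<noteq> x" and f: "ad b y x f" and g: "ad b z x g"
  shows "E y x f (E z x g v) = 0"
proof -
  have vac_vac: "E y x f (E z x g v) = 0" if "y \<notin> F" "z \<notin> F" "y \<noteq> z" "ad b y x f" "ad b z x g" for y z f g
    using that xF by (intro out_out) auto
  have any_vac: "E y x f (E z x g v) = 0" if z: "z \<notin> F" "y \<noteq> z" "y \<noteq> x" "ad b y x f" "ad b z x g" for y z f g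
  proof (cases "y \<in> F")
    case True
    obtain z' where z': "z' \<notin> F" "z' \<notin> {y, x, z}" "z' - x \<in> G" using fresh[of "{y, x, z}" x] by auto
    obtain p q where pq: "ad b z' x p" "ad b y z' q" "\<And>u. E y x f u = E y z' q (E z' x p u) - E z' x p (E y z' q u)"
      using E_via[of y x z' f] z' z(3,4) nonzero[of z'] by auto
    have 1: "E z' x p (E z x g v) = 0" using z' z pq by (intro vac_vac) auto
    have "E y z' q (E z x g v) = E z x g (E y z' q v)" using z' z pq xF by (intro E_commute) auto
    then have 2: "E y z' q (E z x g v) = 0" using dead[of z' y q] z' pq xF z E_zero[of z x g] by (cases "z = x") auto
    show ?thesis unfolding pq(3) 1 2 using pq z' by auto
  qed (use vac_vac z in auto)
  obtain z1 where z1: "z1 \<notin> F" "z1 \<notin> {y, x, z}" "z1 - x \<in> G" using fresh[of "{y, x, z}" x] by auto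
  obtain p q where pq: "ad b z1 x p" "ad b z z1 q" "\<And>u. E z x g u = E z z1 q (E z1 x p u) - E z1 x p (E z z1 q u)"
    using E_via[of z x z1 g] z1 g y nonzero[of z1] by auto
  have "E z z1 q v = 0" using dead[of z1 z q] z1 pq xF by auto
  then have "E z x g v = E z z1 q (E z1 x p v)" unfolding pq(3) using pq z1 by auto
  then have "E y x f (E z x g v) = E y x f (E z z1 q (E z1 x p v))" by simp
  also have "\<dots> = E z z1 q (E y x f (E z1 x p v))" using y z1 f pq by (intro E_commute) auto
  also have "E y x f (E z1 x p v) = 0" using y z1 f pq by (intro any_vac) auto
  finally show ?thesis using pq z1 by auto
qed

text \<open>If the condition sits at the source, f lies on the leg from x to the vacuum. There only
  \<open>f 0\<close> counts, so it can be handed to the other leg as a constant.\<close>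

lemma E_via_vacuum:
  assumes y: "y \<noteq> x" "z \<notin> F" "z \<noteq> y" "z - x \<in> G" and f: "ad b y x f"
  shows "\<exists>q. ad b y z q \<and> E y x f v = E y z q (E z x 1 v) \<and> (q = f \<or> q = cst (f 0))"
proof -
  have zx: "z \<noteq> x" "z \<noteq> 0" using y xF nonzero by auto
  have pf: "polyfun f" using f by (simp add: ad_def)
  have in0: "E y z q v = 0" if "ad b y z q" for q using dead[of z y q] zx y that by auto
  show ?thesis
  proof (cases b)
    case True
    have a: "ad b z x f" "ad b y z 1" "ad b y z (cst (f 0))" using True zx pf x by (auto simp: ad_def)
    have "E y x f v = E y z 1 (E z x f v)" using E_bracket[of x z y f 1 v] y zx a in0 by auto
    also have "\<dots> = E y z (cst (f 0) * 1) (E z x 1 v)"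
      using E_z_x[OF y(2) pf] a y by (simp add: E_vscale E_scale del: mult_1_right)
    finally show ?thesis using a by auto
  next
    case False
    have a: "ad b z x 1" "ad b y z f" using False zx f by (auto simp: ad_def pointwise)
    have "E y x f v = E y z f (E z x 1 v)" using E_bracket[of x z y 1 f v] y zx a in0 by auto
    then show ?thesis using a by auto
  qed
qed

lemma E_y_x:
  assumes y: "y \<noteq> x" "y \<noteq> 0" "polyfun f" shows "E y x f v = sc (f 0) (E y x 1 v)"
proof (cases "y - x \<in> G")
  case True
  obtain z where z: "z \<notin> F" "z \<notin> {y, x}" "z - x \<in> G" using fresh[of "{y, x}" x] by auto
  have zx: "z \<noteq> x" "z \<noteq> 0" using z nonzero by auto
  have a: "ad b z x p" "ad b y z p" if "polyfun p" for p using that zx y x by (auto simp: ad_def)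
  have in0: "E y z 1 v = 0" using dead[of z y 1] zx z a by auto
  have "E y x p v = E y z 1 (E z x p v)" if "polyfun p" for p
    using E_bracket[of x z y p 1 v] y z a that in0 by auto
  moreover have "E y z 1 (sc (f 0) (E z x 1 v)) = sc (f 0) (E y z 1 (E z x 1 v))"
    using z a by (intro E_vscale) auto
  ultimately show ?thesis using E_z_x[OF z(1) y(3)] y by simp
qed (use E_off in simp)

text \<open>For a vacuum site z this is \<open>bracket_v\<close>, the second term of which is dead.
  Every other z is reached through a vacuum site.\<close>

lemma E_x_z_x:
  assumes z: "z \<noteq> x" "z \<noteq> 0" "z - x \<in> G" and f: "polyfun f"
  shows "E x z f (E z x 1 v) = sc (f 0) v"
proof -
  have base: "E x z f (E z x 1 v) = sc (f 0) v" if z: "z \<notin> F" "z - x \<in> G" for z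
  proof -
    have zx: "z \<noteq> x" using z xF by auto
    then have "E x z f v = 0" using dead[of z x f] ad_x f z by auto
    then show ?thesis using bracket_v[OF z, of 1 f] f zx ad_x z by (auto simp: pointwise)
  qed
  obtain z1 where z1: "z1 \<notin> F" "z1 \<notin> {z, x}" "z1 - x \<in> G" using fresh[of "{z, x}" x] by auto
  have n: "z1 \<noteq> 0" using nonzero z1 by auto
  have a: "ad b p q h" if "p \<noteq> 0" "q \<noteq> 0" "polyfun h" for p q h using that by (auto simp: ad_def)
  have "E z z1 1 v = 0" using dead[of z1 z 1] z1 a n z by auto
  then have 1: "E z x 1 v = E z z1 1 (E z1 x 1 v)"
    using E_bracket[of x z1 z 1 1 v] z z1 n x a by auto
  have "E z1 z f v = 0" "E x z f v = 0"
    using dead[of z z1 f] dead[of z x f] a[of z1 z f] a[of x z f] z z1 n x f by auto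
  then have 2: "E x z f (E z1 x 1 v) = 0"
    using E_compose[of z x z1 f 1 v] z z1 a n x f by auto
  have "z - z1 \<in> G" using z z1 G_diff_trans G_diff_commute by blast
  then have "E x z f (E z z1 1 (E z1 x 1 v)) = E z z1 1 (E x z f (E z1 x 1 v)) + E x z1 f (E z1 x 1 v)"
    using E_compose[of z1 z x 1 f "E z1 x 1 v"] z z1 a n x f by auto
  then show ?thesis using 1 2 base[of z1] z1 z a[of z z1 1] n E_zero[of z z1 1] by auto
qed

text \<open>This would be the state with the particle at 0. A further move out of 0 multiplies two
  polynomials one of which vanishes at 0, so no move acts on it, and \<open>faithful\<close> makes
  it 0.\<close>

lemma E_0_x:
  assumes f: "ad b 0 x f" shows "E 0 x f v = 0"
proof (cases "- x \<in> G")
  case True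
  let ?u = "E 0 x f v"
  have pf: "polyfun f" using f by (simp add: ad_def)
  show ?thesis
  proof (rule faithful)
    fix y w g assume yw: "(y::'a^'n) \<noteq> w" "ad b y w g"
    then have pg: "polyfun g" by (simp add: ad_def)
    consider "w = x" | "w \<noteq> x" "w \<noteq> 0" "y = x" | "w \<noteq> x" "w \<noteq> 0" "y \<noteq> x" | "w = 0" "y \<noteq> x" | "w = 0" "y = x"
      by blast
    then show "E y w g ?u = 0"
    proof cases
      case 1
      then show ?thesis using double_out[of y 0 g f] yw f x by auto
    next
      case 2
      have "E 0 w (g * f) v = 0" using dead[of w 0 "g * f"] 2 pf pg f by (auto simp: ad_def pointwise)
      moreover have "E x w g v = 0" using dead[of w x g] 2 yw by auto
      ultimately show ?thesis using E_compose[of w x 0 g f v] 2 yw f x True by auto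
    next
      case 3
      have "E y w g ?u = E 0 x f (E y w g v)" using 3 yw f x by (intro E_commute) auto
      then show ?thesis using dead[of w y g] 3 yw f x by auto
    next
      case 4
      have "E y 0 g v = 0" using dead[of 0 y g] 4 yw x by auto
      moreover have "(f * g) 0 = 0" using f yw 4 by (auto simp: ad_def pointwise split: if_splits)
      then have "E y x (f * g) v = 0" using E_y_x[of y "f * g"] 4 yw pf pg by auto
      ultimately show ?thesis using E_compose[of x 0 y f g v] 4 yw f x True by auto
    next
      case 5
      obtain z where z: "z \<notin> F" "z \<notin> {0, x}" "z - x \<in> G" using fresh[of "{0, x}" x] by auto
      obtain q where q: "ad b 0 z q" "?u = E 0 z q (E z x 1 v)" "q = f \<or> q = cst (f 0)"
        using E_via_vacuum[of 0 z f] z x f by auto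
      have pq: "polyfun q" using q by (simp add: ad_def)
      have gx: "ad b x 0 g" using yw 5 by simp
      have "E z 0 g v = 0" "E x 0 g v = 0"
        using dead[of 0] z x gx pg by (auto simp: ad_def)
      then have 1: "E x 0 g (E z x 1 v) = 0"
        using E_compose[of 0 x z g 1 v] z x gx ad_x[of 1 z] True by auto
      have "E x z (q * g) (E z x 1 v) = sc ((q * g) 0) v" using z pq pg x by (intro E_x_z_x) auto
      moreover have "(q * g) 0 = 0" using f yw 5 q by (auto simp: ad_def pointwise split: if_splits)
      moreover have "E x 0 g (E 0 z q u) = E 0 z q (E x 0 g u) + E x z (q * g) u" for u
        using E_compose[of z 0 x q g u] z x gx q G_neg[OF True] by auto
      ultimately show ?thesis unfolding 5 q(2) using 1 q(1) z by auto
    qed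
  qed
qed (use E_off[of 0 x] in auto)

definition w :: "'a ^ 'n \<Rightarrow> 'v" where
  "w z = (if z = x then v else if z = 0 then 0 else E z x 1 v)"

lemma w_move:
  assumes y: "y \<noteq> z" "z - x \<in> G" "z \<noteq> 0" "ad b y z f"
  shows "E y z f (w z) = sc (f 0) (w y)"
proof -
  have pf: "polyfun f" using y by (simp add: ad_def)
  have yx: "E y x f v = sc (f 0) (w y)" if "y \<noteq> x" "ad b y x f"
    using that E_y_x[of y f] E_0_x[of f] pf x unfolding w_def by auto
  show ?thesis
  proof (cases "z = x")
    case True
    then show ?thesis using yx y by (simp add: w_def)
  next
    case False
    have a: "ad b z x 1" using y x by (auto simp: ad_def)
    show ?thesis
    proof (cases "y = x")
      case True
      then show ?thesis using E_x_z_x[of z f] False y pf by (simp add: w_def)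
    next
      case yne: False
      have "E y z f v = 0" using dead[of z y f] False y by auto
      moreover have "ad b y x f" using y x by (auto simp: ad_def split: if_splits)
      ultimately show ?thesis using E_compose[of x z y 1 f v] y False yne a yx by (auto simp: w_def)
    qed
  qed
qed

lemma w_dead:
  assumes "y \<noteq> z'" "z' \<noteq> z" "ad b y z' f"
  shows "E y z' f (w z) = 0"
proof (cases "z = x \<or> z = 0")
  case True
  then show ?thesis using dead[of z' y f] assms by (auto simp: w_def)
next
  case False
  have a: "ad b z x 1" using False x by (auto simp: ad_def)
  have "E y z' f (E z x 1 v) = 0"
  proof (cases "z' = x")
    case True
    then show ?thesis using double_out[of y z f 1] assms a False by auto
  next
    case zx: False
    have v0: "E y z' f v = 0" using dead[of z' y f] assms zx by auto
    show ?thesis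
    proof (cases "y = x")
      case True
      have "E z z' (f * 1) v = 0"
        using dead[of z' z f] assms zx True False by (auto simp: ad_def split: if_splits)
      then show ?thesis
        using E_compose[of z' x z f 1 v] assms zx True False a v0
        by (cases "z - x \<in> G") (auto simp: E_off)
    next
      case yx: False
      have "E y z' f (E z x 1 v) = E z x 1 (E y z' f v)"
        using assms zx yx a False by (intro E_commute) auto
      then show ?thesis using v0 a False by auto
    qed
  qed
  then show ?thesis using False by (simp add: w_def)
qed

lemma particle_exists: "\<exists>lam. particle sc G E H b x w lam"
proof -
  obtain c where c: "\<And>h. polyfun h \<Longrightarrow> h 0 = 0 \<Longrightarrow> H h v = sc (c h) v"
    using v(4) unfolding eig_def by metis
  have "H h (w z) = sc (h z + (c h - h x)) (w z)" if h: "polyfun h" "h 0 = 0" for h z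
  proof -
    consider "z = x" | "z = 0" "z \<noteq> x" | "z \<noteq> x" "z \<noteq> 0" by blast
    then show ?thesis
    proof cases
      case 1
      then show ?thesis using c[OF h] by (simp add: w_def)
    next
      case 2
      then show ?thesis using H_vadd[OF h, of 0 0] by (simp add: w_def)
    next
      case 3
      have a: "ad b z x 1" using 3 x by (auto simp: ad_def)
      obtain p where p: "polyfun p" "p 0 = h z - h x"
        "H h (E z x 1 v) = E z x 1 (H h v) + E z x (p * 1) v"
        using H_E[of z x h] 3 h a by blast
      have "H h (E z x 1 v) = sc (c h) (E z x 1 v) + sc (h z - h x) (E z x 1 v)"
        using p c[OF h] E_y_x[of z p] 3 a by (simp add: E_vscale)
      then show ?thesis using 3 by (simp add: w_def algebra_simps)
    qed
  qed
  moreover have "w z \<noteq> 0 \<longleftrightarrow> z - x \<in> G \<and> z \<noteq> 0" for z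
  proof -
    have "E z x 1 v \<noteq> 0" if "z \<noteq> x" "z \<noteq> 0" "z - x \<in> G"
      using E_x_z_x[OF that, of 1] v x that by (auto simp: pointwise ad_def)
    then show ?thesis using v x E_off[of z x] G_zero by (auto simp: w_def)
  qed
  ultimately show ?thesis unfolding particle_def using w_move w_dead x
    by (intro exI[of _ "\<lambda>h. c h - h x"]) blast
qed

end

context onevac
begin

text \<open>A particle at 0 is moved to z0. The result is again an eigenvector with a single vacuum,
  with core \<open>insert z0 F\<close>, and now z0 is an occupied nonzero site.\<close>

lemma alive_nonzero_site:
  assumes "z0 \<notin> F" "z0 \<noteq> x" "ad b z0 x g" "E z0 x g v \<noteq> 0"
  shows "\<exists>x w lam. particle sc G E H b x w lam"
proof (cases "x = 0")
  case False
  then interpret onevac_alive sc G Vg E H b F v a k x z0 g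
    using assms by unfold_locales auto
  show ?thesis using particle_exists by blast
next
  case True
  note alive = assms[unfolded True]
  have nz: "z0 \<noteq> 0" using alive by auto
  have zG: "z0 \<in> G" using E_off[of z0 0] alive by force
  let ?u = "E z0 0 g v"
  have pg: "polyfun g" using alive by (simp add: ad_def)
  obtain z where z: "z \<notin> F" "z \<notin> {0, z0}" "z - 0 \<in> G" using fresh[of "{0, z0}" 0] by auto
  \<comment> \<open>f is assigned to that factor of the bracket which \<open>ad b\<close> forces to
    vanish at 0, the other being 1; the coefficient \<open>f 0 * 1\<close> is then 0.\<close>
  have kill: "E z0 0 (f * g) v = 0" if f: "polyfun f" "f 0 = 0" for f
  proof (cases b)
    case True
    then have "ad b z 0 f" "ad b 0 z 1" using f z by (auto simp: ad_def)
    then show ?thesis using alive_bracket(2)[OF alive(1) _ alive(3,4), of z f 1 g] z alive nz f by auto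
  next
    case False
    then have "ad b z 0 1" "ad b 0 z f" using f z by (auto simp: ad_def)
    then show ?thesis using alive_bracket(2)[OF alive(1) _ alive(3,4), of z 1 f g] z alive nz f by auto
  qed
  have scal: "E z0 0 (p * g) v = sc (p 0) ?u" if p: "polyfun p" for p
  proof -
    have "E z0 0 ((p - cst (p 0)) * g) v = 0" using p by (intro kill) (auto simp: pointwise)
    moreover have "p * g = (p - cst (p 0)) * g + cst (p 0) * g"
      by (auto simp: fun_eq_iff pointwise algebra_simps)
    moreover have adm: "ad b z0 0 (q * g)" if "polyfun q" for q
      using alive(3) that by (simp add: ad_def times_fun_apply)
    have "ad b z0 0 ((p - cst (p 0)) * g)" "ad b z0 0 (cst (p 0) * g)"
      using adm[of "p - cst (p 0)"] adm[of "cst (p 0)"] p by blast+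
    ultimately have "E z0 0 (p * g) v = E z0 0 ((p - cst (p 0)) * g) v + E z0 0 (cst (p 0) * g) v"
      using E_add[of z0 0 "(p - cst (p 0)) * g" "cst (p 0) * g" v] nz by simp
    then show ?thesis using E_scale[OF nz alive(3), of "p 0" v] kill[of "p - cst (p 0)"] p by (simp add: pointwise)
  qed
  have E_u: "E y w f ?u = 0" if "y \<notin> F" "w \<notin> insert z0 F" "y \<noteq> w" "polyfun f" for y w f
  proof -
    have "ad b y w f" using that nonzero by (auto simp: ad_def)
    then have "E y w f ?u = E z0 0 g (E y w f v)" using that nonzero alive nz by (intro E_commute) auto
    then show ?thesis using vacuum[of w y f] that alive nz by auto
  qed
  have "vac ?u (- insert z0 F)" using E_u F0 unfolding vac_def by auto
  moreover have "?u \<in> Vg (a + (z0 - 0))" using alive v zG by (intro E_grade) auto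
  moreover have "eig ?u" unfolding eig_def
  proof (intro allI impI)
    fix h :: "'a ^ 'n \<Rightarrow> 'a" assume h: "polyfun h" "h 0 = 0"
    obtain c where c: "H h v = sc c v" using eigD v h by blast
    obtain p where p: "polyfun p" "H h ?u = E z0 0 g (H h v) + E z0 0 (p * g) v"
      using H_E[of z0 0 h] nz h alive by blast
    then have "H h ?u = sc (c + p 0) ?u" using c scal[OF p(1)] alive nz
      by (simp add: E_vscale scale_left_distrib)
    then show "\<exists>c. H h ?u = sc c ?u" by blast
  qed
  ultimately interpret U: onevac sc G Vg E H b "insert z0 F" ?u "a + z0" k
    using finF v k faithful zG G_add[of a z0] alive
    by unfold_locales auto
  \<comment> \<open>Continuing from z0 to z amounts to moving from 0 to z directly, and moving back
    to z0 recovers \<open>?u\<close>. So z0 is occupied in \<open>?u\<close>.\<close>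
  have "E z z0 1 ?u = E z0 0 g (E z z0 1 v) + E z 0 (g * 1) v"
  proof (rule E_compose)
    show "ad b z z0 1" using z nz by (auto simp: ad_def)
  qed (use alive z nz zG in auto)
  also have "E z z0 1 v = 0" using vacuum z alive by auto
  finally have 1: "E z z0 1 ?u = E z 0 g v" using alive nz by simp
  have ag: "ad b z 0 g" using alive z nz by (auto simp: ad_def)
  have "E z0 z 1 (E z 0 g v) = E z 0 g (E z0 z 1 v) + E z0 0 (g * 1) v"
  proof (rule E_compose)
    show "ad b z0 z 1" using z nz by (auto simp: ad_def)
  qed (use alive z nz ag in auto)
  also have "E z0 z 1 v = 0" using vacuum z alive by auto
  finally have "E z0 z 1 (E z 0 g v) = ?u" using ag z by simp
  then have "E z 0 g v \<noteq> 0" using alive z nz E_zero[of z0 z 1] by (auto simp: ad_def)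
  then interpret onevac_alive sc G Vg E H b "insert z0 F" ?u "a + z0" k z0 z 1
    using 1 z nz by unfold_locales (auto simp: ad_def)
  show ?thesis using particle_exists by blast
qed

text \<open>Some move from x to y acts on v, and it factors through a vacuum site z. Either a
  particle goes from x to the vacuum or, in the dual picture, a hole goes from y to the
  vacuum.\<close>

theorem one_particle:
  "(\<exists>x w lam. particle sc G E H b x w lam) \<or>
   (\<exists>x w lam. particle sc G (\<lambda>y x f u. - E (- x) (- y) (refl f) u) (\<lambda>h u. - H (refl h) u) (\<not> b) x w lam)"
proof -
  interpret D: onevac sc G Vg "\<lambda>y x f u. - E (- x) (- y) (refl f) u" "\<lambda>h u. - H (refl h) u" "\<not> b" "uminus ` F" v a k
    by (rule dual_onevac)
  obtain y x f where f: "y \<noteq> x" "ad b y x f" "E y x f v \<noteq> 0" using faithful[of v] v by blast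
  obtain z where z: "z \<notin> F" "z \<notin> {y, x}" "z - x \<in> G" using fresh[of "{y, x}" x] by auto
  obtain p q where pq: "ad b z x p" "ad b y z q" "\<And>u. E y x f u = E y z q (E z x p u) - E z x p (E y z q u)"
    using E_via[of y x z f] z f nonzero[of z] by auto
  have "E z x p v \<noteq> 0 \<or> E y z q v \<noteq> 0" using pq(3)[of v] f pq z by auto
  then show ?thesis
  proof
    assume "E z x p v \<noteq> 0"
    then show ?thesis using alive_nonzero_site[of z x p] z pq by auto
  next
    assume "E y z q v \<noteq> 0"
    then show ?thesis using D.alive_nonzero_site[of "- z" "- y" "refl q"] z pq by (auto simp: ad_dual)
  qed
qed

end

subsection \<open>Common eigenvectors of commuting operators\<close>

definition poly_act :: "('a::comm_semiring_1 \<Rightarrow> 'b \<Rightarrow> 'b) \<Rightarrow> ('b \<Rightarrow> 'b) \<Rightarrow> 'b \<Rightarrow> 'a poly \<Rightarrow> 'b::comm_monoid_add" where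
  "poly_act sc T u p = (\<Sum>i\<le>degree p. sc (coeff p i) ((T ^^ i) u))"

context vector_space
begin

lemma sequence_in_span_of_predecessors:
  assumes "finite S" and w: "\<And>i::nat. w i \<in> span S"
  shows "\<exists>n. w n \<in> span (w ` {..<n})"
proof (rule ccontr)
  assume "\<not> ?thesis"
  then have n: "w n \<notin> span (w ` {..<n})" for n by simp
  have ind: "independent (w ` {..<n}) \<and> card (w ` {..<n}) = n" for n
  proof (induction n)
    case 0
    then show ?case by (simp add: independent_empty)
  next
    case (Suc m)
    then have "w m \<notin> w ` {..<m}" using span_base[of "w m" "w ` {..<m}"] n[of m] by blast
    then show ?case using Suc n[of m] by (simp add: lessThan_Suc independent_insert)
  qed
  have "w ` {..<Suc (card S)} \<subseteq> span S" using w by auto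
  then have "card (w ` {..<Suc (card S)}) \<le> card S"
    using independent_span_bound[OF assms(1)] ind by blast
  then show False using ind[of "Suc (card S)"] by simp
qed

lemma poly_act_bound: "degree p \<le> n \<Longrightarrow> poly_act scale T u p = (\<Sum>i\<le>n. scale (coeff p i) ((T ^^ i) u))"
  unfolding poly_act_def by (rule sum.mono_neutral_left) (auto simp: coeff_eq_0)

lemma poly_act_add: "poly_act scale T u (p + q) = poly_act scale T u p + poly_act scale T u q"
proof -
  let ?n = "max (degree p) (degree q)"
  have "degree (p + q) \<le> ?n" by (rule degree_add_le) auto
  then show ?thesis
    using poly_act_bound[of "p + q" ?n T u] poly_act_bound[of p ?n T u] poly_act_bound[of q ?n T u]
    by (simp add: scale_left_distrib sum.distrib)
qed

lemma poly_act_smult: "poly_act scale T u (smult c p) = scale c (poly_act scale T u p)"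
  using poly_act_bound[of "smult c p" "degree p" T u] poly_act_bound[of p "degree p" T u] degree_smult_le[of c p]
  by (simp add: scale_sum_right)

lemma poly_act_pCons_0:
  assumes "Vector_Spaces.linear scale scale T"
  shows "poly_act scale T u (pCons 0 p) = T (poly_act scale T u p)"
proof -
  have T: "T (x + y) = T x + T y" "T (scale c x) = scale c (T x)" for x y c
    using assms unfolding Vector_Spaces.linear_iff by auto
  have T0: "T 0 = 0" using T(2)[of 0 0] by (simp only: scale_zero_left)
  have Ts: "T (\<Sum>i\<in>A. g i) = (\<Sum>i\<in>A. T (g i))" for g and A :: "nat set"
    by (induction A rule: infinite_finite_induct) (auto simp: T T0)
  have "poly_act scale T u (pCons 0 p) = (\<Sum>i\<le>Suc (degree p). scale (coeff (pCons 0 p) i) ((T ^^ i) u))"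
    by (rule poly_act_bound) (rule degree_pCons_le)
  also have "\<dots> = (\<Sum>i\<le>degree p. scale (coeff p i) ((T ^^ Suc i) u))"
    by (subst sum.atMost_Suc_shift) (simp add: coeff_pCons)
  finally show ?thesis by (simp add: poly_act_def Ts T)
qed

text \<open>Univariate polynomials have infinite dimension. This produces annihilating polynomials
  of vectors here and the univariate members of annihilator ideals later.\<close>

lemma poly_kernel:
  assumes S: "finite S" "\<And>p. L p \<in> span S"
    and L: "\<And>p q. L (p + q) = L p + L q" "\<And>c p. L (smult c p) = scale c (L p)"
  shows "\<exists>p :: 'a poly. p \<noteq> 0 \<and> L p = 0"
proof -
  obtain n where n: "L (monom 1 n) \<in> span ((\<lambda>i. L (monom 1 i)) ` {..<n})"
    using sequence_in_span_of_predecessors[OF S(1), of "\<lambda>i. L (monom 1 i)"] S(2) by blast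
  have L0: "L 0 = 0" using L(2)[of 0 0] by simp
  have "\<exists>q. (\<forall>i\<ge>n. coeff q i = 0) \<and> y = L q" if "y \<in> span ((\<lambda>i. L (monom 1 i)) ` {..<n})" for y
    using that
  proof (induction rule: span_induct_alt)
    case base
    show ?case by (rule exI[of _ 0]) (simp add: L0)
  next
    case (step c x y)
    then obtain i q where "i < n" "x = L (monom 1 i)" "\<forall>i\<ge>n. coeff q i = 0" "y = L q" by auto
    then show ?case
      by (intro exI[of _ "smult c (monom 1 i) + q"]) (auto simp: L)
  qed
  then obtain q where q: "\<forall>i\<ge>n. coeff q i = 0" "L (monom 1 n) = L q" using n by blast
  have "coeff (monom 1 n + smult (-1) q) n = 1" using q(1) by simp
  then have "monom 1 n + smult (-1) q \<noteq> 0" by (metis coeff_0 zero_neq_one)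
  moreover have "L (monom 1 n + smult (-1) q) = 0" unfolding L q(2) by (simp add: scale_minus_left)
  ultimately show ?thesis by blast
qed

end

text \<open>c is a root of an annihilating polynomial of u of least degree, and the eigenvector is
  the cofactor applied to u.\<close>

lemma eigenvalue_exists:
  fixes sc :: "'a::alg_closed_field \<Rightarrow> 'v::ab_group_add \<Rightarrow> 'v"
  assumes "vector_space sc" "finite S" "module.subspace sc U" "U \<subseteq> module.span sc S" "u \<in> U" "u \<noteq> 0"
    and T: "Vector_Spaces.linear sc sc T" "\<And>x. x \<in> U \<Longrightarrow> T x \<in> U"
  shows "\<exists>c x. x \<in> U \<and> x \<noteq> 0 \<and> T x = sc c x"
proof -
  interpret vector_space sc by fact
  have it: "(T ^^ i) u \<in> U" for i by (induction i) (use assms(5) T(2) in auto)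
  have pU: "poly_act sc T u p \<in> U" for p unfolding poly_act_def
    using it assms(3) by (intro subspace_sum subspace_scale) auto
  have pS: "poly_act sc T u p \<in> span S" for p using pU[of p] assms(4) by (rule rev_subsetD)
  note ann = poly_kernel[OF assms(2) pS poly_act_add poly_act_smult]
  define P where "P n \<longleftrightarrow> (\<exists>p. degree p = n \<and> p \<noteq> 0 \<and> poly_act sc T u p = 0)" for n
  have "\<exists>n. P n" using ann unfolding P_def by simp
  then have "P (Least P)" by (rule LeastI_ex)
  then obtain p where p: "degree p = Least P" "p \<noteq> 0" "poly_act sc T u p = 0" unfolding P_def by blast
  have min: "poly_act sc T u q \<noteq> 0" if "degree q < degree p" "q \<noteq> 0" for q
    using not_less_Least[of "degree q" P] that p(1) unfolding P_def by auto
  have "degree p \<noteq> 0"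
  proof
    assume "degree p = 0"
    then obtain c where "p = [:c:]" using degree_eq_zeroE by blast
    then show False using p assms(6) by (simp add: poly_act_def)
  qed
  then obtain c where "poly p c = 0" using alg_closed_imp_poly_has_root[of p] by auto
  then have "[:-c, 1:] dvd p" by (simp only: poly_eq_0_iff_dvd)
  then obtain q where q: "p = [:-c, 1:] * q" by (elim dvdE)
  then have q0: "q \<noteq> 0" using p by auto
  then have "degree p = Suc (degree q)" unfolding q by (subst degree_mult_eq) auto
  then have nz: "poly_act sc T u q \<noteq> 0" using min q0 by simp
  have "p = smult (- c) q + pCons 0 q" unfolding q by simp
  then have "sc (- c) (poly_act sc T u q) + T (poly_act sc T u q) = 0"
    using p by (simp only: poly_act_add poly_act_smult poly_act_pCons_0[OF T(1)])
  then have "T (poly_act sc T u q) = sc c (poly_act sc T u q)" by (simp add: scale_minus_left)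
  moreover have "poly_act sc T u q \<in> U" by (rule pU)
  ultimately show ?thesis using nz by blast
qed

text \<open>Induction on the dimension: an operator that is not scalar on U has a proper nonzero
  eigenspace, which the others preserve because they commute with it. The family may be
  infinite.\<close>

lemma common_eigenvector:
  fixes sc :: "'a::alg_closed_field \<Rightarrow> 'v::ab_group_add \<Rightarrow> 'v"
  assumes vs: "vector_space sc" and "finite S" "module.subspace sc U" "U \<subseteq> module.span sc S" "\<exists>u\<in>U. u \<noteq> 0"
    and T: "\<And>i. i \<in> I \<Longrightarrow> Vector_Spaces.linear sc sc (T i)" "\<And>i x. i \<in> I \<Longrightarrow> x \<in> U \<Longrightarrow> T i x \<in> U"
      "\<And>i j x. i \<in> I \<Longrightarrow> j \<in> I \<Longrightarrow> x \<in> U \<Longrightarrow> T i (T j x) = T j (T i x)"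
  shows "\<exists>v\<in>U. v \<noteq> 0 \<and> (\<forall>i\<in>I. \<exists>c. T i v = sc c v)"
proof -
  interpret vector_space sc by fact
  have *: "\<exists>v\<in>U. v \<noteq> 0 \<and> (\<forall>i\<in>I. \<exists>c. T i v = sc c v)"
    if "subspace U" "U \<subseteq> span S" "\<exists>u\<in>U. u \<noteq> 0" "dim U = n" "\<And>i x. i \<in> I \<Longrightarrow> x \<in> U \<Longrightarrow> T i x \<in> U"
      "\<And>i j x. i \<in> I \<Longrightarrow> j \<in> I \<Longrightarrow> x \<in> U \<Longrightarrow> T i (T j x) = T j (T i x)" for U n
    using that
  proof (induction n arbitrary: U rule: less_induct)
    case (less n)
    show ?case
    proof (cases "\<forall>i\<in>I. \<exists>c. \<forall>x\<in>U. T i x = sc c x")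
      case True
      then show ?thesis using less.prems(3) by blast
    next
      case False
      then obtain i where i: "i \<in> I" and nc: "\<And>c. \<exists>x\<in>U. T i x \<noteq> sc c x" by blast
      obtain c x where x: "x \<in> U" "x \<noteq> 0" "T i x = sc c x"
        using eigenvalue_exists[OF vs assms(2) less.prems(1,2) _ _ T(1)[OF i]] less.prems i by blast
      define U' where "U' = {x\<in>U. T i x = sc c x}"
      have lin: "T j (x + y) = T j x + T j y" "T j (sc a x) = sc a (T j x)" if "j \<in> I" for j x y a
        using T(1)[OF that] unfolding Vector_Spaces.linear_iff by auto
      have T0: "T i 0 = 0" using lin(2)[OF i, of 0 0] by (simp only: scale_zero_left)
      have sub: "subspace U'" unfolding subspace_def U'_def
        using less.prems(1) by (auto simp: subspace_def lin i T0 scale_right_distrib scale_left_commute)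
      have UU: "U' \<subseteq> U" "U' \<noteq> U" using nc[of c] by (auto simp: U'_def)
      obtain B' where B': "B' \<subseteq> U'" "independent B'" "U' \<subseteq> span B'" "card B' = dim U'"
        using basis_exists[of U'] by metis
      have fB: "finite B'" using independent_span_bound[OF assms(2), of B'] B' UU less.prems(2) by blast
      obtain y where y: "y \<in> U" "y \<notin> U'" using UU by blast
      have "span B' \<subseteq> U'" using span_minimal[OF B'(1) sub] .
      then have ind: "independent (insert y B')" using B' y by (auto simp: independent_insert)
      obtain B where B: "B \<subseteq> U" "independent B" "U \<subseteq> span B" "card B = dim U"
        using basis_exists[of U] by metis
      have fB2: "finite B" using independent_span_bound[OF assms(2), of B] B less.prems(2) by blast
      have "card (insert y B') \<le> card B"
        using independent_span_bound[OF fB2 ind] B B' UU y by blast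
      moreover have "y \<notin> B'" using B' y by blast
      ultimately have "dim U' < dim U" using B B' fB by simp
      moreover have "T j x \<in> U'" if "j \<in> I" "x \<in> U'" for j x
      proof -
        have "T i (T j x) = T j (T i x)" using less.prems(6) i that UU by blast
        then show ?thesis using less.prems(5) that by (auto simp: U'_def lin)
      qed
      moreover have "\<exists>u\<in>U'. u \<noteq> 0" using x by (auto simp: U'_def)
      moreover have "U' \<subseteq> span S" using UU less.prems(2) by blast
      moreover have "T i (T j x) = T j (T i x)" if "i \<in> I" "j \<in> I" "x \<in> U'" for i j x
        using less.prems(6) that UU by blast
      ultimately have "\<exists>v\<in>U'. v \<noteq> 0 \<and> (\<forall>i\<in>I. \<exists>c. T i v = sc c v)"
        using less.IH[of "dim U'" U'] less.prems(4) sub by blast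
      then show ?thesis using UU by blast
    qed
  qed
  show ?thesis using *[OF assms(3,4,5) refl T(2,3)] by blast
qed

context glsys
begin

lemma eig_exists:
  assumes "a \<in> G" "subspace U" "U \<subseteq> Vg a" "\<exists>u\<in>U. u \<noteq> 0"
    "\<And>h u. polyfun h \<Longrightarrow> h 0 = 0 \<Longrightarrow> u \<in> U \<Longrightarrow> H h u \<in> U"
  shows "\<exists>v\<in>U. v \<noteq> 0 \<and> eig v"
proof -
  obtain S where S: "finite S" "Vg a \<subseteq> span S" using Vg_fin_dim[OF assms(1)] by (auto simp: fin_dim_def)
  have "\<exists>v\<in>U. v \<noteq> 0 \<and> (\<forall>h\<in>{h. polyfun h \<and> h 0 = 0}. \<exists>c. H h v = sc c v)"
    using S assms by (intro common_eigenvector[OF vector_space_axioms S(1)]) (auto intro: H_linear H_commute)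
  then show ?thesis by (auto simp: eig_def)
qed

subsection \<open>Vectors killed by all large raising operators\<close>

definition killed :: "'a ^ 'n \<Rightarrow> nat \<Rightarrow> 'v \<Rightarrow> bool" where
  "killed k K u \<longleftrightarrow> (\<forall>m x f. m > K \<longrightarrow> ad b (x + of_nat m *s k) x f \<longrightarrow> E (x + of_nat m *s k) x f u = 0)"

lemma killedD: "killed k K u \<Longrightarrow> m > K \<Longrightarrow> ad b y x f \<Longrightarrow> y = x + of_nat m *s k \<Longrightarrow> E y x f u = 0"
  by (auto simp: killed_def)

lemma multiple_nonzero: "(k :: 'a ^ 'n) \<noteq> 0 \<Longrightarrow> m > 0 \<Longrightarrow> (of_nat m :: 'a) *s k \<noteq> 0"
  by (auto simp: vec_eq_iff)

lemma ad_compose: "ad b y x f \<Longrightarrow> ad b z y g \<Longrightarrow> ad b z x (f * g)"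
  by (auto simp: ad_def pointwise)

lemma killed_H:
  assumes "killed k K u" "polyfun h" "h 0 = 0" "k \<noteq> 0" shows "killed k K (H h u)"
  unfolding killed_def
proof (intro allI impI)
  fix m x f assume *: "m > K" "ad b (x + of_nat m *s k) x f"
  have ne: "x + of_nat m *s k \<noteq> x" using multiple_nonzero[OF assms(4), of m] * by simp
  obtain p where p: "polyfun p" "H h (E (x + of_nat m *s k) x f u)
      = E (x + of_nat m *s k) x f (H h u) + E (x + of_nat m *s k) x (p * f) u"
    using H_E[OF ne assms(2,3)] * by blast
  have "ad b (x + of_nat m *s k) x (p * f)" using p * by (auto simp: ad_def pointwise)
  then have "E (x + of_nat m *s k) x (p * f) u = 0" "E (x + of_nat m *s k) x f u = 0"
    using killedD[OF assms(1) *(1)] * by auto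
  then show "E (x + of_nat m *s k) x f (H h u) = 0"
    using p H_vscale[OF assms(2,3), of 0 0] by simp
qed

text \<open>Where the bracket is not zero outright, it is a local operator of degree
  \<open>m + n\<close> times k, beyond the bound K.\<close>

lemma killed_compose_commute:
  assumes kill: "killed k K u" and k: "k \<noteq> 0" and m: "m > 0" "n > 0" "m + n > K"
    and y: "y = x + of_nat m *s k" "y' = x' + of_nat n *s k" and f: "ad b y x f" "ad b y' x' g"
  shows "E y x f (E y' x' g u) = E y' x' g (E y x f u)"
proof -
  have ne: "y \<noteq> x" "y' \<noteq> x'" using multiple_nonzero[OF k] m y by auto
  have mn: "(of_nat (m + n) :: 'a) *s k \<noteq> 0" by (rule multiple_nonzero[OF k]) (use m in simp)
  consider "y \<noteq> x'" "x \<noteq> y'" | "y = x'" "x \<noteq> y'" | "x = y'" "y \<noteq> x'" | "y = x'" "x = y'" by blast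
  then show ?thesis
  proof cases
    case 1
    then show ?thesis using ne f by (intro E_commute) auto
  next
    case 2
    have yx: "y' = x + of_nat (m + n) *s k" using 2 y by (simp add: vector_sadd_rdistrib add.assoc)
    have "E y' x (f * g) u = 0" using killedD[OF kill m(3) _ yx] f 2 ad_compose by blast
    then show ?thesis using E_compose[of x y y' f g u] 2 ne f yx mn
      by (cases "y - x \<in> G") (auto simp: E_off)
  next
    case 3
    have yx: "y = x' + of_nat (m + n) *s k" using 3 y by (simp add: vector_sadd_rdistrib add_ac)
    have "E y x' (g * f) u = 0" using killedD[OF kill m(3) _ yx] f 3 ad_compose by blast
    then show ?thesis using E_compose[of x' y' y g f u] 3 ne f yx mn
      by (cases "y' - x' \<in> G") (auto simp: E_off)
  next
    case 4
    then have "of_nat (m + n) *s k = 0" using y by (simp add: vector_sadd_rdistrib add.commute)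
    then show ?thesis using mn by simp
  qed
qed

lemma killed_E:
  assumes kill: "killed k K u" and k: "k \<noteq> 0" and n: "n > 0" and y: "y = x + of_nat n *s k" "ad b y x f"
  shows "killed k K (E y x f u)"
  unfolding killed_def
proof (intro allI impI)
  fix m x' g assume *: "m > K" "ad b (x' + of_nat m *s k) x' g"
  have ne: "y \<noteq> x" using multiple_nonzero[OF k n] y by auto
  have "E (x' + of_nat m *s k) x' g (E y x f u) = E y x f (E (x' + of_nat m *s k) x' g u)"
    by (rule killed_compose_commute[OF kill k _ n _ refl y(1)]) (use * y in auto)
  then show "E (x' + of_nat m *s k) x' g (E y x f u) = 0"
    using killedD[OF kill *(1)] * ne y by auto
qed

text \<open>The bracket of \<open>E z y 1\<close> and \<open>E y z 1\<close> counts, up to a constant depending on z, the particles at y.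
  If a power of \<open>E y x f\<close> never killed u, then taking z far away would give infinitely many linearly independent
  vectors \<open>E y z 1 (w n)\<close> of the same degree.\<close>

lemma raising_nilpotent_aux:
  assumes kill: "killed k K u" and k: "k \<in> G" "k \<noteq> 0" and K: "K \<ge> 1" and u: "eig u" "u \<in> Vg a" "a \<in> G"
    and y: "y = x + of_nat K *s k" "y \<noteq> 0" and f: "ad b y x f"
  shows "\<exists>n. (E y x f ^^ n) u = 0"
proof (rule ccontr)
  assume nonil: "\<not> ?thesis"
  define w where "w n = (E y x f ^^ n) u" for n
  have wnz: "w n \<noteq> 0" for n using nonil by (auto simp: w_def)
  have wS: "w (Suc n) = E y x f (w n)" "w 0 = u" for n by (auto simp: w_def)
  have kG: "of_nat i *s k \<in> G" for i by (rule add_subgroup_multiples[OF G k(1)])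
  have yx: "y \<noteq> x" "y - x \<in> G" using multiple_nonzero[OF k(2)] K y kG by auto
  have wk: "killed k K (w n)" for n
    by (induction n) (use kill killed_E[OF _ k(2) _ y(1) f] K in \<open>auto simp: wS\<close>)
  have wg: "w n \<in> Vg (a + of_nat (K * n) *s k)" for n
  proof (induction n)
    case (Suc n)
    have "w (Suc n) \<in> Vg (a + of_nat (K * n) *s k + (y - x))"
      unfolding wS using E_grade[OF yx(1) f yx(2) _ Suc] u kG G_add by blast
    then show ?case by (simp add: y algebra_simps vector_sadd_rdistrib)
  qed (use u wS in simp)
  define z where "z m = y + of_nat m *s k" for m :: nat
  obtain M where M: "\<And>m. m \<ge> M \<Longrightarrow> z m \<noteq> 0"
    using multiples_avoid_finite[OF k(2), of "{0}" y] by (auto simp: z_def)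
  define L where "L = M + K + 1"
  have zne: "z m \<noteq> y" "z m \<noteq> x" "z m \<noteq> 0" if "m \<ge> L" for m
  proof -
    show "z m \<noteq> y" using multiple_nonzero[OF k(2), of m] that by (auto simp: z_def L_def)
    show "z m \<noteq> 0" using M that by (simp add: L_def)
    have "z m = x + of_nat (m + K) *s k" by (simp add: z_def y vector_sadd_rdistrib add_ac)
    then show "z m \<noteq> x" using multiple_nonzero[OF k(2), of "m + K"] K by auto
  qed
  have zG: "z m - y \<in> G" "y - z m \<in> G" for m using kG G_neg by (auto simp: z_def)
  have o: "ad b (z m) y 1" "ad b y (z m) 1" "ad b (z m) x f" if "m \<ge> L" for m
    using zne[OF that] y(2) f by (auto simp: ad_def split: if_splits)
  have A0: "E (z m) y 1 (w n) = 0" if "m \<ge> L" for m n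
    using killedD[OF wk _ o(1)[OF that], of m n] that by (simp add: z_def L_def)
  define D where "D m u = E (z m) y 1 (E y (z m) 1 u) - E y (z m) 1 (E (z m) y 1 u)" for m u
  have "\<exists>c. D m u = sc c u" if "m \<ge> L" for m
    unfolding D_def using E_E_eig[OF u] zne[OF that] zG o that by blast
  then obtain c where c: "\<And>m. m \<ge> L \<Longrightarrow> D m u = sc (c m) u" by metis
  \<comment> \<open>D is the occupation of \<open>z m\<close> minus that of y up to a constant, and
    \<open>E y x f\<close> adds one particle at y.\<close>
  have DE: "D m (E y x f v) = E y x f (D m v) - E y x f v" if m: "m \<ge> L" for m v
  proof -
    note n = zne[OF m] and o = o[OF m]
    have 1: "E y (z m) 1 (E y x f v) = E y x f (E y (z m) 1 v)" for v
      using n yx o f by (intro E_commute) auto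
    have 2: "E (z m) y 1 (E y x f v) = E y x f (E (z m) y 1 v) + E (z m) x f v" for v
      using E_compose[of x y "z m" f 1 v] n yx o f by auto
    have 3: "E y (z m) 1 (E (z m) x f v) = E (z m) x f (E y (z m) 1 v) + E y x f v" for v
      using E_compose[of x "z m" y f 1 v] n yx o f zG by auto
    show ?thesis unfolding D_def 1 2 using yx n o f by (simp add: E_vadd E_vminus 1 3)
  qed
  have Dw: "D m (w n) = sc (c m - of_nat n) (w n)" if m: "m \<ge> L" for m n
  proof (induction n)
    case (Suc n)
    have "D m (w (Suc n)) = sc (c m - of_nat n) (w (Suc n)) - w (Suc n)"
      unfolding wS DE[OF m] Suc using yx f by (simp add: E_vscale)
    also have "\<dots> = sc (c m - of_nat n) (w (Suc n)) - sc 1 (w (Suc n))" by simp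
    also have "\<dots> = sc (c m - of_nat (Suc n)) (w (Suc n))"
      by (simp only: scale_left_diff_distrib[symmetric]) (simp add: algebra_simps)
    finally show ?case .
  qed (use c m in \<open>simp add: wS\<close>)
  have AB: "E (z m) y 1 (E y (z m) 1 (w n)) = sc (c m - of_nat n) (w n)" if "m \<ge> L" for m n
    using Dw[OF that, of n] A0[OF that] o[OF that] zne[OF that] by (simp add: D_def)
  \<comment> \<open>For \<open>m = K n - d\<close> the vectors \<open>E y (z m) 1 (w n)\<close> all
    have degree \<open>a + d k\<close>. They are nonzero whenever \<open>c m \<noteq> n\<close>, so
    this happens for finitely many n only.\<close>
  have fin: "finite {n. K * n - d \<ge> L \<and> c (K * n - d) \<noteq> of_nat n}" if d: "d \<le> K" for d
  proof (rule ccontr)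
    define N where "N = {n. K * n - d \<ge> L \<and> c (K * n - d) \<noteq> of_nat n}"
    assume "infinite {n. K * n - d \<ge> L \<and> c (K * n - d) \<noteq> of_nat n}"
    then have inf: "infinite N" by (simp add: N_def)
    define n where "n i = enumerate N (2 * i)" for i
    have nN: "K * n i - d \<ge> L" "c (K * n i - d) \<noteq> of_nat (n i)" for i
      using enumerate_in_set[OF inf, of "2 * i"] by (auto simp: n_def N_def)
    have gap: "n i \<ge> n j + 2" if "j < i" for i j
    proof -
      have "enumerate N (2 * j) < enumerate N (2 * j + 1)" "enumerate N (2 * j + 1) < enumerate N (2 * i)"
        using that enumerate_mono[OF _ inf] by auto
      then show ?thesis by (simp add: n_def)
    qed
    define m where "m i = K * n i - d" for i
    have mL: "m i \<ge> L" for i using nN by (simp add: m_def)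
    have md: "m i + d = K * n i" for i using nN(1)[of i] by (simp add: m_def L_def)
    define v where "v i = E y (z (m i)) 1 (w (n i))" for i
    have "v i \<in> Vg (a + of_nat d *s k)" for i
    proof -
      have "v i \<in> Vg (a + of_nat (K * n i) *s k + (y - z (m i)))"
        unfolding v_def
      proof (rule E_grade)
        show "a + of_nat (K * n i) *s k \<in> G" using u kG G_add by blast
      qed (use o[OF mL] zne[OF mL, of i] zG wg in \<open>auto simp del: of_nat_mult\<close>)
      then show ?thesis unfolding md[symmetric] z_def by (simp add: vector_sadd_rdistrib algebra_simps)
    qed
    moreover obtain B where B: "finite B" "Vg (a + of_nat d *s k) \<subseteq> span B"
      using Vg_fin_dim[of "a + of_nat d *s k"] u kG G_add by (auto simp: fin_dim_def)
    moreover have "Vector_Spaces.linear sc sc (E (z (m i)) y 1)" for i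
      using zne[OF mL, of i] o[OF mL] by (intro E_linear) auto
    moreover have "E (z (m i)) y 1 (v j) = 0" if ji: "j < i" for i j
    proof -
      have "K * n j + 2 * K \<le> K * n i" using gap[OF ji] mult_le_mono2[of "n j + 2" "n i" K] by (simp add: algebra_simps)
      then have "m j + 2 * K \<le> m i" using md[of i] md[of j] by linarith
      then have gt: "m i - m j > K" "m j \<le> m i" using K by auto
      have zz: "z (m i) = z (m j) + of_nat (m i - m j) *s k"
        using gt(2) by (simp add: z_def of_nat_diff vector_sub_rdistrib)
      then have ne: "z (m i) \<noteq> z (m j)" using multiple_nonzero[OF k(2), of "m i - m j"] gt by auto
      have a: "ad b (z (m i)) (z (m j)) 1" using zne[OF mL] by (auto simp: ad_def)
      have "E (z (m i)) (z (m j)) 1 (w (n j)) = 0" by (rule killedD[OF wk gt(1) a zz])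
      then show ?thesis unfolding v_def
        using E_compose[of "z (m j)" y "z (m i)" 1 1 "w (n j)"] A0[OF mL] o[OF mL] zne[OF mL] zG ne
        by (metis E_zero add.right_neutral mult_1)
    qed
    ultimately obtain i where "E (z (m i)) y 1 (v i) = 0"
      using triangular_family_degenerate[of B v "\<lambda>i. E (z (m i)) y 1"] by blast
    then show False using AB[OF mL, of i "n i"] nN(2)[of i] wnz[of "n i"] by (simp add: v_def m_def)
  qed
  \<comment> \<open>The two values of d contradict each other: for large n, d = 0 gives
    \<open>c (K n) = n\<close>, while d = K, applied to n + 1, gives
    \<open>c (K n) = n + 1\<close>.\<close>
  have "finite ({n. K * n - 0 \<ge> L \<and> c (K * n - 0) \<noteq> of_nat n} \<union> {n. K * n - K \<ge> L \<and> c (K * n - K) \<noteq> of_nat n})"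
    using fin[of 0] fin[of K] by simp
  from finite_nat_bounded[OF this] obtain n0 where n0: "\<And>n. n \<in> {n. K * n - 0 \<ge> L \<and> c (K * n - 0) \<noteq> of_nat n} \<union>
      {n. K * n - K \<ge> L \<and> c (K * n - K) \<noteq> of_nat n} \<Longrightarrow> n < n0"
    by blast
  define n where "n = n0 + L"
  have nL: "K * n \<ge> L" using K mult_le_mono[of 1 K L n] by (simp add: n_def)
  have "c (K * n) = of_nat n" using n0[of n] nL by (force simp: n_def)
  moreover have "c (K * Suc n - K) = of_nat (Suc n)" using n0[of "Suc n"] nL by (force simp: n_def)
  moreover have "K * Suc n - K = K * n" by simp
  ultimately have "(of_nat n :: 'a) = of_nat (Suc n)" by metis
  then show False by (simp only: of_nat_eq_iff)
qed

end

lemma (in glsys) eig_dual: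
  assumes "eig v" shows "glsys.eig sc (\<lambda>h u. - H (refl h) u) v"
proof -
  interpret D: glsys sc G Vg "\<lambda>y x f u. - E (- x) (- y) (refl f) u" "\<lambda>h u. - H (refl h) u" "\<not> b"
    by (rule dual)
  have "\<exists>c. - H (refl h) v = sc c v" if "polyfun h" "h 0 = 0" for h
    using eigD[OF assms, of "refl h"] that by (auto simp flip: scale_minus_left)
  then show ?thesis unfolding D.eig_def by blast
qed

context glsys
begin

text \<open>For \<open>y = 0\<close> one of the moves between y and z by the constant 1 is not
  admissible. In the dual system the target is \<open>- x\<close>, which is then nonzero.\<close>

lemma raising_nilpotent:
  assumes kill: "killed k K u" and k: "k \<in> G" "k \<noteq> 0" and K: "K \<ge> 1" and u: "eig u" "u \<in> Vg a" "a \<in> G"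
    and y: "y = x + of_nat K *s k" and f: "ad b y x f"
  shows "\<exists>n. (E y x f ^^ n) u = 0"
proof (cases "y = 0")
  case False
  then show ?thesis using raising_nilpotent_aux[OF kill k K u y] f by blast
next
  case True
  have yx: "y \<noteq> x" using multiple_nonzero[OF k(2)] K y by auto
  interpret D: glsys sc G Vg "\<lambda>y x f u. - E (- x) (- y) (refl f) u" "\<lambda>h u. - H (refl h) u" "\<not> b"
    by (rule dual)
  have "D.killed k K u" unfolding D.killed_def
  proof (intro allI impI)
    fix m x f assume *: "K < m" "ad (\<not> b) (x + of_nat m *s k) x f"
    have "E (- x) (- (x + of_nat m *s k)) (refl f) u = 0"
      by (rule killedD[OF kill *(1)]) (use * in \<open>auto simp: ad_dual\<close>)
    then show "- E (- x) (- (x + of_nat m *s k)) (refl f) u = 0" by simp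
  qed
  moreover have "- x = - y + of_nat K *s k" using y by simp
  moreover have "- x \<noteq> 0" using True yx by simp
  moreover have "ad (\<not> b) (- x) (- y) (refl f)" using f by (simp add: ad_dual)
  ultimately obtain n where n: "((\<lambda>u. - E (- (- y)) (- (- x)) (refl (refl f)) u) ^^ n) u = 0"
    using D.raising_nilpotent_aux[of k K u a "- x" "- y" "refl f"] k K u eig_dual[OF u(1)] by blast
  have "((\<lambda>u. - E y x f u) ^^ n) u = sc ((-1) ^ n) ((E y x f ^^ n) u)" for n
  proof (induction n)
    case (Suc n)
    show ?case using yx f by (simp add: Suc E_vscale scale_minus_left)
  qed simp
  then have "sc ((-1) ^ n) ((E y x f ^^ n) u) = 0" using n by simp
  then show ?thesis by auto
qed

lemma killed_subspace:
  assumes k: "k \<noteq> 0" shows "subspace {u. killed k K u}"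
  unfolding subspace_def killed_def
proof (intro conjI ballI allI CollectI impI)
  fix m x f assume *: "m > K" "ad b (x + of_nat m *s k) x f"
  have ne: "x + of_nat m *s k \<noteq> x" using multiple_nonzero[OF k, of m] * by simp
  show "E (x + of_nat m *s k) x f 0 = 0" using ne * by simp
  fix u v c
  assume u: "u \<in> {u. \<forall>m x f. K < m \<longrightarrow> ad b (x + of_nat m *s k) x f \<longrightarrow> E (x + of_nat m *s k) x f u = 0}"
  show "E (x + of_nat m *s k) x f (sc c u) = 0" using u ne * by (simp add: E_vscale)
  assume "v \<in> {u. \<forall>m x f. K < m \<longrightarrow> ad b (x + of_nat m *s k) x f \<longrightarrow> E (x + of_nat m *s k) x f u = 0}"
  then show "E (x + of_nat m *s k) x f (u + v) = 0" using u ne * by (simp add: E_vadd)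
qed

text \<open>The operators of degree \<open>K + 1\<close> commute on the killed vectors and are
  nilpotent on u, and finitely many of them already span their values at u. Applying the last
  nonvanishing power of each of these leaves a nonzero vector that all of them kill.\<close>

lemma killed_descend:
  assumes kill: "killed k (Suc K) u" and k: "k \<in> G" "k \<noteq> 0" and u: "eig u" "u \<in> Vg a" "a \<in> G" "u \<noteq> 0"
  shows "\<exists>u' a'. u' \<noteq> 0 \<and> a' \<in> G \<and> u' \<in> Vg a' \<and> killed k K u'"
proof -
  define s where "s = of_nat (Suc K) *s k"
  have s: "s \<noteq> 0" "s \<in> G" unfolding s_def
    using multiple_nonzero[OF k(2), of "Suc K"] add_subgroup_multiples[OF G k(1)] by blast+
  define Op where "Op = {(x, f). ad b (x + s) x f}"
  define e where "e p = E (fst p + s) (fst p) (snd p)" for p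
  define Kd where "Kd = {w. killed k (Suc K) w}"
  have e_lin: "Vector_Spaces.linear sc sc (e p)" if "p \<in> Op" for p
    using that s unfolding e_def Op_def by (intro E_linear) auto
  have e0: "e p 0 = 0" if "p \<in> Op" for p using that s by (auto simp: e_def Op_def)
  have eK: "e p w \<in> Kd" if "p \<in> Op" "w \<in> Kd" for p w
    using that killed_E[of k "Suc K" w "Suc K" "fst p + s" "fst p" "snd p"] k
    by (auto simp: e_def Op_def Kd_def s_def)
  have e_comm: "e p (e q w) = e q (e p w)" if "p \<in> Op" "q \<in> Op" "w \<in> Kd" for p q w
    using that k unfolding e_def Op_def Kd_def s_def
    by (intro killed_compose_commute[of k "Suc K" _ "Suc K" "Suc K"]) auto
  have eG: "\<exists>a'\<in>G. e p w \<in> Vg a'" if "p \<in> Op" "w \<in> Vg a" "a \<in> G" for p w a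
    using E_grade[of "fst p + s" "fst p" "snd p" a w] that s G_add unfolding e_def Op_def by force
  have ne: "\<exists>n. (e p ^^ n) u = 0" if "p \<in> Op" for p
    using raising_nilpotent[OF kill k _ u(1-3), of "fst p + s" "fst p" "snd p"] that
    by (auto simp: e_def Op_def s_def)
  obtain B where B: "B \<subseteq> (\<lambda>p. e p u) ` Op" "independent B" "(\<lambda>p. e p u) ` Op \<subseteq> span B"
    using maximal_independent_subset[of "(\<lambda>p. e p u) ` Op"] by metis
  obtain S where S: "finite S" "Vg (a + s) \<subseteq> span S"
    using Vg_fin_dim[of "a + s"] G_add u s by (auto simp: fin_dim_def)
  have "e p u \<in> Vg (a + s)" if "p \<in> Op" for p
    using E_grade[of "fst p + s" "fst p" "snd p" a u] that s u unfolding e_def Op_def by force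
  then have "B \<subseteq> span S" using B S by blast
  then have "finite B" using independent_span_bound[OF S(1) B(2)] by blast
  then obtain P where P: "finite P" "P \<subseteq> Op" "B = (\<lambda>p. e p u) ` P"
    using B(1) by (metis finite_subset_image)
  \<comment> \<open>T is a product of powers of the chosen operators. Carrying it as a linear map
    that commutes with every \<open>e p\<close> on Kd lets linear relations between the vectors
    \<open>e p u\<close> pass to \<open>T u\<close>.\<close>
  have "\<exists>T. Vector_Spaces.linear sc sc T \<and> T ` Kd \<subseteq> Kd \<and> (\<forall>p\<in>Op. \<forall>w\<in>Kd. e p (T w) = T (e p w)) \<and>
      T u \<noteq> 0 \<and> (\<exists>a'\<in>G. T u \<in> Vg a') \<and> (\<forall>p\<in>P. e p (T u) = 0)"
    using P(1,2)
  proof (induction P rule: finite_induct)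
    case empty
    show ?case using u by (intro exI[of _ id]) (auto simp: Vector_Spaces.linear_iff vector_space_axioms)
  next
    case (insert p P)
    have p: "p \<in> Op" "P \<subseteq> Op" using insert.prems by auto
    obtain T where T': "Vector_Spaces.linear sc sc T \<and> T ` Kd \<subseteq> Kd \<and> (\<forall>p\<in>Op. \<forall>w\<in>Kd. e p (T w) = T (e p w)) \<and>
      T u \<noteq> 0 \<and> (\<exists>a'\<in>G. T u \<in> Vg a') \<and> (\<forall>p\<in>P. e p (T u) = 0)"
      using insert.IH[OF p(2)] by (rule exE)
    then have T: "Vector_Spaces.linear sc sc T" "T ` Kd \<subseteq> Kd" "\<And>p w. p \<in> Op \<Longrightarrow> w \<in> Kd \<Longrightarrow> e p (T w) = T (e p w)"
      "T u \<noteq> 0" "\<exists>a'\<in>G. T u \<in> Vg a'" "\<And>p. p \<in> P \<Longrightarrow> e p (T u) = 0" by (elim conjE; (assumption | simp (no_asm_simp)))+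
    have uK: "u \<in> Kd" using kill by (simp add: Kd_def)
    have itK: "(e p ^^ n) w \<in> Kd" if "w \<in> Kd" for n w by (induction n) (use that eK p in auto)
    have itT: "(e p ^^ n) (T w) = T ((e p ^^ n) w)" if "w \<in> Kd" for n w
      by (induction n) (use T(3) p itK that in auto)
    have ite: "e q ((e p ^^ n) w) = (e p ^^ n) (e q w)" if "w \<in> Kd" "q \<in> Op" for n w q
      by (induction n) (use e_comm p itK that in auto)
    have itG: "\<exists>a'\<in>G. (e p ^^ n) (T u) \<in> Vg a'" for n
    proof (induction n)
      case (Suc n)
      then show ?case using eG[OF p(1)] by auto
    qed (use T(5) in auto)
    have itL: "Vector_Spaces.linear sc sc (e p ^^ n)" for n
    proof (induction n)
      case 0
      show ?case by (auto simp: Vector_Spaces.linear_iff vector_space_axioms id_def)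
    next
      case (Suc n)
      then show ?case using e_lin[OF p(1)] unfolding Vector_Spaces.linear_iff by auto
    qed
    obtain n where "(e p ^^ n) u = 0" using ne p by blast
    moreover have "T 0 = 0" using T(1) unfolding Vector_Spaces.linear_iff by (metis scale_zero_left)
    ultimately have ex: "(e p ^^ n) (T u) = 0" using itT[OF uK] by simp
    define n where "n = (LEAST n. (e p ^^ n) (T u) = 0)"
    have n: "(e p ^^ n) (T u) = 0" unfolding n_def using ex by (rule LeastI)
    then obtain n' where n': "n = Suc n'" using T(4) by (cases n) auto
    have nz: "(e p ^^ n') (T u) \<noteq> 0" using not_less_Least[of n' "\<lambda>n. (e p ^^ n) (T u) = 0"] n' by (simp add: n_def)
    have TuK: "T u \<in> Kd" using T(2) uK by auto
    show ?case
    proof (intro exI[of _ "\<lambda>w. (e p ^^ n') (T w)"] conjI ballI)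
      show "Vector_Spaces.linear sc sc (\<lambda>w. (e p ^^ n') (T w))"
        using itL[of n'] T(1) unfolding Vector_Spaces.linear_iff by auto
      show "(\<lambda>w. (e p ^^ n') (T w)) ` Kd \<subseteq> Kd" using T(2) itK by auto
      show "(e p ^^ n') (T u) \<noteq> 0" by (rule nz)
      show "\<exists>a'\<in>G. (e p ^^ n') (T u) \<in> Vg a'" by (rule itG)
    next
      fix q w assume qw: "q \<in> Op" "w \<in> Kd"
      have "T w \<in> Kd" using T(2) qw by auto
      then show "e q ((e p ^^ n') (T w)) = (e p ^^ n') (T (e q w))"
        using ite[OF _ qw(1), of "T w" n'] T(3)[OF qw] by simp
    next
      fix q assume q: "q \<in> insert p P"
      show "e q ((e p ^^ n') (T u)) = 0"
      proof (cases "q = p")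
        case True
        then show ?thesis using n n' by simp
      next
        case False
        have "(e p ^^ n') 0 = 0" using itL[of n'] unfolding Vector_Spaces.linear_iff by (metis scale_zero_left)
        moreover have "q \<in> P" "q \<in> Op" using False q p(2) by auto
        ultimately show ?thesis using ite[OF TuK, of q n'] T(6)[of q] by simp
      qed
    qed
  qed
  then obtain T a' where T: "Vector_Spaces.linear sc sc T" "T ` Kd \<subseteq> Kd" "\<And>p w. p \<in> Op \<Longrightarrow> w \<in> Kd \<Longrightarrow> e p (T w) = T (e p w)"
      "T u \<noteq> 0" "a' \<in> G" "T u \<in> Vg a'" "\<And>p. p \<in> P \<Longrightarrow> e p (T u) = 0" by auto
  have uK: "u \<in> Kd" using kill by (simp add: Kd_def)
  have Tadd: "T (x + y) = T x + T y" "T (sc c x) = sc c (T x)" for x y c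
    using T(1) unfolding Vector_Spaces.linear_iff by blast+
  have T0: "T 0 = 0" using Tadd(2)[of 0 0] by (simp only: scale_zero_left)
  have "T x = 0" if "x \<in> span B" for x
    using that
  proof (induction rule: span_induct_alt)
    case (step c x y)
    then obtain p where "p \<in> P" "x = e p u" using P by auto
    then have "T x = 0" using T(3)[of p u] T(7) P uK by (metis subsetD)
    then show ?case using step by (simp add: Tadd)
  qed (rule T0)
  then have all: "e p (T u) = 0" if "p \<in> Op" for p
    using T(3)[OF that uK] B(3) that by auto
  have "killed k K (T u)" unfolding killed_def
  proof (intro allI impI)
    fix m x f assume *: "m > K" "ad b (x + of_nat m *s k) x f"
    have TK: "killed k (Suc K) (T u)" using T(2) uK by (auto simp: Kd_def)
    show "E (x + of_nat m *s k) x f (T u) = 0"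
    proof (cases "m = Suc K")
      case True
      then show ?thesis using all[of "(x, f)"] * by (simp add: e_def Op_def s_def del: of_nat_Suc)
    next
      case False
      then show ?thesis using killedD[OF TK _ *(2) refl] * by simp
    qed
  qed
  then show ?thesis using T by blast
qed

text \<open>Nilpotency was shown for eigenvectors, so each descent starts by picking a new one. The
  killed vectors of a given degree are stable under H, which provides it.\<close>

theorem killed_imp_highest_weight_vector:
  assumes "killed k K u" "k \<in> G" "k \<noteq> 0" "u \<in> Vg a" "a \<in> G" "u \<noteq> 0"
  shows "\<exists>u a. u \<noteq> 0 \<and> a \<in> G \<and> u \<in> Vg a \<and> eig u \<and> killed k 0 u"
  using assms
proof (induction K arbitrary: u a)
  case (0 u a)
  have "\<exists>v\<in>Vg a \<inter> {u. killed k 0 u}. v \<noteq> 0 \<and> eig v"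
    using 0 killed_subspace[OF 0(3)] Vg_subspace
    by (intro eig_exists[of a]) (auto intro: subspace_inter H_grade killed_H)
  then show ?case using 0 by blast
next
  case (Suc K u a)
  have "\<exists>v\<in>Vg a \<inter> {u. killed k (Suc K) u}. v \<noteq> 0 \<and> eig v"
    using Suc.prems killed_subspace[OF Suc.prems(3)] Vg_subspace
    by (intro eig_exists[of a]) (auto intro: subspace_inter H_grade killed_H)
  then obtain v where v: "v \<in> Vg a" "killed k (Suc K) v" "v \<noteq> 0" "eig v" by blast
  obtain u' a' where "u' \<noteq> 0" "a' \<in> G" "u' \<in> Vg a'" "killed k K u'"
    using killed_descend[OF v(2) Suc.prems(2,3) v(4,1) Suc.prems(5) v(3)] by blast
  then show ?case using Suc.IH Suc.prems by blast
qed

end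

subsection \<open>Vacuum sites of an eigenvector\<close>

context glsys
begin

definition clear :: "('a ^ 'n) set \<Rightarrow> 'a ^ 'n \<Rightarrow> 'a ^ 'n \<Rightarrow> bool" where
  "clear B k y \<longleftrightarrow> (\<forall>i::nat. y + of_nat i *s k \<notin> B)"

text \<open>The sites from which a single step by \<open>k\<close> or \<open>- k\<close> acts on v.
  The site 0 is added so that a clear ray avoids it and all polynomials are admissible along the
  ray.\<close>

definition moves :: "'a ^ 'n \<Rightarrow> 'v \<Rightarrow> ('a ^ 'n) set" where
  "moves k v = {0} \<union> {x. \<exists>f. ad b (x + k) x f \<and> E (x + k) x f v \<noteq> 0} \<union> {x. \<exists>f. ad b (x - k) x f \<and> E (x - k) x f v \<noteq> 0}"

lemma finite_moves: "k \<noteq> 0 \<Longrightarrow> finite (moves k v)"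
  using E_fin[of k v] E_fin[of "- k" v] by (simp add: moves_def)

lemma moves_uminus: "moves (- k) v = moves k v"
  by (auto simp: moves_def)

lemma moves_zero: "0 \<in> moves k v"
  by (simp add: moves_def)

lemma clear_step: "clear B k y \<Longrightarrow> clear B k (y + of_nat j *s k)"
  unfolding clear_def by (metis add.assoc of_nat_add vector_sadd_rdistrib)

lemma clear_start: "clear B k y \<Longrightarrow> y \<notin> B"
  unfolding clear_def by (metis add.right_neutral of_nat_0 vector_smult_lzero)

lemma Suc_multiple: "(of_nat (Suc m) :: 'a) *s k = of_nat m *s k + k"
  by (simp add: vector_sadd_rdistrib add.commute)

text \<open>Longer moves along a clear ray are iterated brackets of single steps, and these
  annihilate v.\<close>

lemma clear_chain:
  assumes k: "k \<in> G" "k \<noteq> 0" and c: "clear (moves k v) k y" and f: "polyfun f"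
  shows "E (y + of_nat (Suc n) *s k) y f v = 0 \<and> E y (y + of_nat (Suc n) *s k) f v = 0"
  using f
proof (induction n arbitrary: f)
  case 0
  have "y \<noteq> 0" "y + k \<noteq> 0"
    using clear_start[OF c] clear_start[OF clear_step[OF c, of 1]] moves_zero[of k v] by auto
  then have "ad b (y + k) y f" "ad b ((y + k) - k) (y + k) f" using 0 by (auto simp: ad_def)
  moreover have "y \<notin> moves k v" "y + k \<notin> moves k v"
    using clear_start[OF c] clear_start[OF clear_step[OF c, of 1]] by auto
  ultimately have "E (y + k) y f v = 0" "E ((y + k) - k) (y + k) f v = 0" unfolding moves_def by blast+
  then show ?case by simp
next
  case (Suc n)
  define z where "z = y + of_nat (Suc n) *s k"
  have zk: "y + of_nat (Suc (Suc n)) *s k = z + k" by (simp only: z_def Suc_multiple[of "Suc n"] add.assoc)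
  have cz: "clear (moves k v) k z" unfolding z_def by (rule clear_step[OF c])
  have n0: "y \<noteq> 0" "z \<noteq> 0" "z + k \<noteq> 0"
    using clear_start[OF c] clear_start[OF cz] clear_start[OF clear_step[OF cz, of 1]] moves_zero[of k v] by auto
  have a: "ad b p q h" if "p \<in> {y, z, z + k}" "q \<in> {y, z, z + k}" "polyfun h" for p q h
    using that n0 by (auto simp: ad_def)
  have "z \<notin> moves k v" "z + k \<notin> moves k v"
    using clear_start[OF cz] clear_start[OF clear_step[OF cz, of 1]] by auto
  moreover have "ad b (z + k) z f" "ad b ((z + k) - k) (z + k) f" using a Suc.prems by auto
  ultimately have v1: "E (z + k) z f v = 0" "E ((z + k) - k) (z + k) f v = 0" unfolding moves_def by blast+
  have v2: "E z y 1 v = 0" "E y z 1 v = 0" using Suc.IH[of 1] by (auto simp: z_def)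
  have ne: "y \<noteq> z" "z \<noteq> z + k" "y \<noteq> z + k"
  proof -
    show "y \<noteq> z" using multiple_nonzero[OF k(2), of "Suc n"] unfolding z_def by (simp del: of_nat_Suc)
    show "z \<noteq> z + k" using k by simp
    show "y \<noteq> z + k" using multiple_nonzero[OF k(2), of "Suc (Suc n)"]
      unfolding zk[symmetric] by (simp del: of_nat_Suc)
  qed
  have G: "z + k - z \<in> G" "z - (z + k) \<in> G" using k G_neg by auto
  have "E (z + k) y (1 * f) v = 0"
    using E_bracket[of y z "z + k" 1 f v] ne a Suc.prems G v1 v2 by auto
  moreover have "E y (z + k) (f * 1) v = 0"
    using E_bracket[of "z + k" z y f 1 v] ne a Suc.prems G v1 v2 by auto
  ultimately show ?case unfolding zk by simp
qed

lemma clear_vac: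
  assumes k: "k \<in> G" "k \<noteq> 0" and c: "clear (moves k v) k y"
  shows "vac v (range (\<lambda>i. y + of_nat i *s k))"
  unfolding vac_def
proof (intro conjI ballI allI impI)
  show "0 \<notin> range (\<lambda>i. y + of_nat i *s k)"
  proof
    assume "0 \<in> range (\<lambda>i. y + of_nat i *s k)"
    then obtain i where "0 = y + of_nat i *s k" by (rule rangeE)
    then show False using clear_start[OF clear_step[OF c, of i]] moves_zero[of k v] by simp
  qed
  fix p q :: "'a ^ 'n" and f :: "'a ^ 'n \<Rightarrow> 'a"
  assume "p \<in> range (\<lambda>i. y + of_nat i *s k)" "q \<in> range (\<lambda>i. y + of_nat i *s k)" and pq: "p \<noteq> q" and f: "polyfun f"
  then obtain i j where ij: "p = y + of_nat i *s k" "q = y + of_nat j *s k" by auto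
  have *: "E (y + of_nat j *s k) (y + of_nat i *s k) f v = 0 \<and> E (y + of_nat i *s k) (y + of_nat j *s k) f v = 0"
    if lt: "i < j" for i j
  proof -
    obtain n where n: "j = i + Suc n" using less_imp_Suc_add[OF lt] by auto
    have "y + of_nat j *s k = (y + of_nat i *s k) + of_nat (Suc n) *s k"
      unfolding n by (simp only: of_nat_add vector_sadd_rdistrib add.assoc)
    then show ?thesis using clear_chain[OF k clear_step[OF c, of i] f, of n] by metis
  qed
  have "i \<noteq> j" using pq ij by auto
  then consider "i < j" | "j < i" by linarith
  then show "E q p f v = 0" using *[of i j] *[of j i] ij by cases auto
qed

lemma clear_pair:
  assumes k: "k \<in> G" "k \<noteq> 0" and c: "clear (moves k v) k y" and n: "n > 0" and f: "polyfun f"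
  shows "E (y + of_nat n *s k) y f v = 0" "E y (y + of_nat n *s k) f v = 0"
  using clear_chain[OF k c f, of "n - 1"] n by auto

text \<open>If the upper vacuum (from z on) and the lower vacuum (from \<open>z - d k\<close> down) are different, then moving
  one particle between them exhausts what can be done over long distances.\<close>

lemma two_vacua:
  assumes k: "k \<in> G" "k \<noteq> 0" and v: "v \<in> Vg a" "a \<in> G"
    and M: "\<And>y m. m \<ge> M \<Longrightarrow> clear (moves k v) k (y + of_nat m *s k) \<or> clear (moves k v) (- k) y"
    and z: "clear (moves k v) k z" and z': "clear (moves k v) (- k) z'"
    and d: "z = z' + of_nat d *s k" "d > 0" and g: "polyfun g"
  shows "killed k (M + d) (E z' z g v)"
  unfolding killed_def
proof (intro allI impI)
  fix m x f assume m: "m > M + d" and "ad b (x + of_nat m *s k) x f"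
  define y where "y = x + of_nat m *s k"
  have f: "ad b y x f" using \<open>ad b (x + of_nat m *s k) x f\<close> by (simp add: y_def)
  have pf: "polyfun f" using f by (simp add: ad_def)
  have mk: "- k \<in> G" "- k \<noteq> 0" using k G_neg by auto
  note mv = moves_uminus[of k v]
  have yx: "y \<noteq> x" using multiple_nonzero[OF k(2), of m] m by (auto simp: y_def)
  have zz: "z \<noteq> z'" using multiple_nonzero[OF k(2), of d] d by auto
  have z0: "z \<noteq> 0" "z' \<noteq> 0" using clear_start[OF z] clear_start[OF z'] moves_zero[of k v] by auto
  have ag: "ad b z' z g" using g z0 by (auto simp: ad_def)
  have zG: "z - z' \<in> G" "z' - z \<in> G" using d add_subgroup_multiples[OF G k(1), of d] G_neg by auto
  have ray: "\<And>u i. u + of_nat i *s k \<in> range (\<lambda>i. u + of_nat i *s k)" by blast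
  \<comment> \<open>The end y lies in the upper vacuum together with z, and there one particle
    enters while another leaves. The statement B is the same at the lower end.\<close>
  have A: "E z' z g (E y x f v) = 0" if "clear (moves k v) k y" "y \<noteq> z"
    by (rule vacuum_in_out[OF clear_vac[OF k that(1)] clear_vac[OF k z] v k, of y z 0])
      (use that zz yx f ag in \<open>auto intro: range_eqI[of _ _ "0::nat"]\<close>)
  have B: "E z' z g (E y x f v) = 0" if "clear (moves k v) (- k) x" "x \<noteq> z'"
    by (rule vacuum_out_in[OF clear_vac[OF mk, unfolded moves_uminus, OF z'] clear_vac[OF mk, unfolded moves_uminus, OF that(1)] v mk, of z' x 0])
      (use that zz yx f ag in \<open>auto intro: range_eqI[of _ _ "0::nat"]\<close>)
  \<comment> \<open>If y coincides with z, then x continues the lower ray from z', so the argument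
    at the lower end is available instead. The same holds with the ends exchanged.\<close>
  have xdown: "x = z' + of_nat (m - d) *s (- k)" if "y = z"
    using that d m unfolding y_def by (simp add: of_nat_diff vector_sub_rdistrib algebra_simps)
  have yup: "y = z + of_nat (m - d) *s k" if "x = z'"
    using that d m unfolding y_def by (simp add: of_nat_diff vector_sub_rdistrib algebra_simps)
  have notboth: "\<not> (y = z \<and> x = z')"
    using multiple_nonzero[OF k(2), of "m - d"] yup m by auto
  have kill: "E z' z g (E y x f v) = 0"
  proof -
    consider "clear (moves k v) k y" "y \<noteq> z" | "clear (moves k v) (- k) x" "x \<noteq> z'" | "y = z" | "x = z'"
      using M[of m x] m unfolding y_def by fastforce
    then show ?thesis
    proof cases
      case 3
      then have "clear (moves k v) (- k) x" using clear_step[OF z', of "m - d"] xdown by simp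
      then show ?thesis using B notboth 3 by blast
    next
      case 4
      then have "clear (moves k v) k y" using clear_step[OF z, of "m - d"] yup by simp
      then show ?thesis using A notboth 4 by blast
    qed (use A B in blast)+
  qed
  \<comment> \<open>The two moves fail to commute only if they share a site, and then their bracket
    is a move inside one of the two vacua.\<close>
  have "E y x f (E z' z g v) = 0"
  proof -
    consider "y \<noteq> z" "x \<noteq> z'" | "y = z" | "x = z'" by blast
    then show ?thesis
    proof cases
      case 1
      then have "E y x f (E z' z g v) = E z' z g (E y x f v)" using yx zz f ag by (intro E_commute) auto
      then show ?thesis using kill by simp
    next
      case 2
      have md: "m - d > 0" using m by simp
      have "E z' x (f * g) v = 0"
        using clear_pair(2)[OF mk, unfolded moves_uminus, OF z' md, of "f * g"]
          clear_pair(1)[OF mk, unfolded moves_uminus, OF z' md, of "f * g"] xdown[OF 2] pf g by simp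
      moreover have "x \<noteq> z'" using notboth 2 by blast
      ultimately show ?thesis using E_compose[of x z z' f g v] 2 yx zz f ag zG kill by auto
    next
      case 3
      have md: "m - d > 0" using m by simp
      have "E y z (g * f) v = 0"
        using clear_pair(1)[OF k z md, of "g * f"] yup[OF 3] pf g by simp
      moreover have "y \<noteq> z" using notboth 3 by blast
      ultimately show ?thesis using E_compose[of z z' y g f v] 3 yx zz f ag zG kill by auto
    qed
  qed
  then show "E (x + of_nat m *s k) x f (E z' z g v) = 0" by (simp add: y_def)
qed

text \<open>If both alternatives fail, the line through y contains two points of the finite set
  \<open>moves k v\<close> that are at least m steps apart; such distances are bounded.\<close>

lemma moves_bounded:
  assumes k: "(k :: 'a ^ 'n) \<noteq> 0"
  shows "\<exists>M. \<forall>y m. m \<ge> M \<longrightarrow> clear (moves k v) k (y + of_nat m *s k) \<or> clear (moves k v) (- k) y"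
proof -
  let ?B = "moves k v"
  have "\<exists>M. \<forall>i\<ge>M. r + of_nat i *s k \<notin> ?B" for r
    using multiples_avoid_finite[OF k finite_moves[OF k]] by blast
  then obtain Mf where Mf: "\<And>r i. i \<ge> Mf r \<Longrightarrow> r + of_nat i *s k \<notin> ?B" by metis
  define M where "M = Max (Mf ` ?B)"
  have M: "r + of_nat i *s k \<notin> ?B" if "r \<in> ?B" "i \<ge> M" for r i
  proof -
    have "Mf r \<le> M" unfolding M_def using that finite_moves[OF k] by (intro Max_ge) auto
    then show ?thesis using Mf that by simp
  qed
  show ?thesis
  proof (intro exI[of _ M] allI impI)
    fix y m assume m: "m \<ge> M"
    show "clear ?B k (y + of_nat m *s k) \<or> clear ?B (- k) y"
    proof (rule ccontr)
      assume "\<not> ?thesis"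
      then obtain i j where *: "(y + of_nat m *s k) + of_nat i *s k \<in> ?B" "y + of_nat j *s (- k) \<in> ?B"
        by (auto simp: clear_def)
      have "(y + of_nat m *s k) + of_nat i *s k = (y + of_nat j *s (- k)) + of_nat (m + i + j) *s k"
        by (simp add: vector_sadd_rdistrib algebra_simps)
      then show False using M[OF *(2), of "m + i + j"] * m by (simp add: add.assoc)
    qed
  qed
qed

lemma finite_unclear:
  assumes k: "(k :: 'a ^ 'n) \<noteq> 0"
  shows "finite {y. \<not> clear (moves k v) k y \<and> \<not> clear (moves k v) (- k) y}"
proof -
  let ?B = "moves k v"
  obtain M where M: "\<And>y m. m \<ge> M \<Longrightarrow> clear ?B k (y + of_nat m *s k) \<or> clear ?B (- k) y"
    using moves_bounded[OF k] by blast
  define F where "F = {y. \<not> clear ?B k y \<and> \<not> clear ?B (- k) y}"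

  have "F \<subseteq> (\<lambda>(r, i). r + of_nat i *s k) ` (?B \<times> {..M})"
    proof
      fix y assume "y \<in> F"
      then obtain i j where ij: "y + of_nat i *s k \<in> ?B" "y + of_nat j *s (- k) \<in> ?B"
        by (auto simp: F_def clear_def)
      have "j < M"
      proof (rule ccontr)
        assume "\<not> j < M"
        then have "clear ?B k (y + of_nat j *s (- k) + of_nat j *s k) \<or> clear ?B (- k) (y + of_nat j *s (- k))"
          by (intro M) simp
        moreover have "y + of_nat j *s (- k) + of_nat j *s k = y" by simp
        moreover have "\<not> clear ?B k y" using \<open>y \<in> F\<close> by (simp add: F_def)
        ultimately have "clear ?B (- k) (y + of_nat j *s (- k))" by simp
        then show False using clear_start ij by blast
      qed
      moreover have "y = (y + of_nat j *s (- k)) + of_nat j *s k" by simp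
      ultimately show "y \<in> (\<lambda>(r, i). r + of_nat i *s k) ` (?B \<times> {..M})" using ij(2)
        by (intro image_eqI[of _ _ "(y + of_nat j *s (- k), j)"]) auto
    qed
    then show ?thesis using finite_moves[OF k] by (auto simp: F_def dest: finite_subset)
qed

text \<open>Outside F every site belongs to the upper or the lower vacuum of its line. Two sites
  that exchange a particle lie on one line, as k generates G, with one in each vacuum. The direction
  of the exchange decides whether large degrees along \<open>k\<close> or along \<open>- k\<close>
  are killed.\<close>

theorem trichotomy:
  assumes k: "k \<in> G" "k \<noteq> 0" and gen: "\<And>x. x \<in> G \<Longrightarrow> \<exists>i::nat. x = of_nat i *s k \<or> x = - (of_nat i *s k)"
    and v: "v \<in> Vg a" "a \<in> G"
  shows "(\<exists>F. finite F \<and> vac v (- F)) \<or>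
    (\<exists>u a K. u \<noteq> 0 \<and> a \<in> G \<and> u \<in> Vg a \<and> (killed k K u \<or> killed (- k) K u))"
proof -
  let ?B = "moves k v"
  have mk: "- k \<in> G" "- k \<noteq> 0" using k G_neg by auto
  note mv = moves_uminus[of k v]
  obtain M where M: "\<And>y m. m \<ge> M \<Longrightarrow> clear ?B k (y + of_nat m *s k) \<or> clear ?B (- k) y"
    using moves_bounded[OF k(2)] by blast
  define F where "F = {y. \<not> clear ?B k y \<and> \<not> clear ?B (- k) y}"
  have finF: "finite F" using finite_unclear[OF k(2)] by (simp add: F_def)
  show ?thesis
  proof (cases "vac v (- F)")
    case False
    have "0 \<in> F" using clear_start moves_zero[of k v] by (auto simp: F_def)
    then obtain x y f where xy: "x \<notin> F" "y \<notin> F" "x \<noteq> y" "polyfun f" "E y x f v \<noteq> 0"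
      using False by (auto simp: vac_def)
    then have "y - x \<in> G" using E_off by blast
    then obtain i where "y - x = of_nat i *s k \<or> y - x = - (of_nat i *s k)" using gen by blast
    then have "y = x + of_nat i *s k \<or> x = y + of_nat i *s k" by (auto simp: algebra_simps)
    then obtain p q where pq: "{p, q} = {x, y}" "q = p + of_nat i *s k" by blast
    have i0: "i > 0" using pq xy(3) by (cases i) auto
    have F: "p \<notin> F" "q \<notin> F" "p \<noteq> q" using pq(1) xy by auto
    have E: "E q p f v \<noteq> 0 \<or> E p q f v \<noteq> 0" using pq(1) xy by (auto simp: doubleton_eq_iff)
    have np: "\<not> clear ?B k p" using clear_pair[OF k _ i0 xy(4), of v p] E pq by auto
    have nq: "\<not> clear ?B (- k) q"
    proof
      assume "clear ?B (- k) q"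
      moreover have "p = q + of_nat i *s (- k)" using pq by simp
      ultimately show False using clear_pair[OF mk, unfolded moves_uminus, OF _ i0 xy(4), of v q] E by auto
    qed
    have cl: "clear ?B k q" "clear ?B (- k) p" using F np nq by (auto simp: F_def)
    have n0: "p \<noteq> 0" "q \<noteq> 0" using clear_start[OF cl(1)] clear_start[OF cl(2)] moves_zero[of k v] by auto
    have a: "ad b p q f" "ad b q p f" using n0 xy by (auto simp: ad_def)
    have G2: "q - p \<in> G" "p - q \<in> G" using pq(2) add_subgroup_multiples[OF G k(1), of i] G_neg by auto
    show ?thesis
    proof (cases "E p q f v = 0")
      case False
      have "killed k (M + i) (E p q f v)" by (rule two_vacua[OF k v M cl pq(2) i0 xy(4)])
      moreover have "E p q f v \<in> Vg (a + (p - q))" using E_grade a v F G2 by auto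
      ultimately show ?thesis using False v G2 G_add by blast
    next
      case True
      then have nz: "E q p f v \<noteq> 0" using E by simp
      have M': "clear ?B (- k) (y + of_nat m *s (- k)) \<or> clear ?B (- (- k)) y" if "m \<ge> M" for y m
        using M[OF that, of "y + of_nat m *s (- k)"] by auto
      have "killed (- k) (M + i) (E q p f v)"
        by (rule two_vacua[OF mk v, unfolded moves_uminus, OF M' cl(2) _ _ i0 xy(4)]) (use cl pq in auto)
      moreover have "E q p f v \<in> Vg (a + (q - p))" using E_grade a v F G2 by auto
      ultimately show ?thesis using nz v G2 G_add by blast
    qed
  qed (use finF in blast)
qed

text \<open>When the multiples of k have infinite index in G, some of the lines in direction k consist of vacuum
  only; neighbouring lines are connected far away, so there is just one vacuum.\<close>

theorem single_vacuum:
  assumes k: "k \<in> G" "k \<noteq> 0" and v: "v \<in> Vg a" "a \<in> G"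
    and inf: "\<And>B. finite B \<Longrightarrow> B \<subseteq> G \<Longrightarrow> \<exists>g\<in>G. \<forall>r\<in>B. \<forall>i::int. g \<noteq> r + of_int i *s k"
  shows "\<exists>F. finite F \<and> vac v (- F)"
proof -
  let ?B = "moves k v"
  have mk: "- k \<in> G" "- k \<noteq> 0" using k G_neg by auto
  note mv = moves_uminus[of k v]
  define F where "F = {y. \<not> clear ?B k y \<and> \<not> clear ?B (- k) y}"
  have finF: "finite F" using finite_unclear[OF k(2)] by (simp add: F_def)
  \<comment> \<open>Linked sites belong to the same vacuum.\<close>
  define link where "link p q \<longleftrightarrow> p = q \<or> (\<forall>f. polyfun f \<longrightarrow> E q p f v = 0 \<and> E p q f v = 0)" for p q
  have ad_nz: "ad b p q f" if "p \<noteq> 0" "q \<noteq> 0" "polyfun f" for p q f using that by (auto simp: ad_def)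
  have link_sym: "link p q \<Longrightarrow> link q p" for p q by (auto simp: link_def)
  have link_trans: "link p r" if "link p q" "link q r" "q - p \<in> G" "p \<noteq> 0" "q \<noteq> 0" "r \<noteq> 0" for p q r
  proof (cases "p = q \<or> q = r \<or> p = r")
    case False
    have "p - q \<in> G" using that G_diff_commute by blast
    moreover have "ad b q p 1" "ad b p q 1" using ad_nz that by blast+
    moreover have "ad b r q f" "ad b q r f" if "polyfun f" for f
      using ad_nz that \<open>q \<noteq> 0\<close> \<open>r \<noteq> 0\<close> by blast+
    ultimately have "E r p f v = 0" "E p r f v = 0" if "polyfun f" for f
      using E_bracket[of p q r 1 f v] E_bracket[of r q p f 1 v] False \<open>link p q\<close> \<open>link q r\<close> that
        \<open>p \<noteq> 0\<close> \<open>q \<noteq> 0\<close> \<open>r \<noteq> 0\<close> \<open>q - p \<in> G\<close> by (auto simp: link_def)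
    then show ?thesis by (simp add: link_def)
  qed (use that in \<open>auto simp: link_def\<close>)
  \<comment> \<open>Far along the two parallel rays the finitely many sites where a move by
    \<open>q - p\<close> or back acts on v are avoided. The link found there is carried back along
    the rays.\<close>
  have up: "link p q" if c: "clear ?B \<kappa> p" "clear ?B \<kappa> q" and pq: "q - p \<in> G" and kap: "\<kappa> = k \<or> \<kappa> = - k" for p q \<kappa>
  proof (cases "p = q")
    case False
    define l where "l = q - p"
    have l: "l \<noteq> 0" "- l \<noteq> 0" using False by (auto simp: l_def)
    have kk: "\<kappa> \<in> G" "\<kappa> \<noteq> 0" "moves \<kappa> v = ?B" using kap k mk mv by auto
    let ?X = "\<lambda>l. {x. \<exists>f. ad b (x + l) x f \<and> E (x + l) x f v \<noteq> 0}"
    from multiples_avoid_finite[OF kk(2) E_fin[OF l(1)], of p v] obtain j1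
      where j1: "\<forall>i\<ge>j1. p + of_nat i *s \<kappa> \<notin> ?X l" by (rule exE)
    from multiples_avoid_finite[OF kk(2) E_fin[OF l(2)], of q v] obtain j2
      where j2: "\<forall>i\<ge>j2. q + of_nat i *s \<kappa> \<notin> ?X (- l)" by (rule exE)
    define j where "j = Suc (j1 + j2)"
    define p' where "p' = p + of_nat j *s \<kappa>"
    define q' where "q' = q + of_nat j *s \<kappa>"
    have eq: "q' = p' + l" "p' = q' + - l" by (auto simp: p'_def q'_def l_def)
    have cl: "clear ?B \<kappa> p'" "clear ?B \<kappa> q'" unfolding p'_def q'_def using c clear_step by blast+
    have nz: "p \<noteq> 0" "q \<noteq> 0" "p' \<noteq> 0" "q' \<noteq> 0"
      using clear_start[OF c(1)] clear_start[OF c(2)] clear_start[OF cl(1)] clear_start[OF cl(2)] moves_zero[of k v] by auto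
    have "E q' p' f v = 0 \<and> E p' q' f v = 0" if f: "polyfun f" for f
    proof -
      have "ad b (p' + l) p' f" "ad b (q' + - l) q' f"
        unfolding eq(1)[symmetric] eq(2)[symmetric] using ad_nz nz f by blast+
      moreover have "j1 \<le> j" "j2 \<le> j" by (auto simp: j_def)
      then have "p' \<notin> ?X l" "q' \<notin> ?X (- l)" unfolding p'_def q'_def using j1 j2 by blast+
      ultimately have "E (p' + l) p' f v = 0" "E (q' + - l) q' f v = 0" by blast+
      then show ?thesis unfolding eq(1)[symmetric] eq(2)[symmetric] by simp
    qed
    then have 1: "link p' q'" by (simp add: link_def)
    have ray: "link u (u + of_nat j *s \<kappa>)" if "clear ?B \<kappa> u" for u
      using clear_pair[OF kk(1,2), of v u j] that kk(3) by (auto simp: link_def j_def)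
    have G': "of_nat j *s \<kappa> \<in> G" using add_subgroup_multiples[OF G kk(1)] .
    have "p' - p \<in> G" "q' - p' \<in> G" using G' pq eq by (auto simp: p'_def l_def)
    moreover have "q' - p \<in> G" using calculation G_diff_trans by blast
    ultimately have "link p q'" using link_trans[OF _ 1] ray[OF c(1)] nz unfolding p'_def by blast
    moreover have "link q' q" using ray[OF c(2)] link_sym unfolding q'_def by blast
    ultimately show ?thesis using link_trans \<open>q' - p \<in> G\<close> nz by blast
  qed (simp add: link_def)
  \<comment> \<open>Infinite index yields a translate of p whose whole line avoids
    \<open>moves k v\<close>. Being clear in both directions, it joins the upper vacuum to the lower
    one.\<close>
  have updown: "link p q" if c: "clear ?B k p" "clear ?B (- k) q" and pq: "q - p \<in> G" for p q
  proof -
    have "finite {x. x + p \<in> ?B}"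
      using finite_vimageI[OF finite_moves[OF k(2)], of "\<lambda>x. x + p" v] by (simp add: vimage_def)
    then have "finite {x\<in>G. x + p \<in> ?B}" by (rule rev_finite_subset) auto
    then obtain g where g: "g \<in> G" "\<And>r i. r \<in> G \<Longrightarrow> r + p \<in> ?B \<Longrightarrow> g \<noteq> r + of_int i *s k"
      using inf[of "{x\<in>G. x + p \<in> ?B}"] by auto
    have full: "g + p + of_int i *s k \<notin> ?B" for i :: int
    proof
      assume *: "g + p + of_int i *s k \<in> ?B"
      have "of_int i *s k \<in> G"
      proof (cases "i \<ge> 0")
        case True
        then show ?thesis using add_subgroup_multiples[OF G k(1), of "nat i"] by simp
      next
        case False
        then show ?thesis using add_subgroup_multiples[OF G mk(1), of "nat (- i)"] by simp
      qed
      then have "g + of_int i *s k \<in> G" using g G_add by blast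
      then have "g \<noteq> (g + of_int i *s k) + of_int (- i) *s k" using * by (intro g(2)) (auto simp: add_ac)
      then show False by (simp add: vector_smult_lneg)
    qed
    have "clear ?B k (g + p)" "clear ?B (- k) (g + p)" unfolding clear_def
      using full[of "int _"] full[of "- int _"] by (simp_all add: vector_smult_lneg vector_smult_rneg)
    then have "link p (g + p)" "link (g + p) q" "g + p \<noteq> 0" "p \<noteq> 0" "q \<noteq> 0"
      using up[of k p "g + p"] up[of "- k" "g + p" q] c g pq G_diff_trans[of q p "g + p"] G_neg
        clear_start moves_zero[of k v] by auto
    then show ?thesis using link_trans g by (metis add_diff_cancel_right')
  qed
  have "E y x f v = 0" if "x \<notin> F" "y \<notin> F" "x \<noteq> y" "polyfun f" for x y f
  proof (cases "y - x \<in> G")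
    case True
    have "link x y \<or> link y x"
      using that up[of k x y] up[of "- k" x y] updown[of x y] updown[of y x] True G_diff_commute
      unfolding F_def by blast
    then show ?thesis using that by (auto simp: link_def)
  qed (use E_off in blast)
  moreover have "0 \<in> F" using clear_start moves_zero[of k v] by (auto simp: F_def)
  ultimately have "vac v (- F)" by (auto simp: vac_def)
  then show ?thesis using finF by blast
qed

end

section \<open>From the Lie algebra to local operators\<close>

lemma isdelta_unique:
  fixes J :: "('a::alg_closed_field ^ 'n::finite \<Rightarrow> 'a) set"
  assumes J: "pideal J" and d: "isdelta J x d" "isdelta J x d'" shows "d - d' \<in> J"
proof -
  have "d - d' = d * (1 - d') - d' * (1 - d)" by (simp add: algebra_simps)
  then show ?thesis using isdelta_absorb[OF J d] isdelta_absorb[OF J d(2,1)] pideal_minus[OF J] by metis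
qed

lemma isdelta_mult:
  fixes J :: "('a::alg_closed_field ^ 'n::finite \<Rightarrow> 'a) set"
  assumes J: "pideal J" and d: "isdelta J x d" "isdelta J x d'" shows "isdelta J x (d * d')"
proof -
  have pf: "polyfun d" "polyfun d'" using d by (auto simp: isdelta_def)
  have "\<exists>N. lin i (x $ i) ^ N * (d * d') \<in> J" for i
  proof -
    obtain N where "lin i (x $ i) ^ N * d \<in> J" using d by (auto simp: isdelta_def)
    then have "(lin i (x $ i) ^ N * d) * d' \<in> J" using pideal_mult2[OF J] pf by blast
    then show ?thesis by (auto simp: mult.assoc)
  qed
  moreover obtain e where e: "polyfun e" "e x = 1" "e * (1 - d) \<in> J" using d by (auto simp: isdelta_def)
  have "e * (1 - d * d') = e * (1 - d) + e * (d * (1 - d'))" by (simp add: algebra_simps)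
  then have "e * (1 - d * d') \<in> J"
    using e isdelta_absorb[OF J d] pideal_add[OF J] pideal_mult[OF J] by metis
  ultimately show ?thesis using e pf unfolding isdelta_def by blast
qed

text \<open>The difference of \<open>x_a x_b\<close> is \<open>k_b x_a + k_a x_b + k_a k_b\<close>.
  With \<open>k_j \<noteq> 0\<close>, the case a = b = j yields \<open>x_j\<close>, dividing by
  \<open>2 k_j\<close>, and the case a = i, b = j then yields \<open>x_i\<close>.\<close>

lemma polyfun_generated_by_differences:
  fixes k :: "'a::field_char_0 ^ 'n::finite"
  assumes "k \<noteq> 0" "polyfun q"
    and const: "\<And>c. Q (cst c)" and add: "\<And>f g. polyfun f \<Longrightarrow> polyfun g \<Longrightarrow> Q f \<Longrightarrow> Q g \<Longrightarrow> Q (f + g)"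
    and mult: "\<And>f g. polyfun f \<Longrightarrow> polyfun g \<Longrightarrow> Q f \<Longrightarrow> Q g \<Longrightarrow> Q (f * g)"
    and diff: "\<And>h. polyfun h \<Longrightarrow> h 0 = 0 \<Longrightarrow> Q (sh k h - h)"
  shows "Q q"
proof -
  obtain j where j: "k $ j \<noteq> 0" using assms(1) by (auto simp: vec_eq_iff)
  have D: "Q (cst (k $ b) * lin a 0 + (cst (k $ a) * lin b 0 + cst (k $ a * k $ b)))" for a b
  proof -
    have "sh k (lin a 0 * lin b 0) - lin a 0 * lin b 0 =
        cst (k $ b) * lin a 0 + (cst (k $ a) * lin b 0 + cst (k $ a * k $ b))"
      by (auto simp: fun_eq_iff pointwise algebra_simps)
    then show ?thesis using diff[of "lin a 0 * lin b 0"] by (auto simp: pointwise)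
  qed
  have Qj: "Q (lin j 0)"
  proof -
    let ?d = "cst (k $ j) * lin j 0 + (cst (k $ j) * lin j 0 + cst (k $ j * k $ j))"
    have "lin j 0 = cst (inverse (2 * k $ j)) * (?d + cst (- (k $ j * k $ j)))"
      using j by (auto simp: fun_eq_iff pointwise field_simps)
    moreover have "Q (cst (inverse (2 * k $ j)) * (?d + cst (- (k $ j * k $ j))))"
      by (rule mult[OF _ _ const add[OF _ _ D const]]; intro polyfun_add polyfun_mult polyfun_cst polyfun_lin)
    ultimately show ?thesis by metis
  qed
  have Qi: "Q (lin i 0)" for i
  proof -
    let ?d = "cst (k $ j) * lin i 0 + (cst (k $ i) * lin j 0 + cst (k $ i * k $ j))"
    have "lin i 0 = cst (inverse (k $ j)) * (?d + (cst (- (k $ i)) * lin j 0 + cst (- (k $ i * k $ j))))"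
      using j by (auto simp: fun_eq_iff pointwise field_simps)
    moreover have "Q (cst (inverse (k $ j)) * (?d + (cst (- (k $ i)) * lin j 0 + cst (- (k $ i * k $ j)))))"
      by (rule mult[OF _ _ const add[OF _ _ D add[OF _ _ mult[OF _ _ const Qj] const]]];
          intro polyfun_add polyfun_mult polyfun_cst polyfun_lin)
    ultimately show ?thesis by metis
  qed
  show ?thesis using assms(2)
  proof (induction rule: polyfun.induct)
    case (const c)
    show ?case using assms(3)[of c] by (simp add: cst_def)
  next
    case (coord i)
    have "lin i 0 = (\<lambda>x::'a ^ 'n. x $ i)" by (auto simp: fun_eq_iff pointwise)
    then show ?case using Qi[of i] by simp
  qed (use add mult in blast)+
qed

text \<open>The scalar s in opposite degrees absorbs the cocycle, since the centre acts by a scalar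
  on an irreducible module. It may depend on f and g but not on the vector.\<close>

locale Tsys = vector_space sc
  for sc :: "'a::{alg_closed_field, field_char_0} \<Rightarrow> 'v::ab_group_add \<Rightarrow> 'v" +
  fixes G :: "('a ^ 'n::finite) set" and Vg :: "'a ^ 'n \<Rightarrow> 'v set"
    and T :: "'a ^ 'n \<Rightarrow> ('a ^ 'n \<Rightarrow> 'a) \<Rightarrow> 'v \<Rightarrow> 'v"
  assumes G: "add_subgroup G"
    and grading: "qf_grading sc G Vg"
    and T_off: "k \<notin> G \<Longrightarrow> T k f u = 0"
    and T_linear: "polyfun f \<Longrightarrow> f 0 = 0 \<Longrightarrow> Vector_Spaces.linear sc sc (T k f)"
    and T_add: "polyfun f \<Longrightarrow> f 0 = 0 \<Longrightarrow> polyfun g \<Longrightarrow> g 0 = 0 \<Longrightarrow> T k (f + g) u = T k f u + T k g u"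
    and T_scale: "polyfun f \<Longrightarrow> f 0 = 0 \<Longrightarrow> T k (cst c * f) u = sc c (T k f u)"
    and T_grade: "polyfun f \<Longrightarrow> f 0 = 0 \<Longrightarrow> k \<in> G \<Longrightarrow> a \<in> G \<Longrightarrow> u \<in> Vg a \<Longrightarrow> T k f u \<in> Vg (a + k)"
    and T_bracket: "polyfun f \<Longrightarrow> f 0 = 0 \<Longrightarrow> polyfun g \<Longrightarrow> g 0 = 0 \<Longrightarrow> k \<in> G \<Longrightarrow> l \<in> G \<Longrightarrow> k + l \<noteq> 0 \<or> k = 0 \<Longrightarrow>
        T k f (T l g u) - T l g (T k f u) = T (k + l) (sh l f * g - f * sh k g) u"
    and T_bracket_opposite: "polyfun f \<Longrightarrow> f 0 = 0 \<Longrightarrow> polyfun g \<Longrightarrow> g 0 = 0 \<Longrightarrow> k \<in> G \<Longrightarrow>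
        \<exists>s. \<forall>u. T k f (T (- k) g u) - T (- k) g (T k f u) = T 0 (sh (- k) f * g - f * sh k g) u + sc s u"
begin

lemma Vg_subspace: "a \<in> G \<Longrightarrow> subspace (Vg a)"
  and Vg_fin_dim: "a \<in> G \<Longrightarrow> fin_dim sc (Vg a)"
  using grading by (auto simp: qf_grading_def)

lemma
  assumes "polyfun f" "f 0 = 0"
  shows T_zero [simp]: "T k f 0 = 0"
    and T_vadd: "T k f (u + v) = T k f u + T k f v"
    and T_vscale: "T k f (sc c u) = sc c (T k f u)"
proof -
  interpret l: Vector_Spaces.linear sc sc "T k f" by (rule T_linear[OF assms])
  show "T k f 0 = 0" "T k f (u + v) = T k f u + T k f v" "T k f (sc c u) = sc c (T k f u)"
    by (rule l.zero l.add l.scale)+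
qed

lemma T_0 [simp]: "T k 0 u = 0"
  using T_add[of 0 0 k u] by (simp add: zero_fun_apply)

lemma T_uminus: "polyfun f \<Longrightarrow> f 0 = 0 \<Longrightarrow> T k (- f) u = - T k f u"
proof -
  assume *: "polyfun f" "f 0 = 0"
  have "- f = cst (- 1) * f" by (auto simp: fun_eq_iff pointwise)
  then show ?thesis using T_scale[OF *, of k "-1" u] by (simp add: scale_minus_left)
qed

lemma T_minus: "polyfun f \<Longrightarrow> f 0 = 0 \<Longrightarrow> polyfun g \<Longrightarrow> g 0 = 0 \<Longrightarrow> T k (f - g) u = T k f u - T k g u"
  using T_add[of f "- g" k u] T_uminus[of g k u] by (simp add: uminus_apply)

lemma T_sum: "(\<And>i. i \<in> A \<Longrightarrow> polyfun (f i) \<and> f i 0 = 0) \<Longrightarrow> T k (\<Sum>i\<in>A. f i) u = (\<Sum>i\<in>A. T k (f i) u)"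
proof (induction A rule: infinite_finite_induct)
  case (insert a A)
  then have "polyfun (\<Sum>i\<in>A. f i)" "(\<Sum>i\<in>A. f i) 0 = 0" by (auto intro!: polyfun_sum simp: sum_fun_apply)
  then show ?case using insert by (simp add: T_add)
qed auto

lemma G_closed:
  shows G_zero: "0 \<in> G" and G_add: "x \<in> G \<Longrightarrow> y \<in> G \<Longrightarrow> x + y \<in> G"
    and G_neg: "x \<in> G \<Longrightarrow> - x \<in> G" and G_diff: "x \<in> G \<Longrightarrow> y \<in> G \<Longrightarrow> x - y \<in> G"
  using G unfolding add_subgroup_def by (blast, blast, blast, metis add_uminus_conv_diff)

section \<open>Annihilator ideals of weight spaces\<close>

definition VA :: "('a ^ 'n) set \<Rightarrow> 'v set" where
  "VA A = span (\<Union>a\<in>A. Vg a)"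

text \<open>A finite set of degrees carrying u. Annihilators are taken on whole weight spaces
  because \<open>T 0 h\<close> preserves these but not single vectors.\<close>

definition carr :: "('a ^ 'n) set \<Rightarrow> 'v \<Rightarrow> bool" where
  "carr A u \<longleftrightarrow> finite A \<and> A \<noteq> {} \<and> A \<subseteq> G \<and> u \<in> VA A"

lemma VA_mono: "A \<subseteq> B \<Longrightarrow> VA A \<subseteq> VA B"
  unfolding VA_def by (intro span_mono) auto

lemma carr_mono: "carr A u \<Longrightarrow> A \<subseteq> B \<Longrightarrow> finite B \<Longrightarrow> B \<subseteq> G \<Longrightarrow> carr B u"
  using VA_mono[of A B] by (auto simp: carr_def)

lemma carr_exists: "\<exists>A. carr A u"
proof -
  have "\<exists>!f. (\<forall>\<beta>. \<beta> \<notin> G \<longrightarrow> f \<beta> = 0) \<and> finite {\<beta>. f \<beta> \<noteq> 0} \<and>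
      (\<forall>\<beta>\<in>G. f \<beta> \<in> Vg \<beta>) \<and> u = (\<Sum>\<beta>\<in>{\<beta>. f \<beta> \<noteq> 0}. f \<beta>)"
    using grading unfolding qf_grading_def by blast
  from ex1_implies_ex[OF this] obtain f where f: "\<forall>\<beta>. \<beta> \<notin> G \<longrightarrow> f \<beta> = 0" "finite {\<beta>. f \<beta> \<noteq> 0}" "\<forall>\<beta>\<in>G. f \<beta> \<in> Vg \<beta>" "u = (\<Sum>\<beta>\<in>{\<beta>. f \<beta> \<noteq> 0}. f \<beta>)"
    by (elim exE conjE) rule
  have "u \<in> VA (insert 0 {\<beta>. f \<beta> \<noteq> 0})" unfolding f(4) VA_def
    using f by (intro span_sum span_base) blast
  then show ?thesis using f G_zero unfolding carr_def by (intro exI[of _ "insert 0 {\<beta>. f \<beta> \<noteq> 0}"]) blast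
qed

lemma carr_Vg: "a \<in> G \<Longrightarrow> u \<in> Vg a \<Longrightarrow> carr {a} u"
  by (auto simp: carr_def VA_def intro: span_base)

lemma carr_T:
  assumes u: "carr A u" and f: "polyfun f" "f 0 = 0" and k: "k \<in> G"
  shows "carr ((+) k ` A) (T k f u)"
proof -
  have "T k f u \<in> VA ((+) k ` A)" if "u \<in> VA A" for u
    using that unfolding VA_def
  proof (induction rule: span_induct_alt)
    case base
    then show ?case using f by (simp add: span_zero)
  next
    case (step c x y)
    then obtain a where "a \<in> A" "x \<in> Vg a" by blast
    then have "T k f x \<in> Vg (k + a)" using T_grade[OF f k, of a x] u by (auto simp: carr_def add.commute)
    then have "T k f x \<in> span (\<Union> (Vg ` (+) k ` A))" using \<open>a \<in> A\<close> by (intro span_base) auto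
    then show ?case using step f by (simp add: T_vadd T_vscale span_add span_scale)
  qed
  then show ?thesis using u k G_add by (auto simp: carr_def)
qed

text \<open>Only polynomials vanishing at 0 belong to the algebra, so 0 is a zero of every such
  annihilator.\<close>

definition II :: "('a ^ 'n) set \<Rightarrow> 'a ^ 'n \<Rightarrow> ('a ^ 'n \<Rightarrow> 'a) set" where
  "II A k = {f. polyfun f \<and> f 0 = 0 \<and> (\<forall>a\<in>A. \<forall>u\<in>Vg a. T k f u = 0)}"

lemma II_mono: "A \<subseteq> B \<Longrightarrow> II B k \<subseteq> II A k"
  by (auto simp: II_def)

lemma II_kills: "f \<in> II A k \<Longrightarrow> u \<in> VA A \<Longrightarrow> T k f u = 0"
proof -
  assume f: "f \<in> II A k" and "u \<in> VA A"
  from \<open>u \<in> VA A\<close> show ?thesis unfolding VA_def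
  proof (induction rule: span_induct_alt)
    case (step c x y)
    then show ?case using f by (auto simp: II_def T_vadd T_vscale)
  qed (use f in \<open>auto simp: II_def\<close>)
qed

lemma T0_shift:
  assumes "polyfun f" "f 0 = 0" "polyfun h" "h 0 = 0" "k \<in> G"
  shows "T 0 h (T k f u) - T k f (T 0 h u) = T k ((sh k h - h) * f) u"
  using T_bracket[OF assms(3,4,1,2) G_zero assms(5)] by (simp add: algebra_simps)

text \<open>By \<open>T0_shift\<close> the annihilator is closed under multiplication by the
  differences \<open>sh k h - h\<close>, and these generate all polynomials.\<close>

lemma pideal_II:
  assumes "k \<noteq> 0" "A \<subseteq> G" shows "pideal (II A k)"
proof (rule pidealI)
  show "0 \<in> II A k" by (auto simp: II_def zero_fun_apply)
  show "f + g \<in> II A k" if "f \<in> II A k" "g \<in> II A k" for f g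
    using that by (auto simp: II_def T_add pointwise)
  fix f h :: "'a ^ 'n \<Rightarrow> 'a" assume f: "f \<in> II A k" and h: "polyfun h"
  have "\<forall>f\<in>II A k. h * f \<in> II A k"
  proof (rule polyfun_generated_by_differences[OF assms(1) h, where Q = "\<lambda>h. \<forall>f\<in>II A k. h * f \<in> II A k"])
    show "\<forall>f\<in>II A k. cst c * f \<in> II A k" for c by (auto simp: II_def T_scale pointwise)
  next
    fix g h assume "\<forall>f\<in>II A k. g * f \<in> II A k" "\<forall>f\<in>II A k. h * f \<in> II A k"
    then show "\<forall>f\<in>II A k. (g + h) * f \<in> II A k" "\<forall>f\<in>II A k. (g * h) * f \<in> II A k"
      by (auto simp: II_def T_add pointwise distrib_right mult.assoc)
  next
    fix h :: "'a ^ 'n \<Rightarrow> 'a" assume h: "polyfun h" "h 0 = 0"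
    show "\<forall>f\<in>II A k. (sh k h - h) * f \<in> II A k"
    proof
      fix f assume f: "f \<in> II A k"
      then have pf: "polyfun f" "f 0 = 0" by (auto simp: II_def)
      have "T k ((sh k h - h) * f) u = 0" if u: "a \<in> A" "u \<in> Vg a" for a u
      proof (cases "k \<in> G")
        case True
        have "T 0 h u \<in> Vg a" using T_grade[OF h G_zero, of a u] assms u by auto
        then have "T k f (T 0 h u) = 0" "T k f u = 0" using f u by (auto simp: II_def)
        then show ?thesis using T0_shift[OF pf h True, of u] h by simp
      qed (use T_off in simp)
      then show "(sh k h - h) * f \<in> II A k" using pf h by (auto simp: II_def pointwise)
    qed
  qed
  then show "h * f \<in> II A k" using f by blast
qed (simp add: II_def)

text \<open>In coordinate i, p is sent to the operator of \<open>X p(X)\<close> restricted to finite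
  bases of the weight spaces in A. The values lie in a finite-dimensional space, spanned by the maps
  \<open>single b s\<close>, so some nonzero p acts by zero. The factor X provides the vanishing at
  0.\<close>

lemma cofinite_II:
  assumes "k \<noteq> 0" "finite A" "A \<subseteq> G" shows "cofinite_ideal (II A k)"
  unfolding cofinite_ideal_def
proof (intro conjI allI pideal_II assms)
  fix i
  show "\<exists>p. p \<noteq> 0 \<and> upoly p i \<in> II A k"
  proof (cases "k \<in> G")
    case False
    have "upoly [:0, 1:] i \<in> II A k" using T_off[OF False] by (auto simp: II_def pointwise)
    then show ?thesis by (intro exI[of _ "[:0, 1:]"]) auto
  next
    case True
    have "\<exists>B. finite B \<and> B \<subseteq> Vg a \<and> Vg a \<subseteq> span B" if aG: "a \<in> G" for a
    proof -
      obtain B where B: "B \<subseteq> Vg a" "independent B" "Vg a \<subseteq> span B" using basis_exists[of "Vg a"] by metis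
      obtain S where "finite S" "Vg a \<subseteq> span S" using Vg_fin_dim[OF aG] by (auto simp: fin_dim_def)
      then have "finite B" using independent_span_bound[of S B] B by blast
      then show ?thesis using B by blast
    qed
    then obtain Bs where Bs: "\<And>a. a \<in> G \<Longrightarrow> finite (Bs a) \<and> Bs a \<subseteq> Vg a \<and> Vg a \<subseteq> span (Bs a)" by metis
    define B where "B = (\<Union>a\<in>A. Bs a)"
    define S where "S = (\<Union>a\<in>A. Bs (a + k))"
    have fin: "finite B" "finite S" using Bs assms True G_add unfolding B_def S_def by blast+
    define scF :: "'a \<Rightarrow> ('v \<Rightarrow> 'v) \<Rightarrow> 'v \<Rightarrow> 'v" where "scF c F = (\<lambda>u. sc c (F u))" for c F
    interpret F: vector_space scF
      by unfold_locales (auto simp: scF_def fun_eq_iff pointwise scale_right_distrib scale_left_distrib)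
    define g where "g p = upoly ([:0, 1:] * p) i" for p :: "'a poly"
    have g: "polyfun (g p)" "g p 0 = 0" for p unfolding g_def by (auto simp: pointwise)
    have gadd: "g (p + q) = g p + g q" and gs: "g (smult c p) = cst c * g p" for p q c
      by (auto simp: g_def fun_eq_iff pointwise algebra_simps)
    define L where "L p = (\<lambda>u. if u \<in> B then T k (g p) u else 0)" for p
    define single where "single b s = (\<lambda>u. if u = b then s else 0)" for b s :: 'v
    have sp: "single b s \<in> F.span ((\<lambda>(b, s). single b s) ` (B \<times> S))" if "s \<in> span S" "b \<in> B" for b s
      using that(1)
    proof (induction rule: span_induct_alt)
      case base
      have "single b 0 = 0" by (auto simp: single_def fun_eq_iff pointwise)
      then show ?case by (metis F.span_zero)
    next
      case (step c x y)
      have "single b (sc c x + y) = scF c (single b x) + single b y"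
        by (auto simp: single_def scF_def fun_eq_iff pointwise)
      moreover have "single b x \<in> F.span ((\<lambda>(b, s). single b s) ` (B \<times> S))"
        using step that(2) by (intro F.span_base) auto
      ultimately show ?case using step F.span_add F.span_scale by metis
    qed
    have "L p \<in> F.span ((\<lambda>(b, s). single b s) ` (B \<times> S))" for p
    proof -
      have Tb: "T k (g p) b \<in> span S" if bB: "b \<in> B" for b
      proof -
        obtain a where a: "a \<in> A" "b \<in> Vg a" using bB Bs assms unfolding B_def by blast
        then have "T k (g p) b \<in> Vg (a + k)" using T_grade[OF g True] assms by blast
        moreover have "a + k \<in> G" using a assms True G_add by blast
        moreover have "span (Bs (a + k)) \<subseteq> span S" using a unfolding S_def by (intro span_mono) auto
        ultimately show ?thesis using Bs by blast
      qed
      have "L p = (\<Sum>b\<in>B. single b (T k (g p) b))"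
        using fin by (auto simp: L_def single_def fun_eq_iff sum_fun_apply)
      then show ?thesis using sp[OF Tb] by (simp add: F.span_sum)
    qed
    moreover have "L (p + q) = L p + L q" for p q
      using g by (auto simp: L_def fun_eq_iff pointwise gadd T_add)
    moreover have "L (smult c p) = scF c (L p)" for p c
      using g by (auto simp: L_def fun_eq_iff scF_def gs T_scale)
    ultimately obtain p where p: "p \<noteq> 0" "L p = 0"
      using F.poly_kernel[of "(\<lambda>(b, s). single b s) ` (B \<times> S)" L] fin by blast
    have "T k (g p) u = 0" if "a \<in> A" "u \<in> Vg a" for a u
    proof -
      have "u \<in> span (Bs a)" using that Bs assms by blast
      then show ?thesis
      proof (induction rule: span_induct_alt)
        case (step c x y)
        have "x \<in> B" using step that by (auto simp: B_def)
        then have "T k (g p) x = 0" using fun_cong[OF p(2), of x] by (simp add: L_def pointwise)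
        then show ?case using step g by (simp add: T_vadd T_vscale)
      qed (use g in simp)
    qed
    then have "g p \<in> II A k" using g by (auto simp: II_def)
    then show ?thesis using p unfolding g_def by (intro exI[of _ "[:0, 1:] * p"]) auto
  qed
qed

text \<open>f is moved to the local coordinate at x and cut off by the idempotent there. The
  idempotent depends on the degrees carrying u, hence the choice for each u; \<open>E_eq\<close>
  shows that the choice does not matter.\<close>

definition E :: "'a ^ 'n \<Rightarrow> 'a ^ 'n \<Rightarrow> ('a ^ 'n \<Rightarrow> 'a) \<Rightarrow> 'v \<Rightarrow> 'v" where
  "E y x f u = T (y - x) (sh (- x) f * (SOME d. isdelta (II (SOME A. carr A u) (y - x)) x d)) u"

text \<open>For \<open>x \<noteq> 0\<close> the idempotent itself vanishes at 0, because the members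
  of the annihilator do. For \<open>x = 0\<close> the condition is supplied by
  \<open>ad True\<close>.\<close>

lemma local_vanishes_at_0:
  assumes d: "isdelta J x d" "J \<subseteq> II A k" and f: "ad True y x f"
  shows "polyfun (sh (- x) f * d) \<and> (sh (- x) f * d) 0 = 0"
proof (cases "x = 0")
  case True
  then show ?thesis using f d by (auto simp: ad_def pointwise isdelta_def)
next
  case False
  then obtain i where i: "x $ i \<noteq> 0" by (auto simp: vec_eq_iff)
  obtain N where "lin i (x $ i) ^ N * d \<in> II A k" using d unfolding isdelta_def by blast
  then have "d 0 = 0" using i by (auto simp: II_def pointwise)
  then show ?thesis using f d by (auto simp: ad_def pointwise isdelta_def)
qed

lemma II_vanish: "f \<in> II A k \<Longrightarrow> polyfun f \<and> f 0 = 0"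
  by (simp add: II_def)

lemma T_cong_mod:
  assumes "f - g \<in> II A k" "polyfun g" "g 0 = 0" "carr A u" shows "T k f u = T k g u"
proof -
  have fg: "f = (f - g) + g" by simp
  have "T k f u = T k (f - g) u + T k g u"
    by (subst fg) (rule T_add; use assms II_vanish in blast)
  then show ?thesis using II_kills[OF assms(1)] assms(4) by (simp add: carr_def)
qed

text \<open>Any two choices are compared with an idempotent for the union of the two carriers, which
  serves for both.\<close>

lemma E_eq:
  assumes u: "carr A u" and d: "isdelta J x d" "J \<subseteq> II A (y - x)" and f: "ad True y x f" and yx: "y \<noteq> x"
  shows "E y x f u = T (y - x) (sh (- x) f * d) u"
proof -
  let ?k = "y - x"
  have k: "?k \<noteq> 0" using yx by simp
  have pf: "polyfun (sh (- x) f)" using f by (auto simp: ad_def)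
  have *: "T ?k (sh (- x) f * d) u = T ?k (sh (- x) f * d') u"
    if u: "carr A u" and d: "isdelta (II A ?k) x d" "isdelta (II A ?k) x d'" for A d d'
  proof (rule T_cong_mod[OF _ _ _ u])
    have J: "pideal (II A ?k)" using pideal_II[OF k] u by (auto simp: carr_def)
    have "sh (- x) f * (d - d') \<in> II A ?k" using pideal_mult[OF J isdelta_unique[OF J d] pf] .
    then show "sh (- x) f * d - sh (- x) f * d' \<in> II A ?k" by (simp add: algebra_simps)
  qed (use local_vanishes_at_0[OF d(2) subset_refl f] in auto)
  define A0 where "A0 = (SOME A. carr A u)"
  have A0: "carr A0 u" unfolding A0_def by (rule someI_ex[OF carr_exists])
  define d0 where "d0 = (SOME d. isdelta (II A0 ?k) x d)"
  have d0: "isdelta (II A0 ?k) x d0" unfolding d0_def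
    by (rule someI_ex[of "isdelta (II A0 ?k) x"], rule isdelta_exists, rule cofinite_II[OF k])
      (use A0 in \<open>auto simp: carr_def\<close>)
  obtain d1 where d1: "isdelta (II (A \<union> A0) ?k) x d1"
    using isdelta_exists[OF cofinite_II[OF k, of "A \<union> A0"], of x] A0 u unfolding carr_def by blast
  have "E y x f u = T ?k (sh (- x) f * d0) u" by (simp add: E_def A0_def d0_def)
  also have "\<dots> = T ?k (sh (- x) f * d1) u"
    by (rule *[OF A0 d0]) (rule isdelta_mono[OF d1], rule II_mono, simp)
  also have "\<dots> = T ?k (sh (- x) f * d) u"
    by (rule *[OF u]) (rule isdelta_mono[OF d1], rule II_mono, simp, rule isdelta_mono[OF d])
  finally show ?thesis .
qed

end

section \<open>Relations of the local parts\<close>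

context Tsys
begin

lemma E_eq_II:
  assumes "carr A u" "isdelta (II A (y - x)) x d" "ad True y x f" "y \<noteq> x"
  shows "E y x f u = T (y - x) (sh (- x) f * d) u"
  using E_eq[OF assms(1,2) subset_refl assms(3,4)] .

lemma E_off: "y - x \<notin> G \<Longrightarrow> E y x f u = 0"
  by (simp add: E_def T_off)

lemma delta_exists: "k \<noteq> 0 \<Longrightarrow> carr A u \<Longrightarrow> \<exists>d. isdelta (II A k) x d"
  using isdelta_exists[OF cofinite_II] by (auto simp: carr_def)

lemma common_carr: "carr A u \<Longrightarrow> carr B v \<Longrightarrow> carr (A \<union> B) u \<and> carr (A \<union> B) v"
  using carr_mono[of A u "A \<union> B"] carr_mono[of B v "A \<union> B"] by (auto simp: carr_def)

lemma carr_add: "carr A u \<Longrightarrow> carr A v \<Longrightarrow> carr A (u + v)"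
  and carr_scale: "carr A u \<Longrightarrow> carr A (sc c u)"
  by (auto simp: carr_def VA_def span_add span_scale)

lemma E_linear:
  assumes yx: "y \<noteq> x" and f: "ad True y x f" shows "Vector_Spaces.linear sc sc (E y x f)"
proof -
  have k: "y - x \<noteq> 0" using yx by simp
  have "E y x f (u + v) = E y x f u + E y x f v" for u v
  proof -
    obtain A B where "carr A u" "carr B v" using carr_exists by metis
    then have c: "carr (A \<union> B) u" "carr (A \<union> B) v" "carr (A \<union> B) (u + v)"
      using common_carr carr_add by blast+
    obtain d where d: "isdelta (II (A \<union> B) (y - x)) x d" using delta_exists[OF k c(1)] by blast
    show ?thesis using E_eq_II[OF c(1) d f yx] E_eq_II[OF c(2) d f yx] E_eq_II[OF c(3) d f yx]
        local_vanishes_at_0[OF d subset_refl f] by (simp add: T_vadd)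
  qed
  moreover have "E y x f (sc c u) = sc c (E y x f u)" for c u
  proof -
    obtain A where c: "carr A u" using carr_exists by metis
    obtain d where d: "isdelta (II A (y - x)) x d" using delta_exists[OF k c(1)] by blast
    show ?thesis using E_eq_II[OF c(1) d f yx] E_eq_II[OF carr_scale[OF c] d f yx]
        local_vanishes_at_0[OF d subset_refl f] by (simp add: T_vscale)
  qed
  ultimately show ?thesis by (simp add: Vector_Spaces.linear_iff vector_space_axioms)
qed

lemma E_add:
  assumes yx: "y \<noteq> x" and f: "ad True y x f" and g: "ad True y x g"
  shows "E y x (f + g) u = E y x f u + E y x g u"
    and "E y x (cst c * f) u = sc c (E y x f u)"
proof -
  have k: "y - x \<noteq> 0" using yx by simp
  obtain A where u: "carr A u" using carr_exists by metis
  obtain d where d: "isdelta (II A (y - x)) x d" using delta_exists[OF k u] by blast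
  have fg: "ad True y x (f + g)" "ad True y x (cst c * f)" using f g by (auto simp: ad_def pointwise)
  note v = local_vanishes_at_0[OF d subset_refl f] local_vanishes_at_0[OF d subset_refl g]
  show "E y x (f + g) u = E y x f u + E y x g u"
    using E_eq_II[OF u d f yx] E_eq_II[OF u d g yx] E_eq_II[OF u d fg(1) yx] v
    by (simp add: sh_add distrib_right T_add)
  show "E y x (cst c * f) u = sc c (E y x f u)"
    using E_eq_II[OF u d f yx] E_eq_II[OF u d fg(2) yx] v
    by (simp add: sh_mult sh_cst mult.assoc T_scale)
qed

lemma bracket_formula:
  assumes "polyfun f" "f 0 = 0" "polyfun g" "g 0 = 0" "k \<in> G" "l \<in> G" "k + l \<noteq> 0"
  shows "T k f (T l g u) = T l g (T k f u) + T (k + l) (sh l f * g) u - T (k + l) (f * sh k g) u"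
proof -
  have "polyfun (sh l f * g)" "(sh l f * g) 0 = 0" "polyfun (f * sh k g)" "(f * sh k g) 0 = 0"
    using assms by (auto simp: pointwise)
  then show ?thesis using T_bracket[OF assms(1-6), of u] assms(7) by (simp add: T_minus algebra_simps)
qed

lemma E_comp:
  assumes ne: "x \<noteq> y" "y \<noteq> z" "x \<noteq> z" and G2: "y - x \<in> G" "z - y \<in> G" and f: "ad True y x f" and g: "ad True z y g"
  shows "E z y g (E y x f u) = E y x f (E z y g u) + E z x (f * g) u"
proof -
  define k l where "k = y - x" and "l = z - y"
  have kl: "k \<in> G" "l \<in> G" "k \<noteq> 0" "l \<noteq> 0" "k + l \<noteq> 0" "k + l = z - x"
    using ne G2 by (auto simp: k_def l_def)
  obtain A where u: "carr A u" using carr_exists by metis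
  \<comment> \<open>These are the degrees of u and of both intermediate vectors.\<close>
  define A' where "A' = A \<union> (+) k ` A \<union> (+) l ` A"
  have A: "A \<subseteq> G" "A \<noteq> {}" "finite A" using u by (auto simp: carr_def)
  then have fA': "finite A'" "A' \<subseteq> G" using kl G_add by (auto simp: A'_def)
  have u': "carr A' u" by (rule carr_mono[OF u _ fA']) (auto simp: A'_def)
  define J where "J = II A (k + l)"
  have coJ: "cofinite_ideal J" unfolding J_def using cofinite_II[OF kl(5)] A by auto
  then have J: "pideal J" by (simp add: cofinite_ideal_def)
  \<comment> \<open>Besides cutting out its own move, each idempotent has to stay one modulo J after
    the shift that the bracket applies to it.\<close>
  define Jx where "Jx = II A' k \<inter> J \<inter> {h. polyfun h \<and> sh l h \<in> J}"
  define Jy where "Jy = II A' l \<inter> J \<inter> {h. polyfun h \<and> sh k h \<in> J}"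
  have "cofinite_ideal Jx" "cofinite_ideal Jy" unfolding Jx_def Jy_def
    using cofinite_II fA' kl coJ by (auto intro!: cofinite_Int cofinite_shift)
  then obtain dx dy where dx: "isdelta Jx x dx" and dy: "isdelta Jy y dy" using isdelta_exists by metis
  have "isdelta (II A' (y - x)) x dx" "isdelta (II A' (z - y)) y dy"
    using isdelta_mono[OF dx, of "II A' k"] isdelta_mono[OF dy, of "II A' l"]
    unfolding Jx_def Jy_def k_def l_def by auto
  note d' = this
  have Jx: "isdelta J x dx" "isdelta J (x - l) (sh l dx)"
    using isdelta_mono[OF dx, of J] isdelta_shift[OF isdelta_mono[OF dx, of "{h. polyfun h \<and> sh l h \<in> J}"]]
    unfolding Jx_def by auto
  have Jy: "isdelta J y dy" "isdelta J (y - k) (sh k dy)"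
    using isdelta_mono[OF dy, of J] isdelta_shift[OF isdelta_mono[OF dy, of "{h. polyfun h \<and> sh k h \<in> J}"]]
    unfolding Jy_def by auto
  have pf: "polyfun f" "polyfun g" using f g by (auto simp: ad_def)
  define fx gy where "fx = sh (- x) f * dx" and "gy = sh (- y) g * dy"
  have fx: "polyfun fx" "fx 0 = 0" and gy: "polyfun gy" "gy 0 = 0" unfolding fx_def gy_def
    using local_vanishes_at_0[OF d'(1) subset_refl f] local_vanishes_at_0[OF d'(2) subset_refl g] by auto
  have Ef: "E y x f v = T k fx v" if "carr A' v" for v
    using E_eq_II[OF that d'(1) f] ne by (simp add: k_def fx_def)
  have Eg: "E z y g v = T l gy v" if "carr A' v" for v
    using E_eq_II[OF that d'(2) g] ne by (simp add: l_def gy_def)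
  have uk: "carr A' (T k fx u)" "carr A' (T l gy u)"
    by (rule carr_mono[OF carr_T[OF u fx kl(1)] _ fA'], simp add: A'_def le_supI1)
      (rule carr_mono[OF carr_T[OF u gy kl(2)] _ fA'], simp add: A'_def le_supI1)
  have fg: "ad True z x (f * g)" using f g by (auto simp: ad_def pointwise)
  \<comment> \<open>Shifted by k, the idempotent at y becomes one at x, so this term of the bracket
    is the local operator from x to z.\<close>
  have "y - k = x" by (simp add: k_def)
  then have dd: "isdelta J x (sh k dy * dx)" using isdelta_mult[OF J] Jx Jy by metis
  have "sh k gy * fx = sh (- x) (f * g) * (sh k dy * dx)"
  proof -
    have "sh k (sh (- y) g) = sh (- x) g" by (simp add: sh_sh k_def)
    then show ?thesis by (simp add: fx_def gy_def sh_mult mult_ac)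
  qed
  then have 1: "T (l + k) (sh k gy * fx) u = E z x (f * g) u"
    using E_eq_II[OF u dd[unfolded J_def kl(6)] fg] ne kl(6) by (simp add: add.commute)
  \<comment> \<open>In the other term the idempotents sit at \<open>x - l\<close> and y, which
    differ because \<open>x \<noteq> z\<close>; their product lies in J.\<close>
  have "x - l \<noteq> y" using ne by (auto simp: l_def algebra_simps)
  then have "sh l dx * dy \<in> J" using isdelta_orthogonal[OF J Jx(2) Jy(1)] by blast
  then have "(sh (- y) g * sh l (sh (- x) f)) * (sh l dx * dy) \<in> J"
    by (rule pideal_mult[OF J]) (use pf in auto)
  then have "gy * sh l fx \<in> J" by (simp add: fx_def gy_def sh_mult mult_ac)
  then have 2: "T (l + k) (gy * sh l fx) u = 0"
    using II_kills u by (simp add: J_def carr_def add.commute)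
  have "T l gy (T k fx u) = T k fx (T l gy u) + T (l + k) (sh k gy * fx) u - T (l + k) (gy * sh l fx) u"
    by (rule bracket_formula) (use fx gy kl in \<open>auto simp: add.commute\<close>)
  then show ?thesis using 1 2 Ef[OF u'] Eg[OF u'] Ef[OF uk(2)] Eg[OF uk(1)] by simp
qed

text \<open>On components of opposite degree the bracket involves \<open>T 0\<close>, where no ideal is available. Instead a
  factor can be moved from one entry to the other by the Jacobi identity.\<close>

lemma bracket_opposite_balanced:
  assumes k: "k \<in> G" "k \<noteq> 0" and q: "polyfun q"
  shows "\<forall>f g u. polyfun f \<longrightarrow> f 0 = 0 \<longrightarrow> polyfun g \<longrightarrow> g 0 = 0 \<longrightarrow>
    T k (q * f) (T (- k) g u) - T (- k) g (T k (q * f) u) =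
    T k f (T (- k) (sh (- k) q * g) u) - T (- k) (sh (- k) q * g) (T k f u)"
proof -
  define B where "B f g u = T k f (T (- k) g u) - T (- k) g (T k f u)" for f g u
  define Q where "Q q \<longleftrightarrow> (\<forall>f g u. polyfun f \<longrightarrow> f 0 = 0 \<longrightarrow> polyfun g \<longrightarrow> g 0 = 0 \<longrightarrow>
    B (q * f) g u = B f (sh (- k) q * g) u)" for q
  have "Q q"
  proof (rule polyfun_generated_by_differences[OF k(2) q])
    show "Q (cst c)" for c
      by (auto simp: Q_def B_def T_scale T_vscale sh_cst)
  next
    fix p q :: "'a ^ 'n \<Rightarrow> 'a" assume *: "polyfun p" "polyfun q" "Q p" "Q q"
    show "Q (p + q)" unfolding Q_def
    proof (intro allI impI)
      fix f g :: "'a ^ 'n \<Rightarrow> 'a" and u assume fg: "polyfun f" "f 0 = 0" "polyfun g" "g 0 = 0"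
      have "B ((p + q) * f) g u = B (p * f) g u + B (q * f) g u"
        using fg * by (simp add: B_def distrib_right T_add T_vadd pointwise)
      also have "\<dots> = B f (sh (- k) p * g) u + B f (sh (- k) q * g) u"
        using *(3,4) fg unfolding Q_def by simp
      also have "\<dots> = B f (sh (- k) (p + q) * g) u"
        using fg * by (simp add: B_def sh_add distrib_right T_add T_vadd pointwise)
      finally show "B ((p + q) * f) g u = B f (sh (- k) (p + q) * g) u" .
    qed
    show "Q (p * q)" unfolding Q_def
    proof (intro allI impI)
      fix f g :: "'a ^ 'n \<Rightarrow> 'a" and u assume fg: "polyfun f" "f 0 = 0" "polyfun g" "g 0 = 0"
      have "B (p * (q * f)) g u = B (q * f) (sh (- k) p * g) u"
        using *(2,3) fg unfolding Q_def by (simp add: pointwise)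
      also have "\<dots> = B f (sh (- k) q * (sh (- k) p * g)) u"
        using *(1,4) fg unfolding Q_def by (simp add: pointwise)
      finally show "B (p * q * f) g u = B f (sh (- k) (p * q) * g) u" by (simp add: sh_mult mult_ac)
    qed
  next
    fix h :: "'a ^ 'n \<Rightarrow> 'a" assume h: "polyfun h" "h 0 = 0"
    show "Q (sh k h - h)" unfolding Q_def
    proof (intro allI impI)
      fix f g :: "'a ^ 'n \<Rightarrow> 'a" and u assume fg: "polyfun f" "f 0 = 0" "polyfun g" "g 0 = 0"
      define D where "D = sh k h - h"
      have pD: "polyfun D" using h by (simp add: D_def)
      have Dg: "(sh (- k) h - h) * g = - (sh (- k) D * g)"
        by (auto simp: D_def fun_eq_iff pointwise algebra_simps)
      have 1: "T 0 h (T k f v) = T k f (T 0 h v) + T k (D * f) v" for v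
        using T0_shift[OF fg(1,2) h k(1), of v] unfolding D_def by (simp add: algebra_simps)
      have "polyfun (sh (- k) D * g)" "(sh (- k) D * g) 0 = 0" using fg pD by (auto simp: pointwise)
      then have 2: "T 0 h (T (- k) g v) = T (- k) g (T 0 h v) - T (- k) (sh (- k) D * g) v" for v
        using T0_shift[OF fg(3,4) h G_neg[OF k(1)], of v] unfolding Dg by (simp add: T_uminus algebra_simps)
      obtain s where s: "\<And>u. B f g u = T 0 (sh (- k) f * g - f * sh k g) u + sc s u"
        using T_bracket_opposite[OF fg k(1)] unfolding B_def by blast
      define P where "P = sh (- k) f * g - f * sh k g"
      have P: "polyfun P" "P 0 = 0" using fg by (auto simp: P_def pointwise)
      \<comment> \<open>The opposite bracket is \<open>T 0 P\<close> plus a scalar, so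
        \<open>T 0 h\<close> commutes with it. By the Leibniz rule the two changes of its entries
        cancel, which is the claim for a difference \<open>sh k h - h\<close>.\<close>
      have "T 0 h (T 0 P u) = T 0 P (T 0 h u)"
        using T_bracket[OF h P G_zero G_zero, of u] by (simp add: mult.commute)
      then have comm: "T 0 h (B f g u) = B f g (T 0 h u)"
        unfolding s P_def[symmetric] using h by (simp add: T_vadd T_vscale)
      have Tm: "T c e (x - y) = T c e x - T c e y" if "polyfun e" "e 0 = 0" for c e x y
        using T_vadd[OF that, of c "x - y" y] by simp
      have e: "polyfun (D * f)" "(D * f) 0 = 0" "polyfun (sh (- k) D * g)" "(sh (- k) D * g) 0 = 0"
        using fg pD by (auto simp: pointwise)
      have "T 0 h (B f g u) = B f g (T 0 h u) + B (D * f) g u - B f (sh (- k) D * g) u"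
        unfolding B_def using fg h e by (simp add: 1 2 T_vadd Tm algebra_simps)
      then show "B ((sh k h - h) * f) g u = B f (sh (- k) (sh k h - h) * g) u"
        using comm unfolding D_def by simp
    qed
  qed
  then show ?thesis by (simp add: Q_def B_def)
qed

lemma E_commute:
  assumes ne: "y \<noteq> x" "w \<noteq> z" "y \<noteq> z" "x \<noteq> w" and f: "ad True y x f" and g: "ad True w z g"
  shows "E y x f (E w z g u) = E w z g (E y x f u)"
proof (cases "y - x \<in> G \<and> w - z \<in> G")
  case False
  have "E y x f 0 = 0" "E w z g 0 = 0"
    using E_linear[OF ne(1) f] E_linear[OF ne(2) g] unfolding Vector_Spaces.linear_iff by (metis scale_zero_left)+
  then show ?thesis using False E_off by auto
next
  case True
  define k l where "k = y - x" and "l = w - z"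
  have kl: "k \<in> G" "l \<in> G" "k \<noteq> 0" "l \<noteq> 0" using ne True by (auto simp: k_def l_def)
  obtain A where u: "carr A u" using carr_exists by metis
  define A' where "A' = A \<union> (+) k ` A \<union> (+) l ` A"
  have A: "A \<subseteq> G" "A \<noteq> {}" "finite A" using u by (auto simp: carr_def)
  then have fA': "finite A'" "A' \<subseteq> G" using kl G_add by (auto simp: A'_def)
  have u': "carr A' u" by (rule carr_mono[OF u _ fA']) (auto simp: A'_def)
  \<comment> \<open>In opposite degrees the bracket itself has no annihilator ideal to work with,
    and the ideal of the second factor takes its place.\<close>
  define J where "J = (if k + l = 0 then II A' l else II A (k + l))"
  have coJ: "cofinite_ideal J" unfolding J_def using cofinite_II kl A fA' by auto
  then have J: "pideal J" by (simp add: cofinite_ideal_def)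
  define Jx where "Jx = II A' k \<inter> J \<inter> {h. polyfun h \<and> sh l h \<in> J}"
  define Jz where "Jz = II A' l \<inter> J \<inter> {h. polyfun h \<and> sh k h \<in> J}"
  have "cofinite_ideal Jx" "cofinite_ideal Jz" unfolding Jx_def Jz_def
    using cofinite_II fA' kl coJ by (auto intro!: cofinite_Int cofinite_shift)
  then obtain dx dz where dx: "isdelta Jx x dx" and dz: "isdelta Jz z dz" using isdelta_exists by metis
  have d': "isdelta (II A' (y - x)) x dx" "isdelta (II A' (w - z)) z dz"
    using isdelta_mono[OF dx, of "II A' k"] isdelta_mono[OF dz, of "II A' l"]
    unfolding Jx_def Jz_def k_def l_def by auto
  have Jx: "isdelta J x dx" "isdelta J (x - l) (sh l dx)"
    using isdelta_mono[OF dx, of J] isdelta_shift[OF isdelta_mono[OF dx, of "{h. polyfun h \<and> sh l h \<in> J}"]]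
    unfolding Jx_def by auto
  have Jz: "isdelta J z dz" "isdelta J (z - k) (sh k dz)"
    using isdelta_mono[OF dz, of J] isdelta_shift[OF isdelta_mono[OF dz, of "{h. polyfun h \<and> sh k h \<in> J}"]]
    unfolding Jz_def by auto
  have pf: "polyfun f" "polyfun g" using f g by (auto simp: ad_def)
  define fx gz where "fx = sh (- x) f * dx" and "gz = sh (- z) g * dz"
  have fx: "polyfun fx" "fx 0 = 0" and gz: "polyfun gz" "gz 0 = 0" unfolding fx_def gz_def
    using local_vanishes_at_0[OF d'(1) subset_refl f] local_vanishes_at_0[OF d'(2) subset_refl g] by auto
  have Ef: "E y x f v = T k fx v" if "carr A' v" for v
    using E_eq_II[OF that d'(1) f] ne by (simp add: k_def fx_def)
  have Eg: "E w z g v = T l gz v" if "carr A' v" for v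
    using E_eq_II[OF that d'(2) g] ne by (simp add: l_def gz_def)
  have uk: "carr A' (T k fx u)" "carr A' (T l gz u)"
    by (rule carr_mono[OF carr_T[OF u fx kl(1)] _ fA'], simp add: A'_def le_supI1)
      (rule carr_mono[OF carr_T[OF u gz kl(2)] _ fA'], simp add: A'_def le_supI1)
  have "x - l \<noteq> z" using ne by (auto simp: l_def algebra_simps)
  then have "sh l dx * dz \<in> J" using isdelta_orthogonal[OF J Jx(2) Jz(1)] by blast
  then have o1: "(sh (- z) g * h) * (sh l dx * dz) \<in> J" if "polyfun h" for h
    by (rule pideal_mult[OF J]) (use pf that in auto)
  have "T k fx (T l gz u) = T l gz (T k fx u)"
  proof (cases "k + l = 0")
    case False
    have "sh l fx * gz \<in> J" using o1[of "sh l (sh (- x) f)"] pf by (simp add: fx_def gz_def sh_mult mult_ac)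
    then have 1: "T (k + l) (sh l fx * gz) u = 0" using II_kills u False by (simp add: J_def carr_def)
    have "x \<noteq> z - k" using ne by (auto simp: k_def algebra_simps)
    then have "dx * sh k dz \<in> J" using isdelta_orthogonal[OF J Jx(1) Jz(2)] by blast
    then have "(sh (- x) f * sh k (sh (- z) g)) * (dx * sh k dz) \<in> J"
      by (rule pideal_mult[OF J]) (use pf in auto)
    then have "fx * sh k gz \<in> J" by (simp add: fx_def gz_def sh_mult mult_ac)
    then have 2: "T (k + l) (fx * sh k gz) u = 0" using II_kills u False by (simp add: J_def carr_def)
    show ?thesis using bracket_formula[OF fx gz kl(1,2) False, of u] 1 2 by simp
  next
    \<comment> \<open>fx absorbs one more factor dx, which is handed to the other entry. There it
      becomes an idempotent at \<open>x - l\<close>, orthogonal to the one at z.\<close>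
    case True
    then have lk: "l = - k" by (simp add: eq_neg_iff_add_eq_0 add.commute)
    have pI: "pideal (II A' k)" by (rule pideal_II) (use kl fA' in auto)
    have "sh (- x) f * (dx * (1 - dx)) \<in> II A' k"
      using pideal_mult[OF pI isdelta_absorb[OF pI d'(1)[folded k_def] d'(1)[folded k_def]]] pf by blast
    then have "fx - dx * fx \<in> II A' k" by (simp add: fx_def algebra_simps)
    moreover have pdx: "polyfun dx" using dx by (simp add: isdelta_def)
    ultimately have r: "T k fx v = T k (dx * fx) v" if "carr A' v" for v
      using T_cong_mod[OF _ _ _ that] fx by (simp add: pointwise)
    have "sh l dx * gz \<in> II A' l" using o1[of 1] True by (simp add: J_def gz_def mult_ac)
    then have z: "T l (sh l dx * gz) v = 0" if "carr A' v" for v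
      using II_kills that by (simp add: carr_def)
    have fkx: "carr A' (T k fx u)" by (rule uk)
    have "T k (dx * fx) (T l gz u) - T l gz (T k (dx * fx) u) =
        T k fx (T l (sh l dx * gz) u) - T l (sh l dx * gz) (T k fx u)"
      using bracket_opposite_balanced[OF kl(1,3) pdx] fx gz unfolding lk by blast
    also have "\<dots> = 0" using z[OF u'] z[OF fkx] fx by simp
    finally show ?thesis using r[OF u'] r[OF uk(2)] by simp
  qed
  then show ?thesis using Ef[OF u'] Eg[OF u'] Ef[OF uk(2)] Eg[OF uk(1)] by simp
qed

sublocale gl: glsys sc G Vg E "T 0" True
proof (intro glsys.intro glsys_axioms.intro)
  show "vector_space sc" by (rule vector_space_axioms)
  show "add_subgroup G" by (rule G)
next
  fix a assume "a \<in> G"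
  then show "fin_dim sc (Vg a)" "subspace (Vg a)" by (rule Vg_fin_dim Vg_subspace)+
next
  fix y x :: "'a^'n" and f u assume "y - x \<notin> G"
  then show "E y x f u = 0" by (rule E_off)
next
  fix y x :: "'a^'n" and f assume "y \<noteq> x" "ad True y x f"
  then show "Vector_Spaces.linear sc sc (E y x f)" by (rule E_linear)
next
  fix y x :: "'a^'n" and f g u assume "y \<noteq> x" "ad True y x f" "ad True y x g"
  then show "E y x (f + g) u = E y x f u + E y x g u" by (rule E_add)
next
  fix y x :: "'a^'n" and f c u assume "y \<noteq> x" "ad True y x f"
  then show "E y x (cst c * f) u = sc c (E y x f u)" using E_add(2) by blast
next
  fix x y z :: "'a^'n" and f g u
  assume "x \<noteq> y" "y \<noteq> z" "x \<noteq> z" "y - x \<in> G" "z - y \<in> G" "ad True y x f" "ad True z y g"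
  then show "E z y g (E y x f u) = E y x f (E z y g u) + E z x (f * g) u" by (rule E_comp)
next
  fix y x w z :: "'a^'n" and f g u
  assume "y \<noteq> x" "w \<noteq> z" "y \<noteq> z" "x \<noteq> w" "ad True y x f" "ad True w z g"
  then show "E y x f (E w z g u) = E w z g (E y x f u)" by (rule E_commute)
next
  fix y x a :: "'a^'n" and f u
  assume *: "y \<noteq> x" "ad True y x f" "y - x \<in> G" "a \<in> G" "u \<in> Vg a"
  have c: "carr {a} u" by (rule carr_Vg) (use * in auto)
  obtain d where d: "isdelta (II {a} (y - x)) x d" using delta_exists[OF _ c, of "y - x" x] * by auto
  show "E y x f u \<in> Vg (a + (y - x))"
    unfolding E_eq_II[OF c d *(2,1)] using T_grade local_vanishes_at_0[OF d subset_refl *(2)] * by blast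
next
  fix y x :: "'a^'n" and i u assume yx: "y \<noteq> x"
  obtain A where c: "carr A u" using carr_exists by metis
  obtain d where d: "isdelta (II A (y - x)) x d" using delta_exists[OF _ c, of "y - x" x] yx by auto
  obtain N where N: "lin i (x $ i) ^ N * d \<in> II A (y - x)" using d unfolding isdelta_def by blast
  have pI: "pideal (II A (y - x))" by (rule pideal_II) (use yx c in \<open>auto simp: carr_def\<close>)
  have "E y x (lin i 0 ^ N * f) u = 0" if f: "ad True y x f" for f
  proof -
    have f': "ad True y x (lin i 0 ^ N * f)" using f by (auto simp: ad_def pointwise)
    have "sh (- x) f * (lin i (x $ i) ^ N * d) \<in> II A (y - x)"
      using pideal_mult[OF pI N] f by (auto simp: ad_def)
    then have "sh (- x) (lin i 0 ^ N * f) * d \<in> II A (y - x)"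
      by (simp add: sh_mult sh_power sh_lin mult_ac)
    then show ?thesis unfolding E_eq_II[OF c d f' yx] using II_kills c by (simp add: carr_def)
  qed
  then show "\<exists>N. \<forall>f. ad True y x f \<longrightarrow> E y x (lin i 0 ^ N * f) u = 0" by blast
next
  fix k :: "'a^'n" and u assume k: "k \<noteq> 0"
  obtain A where c: "carr A u" using carr_exists by metis
  have co: "cofinite_ideal (II A k)" using cofinite_II[OF k] c by (auto simp: carr_def)
  then have pI: "pideal (II A k)" by (simp add: cofinite_ideal_def)
  have "x \<in> {x. \<forall>h\<in>II A k. h x = 0}" if f: "ad True (x + k) x f" "E (x + k) x f u \<noteq> 0" for x f
  proof (rule ccontr)
    assume "x \<notin> {x. \<forall>h\<in>II A k. h x = 0}"
    then obtain h where h: "h \<in> II A k" "h x \<noteq> 0" by auto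
    obtain d where d: "isdelta (II A k) x d" using delta_exists[OF k c] by auto
    have "sh (- x) f * d \<in> II A k" using pideal_mult[OF pI isdelta_vanishes[OF pI d h]] f by (auto simp: ad_def)
    then have "T k (sh (- x) f * d) u = 0" using II_kills c by (simp add: carr_def)
    then show False using f E_eq_II[OF c _ f(1), of d] d k by simp
  qed
  then have "{x. \<exists>f. ad True (x + k) x f \<and> E (x + k) x f u \<noteq> 0} \<subseteq> {x. \<forall>h\<in>II A k. h x = 0}" by blast
  then show "finite {x. \<exists>f. ad True (x + k) x f \<and> E (x + k) x f u \<noteq> 0}"
    by (rule finite_subset[OF _ cofinite_zeros[OF co]])
next
  fix h :: "'a^'n \<Rightarrow> 'a" assume "polyfun h" "h 0 = 0"
  then show "Vector_Spaces.linear sc sc (T 0 h)" by (rule T_linear)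
next
  fix h :: "'a^'n \<Rightarrow> 'a" and u assume "polyfun h" "h 0 = 0"
  then show "T 0 (- h) u = - T 0 h u" by (rule T_uminus)
next
  fix h :: "'a^'n \<Rightarrow> 'a" and a u assume "polyfun h" "h 0 = 0" "a \<in> G" "u \<in> Vg a"
  then show "T 0 h u \<in> Vg a" using T_grade[of h 0 a u] G_zero by simp
next
  fix h h' :: "'a^'n \<Rightarrow> 'a" and u assume "polyfun h" "h 0 = 0" "polyfun h'" "h' 0 = 0"
  then show "T 0 h (T 0 h' u) = T 0 h' (T 0 h u)"
    using T_bracket[of h h' 0 0 u] G_zero by (simp add: mult.commute)
next
  fix y x h assume *: "(y :: 'a^'n) \<noteq> x" "polyfun h" "h (0 :: 'a^'n) = (0::'a)"
  \<comment> \<open>This is the difference \<open>sh (y - x) h - h\<close> written in the local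
    coordinate at x.\<close>
  define p where "p = sh y h - sh x h"
  have p: "polyfun p" "p 0 = h y - h x" using * by (auto simp: p_def pointwise)
  have "T 0 h (E y x f u) = E y x f (T 0 h u) + E y x (p * f) u" if f: "ad True y x f" for f u
  proof (cases "y - x \<in> G")
    case False
    then show ?thesis using E_off * by simp
  next
    case True
    obtain A where c: "carr A u" using carr_exists by metis
    have c0: "carr A (T 0 h u)" using carr_T[OF c *(2,3) G_zero] by simp
    obtain d where d: "isdelta (II A (y - x)) x d" using delta_exists[OF _ c, of "y - x" x] * by auto
    have f': "ad True y x (p * f)" using f p by (auto simp: ad_def pointwise)
    note v = local_vanishes_at_0[OF d subset_refl f]
    have "(sh (y - x) h - h) * (sh (- x) f * d) = sh (- x) (p * f) * d"
      by (auto simp: p_def fun_eq_iff pointwise algebra_simps)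
    then show ?thesis using E_eq_II[OF c d f *(1)] E_eq_II[OF c0 d f *(1)] E_eq_II[OF c d f' *(1)]
        T0_shift[of "sh (- x) f * d" h "y - x" u] v * True by (simp add: algebra_simps)
  qed
  then show "\<exists>p. polyfun p \<and> p 0 = h y - h x \<and> (\<forall>f u. ad True y x f \<longrightarrow>
      T 0 h (E y x f u) = E y x f (T 0 h u) + E y x (p * f) u)" using p by blast
next
  fix y x a :: "'a^'n" and f g
  assume *: "y \<noteq> x" "y - x \<in> G" "a \<in> G" "ad True y x f" "ad True x y g"
  define k where "k = y - x"
  define A where "A = {a, a + k, a + - k}"
  have k: "k \<in> G" "- k \<in> G" "k \<noteq> 0" "- k = x - y" using * G_neg[of k] by (auto simp: k_def)
  have A: "finite A" "A \<subseteq> G" "A \<noteq> {}" using * k G_add unfolding A_def by blast+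
  obtain dx dy where d: "isdelta (II A k) x dx" "isdelta (II A (- k)) y dy"
    using isdelta_exists[OF cofinite_II[OF _ A(1,2)]] k by (metis neg_equal_0_iff_equal)
  define fx gy where "fx = sh (- x) f * dx" and "gy = sh (- y) g * dy"
  have fx: "polyfun fx" "fx 0 = 0" and gy: "polyfun gy" "gy 0 = 0" unfolding fx_def gy_def
    using local_vanishes_at_0[OF d(1) subset_refl *(4)] local_vanishes_at_0[OF d(2) subset_refl *(5)] by auto
  have Ef: "E y x f v = T k fx v" if "carr A v" for v
    using E_eq_II[OF that _ *(4), of dx] d * by (simp add: k_def fx_def)
  have Eg: "E x y g v = T (- k) gy v" if "carr A v" for v
    using E_eq_II[OF that _ *(5), of dy] d * by (simp add: k_def gy_def)
  have cV: "carr A v" if "c \<in> A" "v \<in> Vg c" for c v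
    using carr_mono[OF carr_Vg] that A by blast
  obtain s where s: "\<And>u. T k fx (T (- k) gy u) - T (- k) gy (T k fx u) = T 0 (sh (- k) fx * gy - fx * sh k gy) u + sc s u"
    using T_bracket_opposite[OF fx gy k(1)] by blast
  show "\<exists>h s. polyfun h \<and> h 0 = 0 \<and> (\<forall>u\<in>Vg a. E y x f (E x y g u) - E x y g (E y x f u) = T 0 h u + sc s u)"
  proof (intro exI conjI ballI)
    show "polyfun (sh (- k) fx * gy - fx * sh k gy)" "(sh (- k) fx * gy - fx * sh k gy) 0 = 0"
      using fx gy by (auto simp: pointwise)
    fix u assume u: "u \<in> Vg a"
    have "T k fx u \<in> Vg (a + k)" "T (- k) gy u \<in> Vg (a + - k)"
      using T_grade[OF fx k(1) *(3) u] T_grade[OF gy k(2) *(3) u] by auto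
    then have "carr A u" "carr A (T k fx u)" "carr A (T (- k) gy u)"
      using cV u unfolding A_def by blast+
    then show "E y x f (E x y g u) - E x y g (E y x f u) = T 0 (sh (- k) fx * gy - fx * sh k gy) u + sc s u"
      using Ef Eg s by simp
  qed
qed

text \<open>The idempotents form a partition of unity modulo the annihilator. X0 is its zero set and
  serves all f at once.\<close>

lemma T_eq_sum_E:
  assumes k: "k \<noteq> 0"
  shows "\<exists>X0. finite X0 \<and> (\<forall>X f. finite X \<longrightarrow> X0 \<subseteq> X \<longrightarrow> polyfun f \<longrightarrow> f 0 = 0 \<longrightarrow>
     T k f u = (\<Sum>x\<in>X. E (x + k) x (sh x f) u))"
proof -
  obtain A where c: "carr A u" using carr_exists by metis
  have co: "cofinite_ideal (II A k)" using cofinite_II[OF k] c by (auto simp: carr_def)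
  then have pI: "pideal (II A k)" by (simp add: cofinite_ideal_def)
  obtain d where d: "\<And>x. isdelta (II A k) x (d x)" using delta_exists[OF k c] by metis
  have "T k f u = (\<Sum>x\<in>X. E (x + k) x (sh x f) u)"
    if X: "finite X" "{x. \<forall>h\<in>II A k. h x = 0} \<subseteq> X" and f: "polyfun f" "f 0 = 0" for X f
  proof -
    have pd: "polyfun (d x)" for x using d isdelta_polyfun by blast
    have "1 - (\<Sum>x\<in>X. d x) \<in> II A k" by (rule isdelta_partition[OF co d X])
    then have "f * (1 - (\<Sum>x\<in>X. d x)) \<in> II A k" using pideal_mult[OF pI] f by blast
    then have "f - (\<Sum>x\<in>X. f * d x) \<in> II A k" by (simp add: right_diff_distrib sum_distrib_left)
    then have "T k f u = T k (\<Sum>x\<in>X. f * d x) u"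
      by (rule T_cong_mod) (use c f pd in \<open>auto intro!: polyfun_sum simp: sum_fun_apply pointwise\<close>)
    also have "\<dots> = (\<Sum>x\<in>X. T k (f * d x) u)" using f pd by (intro T_sum) (auto simp: pointwise)
    also have "\<dots> = (\<Sum>x\<in>X. E (x + k) x (sh x f) u)"
    proof (rule sum.cong[OF refl])
      fix x
      have "ad True (x + k) x (sh x f)" using f by (auto simp: ad_def pointwise)
      then have "E (x + k) x (sh x f) u = T k (sh (- x) (sh x f) * d x) u"
        using E_eq_II[OF c, of "x + k" x "d x" "sh x f"] d k by simp
      then show "T k (f * d x) u = E (x + k) x (sh x f) u" by (simp add: sh_sh)
    qed
    finally show ?thesis .
  qed
  then show ?thesis using cofinite_zeros[OF co] by blast
qed

end

section \<open>Irreducible modules\<close>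

lemma polyfun_coord_induct [consumes 1, case_names one scale coord add]:
  assumes "polyfun f" and one: "P 1" and scale: "\<And>c f. polyfun f \<Longrightarrow> P f \<Longrightarrow> P (cst c * f)"
    and coord: "\<And>i f. polyfun f \<Longrightarrow> P f \<Longrightarrow> P (lin i 0 * f)"
    and add: "\<And>f g. polyfun f \<Longrightarrow> polyfun g \<Longrightarrow> P f \<Longrightarrow> P g \<Longrightarrow> P (f + g)"
  shows "P f"
proof -
  have "\<forall>g. polyfun g \<longrightarrow> P g \<longrightarrow> P (f * g)" using assms(1)
  proof (induction rule: polyfun.induct)
    case (const c)
    then show ?case using scale by (auto simp: cst_def)
  next
    case (coord i)
    have "(\<lambda>x. x $ i) = lin i (0 :: 'a)" by (auto simp: fun_eq_iff pointwise)
    then show ?case using assms(4)[of _ i] by metis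
  next
    case (add f g)
    then show ?case using assms(5) by (auto simp: distrib_right)
  next
    case (mult f g)
    then show ?case by (auto simp: mult.assoc)
  qed
  then have "P (f * 1)" using one by blast
  then show ?thesis by simp
qed

text \<open>The binomial polynomials are an infinite chain of preimages of 1 under the difference operator; the
  functions with such a chain are closed under multiplication by coordinates.\<close>

lemma difference_surjective:
  fixes k :: "'a::field_char_0 ^ 'n::finite"
  assumes k: "k \<noteq> 0" and h: "polyfun h" shows "\<exists>p. polyfun p \<and> sh k p - p = h"
proof -
  obtain i where i: "k $ i \<noteq> 0" using k by (auto simp: vec_eq_iff)
  have "\<exists>p. p 0 = h \<and> (\<forall>r::nat. polyfun (p r) \<and> sh k (p (Suc r)) - p (Suc r) = p r)"
    using h
  proof (induction rule: polyfun_coord_induct)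
    case one
    define p where "p r = (\<lambda>x :: 'a ^ 'n. (x $ i / k $ i) gchoose r)" for r
    have "polyfun (p r)" for r
    proof (induction r)
      case 0
      then show ?case by (simp add: p_def one_fun_def[symmetric])
    next
      case (Suc r)
      have "p (Suc r) = cst (inverse (of_nat (Suc r))) * ((cst (inverse (k $ i)) * lin i 0 - cst (of_nat r)) * p r)"
      proof (rule ext)
        fix x :: "'a ^ 'n"
        have "of_nat (Suc r) * ((x $ i / k $ i) gchoose Suc r) = (x $ i / k $ i - of_nat r) * ((x $ i / k $ i) gchoose r)"
          using gbinomial_absorption[of r "x $ i / k $ i"] gbinomial_absorb_comp[of "x $ i / k $ i" r] by simp
        then show "p (Suc r) x = (cst (inverse (of_nat (Suc r))) * ((cst (inverse (k $ i)) * lin i 0 - cst (of_nat r)) * p r)) x"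
          by (simp add: p_def pointwise field_simps del: of_nat_Suc)
      qed
      then show ?case using Suc by simp
    qed
    moreover have "sh k (p (Suc r)) - p (Suc r) = p r" for r
    proof (rule ext)
      fix x :: "'a ^ 'n"
      have "(x + k) $ i / k $ i = x $ i / k $ i + 1" using i by (simp add: field_simps)
      then show "(sh k (p (Suc r)) - p (Suc r)) x = p r x"
        by (simp add: p_def pointwise gbinomial_Suc_Suc)
    qed
    moreover have "p 0 = 1" by (auto simp: p_def one_fun_def)
    ultimately show ?case by blast
  next
    case (scale c f)
    then obtain p where p: "p 0 = f" "\<And>r::nat. polyfun (p r) \<and> sh k (p (Suc r)) - p (Suc r) = p r" by blast
    have "sh k (cst c * p (Suc r)) - cst c * p (Suc r) = cst c * p r" for r
      using p(2)[of r] by (simp add: sh_mult sh_cst flip: right_diff_distrib)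
    then show ?case using p by (intro exI[of _ "\<lambda>r. cst c * p r"]) auto
  next
    case (add f g)
    then obtain p q where p: "p 0 = f" "\<And>r::nat. polyfun (p r) \<and> sh k (p (Suc r)) - p (Suc r) = p r"
      and q: "q 0 = g" "\<And>r::nat. polyfun (q r) \<and> sh k (q (Suc r)) - q (Suc r) = q r" by blast
    have "sh k (p (Suc r) + q (Suc r)) - (p (Suc r) + q (Suc r)) = p r + q r" for r
      using conjunct2[OF p(2)[of r], symmetric] conjunct2[OF q(2)[of r], symmetric] by (simp add: sh_add)
    then show ?case using p q by (intro exI[of _ "\<lambda>r. p r + q r"]) auto
  next
    case (coord j f)
    then obtain p where p: "p 0 = f" "\<And>r::nat. polyfun (p r) \<and> sh k (p (Suc r)) - p (Suc r) = p r" by blast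
    \<comment> \<open>The difference of \<open>x_j * p (r + 1)\<close> is
      \<open>x_j * p r + k_j * (p (r + 1) + p r)\<close>. The second term of q absorbs this surplus;
      its coefficient is proportional to r, so it is absent for r = 0.\<close>
    define q where "q r = lin j 0 * p r - cst (of_nat r * k $ j) * (p (Suc r) + p r)" for r
    have "sh k (q (Suc r)) - q (Suc r) = q r" for r
    proof -
      have 1: "sh k (p (Suc r)) = p (Suc r) + p r" for r using p(2)[of r] by (simp add: diff_eq_eq add.commute)
      show ?thesis unfolding q_def sh_minus sh_mult sh_add sh_cst 1
        by (auto simp: fun_eq_iff pointwise algebra_simps)
    qed
    moreover have "q 0 = lin j 0 * f" using p by (simp add: q_def cst_def zero_fun_def[symmetric])
    moreover have "polyfun (q r)" for r using p unfolding q_def by blast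
    ultimately show ?case by blast
  qed
  then show ?thesis by metis
qed

text \<open>The coefficient of \<open>t^l f(D)\<close> from z to \<open>z + l\<close>: f at the
  source in A, and minus f at the reflected target in B. For a monomial the latter produces the sign
  \<open>(-1)^(|\<mu>|+1)\<close>.\<close>

definition kap :: "bool \<Rightarrow> ('a::ab_group_add ^ 'n \<Rightarrow> 'a) \<Rightarrow> 'a ^ 'n \<Rightarrow> 'a ^ 'n \<Rightarrow> 'a" where
  "kap b f z l = (if b then f z else - f (- (z + l)))"

text \<open>\<open>w z\<close> plays the role of \<open>y_(z - x)\<close> in \<open>A_x\<close> or \<open>B_x\<close>; the functional lam twists the action of the
  elements of degree 0. The one-dimensional module is the case of w supported at 0.\<close>

definition intermediate_basis :: "('a::field \<Rightarrow> 'v \<Rightarrow> 'v) \<Rightarrow> ('a ^ 'n::finite) set \<Rightarrow>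
    ('a ^ 'n \<Rightarrow> ('a ^ 'n \<Rightarrow> 'a) \<Rightarrow> 'v \<Rightarrow> 'v) \<Rightarrow> bool \<Rightarrow> 'a ^ 'n \<Rightarrow> ('a ^ 'n \<Rightarrow> 'v::ab_group_add) \<Rightarrow>
    (('a ^ 'n \<Rightarrow> 'a) \<Rightarrow> 'a) \<Rightarrow> bool" where
  "intermediate_basis sc G T b x w lam \<longleftrightarrow>
     module.span sc (range w) = UNIV \<and> (\<exists>z. w z \<noteq> 0) \<and> (\<forall>z. w z \<noteq> 0 \<longrightarrow> z - x \<in> G) \<and> (b \<or> w 0 = 0) \<and>
     (\<forall>z l. w z \<noteq> 0 \<longrightarrow> z \<noteq> 0 \<longrightarrow> l \<in> G \<longrightarrow> z + l \<noteq> 0 \<longrightarrow> w (z + l) \<noteq> 0) \<and>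
     (\<forall>l f z. polyfun f \<longrightarrow> f 0 = 0 \<longrightarrow> l \<in> G \<longrightarrow> w z \<noteq> 0 \<longrightarrow>
        T l f (w z) = sc (kap b f z l + (if l = 0 then lam f else 0)) (w (z + l)))"

section \<open>From local operators to bases of irreducible modules\<close>

locale Tirr = Tsys sc G Vg T
  for sc :: "'a::{alg_closed_field, field_char_0} \<Rightarrow> 'v::ab_group_add \<Rightarrow> 'v"
    and G :: "('a ^ 'n::finite) set" and Vg T +
  assumes irr: "subspace S \<Longrightarrow> (\<And>k f u. polyfun f \<Longrightarrow> f 0 = 0 \<Longrightarrow> u \<in> S \<Longrightarrow> T k f u \<in> S) \<Longrightarrow> S = {0} \<or> S = UNIV"
    and nontrivial: "\<exists>v::'v. v \<noteq> 0"
begin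

lemma eigenvector_exists: "\<exists>a v. a \<in> G \<and> v \<in> Vg a \<and> v \<noteq> 0 \<and> gl.eig v"
proof -
  obtain u :: 'v where u: "u \<noteq> 0" using nontrivial by blast
  obtain A where A: "carr A u" using carr_exists by blast
  have "\<exists>a\<in>A. \<exists>v\<in>Vg a. v \<noteq> 0"
  proof (rule ccontr)
    assume "\<not> ?thesis"
    then have "(\<Union>a\<in>A. Vg a) \<subseteq> {0}" by blast
    then have "VA A \<subseteq> span {0}" unfolding VA_def by (rule span_mono)
    then show False using A u by (auto simp: carr_def)
  qed
  then obtain a where a: "a \<in> G" "\<exists>v\<in>Vg a. v \<noteq> 0" using A by (auto simp: carr_def)
  have "\<exists>v\<in>Vg a. v \<noteq> 0 \<and> gl.eig v"
    by (rule gl.eig_exists[OF a(1) Vg_subspace[OF a(1)] subset_refl a(2)]) (use gl.H_grade a in blast)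
  then show ?thesis using a by blast
qed

lemma span_is_everything:
  assumes "\<And>z k f. polyfun f \<Longrightarrow> f 0 = 0 \<Longrightarrow> k \<in> G \<Longrightarrow> T k f (w z) \<in> span (range w)" "w z \<noteq> 0"
  shows "span (range w) = UNIV"
proof -
  have "T k f u \<in> span (range w)" if f: "polyfun f" "f 0 = 0" and u: "u \<in> span (range w)" for k f u
    using u
  proof (induction rule: span_induct_alt)
    case (step c x y)
    have "T k f x \<in> span (range w)" using step assms(1)[OF f] T_off[of k] by (cases "k \<in> G") (auto simp: span_zero)
    then show ?case using step f by (simp add: T_vadd T_vscale span_add span_scale)
  qed (use f in \<open>simp add: span_zero\<close>)
  then have "span (range w) = {0} \<or> span (range w) = UNIV" by (intro irr) auto
  moreover have "w z \<in> span (range w)" by (intro span_base) auto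
  ultimately show ?thesis using assms(2) by auto
qed

lemma killed_by_E_imp_killed_by_T:
  assumes E: "\<And>x f. ad True (x + k) x f \<Longrightarrow> E (x + k) x f u = 0" and k: "k \<noteq> 0" and f: "polyfun f" "f 0 = 0"
  shows "T k f u = 0"
proof -
  obtain X0 where "finite X0" "T k f u = (\<Sum>x\<in>X0. E (x + k) x (sh x f) u)"
    using T_eq_sum_E[OF k, of u] f by blast
  moreover have "ad True (x + k) x (sh x f)" for x using f by (auto simp: ad_def pointwise)
  ultimately show ?thesis using E by simp
qed

text \<open>The vectors killed in all nonzero degrees form a submodule, hence the whole module, and
  an eigenvector spans it. Placed at the site 0 in A it fits the general form, since all
  coefficients \<open>f 0\<close> vanish there.\<close>

lemma trivial_module:
  assumes u: "u \<noteq> 0" "\<And>y x f. y \<noteq> x \<Longrightarrow> ad True y x f \<Longrightarrow> E y x f u = 0"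
  shows "\<exists>x w lam. intermediate_basis sc G T True x w lam"
proof -
  define S where "S = {u. \<forall>k f. k \<noteq> 0 \<longrightarrow> polyfun f \<longrightarrow> f 0 = 0 \<longrightarrow> T k f u = 0}"
  have "S = {0} \<or> S = UNIV"
  proof (rule irr)
    show "subspace S" unfolding S_def subspace_def by (auto simp: T_vadd T_vscale)
    fix l :: "'a ^ 'n" and h v assume h: "polyfun h" "h (0 :: 'a ^ 'n) = (0 :: 'a)" and v: "v \<in> S"
    show "T l h v \<in> S"
    proof (cases "l = 0")
      case True
      have "T k f (T 0 h v) = 0" if f: "k \<noteq> 0" "polyfun f" "f 0 = 0" for k f
      proof (cases "k \<in> G")
        case True
        have "T k ((sh k h - h) * f) v = 0" "T k f v = 0"
          using v f h unfolding S_def by (auto simp: pointwise)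
        then show ?thesis using T0_shift[OF f(2,3) h True, of v] h by simp
      qed (use T_off in simp)
      then show ?thesis by (simp add: S_def True)
    next
      case False
      then have "T l h v = 0" using v h by (simp add: S_def)
      then show ?thesis by (simp add: S_def)
    qed
  qed
  moreover have "u \<in> S" unfolding S_def using killed_by_E_imp_killed_by_T[of _ u] u(2) by simp
  ultimately have S: "S = UNIV" using u(1) by auto
  obtain a v where v: "a \<in> G" "v \<in> Vg a" "v \<noteq> 0" "gl.eig v" using eigenvector_exists by blast
  then obtain lam where lam: "\<And>h. polyfun h \<Longrightarrow> h 0 = 0 \<Longrightarrow> T 0 h v = sc (lam h) v"
    unfolding gl.eig_def by metis
  have Tk: "T k f v = 0" if "k \<noteq> 0" "polyfun f" "f 0 = 0" for k f using S that unfolding S_def by blast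
  define w where "w z = (if z = 0 then v else 0)" for z :: "'a ^ 'n"
  have act: "T l f (w z) = sc (kap True f z l + (if l = 0 then lam f else 0)) (w (z + l))"
    if "polyfun f" "f 0 = 0" "w z \<noteq> 0" for l f z
    using that Tk lam by (auto simp: w_def kap_def split: if_splits)
  have "span (range w) = UNIV"
  proof (rule span_is_everything)
    show "w 0 \<noteq> 0" using v by (simp add: w_def)
    fix z k f assume "polyfun f" "f (0 :: 'a ^ 'n) = (0 :: 'a)"
    then show "T k f (w z) \<in> span (range w)"
      using act[of f z k] by (cases "w z = 0") (auto intro: span_zero span_scale span_base)
  qed
  then have "intermediate_basis sc G T True 0 w lam"
    unfolding intermediate_basis_def using act v G_zero by (auto simp: w_def split: if_splits)
  then show ?thesis by blast
qed

lemma particle_True: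
  assumes "particle sc G E (T 0) True x w lam"
  shows "intermediate_basis sc G T True x w lam"
proof -
  note c2 = assms[unfolded particle_def, THEN conjunct2]
  note nz = assms[unfolded particle_def, THEN conjunct1, rule_format]
    and x = c2[THEN conjunct1] and mv = c2[THEN conjunct2, THEN conjunct1, rule_format]
    and dd = c2[THEN conjunct2, THEN conjunct2, THEN conjunct1, rule_format]
    and H = c2[THEN conjunct2, THEN conjunct2, THEN conjunct2, rule_format]
  have act: "T l f (w z) = sc (kap True f z l + (if l = 0 then lam f else 0)) (w (z + l))"
    if f: "polyfun f" "f 0 = 0" and z: "w z \<noteq> 0" and l: "l \<in> G" for l f z
  proof (cases "l = 0")
    case True
    then show ?thesis using H[OF f] by (simp add: kap_def)
  next
    case False
    have ads: "ad True (y + l) y (sh y f)" for y using f by (auto simp: ad_def pointwise)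
    from T_eq_sum_E[OF False, of "w z"] obtain X0 where X0: "finite X0 \<and> (\<forall>X f. finite X \<longrightarrow> X0 \<subseteq> X \<longrightarrow> polyfun f \<longrightarrow> f 0 = 0 \<longrightarrow>
        T l f (w z) = (\<Sum>y\<in>X. E (y + l) y (sh y f) (w z)))" by (rule exE)
    have "T l f (w z) = (\<Sum>y\<in>insert z X0. E (y + l) y (sh y f) (w z))"
      by (rule X0[THEN conjunct2, rule_format]) (use X0 f in auto)
    also have "\<dots> = (\<Sum>y\<in>insert z X0. if y = z then E (z + l) z (sh z f) (w z) else 0)"
      using dd ads False by (intro sum.cong) auto
    also have "\<dots> = E (z + l) z (sh z f) (w z)" using X0 by simp
    also have "\<dots> = sc (f z) (w (z + l))"
      using mv[of "z + l" z "sh z f"] ads z l False by (auto simp: pointwise)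
    finally show ?thesis using False by (simp add: kap_def)
  qed
  have "span (range w) = UNIV"
  proof (rule span_is_everything)
    show "w x \<noteq> 0" using nz x G_zero by simp
    fix z k f assume "polyfun f" "f (0 :: 'a ^ 'n) = (0 :: 'a)" "k \<in> G"
    then show "T k f (w z) \<in> span (range w)"
      using act[of f z k] by (cases "w z = 0") (auto intro: span_zero span_scale span_base)
  qed
  moreover have "w (z + l) \<noteq> 0" if "w z \<noteq> 0" "l \<in> G" "z + l \<noteq> 0" for z l
    using that nz G_add[of "z - x" l] by (simp add: algebra_simps)
  moreover have "\<exists>z. w z \<noteq> 0" using nz x G_zero by (intro exI[of _ x]) simp
  ultimately show ?thesis unfolding intermediate_basis_def using act nz by blast
qed

lemma particle_False:
  assumes "particle sc G (\<lambda>y x f u. - E (- x) (- y) (refl f) u) (\<lambda>h u. - T 0 (refl h) u) False x w lam"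
  shows "intermediate_basis sc G T False x w (\<lambda>f. - lam (refl f))"
proof -
  note c2 = assms[unfolded particle_def, THEN conjunct2]
  note nz = assms[unfolded particle_def, THEN conjunct1, rule_format]
    and x = c2[THEN conjunct1] and mv = c2[THEN conjunct2, THEN conjunct1, rule_format]
    and dd = c2[THEN conjunct2, THEN conjunct2, THEN conjunct1, rule_format]
    and H = c2[THEN conjunct2, THEN conjunct2, THEN conjunct2, rule_format]
  have act: "T l f (w z) = sc (kap False f z l + (if l = 0 then - lam (refl f) else 0)) (w (z + l))"
    if f: "polyfun f" "f 0 = 0" and z: "w z \<noteq> 0" and l: "l \<in> G" for l f z
  proof (cases "l = 0")
    case True
    have "- T 0 f (w z) = sc (f (- z) + lam (refl f)) (w z)"
      using H[of "refl f" z] f by (simp add: refl_apply)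
    then have "T 0 f (w z) = sc (- (f (- z) + lam (refl f))) (w z)" by (metis minus_minus scale_minus_left)
    then show ?thesis using True by (simp add: kap_def)
  next
    case False
    have ads: "ad False (- y) (- (y + l)) (refl (sh y f))" for y using f by (auto simp: ad_def pointwise)
    from T_eq_sum_E[OF False, of "w z"] obtain X0 where X0: "finite X0 \<and> (\<forall>X f. finite X \<longrightarrow> X0 \<subseteq> X \<longrightarrow> polyfun f \<longrightarrow> f 0 = 0 \<longrightarrow>
        T l f (w z) = (\<Sum>y\<in>X. E (y + l) y (sh y f) (w z)))" by (rule exE)
    \<comment> \<open>A dual particle at z is a hole at \<open>- z\<close>. The one move that acts
      fills it from \<open>- (z + l)\<close>, where it leaves a new hole.\<close>
    define y0 where "y0 = - (z + l)"
    have 0: "E (y + l) y (sh y f) (w z) = 0" if "y \<noteq> y0" for y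
    proof -
      have "- (y + l) \<noteq> z" using that by (auto simp: y0_def)
      moreover have "- y \<noteq> - (y + l)" using False by simp
      ultimately have "- E (- (- (y + l))) (- (- y)) (refl (refl (sh y f))) (w z) = 0"
        by (intro dd ads)
      then show ?thesis by (simp only: minus_minus refl_refl neg_equal_0_iff_equal)
    qed
    have "T l f (w z) = (\<Sum>y\<in>insert y0 X0. E (y + l) y (sh y f) (w z))"
      by (rule X0[THEN conjunct2, rule_format]) (use X0 f in auto)
    also have "\<dots> = (\<Sum>y\<in>insert y0 X0. if y = y0 then E (y0 + l) y0 (sh y0 f) (w z) else 0)"
      using 0 by (intro sum.cong) auto
    also have "\<dots> = E (y0 + l) y0 (sh y0 f) (w z)" using X0 by simp
    also have "\<dots> = - sc (f y0) (w (z + l))"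
    proof -
      have e: "- y0 = z + l" "- (y0 + l) = z" by (auto simp: y0_def)
      have a: "ad False (z + l) z (refl (sh y0 f))" using ads[of y0] unfolding e .
      have "- E (- z) (- (z + l)) (refl (refl (sh y0 f))) (w z) = sc (refl (sh y0 f) 0) (w (z + l))"
        by (rule mv[OF _ _ a z]) (use False l in auto)
      moreover have "- z = y0 + l" "- (z + l) = y0" by (auto simp: y0_def)
      ultimately show ?thesis by (simp add: pointwise) (metis minus_minus)
    qed
    finally show ?thesis using False by (simp add: kap_def y0_def scale_minus_left)
  qed
  have "span (range w) = UNIV"
  proof (rule span_is_everything)
    show "w x \<noteq> 0" using nz x G_zero by simp
    fix z k f assume "polyfun f" "f (0 :: 'a ^ 'n) = (0 :: 'a)" "k \<in> G"
    then show "T k f (w z) \<in> span (range w)"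
      using act[of f z k] by (cases "w z = 0") (auto intro: span_zero span_scale span_base)
  qed
  moreover have "w (z + l) \<noteq> 0" if "w z \<noteq> 0" "l \<in> G" "z + l \<noteq> 0" for z l
    using that nz G_add[of "z - x" l] by (simp add: algebra_simps)
  moreover have "\<exists>z. w z \<noteq> 0" using nz x G_zero by (intro exI[of _ x]) simp
  ultimately show ?thesis unfolding intermediate_basis_def using act nz by blast
qed

theorem single_vacuum_imp_intermediate:
  assumes "finite F" "gl.vac v (- F)" "v \<in> Vg a" "a \<in> G" "v \<noteq> 0" "gl.eig v" "k \<in> G" "k \<noteq> 0"
  shows "\<exists>b x w lam. intermediate_basis sc G T b x w lam"
proof (cases "\<exists>u. u \<noteq> 0 \<and> (\<forall>y x f. y \<noteq> x \<longrightarrow> ad True y x f \<longrightarrow> E y x f u = 0)")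
  case True
  then obtain u where u: "u \<noteq> 0" "\<forall>y x f. y \<noteq> x \<longrightarrow> ad True y x f \<longrightarrow> E y x f u = 0" by (elim exE conjE)
  have "\<exists>x w lam. intermediate_basis sc G T True x w lam"
    by (rule trivial_module[OF u(1)]) (rule u(2)[rule_format])
  then show ?thesis by (rule exI)
next
  case False
  interpret o: onevac sc G Vg E "T 0" True F v a k
    by (intro onevac.intro onevac_axioms.intro gl.glsys_axioms) (use assms False in blast)+
  from o.one_particle show ?thesis
  proof
    assume "\<exists>x w lam. particle sc G E (T 0) True x w lam"
    then obtain x w lam where "particle sc G E (T 0) True x w lam" by (elim exE)
    from particle_True[OF this] show ?thesis by (intro exI)
  next
    assume "\<exists>x w lam. particle sc G (\<lambda>y x f u. - E (- x) (- y) (refl f) u) (\<lambda>h u. - T 0 (refl h) u) (\<not> True) x w lam"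
    then obtain x w lam where "particle sc G (\<lambda>y x f u. - E (- x) (- y) (refl f) u) (\<lambda>h u. - T 0 (refl h) u) False x w lam"
      by (simp only: not_True_eq_False) (elim exE)
    from particle_False[OF this] show ?thesis by (intro exI)
  qed
qed

lemma killed_imp_T_zero:
  assumes "gl.killed k 0 u" "k \<noteq> 0" "m > 0" "polyfun f" "f 0 = 0"
  shows "T (of_nat m *s k) f u = 0"
  using assms gl.multiple_nonzero by (intro killed_by_E_imp_killed_by_T) (auto simp: gl.killed_def)

theorem highest_weight_or_intermediate:
  assumes k: "k \<in> G" "k \<noteq> 0" and gen: "\<And>x. x \<in> G \<Longrightarrow> \<exists>i::nat. x = of_nat i *s k \<or> x = - (of_nat i *s k)"
  shows "(\<exists>b x w lam. intermediate_basis sc G T b x w lam) \<or>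
    (\<exists>\<kappa> u a. (\<kappa> = k \<or> \<kappa> = - k) \<and> u \<noteq> 0 \<and> a \<in> G \<and> u \<in> Vg a \<and> gl.eig u \<and>
       (\<forall>m f. m > 0 \<longrightarrow> polyfun f \<longrightarrow> f 0 = 0 \<longrightarrow> T (of_nat m *s \<kappa>) f u = 0))"
proof -
  obtain a v where v: "a \<in> G" "v \<in> Vg a" "v \<noteq> 0" "gl.eig v" using eigenvector_exists by blast
  have mk: "- k \<in> G" "- k \<noteq> 0" using k G_neg by auto
  consider F where "finite F" "gl.vac v (- F)"
    | u a K \<kappa> where "\<kappa> = k \<or> \<kappa> = - k" "u \<noteq> 0" "a \<in> G" "u \<in> Vg a" "gl.killed \<kappa> K u"
    using gl.trichotomy[OF k gen v(2,1)] by blast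
  then show ?thesis
  proof cases
    case 1
    show ?thesis by (rule disjI1, rule single_vacuum_imp_intermediate[OF 1 v(2,1,3,4) k])
  next
    case 2
    then have kk: "\<kappa> \<in> G" "\<kappa> \<noteq> 0" using k mk by auto
    from gl.killed_imp_highest_weight_vector[OF 2(5) kk 2(4,3,2)]
    obtain u' a' where u': "u' \<noteq> 0" "a' \<in> G" "u' \<in> Vg a'" "gl.eig u'" "gl.killed \<kappa> 0 u'"
      by (elim exE conjE) rule
    have "\<forall>m f. m > 0 \<longrightarrow> polyfun f \<longrightarrow> f 0 = 0 \<longrightarrow> T (of_nat m *s \<kappa>) f u' = 0"
      by (intro allI impI) (rule killed_imp_T_zero[OF u'(5) kk(2)])
    then have "(\<kappa> = k \<or> \<kappa> = - k) \<and> u' \<noteq> 0 \<and> a' \<in> G \<and> u' \<in> Vg a' \<and> gl.eig u' \<and>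
       (\<forall>m f. m > 0 \<longrightarrow> polyfun f \<longrightarrow> f 0 = 0 \<longrightarrow> T (of_nat m *s \<kappa>) f u' = 0)"
      using 2(1) u'(1-4) by (intro conjI)
    then show ?thesis by (intro disjI2 exI)
  qed
qed

theorem infinite_index_imp_intermediate:
  assumes k: "k \<in> G" "k \<noteq> 0"
    and inf: "\<And>B. finite B \<Longrightarrow> B \<subseteq> G \<Longrightarrow> \<exists>g\<in>G. \<forall>r\<in>B. \<forall>i::int. g \<noteq> r + of_int i *s k"
  shows "\<exists>b x w lam. intermediate_basis sc G T b x w lam"
proof -
  obtain a v where v: "a \<in> G" "v \<in> Vg a" "v \<noteq> 0" "gl.eig v" using eigenvector_exists by blast
  obtain F where "finite F" "gl.vac v (- F)" using gl.single_vacuum[OF k v(2,1) inf] by blast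
  then show ?thesis by (rule single_vacuum_imp_intermediate[OF _ _ v(2,1,3,4) k])
qed

section \<open>The character of the degree 0 part\<close>

lemma opposite_bracket_lam:
  assumes ib: "intermediate_basis sc G T b x w lam" and f: "polyfun f" "f 0 = 0" and g: "polyfun g" "g 0 = 0"
    and k: "k \<in> G" "k \<noteq> 0"
    and s: "\<And>u. T k f (T (- k) g u) - T (- k) g (T k f u) = T 0 (sh (- k) f * g - f * sh k g) u + sc s u"
  shows "lam (sh (- k) f * g - f * sh k g) = - s"
proof -
  obtain z where z: "w z \<noteq> 0" using ib unfolding intermediate_basis_def by blast
  have act: "T l f (w z) = sc (kap b f z l + (if l = 0 then lam f else 0)) (w (z + l))"
    if "polyfun f" "f 0 = 0" "l \<in> G" "w z \<noteq> 0" for l f z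
    using ib that unfolding intermediate_basis_def by blast
  have step: "w (z + l) \<noteq> 0" if "w z \<noteq> 0" "z \<noteq> 0" "l \<in> G" "z + l \<noteq> 0" for z l
    using ib that unfolding intermediate_basis_def by blast
  \<comment> \<open>If the intermediate vector is 0, then the starting or the intermediate site is
    0, and the product of the coefficients vanishes as well.\<close>
  have 2: "T (- l) g (T l f (w z)) = sc (kap b f z l * kap b g (z + l) (- l)) (w z)"
    if f: "polyfun f" "f 0 = 0" and g: "polyfun g" "g 0 = 0" and l: "l \<in> G" "l \<noteq> 0" for f g l
  proof (cases "w (z + l) = 0")
    case True
    then have "z = 0 \<or> z + l = 0" using step[OF z _ l(1)] by blast
    then have "kap b f z l * kap b g (z + l) (- l) = 0"
    proof
      assume "z + l = 0"
      then show ?thesis using f g by (simp add: kap_def)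
    qed (use f g in \<open>simp add: kap_def\<close>)
    then show ?thesis using act[OF f l(1) z] True l g by simp
  next
    case False
    then show ?thesis using act[OF f l(1) z] act[OF g G_neg[OF l(1)] False] l g
      by (simp add: T_vscale)
  qed
  define P where "P = sh (- k) f * g - f * sh k g"
  have P: "polyfun P" "P 0 = 0" using f g by (auto simp: P_def pointwise)
  have "T k f (T (- k) g (w z)) = sc (kap b g z (- k) * kap b f (z - k) k) (w z)"
    using 2[OF g f G_neg[OF k(1)]] k by simp
  moreover have "T (- k) g (T k f (w z)) = sc (kap b f z k * kap b g (z + k) (- k)) (w z)"
    by (rule 2[OF f g k])
  \<comment> \<open>The coefficients of A and of B satisfy the bracket relation by themselves, so
    the contributions of lam and s have to cancel.\<close>
  moreover have "kap b g z (- k) * kap b f (z - k) k - kap b f z k * kap b g (z + k) (- k) = kap b P z 0"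
    by (simp add: kap_def P_def pointwise algebra_simps)
  ultimately have "sc (kap b P z 0) (w z) = T 0 P (w z) + sc s (w z)"
    using s[of "w z"] unfolding P_def[symmetric] by (metis scale_left_diff_distrib)
  also have "T 0 P (w z) = sc (kap b P z 0 + lam P) (w z)" using act[OF P G_zero z] by simp
  finally have "sc (lam P + s) (w z) = 0" by (simp add: scale_left_distrib)
  then show ?thesis using z by (simp add: P_def eq_neg_iff_add_eq_0)
qed

text \<open>Without a central scalar, lam vanishes on the polynomials arising from opposite
  brackets. Every h is a difference of two of these: one from the pair q and \<open>x_i\<close>, the
  other from the pair \<open>x_i\<close> and \<open>sh (- k) q\<close>.\<close>

lemma lam_zero:
  assumes ib: "intermediate_basis sc G T b x w lam" and k: "k \<in> G" "k \<noteq> 0" and h: "polyfun h" "h 0 = 0"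
    and s: "\<And>f g u. polyfun f \<Longrightarrow> f 0 = 0 \<Longrightarrow> polyfun g \<Longrightarrow> g 0 = 0 \<Longrightarrow>
      T k f (T (- k) g u) - T (- k) g (T k f u) = T 0 (sh (- k) f * g - f * sh k g) u"
  shows "lam h = 0"
proof -
  obtain z where z: "w z \<noteq> 0" using ib unfolding intermediate_basis_def by blast
  have act: "T 0 f (w z) = sc (kap b f z 0 + lam f) (w z)" if "polyfun f" "f 0 = 0" for f
    using ib that G_zero z unfolding intermediate_basis_def by fastforce
  have lam_minus: "lam (f - g) = lam f - lam g" if f: "polyfun f" "f 0 = 0" and g: "polyfun g" "g 0 = 0" for f g
  proof -
    have fg: "polyfun (f - g)" "(f - g) 0 = 0" using f g by (auto simp: pointwise)
    have "sc (kap b (f - g) z 0 + lam (f - g)) (w z) = sc ((kap b f z 0 + lam f) - (kap b g z 0 + lam g)) (w z)"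
      using T_minus[OF f g, of 0 "w z"] by (simp only: act[OF f] act[OF g] act[OF fg] scale_left_diff_distrib)
    then have "kap b (f - g) z 0 + lam (f - g) = (kap b f z 0 + lam f) - (kap b g z 0 + lam g)"
      using z scale_cancel_right by blast
    then show ?thesis by (auto simp: kap_def pointwise algebra_simps split: if_splits)
  qed
  have P: "lam (sh (- k) f * g - f * sh k g) = 0" if "polyfun f" "f 0 = 0" "polyfun g" "g 0 = 0" for f g
    using opposite_bracket_lam[OF ib that k, of 0] s[OF that] by simp
  \<comment> \<open>h becomes \<open>p - sh k p\<close> with \<open>p 0 = 0\<close>. As
    \<open>h 0 = 0\<close>, also \<open>p k = 0\<close>; these two values let q and
    \<open>sh (- k) q\<close> both serve as entries.\<close>
  obtain p0 where p0: "polyfun p0" "sh k p0 - p0 = - h" using difference_surjective[OF k(2), of "- h"] h by auto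
  define p where "p = p0 - cst (p0 0)"
  have p: "polyfun p" "p 0 = 0" "sh k p - p = - h" using p0 by (auto simp: p_def sh_minus sh_cst pointwise)
  have pk: "p k = 0" using fun_cong[OF p(3), of 0] p(2) h by (simp add: pointwise)
  obtain i where i: "k $ i \<noteq> 0" using k by (auto simp: vec_eq_iff)
  define q where "q = cst (inverse (k $ i)) * sh k p"
  have q: "polyfun q" "q 0 = 0" "q (- k) = 0" using p pk by (auto simp: q_def pointwise)
  let ?P1 = "sh (- k) q * lin i 0 - q * sh k (lin i 0)"
  let ?P2 = "sh (- k) (lin i 0) * sh (- k) q - lin i 0 * sh k (sh (- k) q)"
  have "lam ?P1 = 0" "lam ?P2 = 0" using q by (auto intro!: P simp: pointwise)
  moreover have "?P1 - ?P2 = h"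
  proof -
    have "h = p - sh k p" using p(3) by (metis minus_diff_eq minus_minus)
    moreover have "?P1 - ?P2 = p - sh k p"
      using i by (auto simp: q_def fun_eq_iff pointwise field_simps)
    ultimately show ?thesis by simp
  qed
  moreover have "lam (?P1 - ?P2) = lam ?P1 - lam ?P2"
    using q by (intro lam_minus) (auto simp: pointwise)
  ultimately show ?thesis by simp
qed

end

subsection \<open>Subgroups of finite index over a cyclic group\<close>

lemma int_subgroup_generator:
  fixes I :: "int set"
  assumes I: "\<And>x y. x \<in> I \<Longrightarrow> y \<in> I \<Longrightarrow> x - y \<in> I" and c: "c \<in> I" "c \<noteq> 0"
  shows "\<exists>d>0. d \<in> I \<and> (\<forall>x\<in>I. d dvd x)"
proof -
  have 0: "0 \<in> I" using I[OF c(1) c(1)] by simp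
  have neg: "- x \<in> I" if "x \<in> I" for x using I[OF 0 that] by simp
  have add: "x + y \<in> I" if "x \<in> I" "y \<in> I" for x y using I[OF that(1) neg[OF that(2)]] by simp
  have ex: "\<exists>n::nat. n > 0 \<and> int n \<in> I"
    using c neg[OF c(1)] by (intro exI[of _ "nat \<bar>c\<bar>"]) (auto simp: abs_if)
  define d where "d = (LEAST n::nat. n > 0 \<and> int n \<in> I)"
  have d: "d > 0" "int d \<in> I" using LeastI_ex[OF ex] unfolding d_def by auto
  have mul: "int m * int d \<in> I" for m by (induction m) (use 0 add d in \<open>auto simp: algebra_simps\<close>)
  have mul': "m * int d \<in> I" for m :: int
    using mul[of "nat m"] neg[OF mul[of "nat (- m)"]] by (cases "m \<ge> 0") auto
  have "int d dvd x" if x: "x \<in> I" for x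
  proof (rule ccontr)
    assume nd: "\<not> int d dvd x"
    have "x mod int d = x - (x div int d) * int d" by (simp add: minus_div_mult_eq_mod)
    then have "x mod int d \<in> I" using I[OF x mul'] by simp
    moreover have "x mod int d \<noteq> 0" using nd by (metis dvd_eq_mod_eq_0)
    then have "x mod int d > 0" using pos_mod_sign[of "int d" x] d(1) by linarith
    ultimately have "nat (x mod int d) > 0 \<and> int (nat (x mod int d)) \<in> I" by simp
    then have "d \<le> nat (x mod int d)" unfolding d_def by (rule Least_le)
    moreover have "x mod int d < int d" using d(1) by simp
    ultimately show False using \<open>x mod int d > 0\<close> by linarith
  qed
  then show ?thesis using d by (intro exI[of _ "int d"]) auto
qed

text \<open>By the pigeonhole principle every element has a positive multiple among the multiples of
  k, and a common factor N serves all representatives. Then \<open>N g = \<psi>(g) k\<close> embeds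
  G into the integers, with image \<open>d Z\<close>.\<close>

lemma finite_index_imp_iso_to_Z:
  fixes G :: "('a::field_char_0 ^ 'n::finite) set"
  assumes G: "add_subgroup G" and k: "k \<in> G" "k \<noteq> 0" and B: "finite B" "B \<subseteq> G"
    and cover: "\<And>g. g \<in> G \<Longrightarrow> \<exists>r\<in>B. \<exists>i::int. g = r + of_int i *s k"
  shows "iso_to_Z G"
proof -
  have inj: "i = j" if "of_int i *s k = of_int j *s k" for i j :: int
  proof -
    obtain t where t: "k $ t \<noteq> 0" using k by (auto simp: vec_eq_iff)
    have "of_int i * k $ t = of_int j * k $ t" using arg_cong[OF that, of "\<lambda>v. v $ t"] by simp
    then show ?thesis using t by simp
  qed
  have tors: "\<exists>m::nat. m > 0 \<and> (\<exists>i::int. of_nat m *s g = of_int i *s k)" if g: "g \<in> G" for g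
  proof -
    have "\<forall>m. \<exists>r. r \<in> B \<and> (\<exists>i::int. of_nat m *s g = r + of_int i *s k)"
      using cover[OF add_subgroup_multiples[OF G g]] by blast
    then obtain r where r: "\<And>m. r m \<in> B \<and> (\<exists>i::int. of_nat m *s g = r m + of_int i *s k)" by metis
    have "\<not> inj r" using finite_subset[OF _ B(1), of "range r"] r finite_imageD[of r UNIV] by auto
    then obtain m n where mn: "r m = r n" "m < n" by (metis injI linorder_neqE_nat)
    obtain i j :: int where "of_nat m *s g = r m + of_int i *s k" "of_nat n *s g = r n + of_int j *s k"
      using r by blast
    then have "of_nat (n - m) *s g = of_int (j - i) *s k"
      using mn by (simp add: of_nat_diff vector_sub_rdistrib)
    then show ?thesis using mn(2) by (intro exI[of _ "n - m"]) (simp only: zero_less_diff, blast)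
  qed
  then obtain m where m: "\<And>g. g \<in> G \<Longrightarrow> m g > (0::nat) \<and> (\<exists>i::int. of_nat (m g) *s g = of_int i *s k)" by metis
  define N where "N = (\<Prod>r\<in>B. m r)"
  have N: "N > 0" unfolding N_def using m B by (intro prod_pos) blast
  have "\<exists>i::int. of_nat N *s g = of_int i *s k" if g: "g \<in> G" for g
  proof -
    obtain r i where r: "r \<in> B" "g = r + of_int i *s k" using cover[OF g] by blast
    obtain j :: int where j: "of_nat (m r) *s r = of_int j *s k" using m r B by blast
    obtain q where q: "N = q * m r" unfolding N_def using r B by (metis dvd_def dvd_prodI mult.commute)
    have "of_nat N *s r = of_nat q *s (of_nat (m r) *s r)" unfolding q by (simp add: vector_smult_assoc)
    then have "of_nat N *s g = of_int (int q * j + int N * i) *s k"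
      unfolding r(2) j by (simp add: vector_add_ldistrib vector_smult_assoc vector_sadd_rdistrib)
    then show ?thesis by blast
  qed
  then obtain \<psi> where \<psi>: "\<And>g. g \<in> G \<Longrightarrow> of_nat N *s g = of_int (\<psi> g :: int) *s k" by metis
  have Gc: "x + y \<in> G" "x - y \<in> G" if "x \<in> G" "y \<in> G" for x y
    using G that unfolding add_subgroup_def by (blast, metis add_uminus_conv_diff)
  have add: "\<psi> (x + y) = \<psi> x + \<psi> y" if "x \<in> G" "y \<in> G" for x y
    by (rule inj) (simp add: \<psi>[OF Gc(1)[OF that], symmetric] \<psi>[OF that(1), symmetric] \<psi>[OF that(2), symmetric]
        vector_add_ldistrib vector_sadd_rdistrib)
  have diff: "\<psi> (x - y) = \<psi> x - \<psi> y" if "x \<in> G" "y \<in> G" for x y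
    using add[OF Gc(2)[OF that] that(2)] by simp
  have "\<psi> k = int N" 
    using inj[of "int N" "\<psi> k"] \<psi>[OF k(1)] by (simp only: of_int_of_nat_eq)
  then have "\<psi> k \<noteq> 0" using N by simp
  moreover have "x - y \<in> \<psi> ` G" if xy: "x \<in> \<psi> ` G" "y \<in> \<psi> ` G" for x y
  proof -
    obtain x' y' where "x' \<in> G" "y' \<in> G" "x = \<psi> x'" "y = \<psi> y'" using xy by blast
    then show ?thesis using diff Gc by (intro image_eqI[of _ _ "x' - y'"]) auto
  qed
  ultimately obtain d where d: "d > 0" "d \<in> \<psi> ` G" "\<forall>x\<in>\<psi> ` G. d dvd x"
    using int_subgroup_generator[of "\<psi> ` G" "\<psi> k"] k by blast
  define \<phi> where "\<phi> g = \<psi> g div d" for g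
  have \<phi>: "\<psi> g = \<phi> g * d" if "g \<in> G" for g using d that by (simp add: \<phi>_def)
  have "\<phi> (x + y) = \<phi> x + \<phi> y" if "x \<in> G" "y \<in> G" for x y
    using add[OF that] \<phi>[OF that(1)] \<phi>[OF that(2)] \<phi>[OF Gc(1)[OF that]] d(1)
    by (metis distrib_right mult_cancel_right order_less_irrefl)
  moreover have "bij_betw \<phi> G UNIV" unfolding bij_betw_def
  proof
    show "inj_on \<phi> G"
    proof (rule inj_onI)
      fix x y assume xy: "x \<in> G" "y \<in> G" "\<phi> x = \<phi> y"
      then have "of_nat N *s x = of_nat N *s y" using \<phi> \<psi> by metis
      then show "x = y" using N by (simp add: vector_mul_lcancel)
    qed
    obtain e where e: "e \<in> G" "\<psi> e = d" using d by auto
    have G0: "0 \<in> G" "\<psi> 0 = 0" using Gc(2)[OF e(1) e(1)] diff[OF e(1) e(1)] by auto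
    have mult: "of_nat n *s e \<in> G \<and> \<psi> (of_nat n *s e) = int n * d" for n
    proof (induction n)
      case (Suc n)
      have "of_nat (Suc n) *s e = e + of_nat n *s e" by (simp add: vector_sadd_rdistrib)
      then show ?case using Suc e add Gc by (simp add: algebra_simps)
    qed (use G0 in simp)
    have "\<exists>g\<in>G. \<phi> g = i" for i
    proof (cases "i \<ge> 0")
      case True
      then show ?thesis using mult[of "nat i"] d(1) by (intro bexI[of _ "of_nat (nat i) *s e"]) (auto simp: \<phi>_def)
    next
      case False
      define n where "n = nat (- i)"
      have n: "i = - int n" using False by (simp add: n_def)
      have "\<psi> (0 - of_nat n *s e) = 0 - int n * d"
        using diff[OF G0(1) conjunct1[OF mult[of n]]] mult[of n] G0(2) by metis
      then have "\<phi> (0 - of_nat n *s e) = i" using d(1) by (simp add: \<phi>_def n flip: mult_minus_left)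
      then show ?thesis using Gc(2)[OF G0(1) conjunct1[OF mult[of n]]] by blast
    qed
    then have "i \<in> \<phi> ` G" for i by (metis imageI)
    then show "\<phi> ` G = UNIV" by (intro UNIV_eq_I[symmetric])
  qed
  ultimately show ?thesis unfolding iso_to_Z_def by blast
qed

section \<open>Linear extension of the action\<close>

definition mf :: "('n::finite \<Rightarrow> nat) \<Rightarrow> 'a::comm_ring_1 ^ 'n \<Rightarrow> 'a" where
  "mf \<mu> = (\<lambda>x. mpow x \<mu>)"

lemma mf_apply [pointwise]: "mf \<mu> x = mpow x \<mu>"
  by (simp add: mf_def)

lemma mf_zero: "mf 0 = 1"
  by (auto simp: mf_def mpow_def fun_eq_iff pointwise)

lemma mf_add: "mf (\<mu> + \<nu>) = mf \<mu> * mf \<nu>"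
  by (auto simp: mf_def mpow_def fun_eq_iff pointwise power_add prod.distrib)

lemma mpow_0:
  fixes \<mu> :: "'n::finite \<Rightarrow> nat"
  shows "mpow (0 :: 'a::idom ^ 'n) \<mu> = (if \<mu> = 0 then 1 else 0)"
proof (cases "\<mu> = 0")
  case False
  then obtain i where "\<mu> i \<noteq> 0" by (auto simp: fun_eq_iff pointwise)
  then show ?thesis using False by (auto simp: mpow_def intro!: prod_zero bexI[of _ i])
qed (simp add: mpow_def pointwise)

lemma polyfun_mf [simp, intro]: "polyfun (mf \<mu> :: 'a::comm_ring_1 ^ 'n::finite \<Rightarrow> 'a)"
proof -
  have "mf \<mu> = (\<Prod>i\<in>UNIV. lin i (0::'a) ^ \<mu> i)"
    by (auto simp: mf_def mpow_def fun_eq_iff prod_fun_apply pointwise)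
  moreover have "polyfun (\<Prod>i\<in>UNIV. lin i (0::'a) ^ \<mu> i)" by (intro polyfun_prod polyfun_power polyfun_lin)
  ultimately show ?thesis by simp
qed

text \<open>Dedekind's argument: the monomials are distinct characters of a multiplicative monoid.\<close>

lemma monomials_independent:
  fixes a :: "('n::finite \<Rightarrow> nat) \<Rightarrow> 'a::field_char_0"
  assumes "finite S" "\<And>x :: 'a ^ 'n. (\<Sum>\<mu>\<in>S. a \<mu> * mpow x \<mu>) = 0" "\<mu> \<in> S"
  shows "a \<mu> = 0"
  using assms
proof (induction S arbitrary: a \<mu> rule: finite_induct)
  case (insert \<nu> S)
  have mult: "mpow (\<chi> i. x $ i * y $ i) \<mu> = mpow x \<mu> * mpow y \<mu>" for x y :: "'a ^ 'n" and \<mu>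
    by (simp add: mpow_def power_mult_distrib prod.distrib)
  have S: "a \<mu> = 0" if \<mu>: "\<mu> \<in> S" for \<mu>
  proof -
    have ne: "\<mu> \<noteq> \<nu>" using \<mu> insert by blast
    then obtain i where i: "\<mu> i \<noteq> \<nu> i" by auto
    define y :: "'a ^ 'n" where "y = (\<chi> j. if j = i then 2 else 1)"
    have y: "mpow y \<kappa> = 2 ^ \<kappa> i" for \<kappa>
    proof -
      have "mpow y \<kappa> = (\<Prod>j\<in>UNIV. if j = i then 2 ^ \<kappa> i else 1)"
        unfolding mpow_def y_def by (intro prod.cong) auto
      then show ?thesis by simp
    qed
    have "(\<Sum>\<kappa>\<in>S. (a \<kappa> * (mpow y \<kappa> - mpow y \<nu>)) * mpow x \<kappa>) = 0" for x
    proof -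
      have "(\<Sum>\<kappa>\<in>insert \<nu> S. a \<kappa> * mpow (\<chi> i. x $ i * y $ i) \<kappa>) - mpow y \<nu> * (\<Sum>\<kappa>\<in>insert \<nu> S. a \<kappa> * mpow x \<kappa>) = 0"
        using insert.prems(1) by simp
      then show ?thesis using insert.hyps
        by (simp add: mult algebra_simps sum_subtractf sum_distrib_left)
    qed
    from insert.IH[OF this \<mu>] have "a \<mu> * (2 ^ \<mu> i - 2 ^ \<nu> i) = 0" by (simp add: y)
    moreover have "(2 :: 'a) ^ \<mu> i \<noteq> 2 ^ \<nu> i"
    proof
      assume "(2 :: 'a) ^ \<mu> i = 2 ^ \<nu> i"
      then have "(of_nat (2 ^ \<mu> i) :: 'a) = of_nat (2 ^ \<nu> i)" by simp
      then have "(2 :: nat) ^ \<mu> i = 2 ^ \<nu> i" by (simp only: of_nat_eq_iff)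
      then show False using i by simp
    qed
    ultimately show ?thesis by simp
  qed
  have "mpow (1 :: 'a ^ 'n) \<nu> = 1" by (simp add: mpow_def)
  then have "a \<nu> = 0" using insert.prems(1)[of 1] insert.hyps S by simp
  then show ?case using S insert.prems(2) by blast
qed simp

section \<open>Coefficients of polynomial functions\<close>

definition is_coef :: "('a::comm_ring_1 ^ 'n::finite \<Rightarrow> 'a) \<Rightarrow> (('n \<Rightarrow> nat) \<Rightarrow> 'a) \<Rightarrow> bool" where
  "is_coef f a \<longleftrightarrow> finite {\<mu>. a \<mu> \<noteq> 0} \<and> (\<forall>x. f x = (\<Sum>\<mu>\<in>{\<mu>. a \<mu> \<noteq> 0}. a \<mu> * mpow x \<mu>))"

definition coef :: "('a::comm_ring_1 ^ 'n::finite \<Rightarrow> 'a) \<Rightarrow> ('n \<Rightarrow> nat) \<Rightarrow> 'a" where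
  "coef f = (SOME a. is_coef f a)"

lemma is_coefI:
  assumes "finite S" "\<And>\<mu>. \<mu> \<notin> S \<Longrightarrow> a \<mu> = 0" "\<And>x. f x = (\<Sum>\<mu>\<in>S. a \<mu> * mpow x \<mu>)"
  shows "is_coef f a"
proof -
  have "{\<mu>. a \<mu> \<noteq> 0} \<subseteq> S" using assms(2) by blast
  moreover have "(\<Sum>\<mu>\<in>S. a \<mu> * mpow x \<mu>) = (\<Sum>\<mu>\<in>{\<mu>. a \<mu> \<noteq> 0}. a \<mu> * mpow x \<mu>)" for x
    using calculation assms(1) by (intro sum.mono_neutral_right) auto
  ultimately show ?thesis using assms finite_subset unfolding is_coef_def by auto
qed

lemma is_coef_sum:
  assumes "is_coef f a" "finite S" "{\<mu>. a \<mu> \<noteq> 0} \<subseteq> S" shows "f x = (\<Sum>\<mu>\<in>S. a \<mu> * mpow x \<mu>)"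
proof -
  have "(\<Sum>\<mu>\<in>{\<mu>. a \<mu> \<noteq> 0}. a \<mu> * mpow x \<mu>) = (\<Sum>\<mu>\<in>S. a \<mu> * mpow x \<mu>)"
    using assms by (intro sum.mono_neutral_left) auto
  then show ?thesis using assms(1) by (simp add: is_coef_def)
qed

lemma is_coef_unique:
  fixes f :: "'a::field_char_0 ^ 'n::finite \<Rightarrow> 'a"
  assumes "is_coef f a" "is_coef f b" shows "a = b"
proof
  fix \<mu>
  define S where "S = insert \<mu> ({\<mu>. a \<mu> \<noteq> 0} \<union> {\<mu>. b \<mu> \<noteq> 0})"
  have S: "finite S" using assms by (simp add: S_def is_coef_def)
  have "(\<Sum>\<kappa>\<in>S. (a \<kappa> - b \<kappa>) * mpow x \<kappa>) = 0" for x
  proof -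
    have "f x = (\<Sum>\<kappa>\<in>S. a \<kappa> * mpow x \<kappa>)" "f x = (\<Sum>\<kappa>\<in>S. b \<kappa> * mpow x \<kappa>)"
      by (rule is_coef_sum[OF assms(1) S], force simp: S_def) (rule is_coef_sum[OF assms(2) S], force simp: S_def)
    then show ?thesis by (simp add: left_diff_distrib sum_subtractf)
  qed
  from monomials_independent[OF S this, of \<mu>] show "a \<mu> = b \<mu>" by (simp add: S_def)
qed

lemma is_coef_add:
  assumes "is_coef f a" "is_coef g b" shows "is_coef (f + g) (\<lambda>\<mu>. a \<mu> + b \<mu>)"
proof -
  let ?S = "{\<mu>. a \<mu> \<noteq> 0} \<union> {\<mu>. b \<mu> \<noteq> 0}"
  have S: "finite ?S" using assms by (auto simp: is_coef_def)
  show ?thesis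
  proof (rule is_coefI[OF S])
    fix x
    show "(f + g) x = (\<Sum>\<mu>\<in>?S. (a \<mu> + b \<mu>) * mpow x \<mu>)"
      using is_coef_sum[OF assms(1) S Un_upper1] is_coef_sum[OF assms(2) S Un_upper2]
      by (simp add: plus_fun_apply distrib_right sum.distrib)
  qed auto
qed

lemma is_coef_scale: "is_coef f a \<Longrightarrow> is_coef (cst c * f) (\<lambda>\<mu>. c * a \<mu>)"
  by (rule is_coefI[of "{\<mu>. a \<mu> \<noteq> 0}"]) (auto simp: is_coef_def pointwise sum_distrib_left mult.assoc)

lemma is_coef_mf: "is_coef (mf \<nu>) (\<lambda>\<mu>. if \<mu> = \<nu> then 1 else 0)"
  by (rule is_coefI[of "{\<nu>}"]) (auto simp: pointwise)

lemma is_coef_exists: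
  fixes f :: "'a::comm_ring_1 ^ 'b::finite \<Rightarrow> 'a"
  assumes "polyfun f" shows "\<exists>a. is_coef f a"
proof -
  have mult: "\<exists>b. is_coef (mf \<nu> * f) b" if ex: "\<exists>a. is_coef f a" for \<nu> and f :: "'a ^ 'b \<Rightarrow> 'a"
  proof -
    obtain a where a: "is_coef f a" using ex by blast
    have "is_coef (mf \<nu> * f) (\<lambda>\<kappa>. \<Sum>\<mu>\<in>{\<mu>. a \<mu> \<noteq> 0}. if \<kappa> = \<nu> + \<mu> then a \<mu> else 0)"
    proof (rule is_coefI[of "(\<lambda>\<mu>. \<nu> + \<mu>) ` {\<mu>. a \<mu> \<noteq> 0}"])
      fix x
      let ?A = "{\<mu>. a \<mu> \<noteq> 0}"
      have fA: "finite ?A" using a by (simp add: is_coef_def)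
      have "(\<Sum>\<kappa>\<in>(+) \<nu> ` ?A. (\<Sum>\<mu>\<in>?A. if \<kappa> = \<nu> + \<mu> then a \<mu> else 0) * mpow x \<kappa>)
          = (\<Sum>\<kappa>\<in>(+) \<nu> ` ?A. \<Sum>\<mu>\<in>?A. if \<kappa> = \<nu> + \<mu> then a \<mu> * mpow x \<kappa> else 0)"
        by (simp add: sum_distrib_right if_distrib if_distribR cong: if_cong)
      also have "\<dots> = (\<Sum>\<mu>\<in>?A. \<Sum>\<kappa>\<in>(+) \<nu> ` ?A. if \<kappa> = \<nu> + \<mu> then a \<mu> * mpow x \<kappa> else 0)"
        by (rule sum.swap)
      also have "\<dots> = (\<Sum>\<mu>\<in>?A. a \<mu> * mpow x (\<nu> + \<mu>))"
        using fA by (intro sum.cong) auto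
      also have "\<dots> = (mf \<nu> * f) x"
        using a fun_cong[OF mf_add[of \<nu>], of _ x] by (simp add: is_coef_def pointwise sum_distrib_left mult_ac)
      finally show "(mf \<nu> * f) x = (\<Sum>\<kappa>\<in>(+) \<nu> ` ?A. (\<Sum>\<mu>\<in>?A. if \<kappa> = \<nu> + \<mu> then a \<mu> else 0) * mpow x \<kappa>)" ..
    qed (use a in \<open>auto simp: is_coef_def intro!: sum.neutral\<close>)
    then show ?thesis by blast
  qed
  show ?thesis using assms
  proof (induction rule: polyfun_coord_induct)
    case one
    show ?case using is_coef_mf[of 0] by (auto simp: mf_zero)
  next
    case (coord i f)
    have "mpow x (\<lambda>j. if j = i then 1 else 0) = x $ i" for x :: "'a ^ 'b"
    proof -
      have "mpow x (\<lambda>j. if j = i then 1 else 0) = (\<Prod>j\<in>UNIV. if j = i then x $ i else 1)"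
        unfolding mpow_def by (intro prod.cong) auto
      then show ?thesis by simp
    qed
    then have "lin i (0 :: 'a) = mf (\<lambda>j. if j = i then 1 else 0)"
      by (intro ext) (simp only: lin_apply mf_apply diff_zero)
    then show ?case using mult[OF coord(2)] by metis
  qed (use is_coef_add is_coef_scale in blast)+
qed

lemma is_coef_coef: "polyfun f \<Longrightarrow> is_coef f (coef f)"
  unfolding coef_def by (rule someI_ex[OF is_coef_exists])

lemma coef_eqI: "is_coef f a \<Longrightarrow> polyfun f \<Longrightarrow> coef f = a"
  for f :: "'a::field_char_0 ^ 'n::finite \<Rightarrow> 'a"
  using is_coef_unique[OF is_coef_coef] by blast

lemma coef_add: "polyfun f \<Longrightarrow> polyfun g \<Longrightarrow> coef (f + g) \<mu> = coef f \<mu> + coef g \<mu>"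
  and coef_scale: "polyfun f \<Longrightarrow> coef (cst c * f) \<mu> = c * coef f \<mu>"
  for f g :: "'a::field_char_0 ^ 'n::finite \<Rightarrow> 'a"
  using coef_eqI[OF is_coef_add[OF is_coef_coef is_coef_coef], of f g]
    coef_eqI[OF is_coef_scale[OF is_coef_coef], of f c] by auto

lemma coef_mf: "coef (mf \<nu> :: 'a::field_char_0 ^ 'n::finite \<Rightarrow> 'a) \<mu> = (if \<mu> = \<nu> then 1 else 0)"
  by (subst coef_eqI[OF is_coef_mf polyfun_mf]) simp

lemma finite_coef: "polyfun f \<Longrightarrow> finite {\<mu>. coef f \<mu> \<noteq> 0}"
  using is_coef_coef by (auto simp: is_coef_def)

lemma coef_0:
  fixes f :: "'a::field_char_0 ^ 'n::finite \<Rightarrow> 'a"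
  assumes "polyfun f" shows "coef f 0 = f 0"
proof -
  let ?S = "insert 0 {\<mu>. coef f \<mu> \<noteq> 0}"
  have S: "finite ?S" using finite_coef[OF assms] by simp
  have "f 0 = (\<Sum>\<mu>\<in>?S. coef f \<mu> * mpow 0 \<mu>)"
    using is_coef_sum[OF is_coef_coef[OF assms] S] by blast
  also have "\<dots> = (\<Sum>\<mu>\<in>?S. if \<mu> = 0 then coef f 0 else 0)" by (intro sum.cong) (auto simp: mpow_0)
  finally show ?thesis using S by simp
qed

text \<open>Linear combinations as an inductive predicate, so that bracket relations extend from a
  spanning set by rule induction.\<close>

inductive lc :: "('a::comm_ring_1 ^ 'n::finite \<Rightarrow> 'a) set \<Rightarrow> ('a ^ 'n \<Rightarrow> 'a) \<Rightarrow> bool" for B where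
  zero: "lc B 0"
| step: "b \<in> B \<Longrightarrow> lc B f \<Longrightarrow> lc B (cst c * b + f)"

lemma lc_sum: "finite S \<Longrightarrow> (\<And>i. i \<in> S \<Longrightarrow> b i \<in> B) \<Longrightarrow> lc B (\<Sum>i\<in>S. cst (a i) * b i)"
  by (induction S rule: finite_induct) (auto intro: lc.intros)

lemma lc_polyfun: "lc B f \<Longrightarrow> (\<And>b. b \<in> B \<Longrightarrow> polyfun b \<and> b 0 = 0) \<Longrightarrow> polyfun f \<and> f 0 = 0"
proof (induction rule: lc.induct)
  case (step b f c)
  then have "polyfun b \<and> b 0 = 0" "polyfun f \<and> f 0 = 0" by blast+
  then have "polyfun (cst c * b + f)" "(cst c * b + f) 0 = 0" by (blast, simp add: pointwise)
  then show ?case ..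
qed (simp add: zero_fun_apply)

lemma lc_mf:
  fixes f :: "'a::field_char_0 ^ 'n::finite \<Rightarrow> 'a"
  assumes "polyfun f" "f 0 = 0" shows "lc (mf ` {\<mu>. \<mu> \<noteq> 0}) f"
proof -
  let ?S = "{\<mu>. coef f \<mu> \<noteq> 0}"
  have "f = (\<Sum>\<mu>\<in>?S. cst (coef f \<mu>) * mf \<mu>)"
    using is_coef_coef[OF assms(1)] by (auto simp: fun_eq_iff sum_fun_apply pointwise is_coef_def)
  moreover have "lc (mf ` {\<mu>. \<mu> \<noteq> 0}) (\<Sum>\<mu>\<in>?S. cst (coef f \<mu>) * mf \<mu>)"
    using coef_0[OF assms(1)] assms(2) finite_coef[OF assms(1)] by (intro lc_sum) auto
  ultimately show ?thesis by simp
qed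

lemma multinomial_shift:
  fixes \<beta> :: "'a::comm_ring_1 ^ 'n::finite"
  shows "finite {l. l \<le> \<mu>}" and "sh \<beta> (mf \<mu>) = (\<Sum>l\<in>{l. l \<le> \<mu>}. cst (of_nat (mbinom \<mu> l) * mpow \<beta> l) * mf (\<mu> - l))"
proof -
  have eq: "{l. l \<le> \<mu>} = PiE UNIV (\<lambda>i. {..\<mu> i})" by (auto simp: PiE_def Pi_def le_fun_def)
  show "finite {l. l \<le> \<mu>}" unfolding eq by (intro finite_PiE) auto
  show "sh \<beta> (mf \<mu>) = (\<Sum>l\<in>{l. l \<le> \<mu>}. cst (of_nat (mbinom \<mu> l) * mpow \<beta> l) * mf (\<mu> - l))"
  proof
    fix x :: "'a ^ 'n"
    have "sh \<beta> (mf \<mu>) x = (\<Prod>i\<in>UNIV. (\<beta> $ i + x $ i) ^ \<mu> i)"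
      by (simp add: pointwise mpow_def add.commute)
    also have "\<dots> = (\<Prod>i\<in>UNIV. \<Sum>j\<in>{..\<mu> i}. of_nat (\<mu> i choose j) * \<beta> $ i ^ j * x $ i ^ (\<mu> i - j))"
      by (simp only: binomial_ring)
    also have "\<dots> = (\<Sum>l\<in>PiE UNIV (\<lambda>i. {..\<mu> i}). \<Prod>i\<in>UNIV. of_nat (\<mu> i choose l i) * \<beta> $ i ^ l i * x $ i ^ (\<mu> i - l i))"
      by (rule prod_sum_PiE) auto
    also have "\<dots> = (\<Sum>l\<in>{l. l \<le> \<mu>}. (cst (of_nat (mbinom \<mu> l) * mpow \<beta> l) * mf (\<mu> - l)) x)"
      unfolding eq by (intro sum.cong refl) (simp add: pointwise mbinom_def mpow_def prod.distrib)
    finally show "sh \<beta> (mf \<mu>) x = (\<Sum>l\<in>{l. l \<le> \<mu>}. cst (of_nat (mbinom \<mu> l) * mpow \<beta> l) * mf (\<mu> - l)) x"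
      by (simp add: sum_fun_apply)
  qed
qed

section \<open>The action of all polynomials on a given module\<close>

locale linrep = vector_space sc
  for sc :: "'a::{alg_closed_field, field_char_0} \<Rightarrow> 'v::ab_group_add \<Rightarrow> 'v" +
  fixes G :: "('a ^ 'n::finite) set" and \<rho> :: "'a ^ 'n \<Rightarrow> ('n \<Rightarrow> nat) \<Rightarrow> 'v \<Rightarrow> 'v"
  assumes G: "add_subgroup G"
    and \<rho>_linear: "\<alpha> \<in> G \<Longrightarrow> \<mu> \<noteq> 0 \<Longrightarrow> Vector_Spaces.linear sc sc (\<rho> \<alpha> \<mu>)"
begin

definition T :: "'a ^ 'n \<Rightarrow> ('a ^ 'n \<Rightarrow> 'a) \<Rightarrow> 'v \<Rightarrow> 'v" where
  "T k f u = (if k \<in> G then \<Sum>\<mu>\<in>{\<mu>. coef f \<mu> \<noteq> 0}. sc (coef f \<mu>) (\<rho> k \<mu> u) else 0)"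

lemma T_sum_over:
  "k \<in> G \<Longrightarrow> finite S \<Longrightarrow> {\<mu>. coef f \<mu> \<noteq> 0} \<subseteq> S \<Longrightarrow> T k f u = (\<Sum>\<mu>\<in>S. sc (coef f \<mu>) (\<rho> k \<mu> u))"
  unfolding T_def by (auto intro: sum.mono_neutral_left)

lemma T_add: "polyfun f \<Longrightarrow> polyfun g \<Longrightarrow> T k (f + g) u = T k f u + T k g u"
proof (cases "k \<in> G")
  case True
  assume fg: "polyfun f" "polyfun g"
  let ?S = "{\<mu>. coef f \<mu> \<noteq> 0} \<union> {\<mu>. coef g \<mu> \<noteq> 0}"
  have S: "finite ?S" using finite_coef fg by auto
  have "T k (f + g) u = (\<Sum>\<mu>\<in>?S. sc (coef (f + g) \<mu>) (\<rho> k \<mu> u))"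
    by (rule T_sum_over[OF True S]) (auto simp: coef_add fg)
  also have "\<dots> = (\<Sum>\<mu>\<in>?S. sc (coef f \<mu>) (\<rho> k \<mu> u)) + (\<Sum>\<mu>\<in>?S. sc (coef g \<mu>) (\<rho> k \<mu> u))"
    by (simp add: coef_add fg scale_left_distrib sum.distrib)
  finally show ?thesis using T_sum_over[OF True S, of f] T_sum_over[OF True S, of g] by auto
qed (simp add: T_def)

lemma T_scale: "polyfun f \<Longrightarrow> T k (cst c * f) u = sc c (T k f u)"
proof (cases "k \<in> G")
  case True
  assume f: "polyfun f"
  have "T k (cst c * f) u = (\<Sum>\<mu>\<in>{\<mu>. coef f \<mu> \<noteq> 0}. sc (coef (cst c * f) \<mu>) (\<rho> k \<mu> u))"
    by (rule T_sum_over[OF True finite_coef[OF f]]) (auto simp: coef_scale f)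
  then show ?thesis using True by (simp add: T_def coef_scale f scale_sum_right)
qed (simp add: T_def)

lemma T_mf: "k \<in> G \<Longrightarrow> T k (mf \<mu>) u = \<rho> k \<mu> u"
  using T_sum_over[of k "{\<mu>}" "mf \<mu>" u] by (simp add: coef_mf)

lemma T_zero_fun: "T k 0 u = 0"
  using T_add[of 0 0 k u] by simp

lemma T_minus: "polyfun f \<Longrightarrow> polyfun g \<Longrightarrow> T k (f - g) u = T k f u - T k g u"
  using T_add[of "f - g" g k u] by (simp add: algebra_simps)

lemma T_sum: "finite A \<Longrightarrow> (\<And>i. i \<in> A \<Longrightarrow> polyfun (f i)) \<Longrightarrow> T k (\<Sum>i\<in>A. f i) u = (\<Sum>i\<in>A. T k (f i) u)"
  by (induction A rule: finite_induct) (auto simp: T_zero_fun T_add polyfun_sum)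

lemma T_linear:
  assumes f: "polyfun f" "f 0 = 0" shows "Vector_Spaces.linear sc sc (T k f)"
proof (cases "k \<in> G")
  case True
  have z: "\<mu> \<noteq> 0" if "coef f \<mu> \<noteq> 0" for \<mu> using that coef_0[OF f(1)] f(2) by metis
  have l: "\<rho> k \<mu> (u + v) = \<rho> k \<mu> u + \<rho> k \<mu> v" "\<rho> k \<mu> (sc c u) = sc c (\<rho> k \<mu> u)" if "coef f \<mu> \<noteq> 0" for \<mu> u v c
    using \<rho>_linear[OF True z[OF that]] unfolding Vector_Spaces.linear_iff by blast+
  have "T k f (u + v) = T k f u + T k f v" for u v
    unfolding T_def using True by (simp add: l scale_right_distrib sum.distrib)
  moreover have "T k f (sc c u) = sc c (T k f u)" for c u
    unfolding T_def using True by (simp add: l scale_sum_right scale_left_commute mult.commute)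
  ultimately show ?thesis by (simp add: Vector_Spaces.linear_iff vector_space_axioms)
next
  case False
  then show ?thesis by (simp add: Vector_Spaces.linear_iff vector_space_axioms T_def)
qed

lemma
  assumes "polyfun f" "f 0 = 0"
  shows T_vzero: "T k f 0 = 0" and T_vadd: "T k f (u + v) = T k f u + T k f v"
    and T_vscale: "T k f (sc c u) = sc c (T k f u)"
proof -
  interpret l: Vector_Spaces.linear sc sc "T k f" by (rule T_linear[OF assms])
  show "T k f 0 = 0" "T k f (u + v) = T k f u + T k f v" "T k f (sc c u) = sc c (T k f u)"
    by (rule l.zero l.add l.scale)+
qed

text \<open>The sum over l is the binomial expansion of \<open>sh \<beta> (mf \<mu>)\<close>, that
  is, of \<open>D^\<mu> t^\<beta> = t^\<beta> (D + \<beta>)^\<mu>\<close>.\<close>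

lemma W_comm_eq:
  assumes "\<alpha> \<in> G" "\<beta> \<in> G" "\<mu> \<noteq> 0" "\<nu> \<noteq> 0"
  shows "W_comm sc \<rho> \<alpha> \<mu> \<beta> \<nu> v = T (\<alpha> + \<beta>) (sh \<beta> (mf \<mu>) * mf \<nu> - mf \<mu> * sh \<alpha> (mf \<nu>)) v"
proof -
  have G': "\<alpha> + \<beta> \<in> G" using assms G by (simp add: add_subgroup_def)
  have *: "T (\<alpha> + \<beta>) (sh \<beta> (mf \<mu>) * mf \<nu>) v =
      (\<Sum>l\<in>{l. l \<le> \<mu>}. sc (of_nat (mbinom \<mu> l) * mpow \<beta> l) (\<rho> (\<alpha> + \<beta>) (\<mu> + \<nu> - l) v))"
    if "\<alpha> + \<beta> \<in> G" for \<alpha> \<beta> and \<mu> \<nu> :: "'n \<Rightarrow> nat"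
  proof -
    have "sh \<beta> (mf \<mu>) * mf \<nu> = (\<Sum>l\<in>{l. l \<le> \<mu>}. cst (of_nat (mbinom \<mu> l) * mpow \<beta> l) * mf (\<mu> + \<nu> - l))"
    proof -
      have "mf (\<mu> - l) * mf \<nu> = (mf (\<mu> + \<nu> - l) :: 'a ^ 'n \<Rightarrow> 'a)" if "l \<le> \<mu>" for l
      proof -
        have "\<mu> + \<nu> - l = (\<mu> - l) + \<nu>" using that by (auto simp: fun_eq_iff le_fun_def pointwise)
        then show ?thesis by (simp add: mf_add)
      qed
      then show ?thesis unfolding multinomial_shift(2) by (simp add: sum_distrib_right mult.assoc)
    qed
    then show ?thesis using that by (simp add: T_sum multinomial_shift(1) T_scale T_mf)
  qed
  have "T (\<alpha> + \<beta>) (mf \<mu> * sh \<alpha> (mf \<nu>)) v = T (\<beta> + \<alpha>) (sh \<alpha> (mf \<nu>) * mf \<mu>) v" by (simp add: add.commute mult.commute)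
  also have "\<dots> = (\<Sum>l\<in>{l. l \<le> \<nu>}. sc (of_nat (mbinom \<nu> l) * mpow \<alpha> l) (\<rho> (\<alpha> + \<beta>) (\<mu> + \<nu> - l) v))"
    using *[of \<beta> \<alpha> \<nu> \<mu>] G' by (simp add: add.commute)
  finally show ?thesis unfolding W_comm_def using *[of \<alpha> \<beta> \<mu> \<nu>] G' by (simp add: T_minus)
qed

text \<open>The scalar s stands for the cocycle, which vanishes unless \<open>k + l = 0\<close> and also for \<open>k = 0\<close>.\<close>

definition R :: "('v \<Rightarrow> 'v) \<Rightarrow> 'a ^ 'n \<Rightarrow> 'a ^ 'n \<Rightarrow> ('a ^ 'n \<Rightarrow> 'a) \<Rightarrow> ('a ^ 'n \<Rightarrow> 'a) \<Rightarrow> bool" where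
  "R c k l f g \<longleftrightarrow> (\<exists>s. (k + l \<noteq> 0 \<or> k = 0 \<longrightarrow> s = 0) \<and>
    (\<forall>u. T k f (T l g u) - T l g (T k f u) = T (k + l) (sh l f * g - f * sh k g) u + sc s (c u)))"

text \<open>The scalar of a linear combination is the same combination of scalars, so its prescribed
  vanishing is inherited.\<close>

lemma R_left:
  assumes "lc B f" and B: "\<And>b. b \<in> B \<Longrightarrow> polyfun b \<and> b 0 = 0" and g: "polyfun g" "g 0 = 0"
    and R: "\<And>b. b \<in> B \<Longrightarrow> R c k l b g"
  shows "R c k l f g"
  using assms(1)
proof (induction rule: lc.induct)
  case zero
  have "sh l 0 = (0 :: 'a ^ 'n \<Rightarrow> 'a)" by (auto simp: fun_eq_iff pointwise)
  then show ?case unfolding R_def by (intro exI[of _ 0]) (use g in \<open>simp add: T_zero_fun T_vzero\<close>)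
next
  case (step b f a)
  have f: "polyfun f" "f 0 = 0" and b: "polyfun b" "b 0 = 0" using lc_polyfun[OF step(2)] B step by auto
  obtain s where s: "k + l \<noteq> 0 \<or> k = 0 \<longrightarrow> s = 0"
    "\<And>u. T k f (T l g u) - T l g (T k f u) = T (k + l) (sh l f * g - f * sh k g) u + sc s (c u)"
    using step(3) unfolding R_def by blast
  obtain t where t: "k + l \<noteq> 0 \<or> k = 0 \<longrightarrow> t = 0"
    "\<And>u. T k b (T l g u) - T l g (T k b u) = T (k + l) (sh l b * g - b * sh k g) u + sc t (c u)"
    using R[OF step(1)] unfolding R_def by blast
  have eq: "sh l (cst a * b + f) * g - (cst a * b + f) * sh k g = cst a * (sh l b * g - b * sh k g) + (sh l f * g - f * sh k g)"
    by (auto simp: fun_eq_iff pointwise algebra_simps)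
  have "T k (cst a * b + f) (T l g u) - T l g (T k (cst a * b + f) u) =
      sc a (T k b (T l g u) - T l g (T k b u)) + (T k f (T l g u) - T l g (T k f u))" for u
    using f b g by (simp add: T_add T_scale T_vadd T_vscale scale_right_diff_distrib)
  also have "\<dots> u = T (k + l) (sh l (cst a * b + f) * g - (cst a * b + f) * sh k g) u + sc (a * t + s) (c u)" for u
    unfolding s t eq using f b g by (simp add: T_add T_scale scale_right_distrib scale_left_distrib)
  finally show ?case unfolding R_def using s(1) t(1) by (intro exI[of _ "a * t + s"]) auto
qed

lemma R_sym:
  assumes R: "R c k l f g" and f: "polyfun f" and g: "polyfun g" shows "R c l k g f"
proof -
  obtain s where s: "k + l \<noteq> 0 \<or> k = 0 \<longrightarrow> s = 0"
    "\<And>u. T k f (T l g u) - T l g (T k f u) = T (k + l) (sh l f * g - f * sh k g) u + sc s (c u)"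
    using R unfolding R_def by blast
  have "T l g (T k f u) - T k f (T l g u) = T (l + k) (sh k g * f - g * sh l f) u + sc (- s) (c u)" for u
  proof -
    have "sh k g * f - g * sh l f = cst (- 1) * (sh l f * g - f * sh k g)"
      by (auto simp: fun_eq_iff pointwise algebra_simps)
    then have "T (l + k) (sh k g * f - g * sh l f) u = - T (k + l) (sh l f * g - f * sh k g) u"
      using f g by (simp add: T_scale scale_minus_left add.commute)
    then show ?thesis using s(2)[of u] by (simp add: algebra_simps scale_minus_left)
  qed
  moreover have "l + k \<noteq> 0 \<or> l = 0 \<longrightarrow> - s = 0" using s(1) by (auto simp: add.commute)
  ultimately show ?thesis unfolding R_def by blast
qed

lemma R_lc:
  assumes f: "lc B f" and g: "lc B g" and B: "\<And>b. b \<in> B \<Longrightarrow> polyfun b \<and> b 0 = 0"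
    and R: "\<And>b b'. b \<in> B \<Longrightarrow> b' \<in> B \<Longrightarrow> R c k l b b'"
  shows "R c k l f g"
proof -
  have fg: "polyfun f \<and> f 0 = 0" "polyfun g \<and> g 0 = 0" using lc_polyfun f g B by blast+
  show ?thesis
  proof (rule R_left[OF f B])
    fix b assume b: "b \<in> B"
    have bs: "R c l k b' b" if b': "b' \<in> B" for b'
      by (rule R_sym[OF R[OF b b'] conjunct1[OF B[OF b]] conjunct1[OF B[OF b']]])
    have "R c l k g b" by (rule R_left[OF g B conjunct1[OF B[OF b]] conjunct2[OF B[OF b]] bs])
    then show "R c k l b g" by (rule R_sym[OF _ conjunct1[OF fg(2)] conjunct1[OF B[OF b]]])
  qed (use fg in auto)
qed

lemma Tsys_T:
  assumes gr: "qf_grading sc G Vg" and grade: "\<And>\<alpha> \<beta> \<mu>. \<alpha> \<in> G \<Longrightarrow> \<beta> \<in> G \<Longrightarrow> \<mu> \<noteq> 0 \<Longrightarrow> \<rho> \<alpha> \<mu> ` Vg \<beta> \<subseteq> Vg (\<alpha> + \<beta>)"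
    and R: "\<And>k l f g. k \<in> G \<Longrightarrow> l \<in> G \<Longrightarrow> polyfun f \<Longrightarrow> f 0 = 0 \<Longrightarrow> polyfun g \<Longrightarrow> g 0 = 0 \<Longrightarrow> R c k l f g"
    and c: "\<And>u. c u = sc c0 u"
  shows "Tsys sc G Vg T"
proof (intro Tsys.intro Tsys_axioms.intro)
  show "vector_space sc" by (rule vector_space_axioms)
  show "add_subgroup G" by (rule G)
  show "qf_grading sc G Vg" by (rule gr)
  show "T k f u = 0" if "k \<notin> G" for k f u using that by (simp add: T_def)
  show "Vector_Spaces.linear sc sc (T k f)" if "polyfun f" "f 0 = 0" for k f using T_linear[OF that] .
  show "T k (f + g) u = T k f u + T k g u" if "polyfun f" "polyfun g" for k f g u using T_add[OF that] .
  show "T k (cst c * f) u = sc c (T k f u)" if "polyfun f" for k c f u using T_scale[OF that] .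
next
  fix f :: "'a ^ 'n \<Rightarrow> 'a" and k a u assume *: "polyfun f" "f 0 = 0" "k \<in> G" "a \<in> G" "u \<in> Vg a"
  have "subspace (Vg (a + k))" using gr * G by (simp add: qf_grading_def add_subgroup_def)
  moreover have "\<rho> k \<mu> u \<in> Vg (a + k)" if "coef f \<mu> \<noteq> 0" for \<mu>
  proof -
    have "\<mu> \<noteq> 0" using that coef_0[OF *(1)] *(2) by metis
    then show ?thesis using grade[OF *(3,4), of \<mu>] *(5) by (auto simp: add.commute)
  qed
  ultimately show "T k f u \<in> Vg (a + k)" unfolding T_def using *
    by (auto intro!: subspace_sum subspace_scale)
next
  fix f g :: "'a ^ 'n \<Rightarrow> 'a" and k l u
  assume *: "polyfun f" "f 0 = 0" "polyfun g" "g 0 = 0" "k \<in> G" "l \<in> G" "k + l \<noteq> 0 \<or> k = 0"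
  show "T k f (T l g u) - T l g (T k f u) = T (k + l) (sh l f * g - f * sh k g) u"
    using R[OF *(5,6,1-4)] *(7) unfolding R_def by auto
next
  fix f g :: "'a ^ 'n \<Rightarrow> 'a" and k
  assume *: "polyfun f" "f 0 = 0" "polyfun g" "g 0 = 0" "k \<in> G"
  have "- k \<in> G" using *(5) G by (simp add: add_subgroup_def)
  from R[OF *(5) this *(1-4)] obtain s where
    "\<And>u. T k f (T (- k) g u) - T (- k) g (T k f u) = T 0 (sh (- k) f * g - f * sh k g) u + sc s (c u)"
    unfolding R_def by auto
  then show "\<exists>s. \<forall>u. T k f (T (- k) g u) - T (- k) g (T k f u) = T 0 (sh (- k) f * g - f * sh k g) u + sc s u"
    by (intro exI[of _ "s * c0"]) (simp add: c)
qed

lemma T_submodule_iff: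
  assumes "subspace S"
  shows "(\<forall>k f u. polyfun f \<longrightarrow> f 0 = 0 \<longrightarrow> u \<in> S \<longrightarrow> T k f u \<in> S) \<longleftrightarrow> W_submodule sc G \<rho> S"
proof
  assume *: "\<forall>k f u. polyfun f \<longrightarrow> f 0 = 0 \<longrightarrow> u \<in> S \<longrightarrow> T k f u \<in> S"
  have "\<rho> \<alpha> \<mu> u \<in> S" if "\<alpha> \<in> G" "\<mu> \<noteq> 0" "u \<in> S" for \<alpha> \<mu> u
    using *[rule_format, of "mf \<mu>" u \<alpha>] that by (simp add: T_mf pointwise mpow_0)
  then show "W_submodule sc G \<rho> S" using assms unfolding W_submodule_def by blast
next
  assume *: "W_submodule sc G \<rho> S"
  show "\<forall>k f u. polyfun f \<longrightarrow> f 0 = 0 \<longrightarrow> u \<in> S \<longrightarrow> T k f u \<in> S"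
  proof (intro allI impI)
    fix k :: "'a ^ 'n" and f u assume f: "polyfun f" "f (0 :: 'a ^ 'n) = (0::'a)" "u \<in> S"
    have "\<rho> k \<mu> u \<in> S" if "coef f \<mu> \<noteq> 0" "k \<in> G" for \<mu>
    proof -
      have "\<mu> \<noteq> 0" using that coef_0[OF f(1)] f(2) by metis
      then show ?thesis using * f(3) that unfolding W_submodule_def by blast
    qed
    then show "T k f u \<in> S" unfolding T_def using assms
      by (auto intro!: subspace_sum subspace_scale subspace_0)
  qed
qed

end

lemma W_module_linrep:
  assumes "add_subgroup G" "W_module sc G \<rho>"
  shows "linrep sc G \<rho>"
  using assms unfolding W_module_def by (intro linrep.intro linrep_axioms.intro) auto

lemma W_module_R:
  fixes sc :: "'a::{alg_closed_field, field_char_0} \<Rightarrow> 'v::ab_group_add \<Rightarrow> 'v"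
  assumes G: "add_subgroup G" and W: "W_module sc G \<rho>"
    and k: "k \<in> G" "l \<in> G" and f: "polyfun f" "f 0 = 0" and g: "polyfun g" "g 0 = 0"
  shows "linrep.R sc G \<rho> (\<lambda>_. 0) k l f g"
proof -
  interpret linrep sc G \<rho> by (rule W_module_linrep[OF G W])
  show ?thesis
  proof (rule R_lc[OF lc_mf[OF f] lc_mf[OF g]])
    fix b b' :: "'a ^ 'b \<Rightarrow> 'a" assume "b \<in> mf ` {\<mu>. \<mu> \<noteq> 0}" "b' \<in> mf ` {\<mu>. \<mu> \<noteq> 0}"
    then obtain \<mu> \<nu> where b: "b = mf \<mu>" "\<mu> \<noteq> 0" "b' = mf \<nu>" "\<nu> \<noteq> 0" by blast
    have "T k b (T l b' u) - T l b' (T k b u) = T (k + l) (sh l b * b' - b * sh k b') u" for u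
      unfolding b using W k b W_comm_eq[OF k b(2,4), of u] unfolding W_module_def by (simp add: T_mf)
    then show "R (\<lambda>_. 0) k l b b'" unfolding R_def by (intro exI[of _ 0]) simp
  qed (auto simp: pointwise mpow_0)
qed

subsection \<open>The central extension\<close>

lemma ffp_Suc: "ffp (Suc m) = ffp m * [:- of_nat m, 1:]"
  by (simp add: ffp_def lessThan_Suc mult.commute)

lemma coeff_ffp_0: "m \<ge> 1 \<Longrightarrow> coeff (ffp m :: 'a::comm_ring_1 poly) 0 = 0"
proof (induction m)
  case (Suc m)
  then show ?case by (cases "m = 0") (simp_all add: ffp_Suc coeff_mult ffp_def[of 0])
qed simp

lemma degree_ffp: "degree (ffp m :: 'a::idom poly) \<le> m"
proof (induction m)
  case (Suc m)
  have "degree (ffp (Suc m) :: 'a poly) \<le> degree (ffp m :: 'a poly) + degree [:- of_nat m, 1 :: 'a:]"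
    unfolding ffp_Suc by (rule degree_mult_le)
  then show ?case using Suc by simp
qed (simp add: ffp_def)

lemma mf_cD: "mf (cD k) x = x $ 1 ^ k"
  by (simp add: pointwise mpow_def cD_def)

lemma cD_zero: "cD k = 0 \<longleftrightarrow> k = 0"
  by (simp add: cD_def fun_eq_iff pointwise)

lemma upoly_ffp: "upoly (ffp m) 1 = (\<Sum>k\<le>m. cst (coeff (ffp m :: 'a::idom poly) k) * mf (cD k))"
proof
  fix x :: "'a ^ 1"
  have "poly (ffp m) (x $ 1) = (\<Sum>k\<le>m. coeff (ffp m) k * (x $ 1) ^ k)"
    unfolding poly_altdef using degree_ffp[of m, where 'a = 'a]
    by (intro sum.mono_neutral_left) (auto simp: coeff_eq_0)
  then show "upoly (ffp m) 1 x = (\<Sum>k\<le>m. cst (coeff (ffp m) k) * mf (cD k)) x"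
    by (simp add: sum_fun_apply mf_cD upoly_apply cst_apply times_fun_apply)
qed

definition FF :: "('a::comm_ring_1 ^ 1 \<Rightarrow> 'a) set" where
  "FF = (\<lambda>m. upoly (ffp m) 1) ` {1..}"

lemma FF_vanish: "b \<in> FF \<Longrightarrow> polyfun b \<and> b 0 = 0"
  by (auto simp: FF_def pointwise poly_0_coeff_0 coeff_ffp_0)

text \<open>\<open>X [X]_m = [X]_(m+1) + m [X]_m\<close> keeps the span of the falling factorials
  with \<open>m \<ge> 1\<close> stable under X. A constant splits off during the induction, and the
  value at 0 shows that it is 0.\<close>

lemma lc_FF:
  fixes f :: "'a::field_char_0 ^ 1 \<Rightarrow> 'a"
  assumes "polyfun f" "f 0 = 0" shows "lc FF f"
proof -
  have lc_add: "lc FF p \<Longrightarrow> lc FF q \<Longrightarrow> lc FF (p + q)" for p q :: "'a ^ 1 \<Rightarrow> 'a"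
    by (induction rule: lc.induct) (auto simp: add.assoc intro: lc.step)
  have lc_scale: "lc FF p \<Longrightarrow> lc FF (cst c * p)" for p :: "'a ^ 1 \<Rightarrow> 'a" and c
  proof (induction rule: lc.induct)
    case (step b f a)
    have "cst c * (cst a * b + f) = cst (c * a) * b + cst c * f" by (auto simp: fun_eq_iff pointwise algebra_simps)
    then show ?case using step by (simp add: lc.step)
  qed (simp add: lc.zero)
  have lc_base: "lc FF (upoly (ffp m) 1 :: 'a ^ 1 \<Rightarrow> 'a)" if "m \<ge> 1" for m
  proof -
    have "upoly (ffp m) 1 \<in> (FF :: ('a ^ 1 \<Rightarrow> 'a) set)" using that by (auto simp: FF_def)
    from lc.step[OF this lc.zero, of 1] show ?thesis by (simp add: cst_def one_fun_def[symmetric])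
  qed
  have X: "lin 1 0 * upoly (ffp m) 1 = upoly (ffp (Suc m)) 1 + cst (of_nat m) * (upoly (ffp m) 1 :: 'a ^ 1 \<Rightarrow> 'a)" for m
    by (auto simp: fun_eq_iff pointwise ffp_Suc algebra_simps)
  have lc_X: "lc FF p \<Longrightarrow> lc FF (lin 1 0 * p)" for p :: "'a ^ 1 \<Rightarrow> 'a"
  proof (induction rule: lc.induct)
    case (step b f a)
    then obtain m where m: "m \<ge> 1" "b = upoly (ffp m) 1" by (auto simp: FF_def)
    have "lin 1 0 * (cst a * b + f) = cst a * (lin 1 0 * b) + lin 1 0 * f" by (simp add: algebra_simps)
    then show ?case unfolding m(2) X using step(3) m lc_base by (auto intro!: lc_add lc_scale)
  qed (simp add: lc.zero)
  have lX: "lin 1 0 = (upoly (ffp 1) 1 :: 'a ^ 1 \<Rightarrow> 'a)" by (auto simp: fun_eq_iff pointwise ffp_def)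
  have "\<exists>p a. lc FF p \<and> f = cst a + p" using assms(1)
  proof (induction rule: polyfun_coord_induct)
    case one
    have "(1 :: 'a ^ 1 \<Rightarrow> 'a) = cst 1 + 0" by (auto simp: fun_eq_iff pointwise)
    then show ?case using lc.zero by blast
  next
    case (scale c f)
    then obtain p a where "lc FF p" "f = cst a + p" by blast
    moreover have "cst c * (cst a + p) = cst (c * a) + cst c * p" by (auto simp: fun_eq_iff pointwise algebra_simps)
    ultimately show ?case using lc_scale by blast
  next
    case (add f g)
    then obtain p a q b where "lc FF p" "f = cst a + p" "lc FF q" "g = cst b + q" by blast
    moreover have "cst a + p + (cst b + q) = cst (a + b) + (p + q)" by (auto simp: fun_eq_iff pointwise algebra_simps)
    ultimately show ?case using lc_add by metis
  next
    case (coord i f)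
    then obtain p a where p: "lc FF p" "f = cst a + p" by blast
    have "i = 1" by simp
    moreover have "lc FF (cst a * lin 1 0 + lin 1 0 * p)" unfolding lX
      using lc_X[OF p(1)] lc_base[of 1] unfolding lX by (auto intro!: lc_add lc_scale)
    moreover have "lin 1 0 * (cst a + p) = cst 0 + (cst a * lin 1 0 + lin 1 0 * p)"
      by (auto simp: fun_eq_iff pointwise algebra_simps)
    ultimately show ?case using p(2) by metis
  qed
  then obtain p a where p: "lc FF p" "f = cst a + p" by blast
  have "p 0 = 0" using lc_polyfun[OF p(1) FF_vanish] by blast
  then have "a = 0" using assms(2) p(2) by (simp add: pointwise)
  then have "f = p" using p(2) by (auto simp: fun_eq_iff pointwise)
  then show ?thesis using p(1) by simp
qed

lemma Wh_module_linrep: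
  assumes "add_subgroup G" "Wh_module sc G \<rho> c"
  shows "linrep sc G \<rho>"
  using assms unfolding Wh_module_def by (intro linrep.intro linrep_axioms.intro) auto

text \<open>In degree 0 the binomial coefficient is \<open>m\<close> over \<open>m + n + 1\<close>,
  which is 0.\<close>

lemma cocycle_zero:
  assumes "k + l \<noteq> 0 \<or> k = 0" "n \<ge> 1" shows "cocycle k m l n = 0"
proof (cases "k = - l")
  case True
  then have k: "k = 0" using assms(1) by auto
  have "((of_nat m :: 'a) gchoose (m + n + 1)) = 0"
    unfolding binomial_gbinomial[symmetric] by (simp add: binomial_eq_0)
  then show ?thesis using k by (simp add: cocycle_def)
qed (simp add: cocycle_def)

lemma Wh_module_bracket:
  fixes sc :: "'a::{alg_closed_field, field_char_0} \<Rightarrow> 'v::ab_group_add \<Rightarrow> 'v"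
  assumes G: "add_subgroup G" and W: "Wh_module sc G \<rho> c" and k: "k \<in> G" "l \<in> G" and m: "m \<ge> 1" "n \<ge> 1"
  defines "f \<equiv> upoly (ffp m) 1" and "g \<equiv> upoly (ffp n) 1"
  shows "linrep.T sc G \<rho> k f (linrep.T sc G \<rho> l g u) - linrep.T sc G \<rho> l g (linrep.T sc G \<rho> k f u) =
    linrep.T sc G \<rho> (k + l) (sh l f * g - f * sh k g) u + sc (cocycle k m l n) (c u)"
proof -
  interpret linrep sc G \<rho> by (rule Wh_module_linrep[OF G W])
  have G': "k + l \<in> G" using k G by (simp add: add_subgroup_def)
  have ff: "rho_ff sc \<rho> \<alpha> m v = T \<alpha> (upoly (ffp m) 1) v" if "\<alpha> \<in> G" for \<alpha> m v
    unfolding rho_ff_def upoly_ffp using that by (simp add: T_sum T_scale T_mf)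
  \<comment> \<open>\<open>W_comm_eq\<close> does not cover the exponent 0, but for it the falling
    factorials have coefficient 0.\<close>
  have tm: "sc (coeff (ffp m) i * coeff (ffp n) j) (W_comm sc \<rho> k (cD i) l (cD j) u) =
      T (k + l) (cst (coeff (ffp m) i * coeff (ffp n) j) * (sh l (mf (cD i)) * mf (cD j) - mf (cD i) * sh k (mf (cD j)))) u" for i j
  proof (cases "i = 0 \<or> j = 0")
    case True
    then have "coeff (ffp m) i * coeff (ffp n) j = (0::'a)" using m coeff_ffp_0[where 'a = 'a] by auto
    then show ?thesis by (simp add: T_scale)
  next
    case False
    then show ?thesis using W_comm_eq[OF k, of "cD i" "cD j" u] by (simp add: T_scale cD_zero)
  qed
  have "(\<Sum>i\<le>m. \<Sum>j\<le>n. sc (coeff (ffp m) i * coeff (ffp n) j) (W_comm sc \<rho> k (cD i) l (cD j) u)) =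
      T (k + l) (\<Sum>i\<le>m. \<Sum>j\<le>n. cst (coeff (ffp m) i * coeff (ffp n) j) *
        (sh l (mf (cD i)) * mf (cD j) - mf (cD i) * sh k (mf (cD j)))) u"
    unfolding tm by (subst T_sum, simp, blast intro: polyfun_sum, subst T_sum) (auto intro!: sum.cong)
  also have "(\<Sum>i\<le>m. \<Sum>j\<le>n. cst (coeff (ffp m) i * coeff (ffp n) j) *
        (sh l (mf (cD i)) * mf (cD j) - mf (cD i) * sh k (mf (cD j)))) = sh l f * g - f * sh k g"
  proof
    fix x :: "'a ^ 1"
    have u: "poly (ffp m) y = (\<Sum>k\<le>m. coeff (ffp m) k * y ^ k)" for m and y :: 'a
      unfolding poly_altdef using degree_ffp[of m, where 'a = 'a]
      by (intro sum.mono_neutral_left) (auto simp: coeff_eq_0)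
    show "(\<Sum>i\<le>m. \<Sum>j\<le>n. cst (coeff (ffp m) i * coeff (ffp n) j) *
        (sh l (mf (cD i)) * mf (cD j) - mf (cD i) * sh k (mf (cD j)))) x = (sh l f * g - f * sh k g) x"
    proof -
      have prod: "(\<Sum>i\<le>m. coeff (ffp m) i * y ^ i) * (\<Sum>j\<le>n. coeff (ffp n) j * z ^ j) =
          (\<Sum>i\<le>m. \<Sum>j\<le>n. coeff (ffp m) i * coeff (ffp n) j * (y ^ i * z ^ j))" for y z :: 'a
        by (simp add: sum_product mult_ac)
      show ?thesis
        unfolding f_def g_def sum_fun_apply minus_apply times_fun_apply cst_apply sh_apply upoly_apply mf_cD u prod
          sum_subtractf[symmetric] right_diff_distrib ..
    qed
  qed
  finally have "(\<Sum>i\<le>m. \<Sum>j\<le>n. sc (coeff (ffp m) i * coeff (ffp n) j) (W_comm sc \<rho> k (cD i) l (cD j) u)) =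
      T (k + l) (sh l f * g - f * sh k g) u" .
  moreover have "rho_ff sc \<rho> k m (rho_ff sc \<rho> l n u) - rho_ff sc \<rho> l n (rho_ff sc \<rho> k m u)
        = (\<Sum>j\<le>m. \<Sum>i\<le>n. sc (coeff (ffp m) j * coeff (ffp n) i) (W_comm sc \<rho> k (cD j) l (cD i) u))
          + sc (cocycle k m l n) (c u)"
    by (rule W[unfolded Wh_module_def, THEN conjunct2, THEN conjunct2, THEN conjunct2, THEN conjunct2, rule_format, OF k m])
  ultimately show ?thesis unfolding f_def g_def using k by (simp add: ff)
qed

lemma Wh_module_R:
  fixes sc :: "'a::{alg_closed_field, field_char_0} \<Rightarrow> 'v::ab_group_add \<Rightarrow> 'v"
  assumes G: "add_subgroup G" and W: "Wh_module sc G \<rho> c" and k: "k \<in> G" "l \<in> G"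
    and f: "polyfun f" "f 0 = 0" and g: "polyfun g" "g 0 = 0"
  shows "linrep.R sc G \<rho> c k l f g"
proof -
  interpret linrep sc G \<rho> by (rule Wh_module_linrep[OF G W])
  show ?thesis
  proof (rule R_lc[OF lc_FF[OF f] lc_FF[OF g] FF_vanish])
    fix b b' :: "'a ^ 1 \<Rightarrow> 'a" assume "b \<in> FF" "b' \<in> FF"
    then obtain m n where b: "b = upoly (ffp m) 1" "m \<ge> 1" "b' = upoly (ffp n) 1" "n \<ge> 1" by (auto simp: FF_def)
    show "R c k l b b'" unfolding R_def b
      using Wh_module_bracket[OF G W k b(2,4)] cocycle_zero[of k l n m] b
      by (intro exI[of _ "cocycle k m l n"]) blast
  qed auto
qed

section \<open>The classification\<close>

definition ser_act :: "bool \<Rightarrow> 'a::comm_ring_1 ^ 'n::finite \<Rightarrow> 'a ^ 'n \<Rightarrow> ('n \<Rightarrow> nat) \<Rightarrow> ('a ^ 'n \<Rightarrow> 'a) \<Rightarrow> ('a ^ 'n \<Rightarrow> 'a)" where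
  "ser_act b x = (if b then A_act x else B_act x)"

lemma mpow_uminus: "mpow (- x :: 'a::comm_ring_1 ^ 'n::finite) \<mu> = (-1) ^ mabs \<mu> * mpow x \<mu>"
proof -
  have "mpow (- x) \<mu> = (\<Prod>i\<in>UNIV. (-1) ^ \<mu> i * (x $ i) ^ \<mu> i)"
    unfolding mpow_def by (intro prod.cong refl) (simp add: power_minus[of "x $ _"])
  then show ?thesis by (simp add: mpow_def mabs_def prod.distrib power_sum)
qed

lemma ser_act_kap: "ser_act b x \<beta> \<mu> f \<delta> = kap b (mf \<mu>) (x + (\<delta> - \<beta>)) \<beta> * f (\<delta> - \<beta>)"
proof (cases b)
  case False
  have "- (x + (\<delta> - \<beta>) + \<beta>) = - (x + \<delta>)" by simp
  then show ?thesis using False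
    by (simp add: ser_act_def B_act_def kap_def mf_apply mpow_uminus del: minus_add_distrib)
qed (simp add: ser_act_def A_act_def kap_def mf_apply)

text \<open>\<open>y_\<gamma>\<close> is sent to \<open>w (x + \<gamma>)\<close>, from the span S of
  the sites that occur. The vanishing of lam makes this map compatible with degree 0.\<close>

lemma (in linrep) intermediate_basis_imp_iso_subquotient:
  assumes ib: "intermediate_basis sc G T b x w lam" and lam: "\<And>f. polyfun f \<Longrightarrow> f 0 = 0 \<Longrightarrow> lam f = 0"
  shows "iso_subquotient sc G \<rho> (ser_act b x)"
proof -
  have sp: "span (range w) = UNIV" and wx: "\<And>z. w z \<noteq> 0 \<Longrightarrow> z - x \<in> G" and w0: "b \<or> w 0 = 0"
    and step: "\<And>z l. w z \<noteq> 0 \<Longrightarrow> z \<noteq> 0 \<Longrightarrow> l \<in> G \<Longrightarrow> z + l \<noteq> 0 \<Longrightarrow> w (z + l) \<noteq> 0"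
    and act: "\<And>l f z. polyfun f \<Longrightarrow> f 0 = 0 \<Longrightarrow> l \<in> G \<Longrightarrow> w z \<noteq> 0 \<Longrightarrow>
        T l f (w z) = sc (kap b f z l + (if l = 0 then lam f else 0)) (w (z + l))"
    using ib unfolding intermediate_basis_def by (blast, blast, blast, blast, blast)
  have Gc: "0 \<in> G" "\<And>u v. u \<in> G \<Longrightarrow> v \<in> G \<Longrightarrow> u + v \<in> G" "\<And>u v. u \<in> G \<Longrightarrow> v \<in> G \<Longrightarrow> u - v \<in> G"
    using G unfolding add_subgroup_def by (blast, blast, metis add_uminus_conv_diff)
  \<comment> \<open>In A the site 0 can be reached even if \<open>w 0 = 0\<close>, so S has to
    contain it in order to be closed, and it goes to the kernel. In B all coefficients into the site
    0 vanish.\<close>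
  define P where "P z \<longleftrightarrow> w z \<noteq> 0 \<or> (b \<and> z = 0)" for z
  define S where "S = {f \<in> fsupp G. \<forall>\<gamma>. f \<gamma> \<noteq> 0 \<longrightarrow> P (x + \<gamma>)}"
  define \<phi> where "\<phi> f = (\<Sum>\<gamma>\<in>{\<gamma>. f \<gamma> \<noteq> 0}. sc (f \<gamma>) (w (x + \<gamma>)))" for f
  have phi: "\<phi> f = (\<Sum>\<gamma>\<in>K. sc (f \<gamma>) (w (x + \<gamma>)))" if "finite K" "{\<gamma>. f \<gamma> \<noteq> 0} \<subseteq> K" for f K
    unfolding \<phi>_def using that by (intro sum.mono_neutral_left) auto
  have rho: "\<rho> \<beta> \<mu> (w z) = sc (kap b (mf \<mu>) z \<beta>) (w (z + \<beta>))" if "\<beta> \<in> G" "\<mu> \<noteq> 0" "P z" for \<beta> \<mu> z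
  proof (cases "w z = 0")
    case True
    then have z: "z = 0" "b" using that by (auto simp: P_def)
    have "kap b (mf \<mu>) z \<beta> = 0" using z that by (simp add: kap_def mf_apply mpow_0)
    moreover have "\<rho> \<beta> \<mu> 0 = 0" using T_vzero[of "mf \<mu>" \<beta>] that by (simp add: T_mf mf_apply mpow_0)
    ultimately show ?thesis using True by simp
  next
    case False
    have m: "polyfun (mf \<mu> :: 'a ^ 'n \<Rightarrow> 'a)" "mf \<mu> (0 :: 'a ^ 'n) = (0 :: 'a)" using that by (auto simp: mf_apply mpow_0)
    show ?thesis using act[OF m that(1) False] lam[OF m] T_mf[OF that(1)] by simp
  qed
  have P_step: "P (z + \<beta>)" if "\<beta> \<in> G" "\<mu> \<noteq> 0" "P z" "kap b (mf \<mu>) z \<beta> \<noteq> 0" for z \<beta> \<mu>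
  proof (cases b)
    case True
    have "z \<noteq> 0" using that(2,4) True by (auto simp: kap_def mf_apply mpow_0)
    then show ?thesis using that step[of z \<beta>] True by (auto simp: P_def)
  next
    case False
    have "z + \<beta> \<noteq> 0"
    proof
      assume "z + \<beta> = 0"
      then show False using that(2,4) False by (simp add: kap_def mf_apply mpow_0)
    qed
    moreover have "z \<noteq> 0" using that False w0 by (auto simp: P_def)
    ultimately show ?thesis using that step[of z \<beta>] False by (auto simp: P_def)
  qed
  have shift_supp: "{\<delta>. ser_act b x \<beta> \<mu> f \<delta> \<noteq> 0} \<subseteq> (\<lambda>\<gamma>. \<gamma> + \<beta>) ` {\<gamma>. f \<gamma> \<noteq> 0}" for \<beta> \<mu> f
  proof
    fix \<delta> assume "\<delta> \<in> {\<delta>. ser_act b x \<beta> \<mu> f \<delta> \<noteq> 0}"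
    then have "f (\<delta> - \<beta>) \<noteq> 0" by (auto simp: ser_act_kap)
    then show "\<delta> \<in> (\<lambda>\<gamma>. \<gamma> + \<beta>) ` {\<gamma>. f \<gamma> \<noteq> 0}" by (intro image_eqI[of _ _ "\<delta> - \<beta>"]) auto
  qed
  have act_S: "ser_act b x \<beta> \<mu> f \<in> S" if "\<beta> \<in> G" "\<mu> \<noteq> 0" "f \<in> S" for \<beta> \<mu> f
  proof -
    have "finite ((\<lambda>\<gamma>. \<gamma> + \<beta>) ` {\<gamma>. f \<gamma> \<noteq> 0})" using that(3) by (simp add: S_def fsupp_def)
    then have "finite {\<delta>. ser_act b x \<beta> \<mu> f \<delta> \<noteq> 0}" by (rule finite_subset[OF shift_supp])
    moreover have "\<delta> \<in> G \<and> P (x + \<delta>)" if \<delta>: "ser_act b x \<beta> \<mu> f \<delta> \<noteq> 0" for \<delta>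
    proof -
      have f: "f (\<delta> - \<beta>) \<noteq> 0" "kap b (mf \<mu>) (x + (\<delta> - \<beta>)) \<beta> \<noteq> 0" using \<delta> by (auto simp: ser_act_kap)
      then have "\<delta> - \<beta> \<in> G" "P (x + (\<delta> - \<beta>))" using \<open>f \<in> S\<close> by (auto simp: S_def fsupp_def)
      then show ?thesis using P_step[OF \<open>\<beta> \<in> G\<close> \<open>\<mu> \<noteq> 0\<close> _ f(2)] Gc(2)[of "\<delta> - \<beta>" \<beta>] \<open>\<beta> \<in> G\<close> by simp
    qed
    ultimately show ?thesis by (simp add: S_def fsupp_def)
  qed
  have add_S: "(\<lambda>\<delta>. f \<delta> + g \<delta>) \<in> S" if "f \<in> S" "g \<in> S" for f g
  proof -
    have "finite ({\<delta>. f \<delta> \<noteq> 0} \<union> {\<delta>. g \<delta> \<noteq> 0})" using that by (simp add: S_def fsupp_def)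
    moreover have "{\<delta>. f \<delta> + g \<delta> \<noteq> 0} \<subseteq> {\<delta>. f \<delta> \<noteq> 0} \<union> {\<delta>. g \<delta> \<noteq> 0}" by auto
    ultimately have "finite {\<delta>. f \<delta> + g \<delta> \<noteq> 0}" by (rule finite_subset[rotated])
    moreover have "\<delta> \<in> G \<and> P (x + \<delta>)" if "f \<delta> + g \<delta> \<noteq> 0" for \<delta>
    proof -
      have "f \<delta> \<noteq> 0 \<or> g \<delta> \<noteq> 0" using that by auto
      then show ?thesis using \<open>f \<in> S\<close> \<open>g \<in> S\<close> by (auto simp: S_def fsupp_def)
    qed
    ultimately show ?thesis by (simp add: S_def fsupp_def)
  qed
  have scale_S: "(\<lambda>\<delta>. a * f \<delta>) \<in> S" if "f \<in> S" for a f
  proof -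
    have "{\<delta>. a * f \<delta> \<noteq> 0} \<subseteq> {\<delta>. f \<delta> \<noteq> 0}" by auto
    then have "finite {\<delta>. a * f \<delta> \<noteq> 0}" using that finite_subset by (auto simp: S_def fsupp_def)
    then show ?thesis using that by (auto simp: S_def fsupp_def)
  qed
  have zero_S: "(\<lambda>_. 0) \<in> S" by (simp add: S_def fsupp_def)
  have phi_add: "\<phi> (\<lambda>\<delta>. f \<delta> + g \<delta>) = \<phi> f + \<phi> g" if "f \<in> S" "g \<in> S" for f g
  proof -
    let ?K = "{\<delta>. f \<delta> \<noteq> 0} \<union> {\<delta>. g \<delta> \<noteq> 0}"
    have K: "finite ?K" using that by (simp add: S_def fsupp_def)
    have "\<phi> (\<lambda>\<delta>. f \<delta> + g \<delta>) = (\<Sum>\<gamma>\<in>?K. sc (f \<gamma> + g \<gamma>) (w (x + \<gamma>)))" by (rule phi[OF K]) auto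
    then show ?thesis using phi[OF K, of f] phi[OF K, of g] by (auto simp: scale_left_distrib sum.distrib)
  qed
  have phi_scale: "\<phi> (\<lambda>\<delta>. a * f \<delta>) = sc a (\<phi> f)" if "f \<in> S" for a f
  proof -
    have "finite {\<delta>. f \<delta> \<noteq> 0}" using that by (simp add: S_def fsupp_def)
    then have "\<phi> (\<lambda>\<delta>. a * f \<delta>) = (\<Sum>\<gamma>\<in>{\<delta>. f \<delta> \<noteq> 0}. sc (a * f \<gamma>) (w (x + \<gamma>)))" by (rule phi) auto
    then show ?thesis by (simp add: \<phi>_def scale_sum_right)
  qed
  have phi_act: "\<phi> (ser_act b x \<beta> \<mu> f) = \<rho> \<beta> \<mu> (\<phi> f)" if h: "\<beta> \<in> G" "\<mu> \<noteq> 0" "f \<in> S" for \<beta> \<mu> f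
  proof -
    let ?K = "{\<gamma>. f \<gamma> \<noteq> 0}"
    have K: "finite ?K" using h by (simp add: S_def fsupp_def)
    have "\<phi> (ser_act b x \<beta> \<mu> f) = (\<Sum>\<delta>\<in>(\<lambda>\<gamma>. \<gamma> + \<beta>) ` ?K. sc (ser_act b x \<beta> \<mu> f \<delta>) (w (x + \<delta>)))"
      by (rule phi) (use K shift_supp in auto)
    also have "\<dots> = (\<Sum>\<gamma>\<in>?K. sc (ser_act b x \<beta> \<mu> f (\<gamma> + \<beta>)) (w (x + (\<gamma> + \<beta>))))"
      by (rule sum.reindex[unfolded o_def]) (simp add: inj_on_def)
    also have "\<dots> = (\<Sum>\<gamma>\<in>?K. sc (f \<gamma>) (\<rho> \<beta> \<mu> (w (x + \<gamma>))))"
    proof (rule sum.cong[OF refl])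
      fix \<gamma> assume "\<gamma> \<in> ?K"
      then have "P (x + \<gamma>)" using h by (auto simp: S_def)
      then show "sc (ser_act b x \<beta> \<mu> f (\<gamma> + \<beta>)) (w (x + (\<gamma> + \<beta>))) = sc (f \<gamma>) (\<rho> \<beta> \<mu> (w (x + \<gamma>)))"
        using rho[OF h(1,2), of "x + \<gamma>"] by (simp add: ser_act_kap add.assoc mult.commute)
    qed
    also have "\<dots> = \<rho> \<beta> \<mu> (\<phi> f)"
    proof -
      interpret l: Vector_Spaces.linear sc sc "\<rho> \<beta> \<mu>" by (rule \<rho>_linear[OF h(1,2)])
      show ?thesis by (simp add: \<phi>_def l.sum l.scale)
    qed
    finally show ?thesis .
  qed
  have onto: "\<phi> ` S = UNIV"
  proof -
    have "u \<in> \<phi> ` S" if "u \<in> span (range w)" for u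
      using that
    proof (induction rule: span_induct_alt)
      case base
      have "\<phi> (\<lambda>_. 0) = 0" by (simp add: \<phi>_def)
      then show ?case using zero_S by (metis imageI)
    next
      case (step c u v)
      then obtain z f where z: "u = w z" and f: "f \<in> S" "v = \<phi> f" by auto
      show ?case
      proof (cases "w z = 0")
        case True
        then show ?thesis using z f by auto
      next
        case False
        define e where "e = (\<lambda>\<gamma>. if \<gamma> = z - x then c else 0)"
        have e: "e \<in> S" using wx[OF False] False by (auto simp: S_def fsupp_def e_def P_def split: if_splits)
        have "\<phi> e = (\<Sum>\<gamma>\<in>{z - x}. sc (e \<gamma>) (w (x + \<gamma>)))" by (rule phi) (auto simp: e_def)
        then have "\<phi> e = sc c (w z)" by (simp add: e_def)
        then have "sc c u + v = \<phi> (\<lambda>\<delta>. e \<delta> + f \<delta>)" using phi_add[OF e f(1)] z f by simp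
        then show ?thesis using add_S[OF e f(1)] by blast
      qed
    qed
    then show ?thesis using sp by blast
  qed
  have SG: "S \<subseteq> fsupp G" unfolding S_def by blast
  have "ser_submodule G (ser_act b x) S"
    unfolding ser_submodule_def
    by (intro conjI ballI allI impI SG zero_S add_S scale_S act_S)
  moreover have "ser_submodule G (ser_act b x) {f \<in> S. \<phi> f = 0}"
    unfolding ser_submodule_def
  proof (intro conjI ballI allI impI)
    show "{f \<in> S. \<phi> f = 0} \<subseteq> fsupp G" using SG by blast
    show "(\<lambda>_. 0) \<in> {f \<in> S. \<phi> f = 0}" using zero_S by (simp add: \<phi>_def)
    fix f assume f: "f \<in> {f \<in> S. \<phi> f = 0}"
    show "(\<lambda>\<delta>. a * f \<delta>) \<in> {f \<in> S. \<phi> f = 0}" for a using f scale_S[of f a] phi_scale[of f a] by simp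
    show "(\<lambda>\<delta>. f \<delta> + g \<delta>) \<in> {f \<in> S. \<phi> f = 0}" if "g \<in> {f \<in> S. \<phi> f = 0}" for g
      using f that add_S[of f g] phi_add[of f g] by simp
    fix \<beta> :: "'a ^ 'n" and \<mu> :: "'n \<Rightarrow> nat" assume h: "\<beta> \<in> G" "\<mu> \<noteq> 0"
    have "\<rho> \<beta> \<mu> 0 = 0" using T_vzero[of "mf \<mu>" \<beta>] h by (simp add: T_mf mf_apply mpow_0)
    then show "ser_act b x \<beta> \<mu> f \<in> {f \<in> S. \<phi> f = 0}" using f act_S[OF h, of f] phi_act[OF h, of f] by simp
  qed
  ultimately show ?thesis unfolding iso_subquotient_def
    by (intro exI[of _ S] exI[of _ "{f \<in> S. \<phi> f = 0}"] exI[of _ \<phi>] conjI ballI allI impI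
        phi_add phi_scale phi_act onto refl Collect_subset; (assumption | simp only:)?) 
      (blast | assumption)+
qed

lemma (in linrep) intermediate_basis_imp_W_intermediate:
  assumes "intermediate_basis sc G T b x w lam" "\<And>f. polyfun f \<Longrightarrow> f 0 = 0 \<Longrightarrow> lam f = 0"
  shows "W_intermediate sc G \<rho>"
  using intermediate_basis_imp_iso_subquotient[OF assms] unfolding W_intermediate_def ser_act_def
  by (cases b) auto

section \<open>The grading groups\<close>

lemma nondegenerate_nonzero:
  fixes G :: "('a::field ^ 'n::finite) set"
  assumes "nondegenerate G" shows "\<exists>k\<in>G. k \<noteq> 0"
proof (rule ccontr)
  assume *: "\<not> ?thesis"
  obtain B where B: "B \<subseteq> G" "vec.span B = UNIV" using assms unfolding nondegenerate_def by blast
  have "B \<subseteq> {0}" using B * by blast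
  then have "vec.span B \<subseteq> vec.span {0}" by (rule vec.span_mono)
  then have "(UNIV :: ('a ^ 'n) set) \<subseteq> {0}" using B by simp
  then have "(1 :: 'a ^ 'n) = 0" by blast
  then show False by simp
qed

lemma not_iso_to_Z_infinite_index:
  fixes G :: "('a::field_char_0 ^ 'n::finite) set"
  assumes "add_subgroup G" "\<not> iso_to_Z G" "k \<in> G" "k \<noteq> 0" "finite B" "B \<subseteq> G"
  shows "\<exists>g\<in>G. \<forall>r\<in>B. \<forall>i::int. g \<noteq> r + of_int i *s k"
  using finite_index_imp_iso_to_Z[OF assms(1,3,4,5,6)] assms(2) by blast

lemma ZZ_positive: "n > 0 \<Longrightarrow> ((\<chi> i. of_int n) :: 'a::comm_ring_1 ^ 1) = of_nat (nat n) *s 1"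
  and ZZ_negative: "n > 0 \<Longrightarrow> ((\<chi> i. of_int (- n)) :: 'a::comm_ring_1 ^ 1) = of_nat (nat n) *s (- 1)"
  by (simp_all add: vec_eq_iff)

lemma add_subgroup_ZZ: "add_subgroup (ZZ :: ('a::ring_1 ^ 1) set)"
  unfolding add_subgroup_def ZZ_def
proof (intro conjI ballI)
  show "0 \<in> range (\<lambda>k::int. (\<chi> i. of_int k) :: 'a ^ 1)" by (intro range_eqI[of _ _ 0]) (simp add: vec_eq_iff)
  fix x :: "'a ^ 1" assume "x \<in> range (\<lambda>k::int. (\<chi> i. of_int k))"
  then obtain k :: int where k: "x = (\<chi> i. of_int k)" by blast
  show "- x \<in> range (\<lambda>k::int. (\<chi> i. of_int k))" by (intro range_eqI[of _ _ "- k"]) (simp add: vec_eq_iff k)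
  fix y :: "'a ^ 1" assume "y \<in> range (\<lambda>k::int. (\<chi> i. of_int k))"
  then obtain l :: int where l: "y = (\<chi> i. of_int l)" by blast
  show "x + y \<in> range (\<lambda>k::int. (\<chi> i. of_int k))" by (intro range_eqI[of _ _ "k + l"]) (simp add: vec_eq_iff k l)
qed

lemma one_in_ZZ: "1 \<in> (ZZ :: ('a::comm_ring_1 ^ 1) set)"
  unfolding ZZ_def by (intro range_eqI[of _ _ 1]) (simp add: vec_eq_iff)

lemma ZZ_generated:
  assumes "x \<in> (ZZ :: ('a::comm_ring_1 ^ 1) set)"
  shows "\<exists>i::nat. x = of_nat i *s 1 \<or> x = - (of_nat i *s 1)"
proof -
  obtain n :: int where n: "x = (\<chi> i. of_int n)" using assms by (auto simp: ZZ_def)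
  show ?thesis
  proof (cases "n \<ge> 0")
    case True
    then show ?thesis using n by (intro exI[of _ "nat n"]) (simp add: vec_eq_iff)
  next
    case False
    then show ?thesis using n by (intro exI[of _ "nat (- n)"]) (simp add: vec_eq_iff)
  qed
qed

lemma (in linrep) Tirr_T:
  assumes "Tsys sc G Vg T" "\<exists>v::'v. v \<noteq> 0" "\<And>S. W_submodule sc G \<rho> S \<Longrightarrow> S = {0} \<or> S = UNIV"
  shows "Tirr sc G Vg T"
proof (intro Tirr.intro Tirr_axioms.intro assms(1,2))
  fix S assume "subspace S" "\<And>k f u. polyfun f \<Longrightarrow> f 0 = 0 \<Longrightarrow> u \<in> S \<Longrightarrow> T k f u \<in> S"
  then show "S = {0} \<or> S = UNIV" using T_submodule_iff[of S] assms(3)[of S] by blast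
qed

lemma (in linrep) highest_weight_conditions:
  fixes u :: 'v
  assumes "\<And>m f. m > 0 \<Longrightarrow> polyfun f \<Longrightarrow> f 0 = 0 \<Longrightarrow> T (of_nat m *s k) f u = 0" "k \<in> G"
    and "\<And>h. polyfun h \<Longrightarrow> h 0 = 0 \<Longrightarrow> \<exists>c. T 0 h u = sc c u" and \<mu>: "\<mu> \<noteq> 0"
  shows "\<exists>a. \<rho> 0 \<mu> u = sc a u" and "m > 0 \<Longrightarrow> \<rho> (of_nat m *s k) \<mu> u = 0"
proof -
  have m: "polyfun (mf \<mu> :: 'a ^ 'n \<Rightarrow> 'a)" "mf \<mu> (0 :: 'a ^ 'n) = (0 :: 'a)" using \<mu> by (auto simp: mf_apply mpow_0)
  have "0 \<in> G" using G by (simp add: add_subgroup_def)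
  then show "\<exists>a. \<rho> 0 \<mu> u = sc a u" using assms(3)[OF m] by (simp add: T_mf)
  show "m > 0 \<Longrightarrow> \<rho> (of_nat m *s k) \<mu> u = 0"
    using assms(1)[OF _ m, of m] T_mf[OF add_subgroup_multiples[OF G assms(2), of m]] by simp
qed

lemma (in linrep) highest_weight_in_ZZ:
  fixes u :: 'v
  assumes sg: "\<And>n::int. n > 0 \<Longrightarrow> (\<chi> i. of_int (sg * n)) = of_nat (nat n) *s (k :: 'a ^ 'n)"
    and van: "\<And>m f. m > 0 \<Longrightarrow> polyfun f \<Longrightarrow> f 0 = 0 \<Longrightarrow> T (of_nat m *s k) f u = 0" "k \<in> G"
    and eig: "\<And>h. polyfun h \<Longrightarrow> h 0 = 0 \<Longrightarrow> \<exists>c. T 0 h u = sc c u"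
  shows "(\<forall>\<mu>. \<mu> \<noteq> 0 \<longrightarrow> (\<exists>a. \<rho> 0 \<mu> u = sc a u)) \<and>
     (\<forall>n::int. n > 0 \<longrightarrow> (\<forall>\<mu>. \<mu> \<noteq> 0 \<longrightarrow> \<rho> (\<chi> i. of_int (sg * n)) \<mu> u = 0))"
proof (intro conjI allI impI)
  fix \<mu> :: "'n \<Rightarrow> nat" assume \<mu>: "\<mu> \<noteq> 0"
  show "\<exists>a. \<rho> 0 \<mu> u = sc a u" by (rule highest_weight_conditions(1)[OF van eig \<mu>])
next
  fix n :: int and \<mu> :: "'n \<Rightarrow> nat" assume n: "n > 0" "\<mu> \<noteq> 0"
  show "\<rho> (\<chi> i. of_int (sg * n)) \<mu> u = 0"
    unfolding sg[OF n(1)] by (rule highest_weight_conditions(2)[OF van eig n(2)]) (use n in auto)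
qed

text \<open>Under irreducibility every nonzero vector generates the module, which settles the
  generation part of the highest weight condition.\<close>

lemma Inter_submodules:
  assumes "\<And>S. Sub S \<Longrightarrow> S = {0} \<or> S = (UNIV :: 'v::zero set)" "v \<noteq> 0"
  shows "\<Inter>{S. Sub S \<and> v \<in> S} = UNIV"
  using assms by (intro UNIV_eq_I[symmetric]) blast

lemma dichotomy_ZZ:
  fixes sc :: "'a::{alg_closed_field, field_char_0} \<Rightarrow> 'v::ab_group_add \<Rightarrow> 'v"
    and \<rho> :: "'a ^ 1 \<Rightarrow> (1 \<Rightarrow> nat) \<Rightarrow> 'v \<Rightarrow> 'v"
  assumes "Tirr sc ZZ Vg (linrep.T sc ZZ \<rho>)" and lr: "linrep sc ZZ \<rho>"
  shows "(\<exists>b x w lam. intermediate_basis sc ZZ (linrep.T sc ZZ \<rho>) b x w lam) \<or>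
    (\<exists>sg u. (sg = 1 \<or> sg = - 1) \<and> u \<noteq> 0 \<and> (\<exists>k::int. u \<in> Vg (\<chi> i. of_int k)) \<and>
      (\<forall>\<mu>. \<mu> \<noteq> 0 \<longrightarrow> (\<exists>a. \<rho> 0 \<mu> u = sc a u)) \<and>
      (\<forall>n::int. n > 0 \<longrightarrow> (\<forall>\<mu>. \<mu> \<noteq> 0 \<longrightarrow> \<rho> (\<chi> i. of_int (sg * n)) \<mu> u = 0)))"
proof -
  interpret linrep sc ZZ \<rho> by fact
  interpret I: Tirr sc ZZ Vg T by fact
  have "(\<exists>b x w lam. intermediate_basis sc ZZ T b x w lam) \<or>
    (\<exists>\<kappa> u a. (\<kappa> = 1 \<or> \<kappa> = - 1) \<and> u \<noteq> 0 \<and> a \<in> ZZ \<and> u \<in> Vg a \<and> I.gl.eig u \<and>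
       (\<forall>m f. m > 0 \<longrightarrow> polyfun f \<longrightarrow> f 0 = 0 \<longrightarrow> T (of_nat m *s \<kappa>) f u = 0))"
    by (rule I.highest_weight_or_intermediate[OF one_in_ZZ _ ZZ_generated]) simp
  then show ?thesis
  proof
    assume "\<exists>\<kappa> u a. (\<kappa> = 1 \<or> \<kappa> = - 1) \<and> u \<noteq> 0 \<and> a \<in> ZZ \<and> u \<in> Vg a \<and> I.gl.eig u \<and>
       (\<forall>m f. m > 0 \<longrightarrow> polyfun f \<longrightarrow> f 0 = 0 \<longrightarrow> T (of_nat m *s \<kappa>) f u = 0)"
    then obtain \<kappa> u a where u: "\<kappa> = 1 \<or> \<kappa> = - 1" "u \<noteq> 0" "a \<in> ZZ" "u \<in> Vg a" "I.gl.eig u"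
      "\<forall>m f. m > 0 \<longrightarrow> polyfun f \<longrightarrow> f 0 = 0 \<longrightarrow> T (of_nat m *s \<kappa>) f u = 0" by (elim exE conjE)
    have kG: "\<kappa> \<in> ZZ" using u(1) one_in_ZZ G unfolding add_subgroup_def by auto
    obtain sg :: int where sg: "sg = 1 \<or> sg = - 1"
      "\<And>n::int. n > 0 \<Longrightarrow> (\<chi> i. of_int (sg * n)) = of_nat (nat n) *s \<kappa>"
      using u(1)
    proof
      assume "\<kappa> = 1"
      then show thesis by (intro that[of 1]) (use ZZ_positive in auto)
    next
      assume "\<kappa> = - 1"
      then show thesis by (intro that[of "- 1"]) (use ZZ_negative in auto)
    qed
    have "\<exists>k::int. u \<in> Vg (\<chi> i. of_int k)" using u(3,4) by (auto simp: ZZ_def)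
    moreover have "(\<forall>\<mu>. \<mu> \<noteq> 0 \<longrightarrow> (\<exists>a. \<rho> 0 \<mu> u = sc a u)) \<and>
      (\<forall>n::int. n > 0 \<longrightarrow> (\<forall>\<mu>. \<mu> \<noteq> 0 \<longrightarrow> \<rho> (\<chi> i. of_int (sg * n)) \<mu> u = 0))"
    proof (rule highest_weight_in_ZZ)
      show "(\<chi> i. of_int (sg * n)) = of_nat (nat n) *s \<kappa>" if "n > 0" for n :: int by (rule sg(2)[OF that])
      show "T (of_nat m *s \<kappa>) f u = 0" if "m > 0" "polyfun f" "f 0 = 0" for m f using u(6) that by blast
      show "\<exists>c. T 0 h u = sc c u" if "polyfun h" "h 0 = 0" for h using u(5) that by (rule I.gl.eigD)
    qed (rule kG)
    ultimately show ?thesis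
      by - (rule disjI2, rule exI[of _ sg], rule exI[of _ u], rule conjI[OF sg(1) conjI[OF u(2) conjI]])
  qed simp
qed

subsection \<open>Modules over the algebra without centre\<close>

lemma W_Tirr:
  fixes sc :: "'a::{alg_closed_field, field_char_0} \<Rightarrow> 'v::ab_group_add \<Rightarrow> 'v"
  assumes G: "add_subgroup G" and W: "W_module sc G \<rho>" "W_quasifinite sc G \<rho> Vg" "W_irreducible sc G \<rho>"
  shows "Tirr sc G Vg (linrep.T sc G \<rho>)"
proof -
  interpret linrep sc G \<rho> by (rule W_module_linrep[OF G W(1)])
  have "Tsys sc G Vg T"
  proof (rule Tsys_T[of Vg "\<lambda>_. 0" 0])
    show "qf_grading sc G Vg" using W(2) by (simp add: W_quasifinite_def)
    show "\<rho> \<alpha> \<mu> ` Vg \<beta> \<subseteq> Vg (\<alpha> + \<beta>)" if "\<alpha> \<in> G" "\<beta> \<in> G" "\<mu> \<noteq> 0" for \<alpha> \<beta> \<mu>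
      using W(2) that by (simp add: W_quasifinite_def)
  qed (use W_module_R[OF G W(1)] in simp_all)
  then show ?thesis
    by (rule Tirr_T) (use W(3) in \<open>simp_all add: W_irreducible_def\<close>)
qed

lemma W_intermediateI:
  fixes sc :: "'a::{alg_closed_field, field_char_0} \<Rightarrow> 'v::ab_group_add \<Rightarrow> 'v"
  assumes G: "add_subgroup G" and W: "W_module sc G \<rho>" "W_quasifinite sc G \<rho> Vg" "W_irreducible sc G \<rho>"
    and k: "k \<in> G" "k \<noteq> 0" and ib: "intermediate_basis sc G (linrep.T sc G \<rho>) b x w lam"
  shows "W_intermediate sc G \<rho>"
proof -
  interpret linrep sc G \<rho> by (rule W_module_linrep[OF G W(1)])
  interpret I: Tirr sc G Vg T by (rule W_Tirr[OF G W])
  show ?thesis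
  proof (rule intermediate_basis_imp_W_intermediate[OF ib])
    fix h :: "'a ^ 'b \<Rightarrow> 'a" assume h: "polyfun h" "h 0 = 0"
    show "lam h = 0"
    proof (rule I.lam_zero[OF ib k h])
      fix f g :: "'a ^ 'b \<Rightarrow> 'a" and u assume *: "polyfun f" "f 0 = 0" "polyfun g" "g 0 = 0"
      have "- k \<in> G" using k G by (simp add: add_subgroup_def)
      from W_module_R[OF G W(1) k(1) this *]
      show "T k f (T (- k) g u) - T (- k) g (T k f u) = T 0 (sh (- k) f * g - f * sh k g) u"
        unfolding R_def by auto
    qed
  qed
qed

subsection \<open>Modules over the central extension\<close>

text \<open>Schur's lemma: C preserves the finite-dimensional weight spaces, so it has an
  eigenvalue, and the eigenspace is a submodule.\<close>

lemma Wh_central_scalar: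
  fixes sc :: "'a::{alg_closed_field, field_char_0} \<Rightarrow> 'v::ab_group_add \<Rightarrow> 'v"
  assumes W: "Wh_module sc G \<rho> c" "Wh_quasifinite sc G \<rho> c Vg" "Wh_irreducible sc G \<rho> c"
  shows "\<exists>c0. \<forall>v. c v = sc c0 v"
proof -
  have vs: "vector_space sc" and cl: "Vector_Spaces.linear sc sc c"
    and rl: "\<And>\<alpha> \<mu>. \<alpha> \<in> G \<Longrightarrow> \<mu> \<noteq> 0 \<Longrightarrow> Vector_Spaces.linear sc sc (\<rho> \<alpha> \<mu>)"
    and comm: "\<And>\<alpha> \<mu> v. \<alpha> \<in> G \<Longrightarrow> \<mu> \<noteq> 0 \<Longrightarrow> c (\<rho> \<alpha> \<mu> v) = \<rho> \<alpha> \<mu> (c v)"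
    using W(1) unfolding Wh_module_def by simp_all
  interpret vector_space sc by (rule vs)
  have gr: "qf_grading sc G Vg" and cV: "\<And>\<beta>. \<beta> \<in> G \<Longrightarrow> c ` Vg \<beta> \<subseteq> Vg \<beta>"
    using W(2) unfolding Wh_quasifinite_def W_quasifinite_def by auto
  obtain v :: 'v where v: "v \<noteq> 0" using W(3) unfolding Wh_irreducible_def by blast
  have "\<exists>!f. (\<forall>\<beta>. \<beta> \<notin> G \<longrightarrow> f \<beta> = 0) \<and> finite {\<beta>. f \<beta> \<noteq> 0} \<and>
      (\<forall>\<beta>\<in>G. f \<beta> \<in> Vg \<beta>) \<and> v = (\<Sum>\<beta>\<in>{\<beta>. f \<beta> \<noteq> 0}. f \<beta>)"
    using gr unfolding qf_grading_def by blast
  from ex1_implies_ex[OF this] obtain f where f: "\<forall>\<beta>. \<beta> \<notin> G \<longrightarrow> f \<beta> = 0" "\<forall>\<beta>\<in>G. f \<beta> \<in> Vg \<beta>"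
      "v = (\<Sum>\<beta>\<in>{\<beta>. f \<beta> \<noteq> 0}. f \<beta>)" by (elim exE conjE) rule
  have "\<exists>\<beta>. f \<beta> \<noteq> 0" using f(3) v by (metis (mono_tags, lifting) mem_Collect_eq sum.neutral)
  then obtain \<beta> where b: "\<beta> \<in> G" "f \<beta> \<in> Vg \<beta>" "f \<beta> \<noteq> 0" using f by blast
  obtain S where S: "finite S" "Vg \<beta> \<subseteq> span S" and sub: "subspace (Vg \<beta>)"
    using gr b(1) unfolding qf_grading_def fin_dim_def by blast
  have "\<exists>c0 y. y \<in> Vg \<beta> \<and> y \<noteq> 0 \<and> c y = sc c0 y"
    by (rule eigenvalue_exists[OF vs S(1) sub S(2) b(2,3) cl]) (use cV[OF b(1)] in auto)
  then obtain c0 y where y: "y \<noteq> 0" "c y = sc c0 y" by blast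
  define U where "U = {v. c v = sc c0 v}"
  have add: "c (u + v) = c u + c v" and scl: "c (sc a u) = sc a (c u)" for u v a
    using cl unfolding Vector_Spaces.linear_iff by auto
  have c0: "c 0 = 0" using scl[of 0 0] by simp
  have "subspace U" unfolding subspace_def U_def
    by (auto simp: add scl c0 scale_right_distrib scale_left_commute)
  moreover have "\<rho> \<alpha> \<mu> u \<in> U" if "\<alpha> \<in> G" "\<mu> \<noteq> 0" "u \<in> U" for \<alpha> \<mu> u
    using that rl[OF that(1,2)] unfolding U_def Vector_Spaces.linear_iff by (simp add: comm)
  moreover have "c u \<in> U" if "u \<in> U" for u using that by (simp add: U_def scl)
  ultimately have "Wh_submodule sc G \<rho> c U" unfolding Wh_submodule_def W_submodule_def by blast
  then have "U = {0} \<or> U = UNIV" using W(3) unfolding Wh_irreducible_def by blast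
  moreover have "y \<in> U" using y by (simp add: U_def)
  ultimately have "U = UNIV" using y(1) by blast
  then show ?thesis unfolding U_def by blast
qed

lemma Wh_Tirr:
  fixes sc :: "'a::{alg_closed_field, field_char_0} \<Rightarrow> 'v::ab_group_add \<Rightarrow> 'v"
  assumes G: "add_subgroup G" and W: "Wh_module sc G \<rho> c" "Wh_quasifinite sc G \<rho> c Vg" "Wh_irreducible sc G \<rho> c"
  shows "Tirr sc G Vg (linrep.T sc G \<rho>)"
proof -
  interpret linrep sc G \<rho> by (rule Wh_module_linrep[OF G W(1)])
  obtain c0 where c0: "\<And>v. c v = sc c0 v" using Wh_central_scalar[OF W] by blast
  have Wq: "W_quasifinite sc G \<rho> Vg" using W(2) by (simp add: Wh_quasifinite_def)
  have "Tsys sc G Vg T"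
  proof (rule Tsys_T[of Vg c c0])
    show "qf_grading sc G Vg" using Wq by (simp add: W_quasifinite_def)
    show "\<rho> \<alpha> \<mu> ` Vg \<beta> \<subseteq> Vg (\<alpha> + \<beta>)" if "\<alpha> \<in> G" "\<beta> \<in> G" "\<mu> \<noteq> 0" for \<alpha> \<beta> \<mu>
      using Wq that by (simp add: W_quasifinite_def)
  qed (use Wh_module_R[OF G W(1)] c0 in simp_all)
  then show ?thesis
  proof (rule Tirr_T)
    show "\<exists>v::'v. v \<noteq> 0" using W(3) by (simp add: Wh_irreducible_def)
    \<comment> \<open>As C acts by a scalar, it preserves every subspace, so both notions of
      submodule agree.\<close>
    fix S assume S: "W_submodule sc G \<rho> S"
    then have "subspace S" by (simp add: W_submodule_def)
    then have "c ` S \<subseteq> S" by (auto simp: c0 intro: subspace_scale)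
    then show "S = {0} \<or> S = UNIV" using S W(3) unfolding Wh_irreducible_def Wh_submodule_def by blast
  qed
qed

lemma (in Tirr) lam_scale:
  assumes ib: "intermediate_basis sc G T b x w lam" and f: "polyfun f" "f 0 = 0"
  shows "lam (cst a * f) = a * lam f"
proof -
  obtain z where z: "w z \<noteq> 0" using ib unfolding intermediate_basis_def by blast
  have act: "T 0 f (w z) = sc (kap b f z 0 + lam f) (w z)" if "polyfun f" "f 0 = 0" for f
    using ib that G_zero z unfolding intermediate_basis_def by fastforce
  have af: "polyfun (cst a * f)" "(cst a * f) 0 = 0" using f by (auto simp: pointwise)
  have "sc (kap b (cst a * f) z 0 + lam (cst a * f)) (w z) = sc (a * (kap b f z 0 + lam f)) (w z)"
    using T_scale[OF f, of 0 a "w z"] by (simp add: act[OF f] act[OF af])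
  then have "kap b (cst a * f) z 0 + lam (cst a * f) = a * (kap b f z 0 + lam f)"
    using z scale_cancel_right by blast
  then show ?thesis by (auto simp: kap_def pointwise algebra_simps split: if_splits)
qed

lemma gchoose_3: "(a :: 'a::field_char_0) gchoose 3 = a * (a - 1) * (a - 2) / 6"
  by (simp add: gbinomial_prod_rev numeral_3_eq_3 fact_numeral)

text \<open>Comparing the cocycle in degrees k and 2 k, on which lam is proportional, shows that the centre acts by 0.\<close>

lemma Wh_central_zero:
  fixes sc :: "'a::{alg_closed_field, field_char_0} \<Rightarrow> 'v::ab_group_add \<Rightarrow> 'v"
  assumes G: "add_subgroup G" and W: "Wh_module sc G \<rho> c" "Wh_quasifinite sc G \<rho> c Vg" "Wh_irreducible sc G \<rho> c"
    and k: "k \<in> G" "k \<noteq> 0" and ib: "intermediate_basis sc G (linrep.T sc G \<rho>) b x w lam"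
  shows "c v = 0"
proof -
  interpret linrep sc G \<rho> by (rule Wh_module_linrep[OF G W(1)])
  interpret I: Tirr sc G Vg T by (rule Wh_Tirr[OF G W])
  obtain c0 where c0: "\<And>v. c v = sc c0 v" using Wh_central_scalar[OF W] by blast
  \<comment> \<open>f is \<open>X = [X]_1\<close>. On it the cocycle is cubic in the degree, while
    the polynomial of the opposite bracket, \<open>- 2 l X\<close>, is linear.\<close>
  define f where "f = (upoly (ffp 1) 1 :: 'a ^ 1 \<Rightarrow> 'a)"
  have f: "polyfun f" "f 0 = 0" by (auto simp: f_def pointwise ffp_def)
  have fx: "f y = y $ 1" for y by (simp add: f_def pointwise ffp_def)
  have lam: "lam (cst (- 2 * l $ 1) * f) = ((l $ 1 + 1) gchoose 3) * c0" if l: "l \<in> G" "l \<noteq> 0" for l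
  proof -
    have ml: "- l \<in> G" using l G by (simp add: add_subgroup_def)
    have P: "sh (- l) f * f - f * sh l f = cst (- 2 * l $ 1) * f"
      by (auto simp: fun_eq_iff pointwise fx algebra_simps)
    have "lam (sh (- l) f * f - f * sh l f) = - (cocycle l 1 (- l) 1 * c0)"
    proof (rule I.opposite_bracket_lam[OF ib f f l])
      fix u
      show "T l f (T (- l) f u) - T (- l) f (T l f u) =
          T 0 (sh (- l) f * f - f * sh l f) u + sc (cocycle l 1 (- l) 1 * c0) u"
        using Wh_module_bracket[OF G W(1) l(1) ml, of 1 1 u] unfolding f_def by (simp add: c0)
    qed
    then show ?thesis unfolding P by (simp add: cocycle_def numeral_3_eq_3)
  qed
  define t where "t = k $ 1"
  have t: "t \<noteq> 0" using k by (auto simp: t_def vec_eq_iff)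
  have k2: "k + k \<in> G" "k + k \<noteq> 0" "(k + k) $ 1 = 2 * t"
  proof -
    show "k + k \<in> G" using k G unfolding add_subgroup_def by blast
    show 2: "(k + k) $ 1 = 2 * t" by (simp add: t_def)
    show "k + k \<noteq> 0" using 2 t by (metis mult_eq_0_iff zero_index zero_neq_numeral)
  qed
  have "cst (- 2 * (k + k) $ 1) * f = cst 2 * (cst (- 2 * k $ 1) * f)"
    unfolding k2(3) t_def by (auto simp: fun_eq_iff pointwise)
  then have "((2 * t + 1) gchoose 3) * c0 = 2 * (((t + 1) gchoose 3) * c0)"
    using lam[OF k2(1,2)] lam[OF k] I.lam_scale[OF ib, of "cst (- 2 * k $ 1) * f" 2] f
    unfolding k2(3) t_def by (simp add: pointwise)
  \<comment> \<open>The cubic terms survive the comparison: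
    \<open>(2t+1 gchoose 3) - 2 (t+1 gchoose 3) = t^3\<close>.\<close>
  then have "t * t * t * c0 = 0" unfolding gchoose_3 by (simp add: field_simps)
  then have "c0 = 0" using t by simp
  then show ?thesis by (simp add: c0)
qed

lemma Wh_intermediateI:
  fixes sc :: "'a::{alg_closed_field, field_char_0} \<Rightarrow> 'v::ab_group_add \<Rightarrow> 'v"
  assumes G: "add_subgroup G" and W: "Wh_module sc G \<rho> c" "Wh_quasifinite sc G \<rho> c Vg" "Wh_irreducible sc G \<rho> c"
    and k: "k \<in> G" "k \<noteq> 0" and ib: "intermediate_basis sc G (linrep.T sc G \<rho>) b x w lam"
  shows "Wh_intermediate sc G \<rho> c"
proof -
  interpret linrep sc G \<rho> by (rule Wh_module_linrep[OF G W(1)])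
  interpret I: Tirr sc G Vg T by (rule Wh_Tirr[OF G W])
  have c: "c v = 0" for v by (rule Wh_central_zero[OF G W k ib])
  have "W_intermediate sc G \<rho>"
  proof (rule intermediate_basis_imp_W_intermediate[OF ib])
    fix h :: "'a ^ 1 \<Rightarrow> 'a" assume h: "polyfun h" "h 0 = 0"
    show "lam h = 0"
    proof (rule I.lam_zero[OF ib k h])
      fix f g :: "'a ^ 1 \<Rightarrow> 'a" and u assume *: "polyfun f" "f 0 = 0" "polyfun g" "g 0 = 0"
      have "- k \<in> G" using k G by (simp add: add_subgroup_def)
      from Wh_module_R[OF G W(1) k(1) this *]
      show "T k f (T (- k) g u) - T (- k) g (T k f u) = T 0 (sh (- k) f * g - f * sh k g) u"
        unfolding R_def by (auto simp: c)
    qed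
  qed
  then show ?thesis using c by (simp add: Wh_intermediate_def)
qed

theorem theorem1p1:
  fixes sc :: "'a::{alg_closed_field, field_char_0} \<Rightarrow> 'v::ab_group_add \<Rightarrow> 'v"
  shows
  "(\<forall>(\<rho>::'a ^ 1 \<Rightarrow> (1 \<Rightarrow> nat) \<Rightarrow> 'v \<Rightarrow> 'v) Vg.
      W_module sc ZZ \<rho> \<and> W_quasifinite sc ZZ \<rho> Vg \<and> W_irreducible sc ZZ \<rho> \<longrightarrow>
      W_hw sc \<rho> Vg 1 \<or> W_hw sc \<rho> Vg (-1) \<or> W_intermediate sc ZZ \<rho>)
 \<and> (\<forall>(\<rho>::'a ^ 1 \<Rightarrow> (1 \<Rightarrow> nat) \<Rightarrow> 'v \<Rightarrow> 'v) c Vg.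
      Wh_module sc ZZ \<rho> c \<and> Wh_quasifinite sc ZZ \<rho> c Vg \<and> Wh_irreducible sc ZZ \<rho> c \<longrightarrow>
      Wh_hw sc \<rho> c Vg 1 \<or> Wh_hw sc \<rho> c Vg (-1) \<or> Wh_intermediate sc ZZ \<rho> c)
 \<and> (\<forall>(G::('a ^ 'n::finite) set) \<rho> Vg.
      add_subgroup G \<and> nondegenerate G \<and> \<not> iso_to_Z G \<and>
      W_module sc G \<rho> \<and> W_quasifinite sc G \<rho> Vg \<and> W_irreducible sc G \<rho> \<longrightarrow>
      W_intermediate sc G \<rho>)
 \<and> (\<forall>(G::('a ^ 1) set) \<rho> c Vg.
      add_subgroup G \<and> nondegenerate G \<and> \<not> iso_to_Z G \<and>
      Wh_module sc G \<rho> c \<and> Wh_quasifinite sc G \<rho> c Vg \<and> Wh_irreducible sc G \<rho> c \<longrightarrow>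
      Wh_intermediate sc G \<rho> c)"
proof (intro conjI allI impI; elim conjE)
  fix \<rho> :: "'a ^ 1 \<Rightarrow> (1 \<Rightarrow> nat) \<Rightarrow> 'v \<Rightarrow> 'v" and Vg
  assume W: "W_module sc ZZ \<rho>" "W_quasifinite sc ZZ \<rho> Vg" "W_irreducible sc ZZ \<rho>"
  note G = add_subgroup_ZZ[where 'a = 'a]
  from dichotomy_ZZ[OF W_Tirr[OF G W] W_module_linrep[OF G W(1)]]
  show "W_hw sc \<rho> Vg 1 \<or> W_hw sc \<rho> Vg (- 1) \<or> W_intermediate sc ZZ \<rho>"
  proof
    assume "\<exists>b x w lam. intermediate_basis sc ZZ (linrep.T sc ZZ \<rho>) b x w lam"
    then show ?thesis using W_intermediateI[OF G W one_in_ZZ] by auto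
  next
    assume "\<exists>sg u. (sg = 1 \<or> sg = - 1) \<and> u \<noteq> 0 \<and> (\<exists>k::int. u \<in> Vg (\<chi> i. of_int k)) \<and>
      (\<forall>\<mu>. \<mu> \<noteq> 0 \<longrightarrow> (\<exists>a. \<rho> 0 \<mu> u = sc a u)) \<and>
      (\<forall>n::int. n > 0 \<longrightarrow> (\<forall>\<mu>. \<mu> \<noteq> 0 \<longrightarrow> \<rho> (\<chi> i. of_int (sg * n)) \<mu> u = 0))"
    then obtain sg u where "(sg = 1 \<or> sg = - 1) \<and> u \<noteq> 0 \<and> (\<exists>k::int. u \<in> Vg (\<chi> i. of_int k)) \<and>
      (\<forall>\<mu>. \<mu> \<noteq> 0 \<longrightarrow> (\<exists>a. \<rho> 0 \<mu> u = sc a u)) \<and>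
      (\<forall>n::int. n > 0 \<longrightarrow> (\<forall>\<mu>. \<mu> \<noteq> 0 \<longrightarrow> \<rho> (\<chi> i. of_int (sg * n)) \<mu> u = 0))" by (elim exE)
    then have sg: "sg = 1 \<or> sg = - 1" and u: "u \<noteq> 0" "\<exists>k::int. u \<in> Vg (\<chi> i. of_int k)"
      "\<forall>\<mu>. \<mu> \<noteq> 0 \<longrightarrow> (\<exists>a. \<rho> 0 \<mu> u = sc a u)"
      "\<forall>n::int. n > 0 \<longrightarrow> (\<forall>\<mu>. \<mu> \<noteq> 0 \<longrightarrow> \<rho> (\<chi> i. of_int (sg * n)) \<mu> u = 0)" by blast+
    have "\<Inter>{S. W_submodule sc ZZ \<rho> S \<and> u \<in> S} = UNIV"
      by (rule Inter_submodules) (use W(3) u(1) in \<open>auto simp: W_irreducible_def\<close>)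
    then have "W_hw sc \<rho> Vg sg" unfolding W_hw_def using u by blast
    then show ?thesis using sg by auto
  qed
next
  fix \<rho> :: "'a ^ 1 \<Rightarrow> (1 \<Rightarrow> nat) \<Rightarrow> 'v \<Rightarrow> 'v" and c Vg
  assume W: "Wh_module sc ZZ \<rho> c" "Wh_quasifinite sc ZZ \<rho> c Vg" "Wh_irreducible sc ZZ \<rho> c"
  note G = add_subgroup_ZZ[where 'a = 'a]
  from dichotomy_ZZ[OF Wh_Tirr[OF G W] Wh_module_linrep[OF G W(1)]]
  show "Wh_hw sc \<rho> c Vg 1 \<or> Wh_hw sc \<rho> c Vg (- 1) \<or> Wh_intermediate sc ZZ \<rho> c"
  proof
    assume "\<exists>b x w lam. intermediate_basis sc ZZ (linrep.T sc ZZ \<rho>) b x w lam"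
    then show ?thesis using Wh_intermediateI[OF G W one_in_ZZ] by auto
  next
    assume "\<exists>sg u. (sg = 1 \<or> sg = - 1) \<and> u \<noteq> 0 \<and> (\<exists>k::int. u \<in> Vg (\<chi> i. of_int k)) \<and>
      (\<forall>\<mu>. \<mu> \<noteq> 0 \<longrightarrow> (\<exists>a. \<rho> 0 \<mu> u = sc a u)) \<and>
      (\<forall>n::int. n > 0 \<longrightarrow> (\<forall>\<mu>. \<mu> \<noteq> 0 \<longrightarrow> \<rho> (\<chi> i. of_int (sg * n)) \<mu> u = 0))"
    then obtain sg u where "(sg = 1 \<or> sg = - 1) \<and> u \<noteq> 0 \<and> (\<exists>k::int. u \<in> Vg (\<chi> i. of_int k)) \<and>
      (\<forall>\<mu>. \<mu> \<noteq> 0 \<longrightarrow> (\<exists>a. \<rho> 0 \<mu> u = sc a u)) \<and>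
      (\<forall>n::int. n > 0 \<longrightarrow> (\<forall>\<mu>. \<mu> \<noteq> 0 \<longrightarrow> \<rho> (\<chi> i. of_int (sg * n)) \<mu> u = 0))" by (elim exE)
    then have sg: "sg = 1 \<or> sg = - 1" and u: "u \<noteq> 0" "\<exists>k::int. u \<in> Vg (\<chi> i. of_int k)"
      "\<forall>\<mu>. \<mu> \<noteq> 0 \<longrightarrow> (\<exists>a. \<rho> 0 \<mu> u = sc a u)"
      "\<forall>n::int. n > 0 \<longrightarrow> (\<forall>\<mu>. \<mu> \<noteq> 0 \<longrightarrow> \<rho> (\<chi> i. of_int (sg * n)) \<mu> u = 0)" by blast+
    have "\<Inter>{S. Wh_submodule sc ZZ \<rho> c S \<and> u \<in> S} = UNIV"
      by (rule Inter_submodules) (use W(3) u(1) in \<open>auto simp: Wh_irreducible_def\<close>)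
    moreover have "\<exists>a. c u = sc a u" using Wh_central_scalar[OF W] by blast
    ultimately have "Wh_hw sc \<rho> c Vg sg" unfolding Wh_hw_def using u by blast
    then show ?thesis using sg by auto
  qed
next
  fix G :: "('a ^ 'n) set" and \<rho> Vg
  assume grp: "add_subgroup G" "nondegenerate G" "\<not> iso_to_Z G"
    and W: "W_module sc G \<rho>" "W_quasifinite sc G \<rho> Vg" "W_irreducible sc G \<rho>"
  obtain k where k: "k \<in> G" "k \<noteq> 0" using nondegenerate_nonzero[OF grp(2)] by blast
  interpret linrep sc G \<rho> by (rule W_module_linrep[OF grp(1) W(1)])
  interpret I: Tirr sc G Vg T by (rule W_Tirr[OF grp(1) W])
  \<comment> \<open>The multiples of k have infinite index in G: finite index would make G
    isomorphic to the integers.\<close>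
  obtain b x w lam where "intermediate_basis sc G T b x w lam"
    using I.infinite_index_imp_intermediate[OF k not_iso_to_Z_infinite_index[OF grp(1,3) k]] by blast
  then show "W_intermediate sc G \<rho>" by (rule W_intermediateI[OF grp(1) W k])
next
  fix G :: "('a ^ 1) set" and \<rho> c Vg
  assume grp: "add_subgroup G" "nondegenerate G" "\<not> iso_to_Z G"
    and W: "Wh_module sc G \<rho> c" "Wh_quasifinite sc G \<rho> c Vg" "Wh_irreducible sc G \<rho> c"
  obtain k where k: "k \<in> G" "k \<noteq> 0" using nondegenerate_nonzero[OF grp(2)] by blast
  interpret linrep sc G \<rho> by (rule Wh_module_linrep[OF grp(1) W(1)])
  interpret I: Tirr sc G Vg T by (rule Wh_Tirr[OF grp(1) W])
  obtain b x w lam where "intermediate_basis sc G T b x w lam"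
    using I.infinite_index_imp_intermediate[OF k not_iso_to_Z_infinite_index[OF grp(1,3) k]] by blast
  then show "Wh_intermediate sc G \<rho> c" by (rule Wh_intermediateI[OF grp(1) W k])
qed

end
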